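(* Let $Q(t)=(Q_1(t),\dots,Q_K(t))^T$, $t\ge 0$, be the queue length process of an ergodic Jackson network with $K$ nodes, routing matrix $P$, arrival rates $\lambda_k>0$ and service rates $\mu_k>0$, with $Q(0)=0$. Let $A>0$ and $$\tau_n=\inf\Bigl\{t:\ \sum_{k=1}^KQ_k(nt)\ge nA\Bigr\}.$$ Assume that the minimum of $\theta^\ast\cdot x$ over all $x\in\mathbb R_+^K$ with $\sum_{k=1}^Kx_k=A$ is attained at a unique point $r$. Let $\overline q$ be the fluid trajectory of the dual network with $\overline q(0)=r$, let $T^\ast$ be the first time at which $\overline q$ reaches the origin, and let $q^\ast(t)=\overline q(T^\ast-t)$, $0\le t\le T^\ast$. Then for all sufficiently large $T$, $$\lim_{n\to\infty}\frac1n\ln\mathbf P(\tau_n\le T)=-\theta^\ast\cdot r$$ and, for every $\delta>0$, $$\lim_{n\to\infty}\mathbf P\Bigl(\sup_{(\tau_n-T^\ast)^+\le t\le\tau_n}\Bigl|\frac{Q(nt)}{n}-q^\ast\bigl(t-(\tau_n-T^\ast)^+\bigr)\Bigr|<\delta\ \Big|\ \tau_n\le T\Bigr)=1 .$$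
   Context: The Jackson network: $Q$ is the continuous-time Markov chain on $\mathbb Z_+^K$ in which customers arrive from outside at node $k$ at rate $\lambda_k$ (Poisson), and, whenever $Q_k>0$, node $k$ completes a service at rate $\mu_k$; the served customer moves to node $l$ with probability $p_{kl}$ and leaves the network with probability $1-\sum_{l=1}^K p_{kl}$. $P=(p_{kl})$ is substochastic (nonnegative entries, row sums at most $1$) with spectral radius less than $1$. Put $\nu=(I-P^T)^{-1}\lambda$ with $\lambda=(\lambda_1,\dots,\lambda_K)^T$, and $\rho_k=\nu_k/\mu_k$; ergodicity means $\rho_k<1$ for all $k$. $\theta^\ast\in\mathbb R^K$ is given by $\theta^\ast_k=-\ln\rho_k$. $|\cdot|$ is a norm on $\mathbb R^K$ and $u^+=\max(u,0)$. The dual network has service rates $\mu_k$, routing matrix $\overline P=(\overline p_{kl})$ with $\overline p_{kl}=\nu_l p_{lk}/\nu_k$, and arrival rates $\overline\lambda_k=\nu_k(1-\sum_{l=1}^K p_{kl})$. Its fluid trajectory started at $r\in\mathbb R_+^K$ is the unique solution $\overline q$ of the oblique reflection problem: $\overline q(t)=r+(\overline\lambda-(I-\overline P^T)\mu)\,t+(I-\overline P^T)\phi(t)\in\mathbb R_+^K$ for $t\ge0$, where $\mu=(\mu_1,\dots,\mu_K)^T$, $\phi(0)=0$, $\phi$ is absolutely continuous and componentwise nondecreasing, and $\overline q_k(t)\dot\phi_k(t)=0$ for a.e. $t$ and all $k$. Under ergodicity it reaches the origin in finite time. *)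

theory Defs
  imports "HOL-Probability.Probability"
begin

section \<open>Continuous-time Markov chains with given jump rates\<close>

text \<open>A (honest, time-homogeneous) transition semigroup on a countable state space; the last
  conjunct is the Chapman--Kolmogorov equation.\<close>

definition transition_semigroup :: "(real \<Rightarrow> 's \<Rightarrow> 's pmf) \<Rightarrow> bool" where
  "transition_semigroup p \<longleftrightarrow>
     (\<forall>x. p 0 x = return_pmf x) \<and>
     (\<forall>s\<ge>0. \<forall>t\<ge>0. \<forall>x. p (s + t) x = bind_pmf (p s x) (p t))"

text \<open>\<open>q x y\<close> is the rate of the jump from \<open>x\<close> to \<open>y\<close>; only off-diagonal values matter.\<close>

definition has_jump_rates :: "(real \<Rightarrow> 's \<Rightarrow> 's pmf) \<Rightarrow> ('s \<Rightarrow> 's \<Rightarrow> real) \<Rightarrow> bool" where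
  "has_jump_rates p q \<longleftrightarrow>
     (\<forall>x y. ((\<lambda>h. pmf (p h x) y) has_real_derivative
        (if y = x then - (\<Sum>\<^sub>\<infinity>z\<in>- {x}. q x z) else q x y)) (at_right 0))"

text \<open>Only times \<open>t \<ge> 0\<close> are considered. Paths are right-continuous with left limits; in the
  discrete topology this means being eventually constant on either side of each time, so there
  are finitely many jumps on bounded time intervals.\<close>

definition ctmc ::
    "'w measure \<Rightarrow> (real \<Rightarrow> 'w \<Rightarrow> 's::countable) \<Rightarrow> ('s \<Rightarrow> 's \<Rightarrow> real) \<Rightarrow> bool" where
  "ctmc M X q \<longleftrightarrow>
     prob_space M \<and>
     (\<forall>t\<ge>0. X t \<in> measurable M (count_space UNIV)) \<and>
     (\<forall>\<omega>\<in>space M.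
        (\<forall>t\<ge>0. \<forall>\<^sub>F s in at_right t. X s \<omega> = X t \<omega>) \<and>
        (\<forall>t>0. \<exists>l. \<forall>\<^sub>F s in at_left t. X s \<omega> = l)) \<and>
     (\<exists>p. transition_semigroup p \<and> has_jump_rates p q \<and>
        (\<forall>n (t :: nat \<Rightarrow> real) (x :: nat \<Rightarrow> 's).
           0 \<le> t 0 \<and> (\<forall>i\<le>n. t i \<le> t (Suc i)) \<longrightarrow>
           \<P>(\<omega> in M. \<forall>i\<le>Suc n. X (t i) \<omega> = x i) =
           \<P>(\<omega> in M. \<forall>i\<le>n. X (t i) \<omega> = x i) * pmf (p (t (Suc n) - t n) (x n)) (x (Suc n))))"


section \<open>Jackson networks\<close>

text \<open>Rates of external arrivals, of transfers from \<open>k\<close> to \<open>l\<close>, and of departures. A customer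
  returning immediately to its own node (\<open>l = k\<close>) causes no jump: it contributes to the
  irrelevant diagonal only.\<close>

definition jackson_rate ::
    "real ^ 'k \<Rightarrow> real ^ 'k \<Rightarrow> real ^ 'k ^ 'k \<Rightarrow> nat ^ 'k \<Rightarrow> nat ^ 'k \<Rightarrow> real" where
  "jackson_rate lam mu P x y =
     (\<Sum>k\<in>UNIV. lam $ k * of_bool (y = x + axis k 1)) +
     (\<Sum>k\<in>{k. x $ k > 0}.
        (\<Sum>l\<in>UNIV. mu $ k * P $ k $ l * of_bool (y = x - axis k 1 + axis l 1)) +
        mu $ k * (1 - (\<Sum>l\<in>UNIV. P $ k $ l)) * of_bool (y = x - axis k 1))"

definition jackson_queue ::
    "'w measure \<Rightarrow> (real \<Rightarrow> 'w \<Rightarrow> nat ^ 'k) \<Rightarrow> real ^ 'k \<Rightarrow> real ^ 'k \<Rightarrow> real ^ 'k ^ 'k \<Rightarrow> bool" where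
  "jackson_queue M Q lam mu P \<longleftrightarrow> ctmc M Q (jackson_rate lam mu P)"

definition substochastic :: "real ^ 'k ^ 'k \<Rightarrow> bool" where
  "substochastic P \<longleftrightarrow> (\<forall>k l. 0 \<le> P $ k $ l) \<and> (\<forall>k. (\<Sum>l\<in>UNIV. P $ k $ l) \<le> 1)"

definition spectral_radius :: "real ^ 'k ^ 'k \<Rightarrow> real" where
  "spectral_radius P =
     Max {cmod z | z. \<exists>v :: complex ^ 'k. v \<noteq> 0 \<and> (\<chi> k l. complex_of_real (P $ k $ l)) *v v = z *s v}"

definition throughput :: "real ^ 'k \<Rightarrow> real ^ 'k ^ 'k \<Rightarrow> real ^ 'k" where
  "throughput lam P = matrix_inv (mat 1 - transpose P) *v lam"

definition load :: "real ^ 'k \<Rightarrow> real ^ 'k \<Rightarrow> real ^ 'k ^ 'k \<Rightarrow> real ^ 'k" where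
  "load lam mu P = (\<chi> k. throughput lam P $ k / mu $ k)"

definition theta_star :: "real ^ 'k \<Rightarrow> real ^ 'k \<Rightarrow> real ^ 'k ^ 'k \<Rightarrow> real ^ 'k" where
  "theta_star lam mu P = (\<chi> k. - ln (load lam mu P $ k))"


section \<open>The dual network and its fluid trajectories\<close>

definition dual_routing :: "real ^ 'k \<Rightarrow> real ^ 'k ^ 'k \<Rightarrow> real ^ 'k ^ 'k" where
  "dual_routing lam P =
     (\<chi> k l. throughput lam P $ l * P $ l $ k / throughput lam P $ k)"

definition dual_arrival :: "real ^ 'k \<Rightarrow> real ^ 'k ^ 'k \<Rightarrow> real ^ 'k" where
  "dual_arrival lam P = (\<chi> k. throughput lam P $ k * (1 - (\<Sum>l\<in>UNIV. P $ k $ l)))"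

text \<open>Absolute continuity of a function on the interval \<open>[a, b]\<close>; the finite set \<open>D\<close> consists of
  the pairs of end points of non-overlapping subintervals.\<close>

definition abs_continuous_on :: "real \<Rightarrow> real \<Rightarrow> (real \<Rightarrow> 'a::metric_space) \<Rightarrow> bool" where
  "abs_continuous_on a b f \<longleftrightarrow>
     (\<forall>\<epsilon>>0. \<exists>\<delta>>0. \<forall>D.
        finite D \<and> (\<forall>(u, v)\<in>D. a \<le> u \<and> u \<le> v \<and> v \<le> b) \<and>
        disjoint_family_on (\<lambda>(u, v). {u<..<v}) D \<and> (\<Sum>(u, v)\<in>D. v - u) < \<delta>
        \<longrightarrow> (\<Sum>(u, v)\<in>D. dist (f u) (f v)) < \<epsilon>)"

text \<open>Solutions on \<open>[0, \<infinity>)\<close> of the oblique reflection problem for a network with arrival rates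
  \<open>lam\<close>, service rates \<open>mu\<close> and routing matrix \<open>P\<close>, started at \<open>r\<close>; values at negative times are
  unconstrained. On the unbounded half-line, absolute continuity is understood on every
  compact subinterval.\<close>

definition fluid_trajectory ::
    "real ^ 'k \<Rightarrow> real ^ 'k \<Rightarrow> real ^ 'k ^ 'k \<Rightarrow> real ^ 'k \<Rightarrow> (real \<Rightarrow> real ^ 'k) \<Rightarrow> bool" where
  "fluid_trajectory lam mu P r q \<longleftrightarrow>
     (\<exists>\<phi> :: real \<Rightarrow> real ^ 'k.
        (\<forall>t\<ge>0. q t = r + t *\<^sub>R (lam - (mat 1 - transpose P) *v mu)
                       + (mat 1 - transpose P) *v \<phi> t) \<and>
        (\<forall>t\<ge>0. \<forall>k. 0 \<le> q t $ k) \<and>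
        \<phi> 0 = 0 \<and>
        (\<forall>b\<ge>0. abs_continuous_on 0 b \<phi>) \<and>
        (\<forall>k. mono_on {0..} (\<lambda>t. \<phi> t $ k)) \<and>
        (AE t in lborel. 0 < t \<longrightarrow>
           (\<exists>D. (\<phi> has_vector_derivative D) (at t) \<and> (\<forall>k. q t $ k * D $ k = 0))))"

definition first_zero_time :: "(real \<Rightarrow> 'a::zero) \<Rightarrow> real" where
  "first_zero_time q = Inf {t. 0 \<le> t \<and> q t = 0}"


section \<open>Overflow time of the scaled queue length\<close>

definition scaled :: "(real \<Rightarrow> 'w \<Rightarrow> nat ^ 'k) \<Rightarrow> nat \<Rightarrow> real \<Rightarrow> 'w \<Rightarrow> real ^ 'k" where
  "scaled Q n t \<omega> = (\<chi> k. real (Q (real n * t) \<omega> $ k) / real n)"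

text \<open>Extended-real valued: \<open>\<infinity>\<close> if the level is never reached.\<close>

definition overflow_time :: "(real \<Rightarrow> 'w \<Rightarrow> nat ^ 'k) \<Rightarrow> real \<Rightarrow> nat \<Rightarrow> 'w \<Rightarrow> ereal" where
  "overflow_time Q A n \<omega> =
     Inf {ereal t | t. 0 \<le> t \<and> (\<Sum>k\<in>UNIV. real (Q (real n * t) \<omega> $ k)) \<ge> real n * A}"

text \<open>A norm on \<open>\<real>\<^sup>K\<close>, not necessarily the Euclidean one provided by the type class.\<close>

definition is_norm :: "('a::real_vector \<Rightarrow> real) \<Rightarrow> bool" where
  "is_norm N \<longleftrightarrow>
     (\<forall>x. 0 \<le> N x) \<and> (\<forall>x. N x = 0 \<longleftrightarrow> x = 0) \<and>
     (\<forall>x y. N (x + y) \<le> N x + N y) \<and> (\<forall>c x. N (c *\<^sub>R x) = \<bar>c\<bar> * N x)"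

text \<open>The event that, over the last \<open>T\<^sup>*\<close> time units before overflow (or since time \<open>0\<close>, if
  overflow occurs earlier), the scaled queue length stays \<open>\<delta>\<close>-close to the path \<open>q\<close>. It is used
  only on the event that the overflow time is finite, where \<open>real_of_ereal\<close> is the identity.\<close>

definition follows_path ::
    "(real ^ 'k \<Rightarrow> real) \<Rightarrow> (real \<Rightarrow> 'w \<Rightarrow> nat ^ 'k) \<Rightarrow> real \<Rightarrow> nat \<Rightarrow> real
      \<Rightarrow> (real \<Rightarrow> real ^ 'k) \<Rightarrow> real \<Rightarrow> 'w \<Rightarrow> bool" where
  "follows_path N Q A n Tstar q \<delta> \<omega> \<longleftrightarrow>
     (let \<tau> = real_of_ereal (overflow_time Q A n \<omega>); s = max (\<tau> - Tstar) 0
      in (SUP t\<in>{s..\<tau>}. N (scaled Q n t \<omega> - q (t - s))) < \<delta>)"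

end

theory Submission
  imports Defs
begin

text \<open>
  Let \<open>m x = (\<Prod>k. \<rho>\<^sub>k ^ x\<^sub>k) = exp (- \<theta>\<^sup>* \<bullet> x)\<close>. This weight is invariant, and reversing time in the network gives
  the dual network: \<open>m x * p\<^sub>t x y = m y * p'\<^sub>t y x\<close>. Hence the probability of a path from \<open>0\<close> that ends
  in \<open>y\<close> is at most \<open>m y\<close> times the probability of the reversed path under the dual chain started in \<open>y\<close>.
  Among the states of total population at least \<open>n A\<close>, all but an exponentially small part of the
  weight lies near \<open>n r\<close>, and from there the dual chain follows \<open>n z (t / n)\<close>, where \<open>z\<close> is the fluid
  trajectory, except on an event of exponentially small probability.

  Neither the oblique reflection map nor a functional law of large numbers is needed for the last
  point. In the coordinates \<open>R x\<close>, where \<open>R = (I - P'\<^sup>T)\<^sup>-\<^sup>1\<close> and \<open>P'\<close> is the dual routing matrix, a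
  service changes on average only the coordinate of the serving node, and the deviation is measured by the maximum of
  \<open>\<bar>(R x - n w)\<^sub>l\<bar> / c\<^sub>l\<close> with \<open>w = R z\<close> and \<open>c = R 1\<close>. If node \<open>l\<close> is empty in one of the two systems, then the
  signed deviation of \<open>l\<close> in the harmful direction falls short of that maximum by a fixed
  proportion; so the boundary terms in the generator of \<open>\<Sum>\<^sub>l exp (\<plusminus> \<beta> (R x - n w)\<^sub>l / c\<^sub>l)\<close> are controlled
  by the remaining terms, and this sum, suitably discounted, is a supermartingale.

  For the lower bound, start the dual chain near \<open>n r\<close>: at time \<open>n T\<^sup>*\<close> it is near \<open>0\<close>, and it goes on to \<open>0\<close>
  at a cost read off from arrivals in the forward network.
\<close>

section \<open>Jump processes with bounded rates\<close>

text \<open>The chain is known only through finite-dimensional laws and the derivatives of its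
  transition probabilities at time 0. Every inequality in time is therefore drawn from one source: a
  function with nonpositive upper right Dini derivative that does not jump up from the left cannot
  increase. It serves the semigroup, the supermartingales, invariance and the fluid path alike. Path
  suprema are controlled along dyadic times and extended by right continuity.

  The constants are governed by a competition of exponents. Rounding the overflow time to an
  integer, or passing from the weight to a tail sum, loses a factor \<open>exp (n * e)\<close> with
  e as small as desired; leaving the fluid path gains \<open>exp (- n * \<gamma>)\<close> with
  \<gamma> fixed by the tolerance. So the deviation estimate is fixed first and the other constants
  are chosen in terms of its \<gamma>. Inside that estimate the discount paid over time
  \<open>n * H\<close> is of order \<open>\<beta>\<^sup>2 * n * H\<close> and the gain is of order
  \<open>\<beta> * n\<close>, so a small fixed \<beta> suffices.\<close>

lemma right_dini_nonincreasing:
  fixes f :: "real \<Rightarrow> real"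
  assumes ab: "a \<le> b"
    and right: "\<And>t \<epsilon>. a \<le> t \<Longrightarrow> t < b \<Longrightarrow> \<epsilon> > 0 \<Longrightarrow> \<forall>\<^sub>F d in at_right 0. f (t + d) \<le> f t + \<epsilon> * d"
    and left: "\<And>t \<epsilon>. a < t \<Longrightarrow> t \<le> b \<Longrightarrow> \<epsilon> > 0 \<Longrightarrow> \<forall>\<^sub>F d in at_right 0. f t \<le> f (t - d) + \<epsilon>"
  shows "f b \<le> f a"
proof (rule field_le_epsilon)
  fix e :: real assume e: "e > 0"
  \<comment> \<open>The summand 1 keeps the quotient defined for \<open>a = b\<close>. S collects
    the times up to which f stays below the line of slope \<epsilon> through \<open>f a\<close>:
    \<open>left\<close> carries the bound to the supremum u of S, and \<open>right\<close> pushes it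
    beyond u unless \<open>u = b\<close>.\<close>
  define \<epsilon> where "\<epsilon> = e / (b - a + 1)"
  have \<epsilon>: "\<epsilon> > 0" using e ab by (simp add: \<epsilon>_def)
  define S where "S = {t \<in> {a..b}. \<forall>s\<in>{a..t}. f s \<le> f a + \<epsilon> * (s - a)}"
  have aS: "a \<in> S" using ab by (simp add: S_def)
  have bdd: "bdd_above S" by (rule bdd_aboveI[of _ b]) (simp add: S_def)
  define u where "u = Sup S"
  have au: "a \<le> u" unfolding u_def using aS bdd by (rule cSup_upper)
  have ub: "u \<le> b" unfolding u_def
  proof (rule cSup_least)
    show "S \<noteq> {}" using aS by auto
    show "\<And>x. x \<in> S \<Longrightarrow> x \<le> b" by (simp add: S_def)
  qed
  have below: "f s \<le> f a + \<epsilon> * (s - a)" if as: "a \<le> s" and su: "s < u" for s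
  proof -
    obtain t where "t \<in> S" "s < t" using less_cSupE[of s S] su aS unfolding u_def by blast
    have "\<forall>s\<in>{a..t}. f s \<le> f a + \<epsilon> * (s - a)" using \<open>t \<in> S\<close> unfolding S_def by blast
    moreover have "s \<in> {a..t}" using as \<open>s < t\<close> by simp
    ultimately show ?thesis by blast
  qed
  have fu: "f u \<le> f a + \<epsilon> * (u - a)"
  proof (cases "u = a")
    case False
    hence "a < u" using au by simp
    show ?thesis
    proof (rule field_le_epsilon)
      fix e' :: real assume e': "e' > 0"
      have "\<forall>\<^sub>F d in at_right 0. f u \<le> f (u - d) + e' \<and> d \<in> {0<..<u - a}"
        by (rule eventually_conj[OF left[OF \<open>a < u\<close> ub e'] eventually_at_right_real]) (use \<open>a < u\<close> in simp)
      then obtain d where d: "f u \<le> f (u - d) + e'" "0 < d" "d < u - a"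
        using eventually_happens[of _ "at_right (0::real)"] trivial_limit_at_right_real[of "0::real"] by fastforce
      have "f (u - d) \<le> f a + \<epsilon> * (u - d - a)" using below[of "u - d"] d by auto
      also have "\<dots> \<le> f a + \<epsilon> * (u - a)" using d \<epsilon> by auto
      finally show "f u \<le> f a + \<epsilon> * (u - a) + e'" using d by linarith
    qed
  qed simp
  have "u = b"
  proof (rule ccontr)
    assume "u \<noteq> b" hence ub': "u < b" using ub by simp
    from right[OF au ub' \<epsilon>] obtain D where D: "D > 0" "\<And>d. 0 < d \<Longrightarrow> d < D \<Longrightarrow> f (u + d) \<le> f u + \<epsilon> * d"
      unfolding eventually_at_right_field by auto
    define v where "v = u + min (D / 2) (b - u)"
    have v: "v \<le> b" "v > u" "v < u + D" using D ub' unfolding v_def by (auto simp: min_def)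
    have "v \<in> S"
    proof -
      have "f s \<le> f a + \<epsilon> * (s - a)" if "a \<le> s" "s \<le> v" for s
      proof -
        consider "s < u" | "s = u" | "s > u" by linarith
        thus ?thesis
        proof cases
          case 3
          have "f (u + (s - u)) \<le> f u + \<epsilon> * (s - u)" using D(2)[of "s - u"] 3 that v by auto
          thus ?thesis using fu by (simp add: algebra_simps)
        qed (use below fu that in auto)
      qed
      hence "\<forall>s\<in>{a..v}. f s \<le> f a + \<epsilon> * (s - a)" by simp
      moreover have "v \<in> {a..b}" using v au by simp
      ultimately show ?thesis unfolding S_def by blast
    qed
    hence "v \<le> u" unfolding u_def using bdd by (rule cSup_upper)
    thus False using v by simp
  qed
  hence "f b \<le> f a + \<epsilon> * (b - a)" using fu by simp
  also have "\<epsilon> * (b - a) \<le> e" using ab e by (simp add: \<epsilon>_def field_simps)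
  finally show "f b \<le> f a + e" by simp
qed

section \<open>Expectations under probability mass functions\<close>

lemma pmf_finite_mass:
  fixes \<mu> :: "'s::countable pmf"
  assumes "e > 0"
  obtains F where "finite F" "measure_pmf.prob \<mu> (- F) < e"
proof -
  define G :: "nat \<Rightarrow> 's set" where "G n = {x. to_nat x < n}" for n
  have "(\<lambda>n. measure_pmf.prob \<mu> (G n)) \<longlonglongrightarrow> measure_pmf.prob \<mu> (\<Union>n. G n)"
    by (rule measure_pmf.finite_Lim_measure_incseq) (auto simp: G_def incseq_def)
  moreover have "(\<Union>n. G n) = UNIV" by (auto simp: G_def)
  ultimately have "(\<lambda>n. measure_pmf.prob \<mu> (G n)) \<longlonglongrightarrow> 1"
    by (simp add: measure_pmf.prob_space[of \<mu>, simplified])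
  hence "\<forall>\<^sub>F n in sequentially. measure_pmf.prob \<mu> (G n) > 1 - e"
    by (rule order_tendstoD) (use assms in auto)
  then obtain n where n: "measure_pmf.prob \<mu> (G n) > 1 - e"
    by (auto simp: eventually_sequentially)
  have "finite (G n)"
  proof (rule finite_imageD)
    show "finite (to_nat ` G n)" by (rule finite_subset[of _ "{..<n}"]) (auto simp: G_def)
    show "inj_on to_nat (G n)" by (auto intro: inj_onI)
  qed
  moreover have "measure_pmf.prob \<mu> (- G n) < e"
    using n measure_pmf.prob_compl[of "G n" \<mu>] by (simp add: Compl_eq_Diff_UNIV)
  ultimately show ?thesis using that by blast
qed

lemma pmf_bounded_integrable:
  fixes f :: "'s::countable \<Rightarrow> real"
  assumes "\<And>z. \<bar>f z\<bar> \<le> B"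
  shows "integrable (measure_pmf \<mu>) f"
  by (rule measure_pmf.integrable_const_bound[where B = B]) (use assms in auto)

lemma pmf_expectation_bounds:
  fixes g :: "'s::countable \<Rightarrow> real"
  assumes "\<And>y. 0 \<le> g y" "\<And>y. g y \<le> B"
  shows "0 \<le> (\<integral>y. g y \<partial>measure_pmf \<mu>)" "(\<integral>y. g y \<partial>measure_pmf \<mu>) \<le> B"
    "ennreal (\<integral>y. g y \<partial>measure_pmf \<mu>) = (\<integral>\<^sup>+y. ennreal (g y) \<partial>measure_pmf \<mu>)"
proof -
  show "0 \<le> (\<integral>y. g y \<partial>measure_pmf \<mu>)" using assms by (simp add: integral_nonneg_AE)
  have i: "integrable (measure_pmf \<mu>) g"
    by (rule pmf_bounded_integrable[where B = B]) (use assms in \<open>simp add: abs_of_nonneg\<close>)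
  thus "(\<integral>y. g y \<partial>measure_pmf \<mu>) \<le> B" using assms by (intro measure_pmf.integral_le_const) auto
  show "ennreal (\<integral>y. g y \<partial>measure_pmf \<mu>) = (\<integral>\<^sup>+y. ennreal (g y) \<partial>measure_pmf \<mu>)"
    by (rule nn_integral_eq_integral[symmetric]) (use assms i in auto)
qed

lemma pmf_expectation_bind_bounded:
  fixes g :: "'s::countable \<Rightarrow> real" and \<mu> :: "'t::countable pmf"
  assumes "\<And>y. 0 \<le> g y" "\<And>y. g y \<le> B"
  shows "(\<integral>y. g y \<partial>measure_pmf (bind_pmf \<mu> \<nu>)) = (\<integral>z. (\<integral>y. g y \<partial>measure_pmf (\<nu> z)) \<partial>measure_pmf \<mu>)"
proof -
  note b = pmf_expectation_bounds[OF assms]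
  have "ennreal (\<integral>y. g y \<partial>measure_pmf (bind_pmf \<mu> \<nu>)) = (\<integral>\<^sup>+z. ennreal (\<integral>y. g y \<partial>measure_pmf (\<nu> z)) \<partial>measure_pmf \<mu>)"
    by (simp add: b)
  also have "\<dots> = ennreal (\<integral>z. (\<integral>y. g y \<partial>measure_pmf (\<nu> z)) \<partial>measure_pmf \<mu>)"
    by (rule pmf_expectation_bounds(3)[symmetric]) (rule b)+
  finally show ?thesis
    by (subst (asm) ennreal_inj[OF b(1) pmf_expectation_bounds(1)[OF b(1,2)]])
qed

text \<open>Dominated convergence for Dini inequalities. The pointwise bound holds for small d
  depending on z, hence uniformly only on a finite set F; the Lipschitz bound \<open>C * d\<close>
  is used off F, where the mass is so small that its contribution is at most
  \<open>\<epsilon> / 2 * d\<close>.\<close>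

lemma expectation_dini:
  fixes \<mu> :: "'s::countable pmf" and f :: "real \<Rightarrow> 's \<Rightarrow> real" and g :: "'s \<Rightarrow> real"
  assumes pt: "\<And>z \<epsilon>. \<epsilon> > 0 \<Longrightarrow> \<forall>\<^sub>F d in at_right 0. f d z \<le> g z + \<epsilon> * d"
    and dom: "\<And>d z. 0 < d \<Longrightarrow> d \<le> 1 \<Longrightarrow> f d z \<le> g z + C * d"
    and bf: "\<And>d z. \<bar>f d z\<bar> \<le> B" and bg: "\<And>z. \<bar>g z\<bar> \<le> B"
    and "\<epsilon> > 0"
  shows "\<forall>\<^sub>F d in at_right 0. (\<integral>z. f d z \<partial>measure_pmf \<mu>) \<le> (\<integral>z. g z \<partial>measure_pmf \<mu>) + \<epsilon> * d"
proof -
  obtain F where F: "finite F" "measure_pmf.prob \<mu> (- F) < \<epsilon> / (2 * (\<bar>C\<bar> + 1))"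
    using pmf_finite_mass[of "\<epsilon> / (2 * (\<bar>C\<bar> + 1))" \<mu>] \<open>\<epsilon> > 0\<close> by auto
  have "\<forall>\<^sub>F d in at_right 0. \<forall>z\<in>F. f d z \<le> g z + (\<epsilon> / 2) * d"
    using F(1) pt[of "\<epsilon> / 2"] \<open>\<epsilon> > 0\<close> by (intro eventually_ball_finite) auto
  moreover have "\<forall>\<^sub>F d in at_right 0. d \<in> {0<..<(1::real)}" by (rule eventually_at_right_real) simp
  ultimately show ?thesis
  proof eventually_elim
    case (elim d)
    have "(\<integral>z. f d z \<partial>measure_pmf \<mu>) \<le> (\<integral>z. g z + (\<epsilon> / 2) * d + \<bar>C\<bar> * d * indicator (- F) z \<partial>measure_pmf \<mu>)"
    proof (rule integral_mono)
      fix z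
      show "f d z \<le> g z + (\<epsilon> / 2) * d + \<bar>C\<bar> * d * indicator (- F) z"
      proof (cases "z \<in> F")
        case False
        have "f d z \<le> g z + C * d" using dom elim by auto
        also have "C * d \<le> \<bar>C\<bar> * d" using elim by (intro mult_right_mono) auto
        finally have "f d z \<le> g z + \<bar>C\<bar> * d" by simp
        moreover have "0 < \<epsilon> * d" using elim \<open>\<epsilon> > 0\<close> by simp
        ultimately show ?thesis using False by simp
      qed (use elim in auto)
    next
      show "integrable (measure_pmf \<mu>) (f d)" using bf by (rule pmf_bounded_integrable)
      have i1: "integrable (measure_pmf \<mu>) g" using bg by (rule pmf_bounded_integrable)
      show "integrable (measure_pmf \<mu>) (\<lambda>z. g z + (\<epsilon> / 2) * d + \<bar>C\<bar> * d * indicator (- F) z)"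
        by (intro Bochner_Integration.integrable_add i1 measure_pmf.integrable_const
          pmf_bounded_integrable[of "\<lambda>z. \<bar>C\<bar> * d * indicator (- F) z" "\<bar>C\<bar> * \<bar>d\<bar>"])
          (auto simp: indicator_def abs_mult)
    qed
    also have "\<dots> = (\<integral>z. g z \<partial>measure_pmf \<mu>) + (\<epsilon> / 2) * d + \<bar>C\<bar> * d * measure_pmf.prob \<mu> (- F)"
    proof -
      have i1: "integrable (measure_pmf \<mu>) g" using bg by (rule pmf_bounded_integrable)
      have i2: "integrable (measure_pmf \<mu>) (\<lambda>z. (\<epsilon> / 2) * d)" by simp
      have i3: "integrable (measure_pmf \<mu>) (\<lambda>z. \<bar>C\<bar> * d * indicator (- F) z)"
        by (rule pmf_bounded_integrable[where B = "\<bar>C\<bar> * \<bar>d\<bar>"]) (auto simp: indicator_def abs_mult)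
      show ?thesis
        by (simp only: Bochner_Integration.integral_add[OF Bochner_Integration.integrable_add[OF i1 i2] i3]
          Bochner_Integration.integral_add[OF i1 i2]) simp
    qed
    also have "\<bar>C\<bar> * d * measure_pmf.prob \<mu> (- F) \<le> (\<epsilon> / 2) * d"
    proof -
      have "\<bar>C\<bar> * measure_pmf.prob \<mu> (- F) \<le> (\<bar>C\<bar> + 1) * (\<epsilon> / (2 * (\<bar>C\<bar> + 1)))"
        using F(2) by (intro mult_mono) auto
      also have "\<dots> = \<epsilon> / 2" by (simp add: field_simps)
      finally show ?thesis using elim by (simp add: mult.commute mult.left_commute mult_right_mono)
    qed
    finally show ?case by simp
  qed
qed

lemma has_derivative_at_rightD:
  fixes f :: "real \<Rightarrow> real"
  assumes "(f has_real_derivative D) (at_right t)" "\<epsilon> > 0"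
  shows "\<forall>\<^sub>F d in at_right 0. \<bar>f (t + d) - f t - D * d\<bar> \<le> \<epsilon> * d"
proof -
  have "((\<lambda>y. (f y - f t) / (y - t)) \<longlongrightarrow> D) (at_right t)"
    using assms(1) by (simp add: has_field_derivative_iff)
  hence "((\<lambda>d. (f (t + d) - f t) / d) \<longlongrightarrow> D) (at_right 0)"
    unfolding at_right_to_0[of t] filterlim_filtermap by (simp add: add.commute)
  hence "\<forall>\<^sub>F d in at_right 0. dist ((f (t + d) - f t) / d) D < \<epsilon>"
    using assms(2) by (rule tendstoD)
  moreover have "\<forall>\<^sub>F d in at_right (0::real). d > 0" by (simp add: eventually_at_right_less)
  ultimately show ?thesis
  proof eventually_elim
    case (elim d)
    have "f (t + d) - f t - D * d = ((f (t + d) - f t) / d - D) * d"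
      using elim by (simp add: field_simps)
    hence "\<bar>f (t + d) - f t - D * d\<bar> = \<bar>(f (t + d) - f t) / d - D\<bar> * d"
      using elim by (simp only: abs_mult abs_of_pos)
    also have "\<dots> \<le> \<epsilon> * d" using elim by (intro mult_right_mono) (auto simp: dist_real_def)
    finally show ?case .
  qed
qed

section \<open>Semigroups with bounded exit rates: short-time estimates\<close>

locale jump_semigroup =
  fixes p :: "real \<Rightarrow> 's::countable \<Rightarrow> 's pmf" and q :: "'s \<Rightarrow> 's \<Rightarrow> real" and \<Lambda> :: real
  assumes semigroup: "transition_semigroup p"
    and rates: "has_jump_rates p q"
    and nonneg: "y \<noteq> x \<Longrightarrow> 0 \<le> q x y"
    and fin: "finite {y. y \<noteq> x \<and> q x y \<noteq> 0}"
    and exit_bound: "(\<Sum>y | y \<noteq> x \<and> q x y \<noteq> 0. q x y) \<le> \<Lambda>"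
begin

definition supp :: "'s \<Rightarrow> 's set" where "supp x = {y. y \<noteq> x \<and> q x y \<noteq> 0}"

definition gen :: "('s \<Rightarrow> real) \<Rightarrow> 's \<Rightarrow> real" where
  "gen g x = (\<Sum>y\<in>supp x. q x y * (g y - g x))"

definition exit :: "'s \<Rightarrow> real" where "exit x = (\<Sum>y\<in>supp x. q x y)"

lemma finite_supp: "finite (supp x)" using fin by (simp add: supp_def)

lemma exit_nonneg: "0 \<le> exit x"
  unfolding exit_def by (rule sum_nonneg) (auto simp: supp_def intro: nonneg)

lemma exit_le: "exit x \<le> \<Lambda>" using exit_bound[of x] by (simp add: exit_def supp_def)

lemma Lambda_nonneg: "0 \<le> \<Lambda>" using exit_nonneg exit_le order_trans by blast

lemma p_0 [simp]: "p 0 x = return_pmf x"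
  using semigroup by (simp add: transition_semigroup_def)

lemma p_add: "0 \<le> s \<Longrightarrow> 0 \<le> t \<Longrightarrow> p (s + t) x = bind_pmf (p s x) (p t)"
  using semigroup by (simp add: transition_semigroup_def)

lemma infsum_exit: "(\<Sum>\<^sub>\<infinity>z\<in>- {x}. q x z) = exit x"
proof -
  have "(\<Sum>\<^sub>\<infinity>z\<in>- {x}. q x z) = (\<Sum>\<^sub>\<infinity>z\<in>supp x. q x z)"
    by (rule infsum_cong_neutral) (auto simp: supp_def)
  thus ?thesis using finite_supp by (simp add: exit_def)
qed

lemma deriv_diag: "((\<lambda>h. pmf (p h x) x) has_real_derivative - exit x) (at_right 0)"
  using rates[unfolded has_jump_rates_def, rule_format, of x x] by (simp add: infsum_exit)

lemma deriv_off: "y \<noteq> x \<Longrightarrow> ((\<lambda>h. pmf (p h x) y) has_real_derivative q x y) (at_right 0)"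
  using rates[unfolded has_jump_rates_def, rule_format, of x y] by simp

lemma chapman_kolmogorov_ge:
  assumes "0 \<le> s" "0 \<le> t" "finite F"
  shows "(\<Sum>z\<in>F. pmf (p s x) z * pmf (p t z) y) \<le> pmf (p (s + t) x) y"
proof -
  have "(\<Sum>z\<in>F. pmf (p s x) z * pmf (p t z) y) = (\<integral>z. indicator F z * pmf (p t z) y \<partial>measure_pmf (p s x))"
    using assms(3)
    by (subst integral_measure_pmf_real[of F]) (auto simp: indicator_def mult.commute intro!: sum.cong)
  also have "\<dots> \<le> (\<integral>z. pmf (p t z) y \<partial>measure_pmf (p s x))"
    by (rule integral_mono) (auto intro!: pmf_bounded_integrable[where B = 1] simp: indicator_def pmf_le_1)
  also have "\<dots> = pmf (p (s + t) x) y" using assms by (simp add: p_add pmf_bind)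
  finally show ?thesis .
qed

lemma stay_small: "\<epsilon> > 0 \<Longrightarrow> \<forall>\<^sub>F d in at_right 0. pmf (p d x) x \<ge> 1 - (\<Lambda> + \<epsilon>) * d"
proof -
  assume "\<epsilon> > 0"
  have "\<forall>\<^sub>F d in at_right 0. \<bar>pmf (p (0 + d) x) x - pmf (p 0 x) x - (- exit x) * d\<bar> \<le> \<epsilon> * d"
    using deriv_diag \<open>\<epsilon> > 0\<close> by (rule has_derivative_at_rightD)
  moreover have "\<forall>\<^sub>F d in at_right (0::real). d > 0" by (simp add: eventually_at_right_less)
  ultimately show ?thesis
  proof eventually_elim
    case (elim d)
    have "exit x * d \<le> \<Lambda> * d" using elim exit_le by (simp add: mult_right_mono)
    moreover have "1 - exit x * d - \<epsilon> * d \<le> pmf (p d x) x" using elim by (simp add: abs_le_iff)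
    ultimately show ?case by (simp only: distrib_right)
  qed
qed

text \<open>The derivative at 0 gives this only for small times depending on x
  (\<open>stay_small\<close>). Supermultiplicativity of \<open>pmf (p t x) x\<close> in t transfers
  the slope at 0 to all times, and the bound becomes uniform in x. This uniformity provides the
  dominating term \<open>C * d\<close> whenever a Dini inequality is integrated over the current
  state.\<close>

lemma stay:
  assumes "0 \<le> t"
  shows "pmf (p t x) x \<ge> 1 - \<Lambda> * t"
proof -
  define f where "f s = - pmf (p s x) x - \<Lambda> * s" for s
  have sub: "pmf (p s x) x * pmf (p d x) x \<le> pmf (p (s + d) x) x" if "0 \<le> s" "0 \<le> d" for s d
    using chapman_kolmogorov_ge[of s d "{x}" x x] that by simp
  have "f t \<le> f 0"
  proof (rule right_dini_nonincreasing[OF assms])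
    fix s \<epsilon> :: real assume s: "0 \<le> s" "s < t" "\<epsilon> > 0"
    have pos: "\<forall>\<^sub>F d in at_right (0::real). d > 0" by (simp add: eventually_at_right_less)
    show "\<forall>\<^sub>F d in at_right 0. f (s + d) \<le> f s + \<epsilon> * d"
      using stay_small[OF s(3), of x] pos
    proof eventually_elim
      case (elim d)
      have "pmf (p s x) x - (\<Lambda> + \<epsilon>) * d \<le> pmf (p s x) x * (1 - (\<Lambda> + \<epsilon>) * d)"
      proof -
        have "pmf (p s x) x * ((\<Lambda> + \<epsilon>) * d) \<le> 1 * ((\<Lambda> + \<epsilon>) * d)"
          using Lambda_nonneg s elim by (intro mult_right_mono) (auto simp: pmf_le_1)
        thus ?thesis by (simp add: algebra_simps)
      qed
      also have "\<dots> \<le> pmf (p s x) x * pmf (p d x) x" using elim by (intro mult_left_mono) auto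
      also have "\<dots> \<le> pmf (p (s + d) x) x" using sub s elim by simp
      finally show ?case by (simp add: f_def algebra_simps)
    qed
  next
    fix s \<epsilon> :: real assume s: "0 < s" "s \<le> t" "\<epsilon> > 0"
    have 1: "\<forall>\<^sub>F d in at_right (0::real). d \<in> {0<..<min s (\<epsilon> / (\<Lambda> + 1))}"
      by (rule eventually_at_right_real) (use s Lambda_nonneg in auto)
    show "\<forall>\<^sub>F d in at_right 0. f s \<le> f (s - d) + \<epsilon>"
      using stay_small[of 1 x, simplified] 1
    proof eventually_elim
      case (elim d)
      have "pmf (p (s - d) x) x - \<epsilon> \<le> pmf (p (s - d) x) x - (\<Lambda> + 1) * d"
        using elim Lambda_nonneg by (auto simp: field_simps)
      also have "\<dots> \<le> pmf (p (s - d) x) x * (1 - (\<Lambda> + 1) * d)"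
      proof -
        have "pmf (p (s - d) x) x * ((\<Lambda> + 1) * d) \<le> 1 * ((\<Lambda> + 1) * d)"
          using Lambda_nonneg s elim by (intro mult_right_mono) (auto simp: pmf_le_1)
        thus ?thesis by (simp add: algebra_simps)
      qed
      also have "\<dots> \<le> pmf (p (s - d) x) x * pmf (p d x) x" using elim by (intro mult_left_mono) auto
      also have "\<dots> \<le> pmf (p s x) x" using sub[of "s - d" d] s elim by simp
      finally have "pmf (p (s - d) x) x - \<epsilon> \<le> pmf (p s x) x" .
      moreover have "\<Lambda> * (s - d) \<le> \<Lambda> * s" using Lambda_nonneg elim by (intro mult_left_mono) auto
      ultimately show ?case by (simp add: f_def)
    qed
  qed
  thus ?thesis by (simp add: f_def)
qed

text \<open>The derivatives at 0 of the finitely many entries over \<open>insert x (supp x)\<close>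
  sum to zero, so these entries keep mass \<open>1 - o(d)\<close>. Vanishing derivatives at the
  other states taken one by one would not suffice, since there are infinitely many of them.\<close>

lemma prob_outside_supp:
  assumes "\<epsilon> > 0"
  shows "\<forall>\<^sub>F d in at_right 0. measure_pmf.prob (p d x) (- insert x (supp x)) \<le> \<epsilon> * d"
proof -
  define F where "F = insert x (supp x)"
  have F: "finite F" "x \<notin> supp x" using finite_supp by (auto simp: F_def supp_def)
  define c where "c = real (card (supp x)) + 1"
  have "\<forall>\<^sub>F d in at_right 0. \<forall>y\<in>supp x. \<bar>pmf (p (0+d) x) y - pmf (p 0 x) y - q x y * d\<bar> \<le> (\<epsilon> / c) * d"
    using finite_supp assms c_def
    by (intro eventually_ball_finite ballI has_derivative_at_rightD deriv_off) (auto simp: supp_def)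
  moreover have "\<forall>\<^sub>F d in at_right 0. \<bar>pmf (p (0 + d) x) x - pmf (p 0 x) x - (- exit x) * d\<bar> \<le> (\<epsilon>/c) * d"
    by (rule has_derivative_at_rightD[OF deriv_diag]) (use assms c_def in auto)
  ultimately show ?thesis
  proof eventually_elim
    case (elim d)
    have 1: "measure_pmf.prob (p d x) (- F) = 1 - (\<Sum>y\<in>F. pmf (p d x) y)"
      using measure_pmf.prob_compl[of F "p d x"] F(1)
      by (simp add: Compl_eq_Diff_UNIV measure_measure_pmf_finite)
    have 2: "(\<Sum>y\<in>F. pmf (p d x) y) = pmf (p d x) x + (\<Sum>y\<in>supp x. pmf (p d x) y)"
      using F finite_supp by (simp add: F_def)
    have 3: "(\<Sum>y\<in>supp x. pmf (p d x) y) \<ge> (\<Sum>y\<in>supp x. q x y * d - (\<epsilon> / c) * d)"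
    proof (rule sum_mono)
      fix y assume y: "y \<in> supp x"
      hence "y \<noteq> x" by (simp add: supp_def)
      thus "q x y * d - (\<epsilon> / c) * d \<le> pmf (p d x) y" using elim(1) y by (auto simp: abs_le_iff)
    qed
    have 4: "(\<Sum>y\<in>supp x. q x y * d - (\<epsilon> / c) * d) = exit x * d - real (card (supp x)) * (\<epsilon> / c * d)"
      by (simp add: sum_subtractf exit_def sum_distrib_right)
    have "measure_pmf.prob (p d x) (- F) \<le> 1 - (pmf (p d x) x + (exit x * d - real (card (supp x)) * (\<epsilon> / c * d)))"
      using 3 unfolding 1 2 4 by linarith
    also have "\<dots> \<le> \<epsilon> / c * d + real (card (supp x)) * (\<epsilon> / c * d)"
      using elim(2) by (simp add: abs_le_iff)
    also have "\<dots> = c * (\<epsilon> / c * d)"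
    proof -
      have "X + n * X = (n + 1) * X" for X n :: real by (simp add: algebra_simps)
      thus ?thesis unfolding c_def .
    qed
    also have "\<dots> = \<epsilon> * d" using c_def by simp
    finally show ?case by (simp add: F_def)
  qed
qed

lemma expectation_upper:
  fixes g :: "'s \<Rightarrow> real"
  assumes "\<And>z. g z \<le> B" "\<And>z. 0 \<le> g z" "finite F" "0 \<le> B"
  shows "(\<integral>y. g y \<partial>measure_pmf \<mu>) \<le> (\<Sum>y\<in>F. pmf \<mu> y * g y) + B * measure_pmf.prob \<mu> (- F)"
proof -
  have "(\<integral>y. g y \<partial>measure_pmf \<mu>) \<le> (\<integral>y. indicator F y * g y + B * indicator (- F) y \<partial>measure_pmf \<mu>)"
    using assms by (intro integral_mono Bochner_Integration.integrable_add
       pmf_bounded_integrable[where B = B]) (auto simp: indicator_def)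
  also have "\<dots> = (\<integral>y. indicator F y * g y \<partial>measure_pmf \<mu>) + (\<integral>y. B * indicator (- F) y \<partial>measure_pmf \<mu>)"
    using assms by (intro Bochner_Integration.integral_add pmf_bounded_integrable[where B = B])
      (auto simp: indicator_def)
  also have "(\<integral>y. indicator F y * g y \<partial>measure_pmf \<mu>) = (\<Sum>y\<in>F. pmf \<mu> y * g y)"
    using assms(3) by (subst integral_measure_pmf_real[of F]) (auto simp: indicator_def mult.commute intro!: sum.cong)
  finally show ?thesis by simp
qed

lemma expectation_jump_bound:
  fixes g :: "'s \<Rightarrow> real"
  assumes "\<And>z. g z \<le> B" "\<And>z. 0 \<le> g z" "0 \<le> d"
  shows "(\<integral>y. g y \<partial>measure_pmf (p d x)) \<le> g x + B * \<Lambda> * d"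
proof -
  have B: "0 \<le> B" using assms(1,2) order_trans by blast
  have "(\<integral>y. g y \<partial>measure_pmf (p d x)) \<le> (\<Sum>y\<in>{x}. pmf (p d x) y * g y) + B * measure_pmf.prob (p d x) (- {x})"
    using assms(1,2) B by (intro expectation_upper) auto
  also have "\<dots> = pmf (p d x) x * g x + B * (1 - pmf (p d x) x)"
    using measure_pmf.prob_compl[of "{x}" "p d x"] by (simp add: Compl_eq_Diff_UNIV measure_pmf_single)
  also have "\<dots> \<le> 1 * g x + B * (\<Lambda> * d)"
    using stay[OF assms(3), of x] assms B by (intro add_mono mult_right_mono mult_left_mono) (auto simp: pmf_le_1)
  finally show ?thesis by simp
qed

text \<open>Two functions occur because U will be a truncation of V. Boundedness of U makes the
  small mass outside \<open>insert z (supp z)\<close> contribute only \<open>o(d)\<close>, while on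
  this finite set the expansion to first order is that of V, which is differentiable in time; the
  truncation need not be.\<close>

lemma gen_dini:
  fixes U V :: "real \<Rightarrow> 's \<Rightarrow> real"
  assumes U: "\<And>d y. 0 \<le> U d y" "\<And>d y. U d y \<le> B" "\<And>d y. U d y \<le> V d y"
    and deriv: "\<And>y. ((\<lambda>d. V d y) has_real_derivative V' y) (at_right 0)"
    and "\<epsilon> > 0"
  shows "\<forall>\<^sub>F d in at_right 0. (\<integral>y. U d y \<partial>measure_pmf (p d z)) \<le> V 0 z + (V' z + gen (V 0) z + \<epsilon>) * d"
proof -
  define F where "F = insert z (supp z)"
  have zs: "z \<notin> supp z" by (simp add: supp_def)
  have B: "0 \<le> B" using U(1,2) order_trans by blast
  define \<psi> where "\<psi> d = (\<Sum>y\<in>F. pmf (p d z) y * V d y)" for d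
  define D where "D y = (if y = z then - exit z else q z y)" for y
  have "(\<psi> has_real_derivative (\<Sum>y\<in>F. pmf (p 0 z) y * V' y + D y * V 0 y)) (at_right 0)"
    unfolding \<psi>_def
    by (intro DERIV_sum DERIV_mult' deriv) (auto simp: D_def intro: deriv_diag deriv_off)
  also have "(\<Sum>y\<in>F. pmf (p 0 z) y * V' y + D y * V 0 y) = V' z + gen (V 0) z"
  proof -
    have 1: "(\<Sum>y\<in>supp z. pmf (p 0 z) y * V' y + D y * V 0 y) = (\<Sum>y\<in>supp z. q z y * V 0 y)"
      by (intro sum.cong) (auto simp: D_def supp_def)
    have 2: "gen (V 0) z = (\<Sum>y\<in>supp z. q z y * V 0 y) - exit z * V 0 z"
      by (simp add: gen_def exit_def right_diff_distrib sum_subtractf sum_distrib_right)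
    show ?thesis unfolding F_def using finite_supp zs 1 2 by (simp add: D_def)
  qed
  finally have d\<psi>: "(\<psi> has_real_derivative V' z + gen (V 0) z) (at_right 0)" .
  have \<psi>0: "\<psi> 0 = V 0 z" unfolding \<psi>_def F_def using finite_supp[of z] zs
    by (simp add: pmf_return indicator_def sum.neutral)
  have e: "\<epsilon> / 2 > 0" "\<epsilon> / (2 * (B + 1)) > 0" using \<open>\<epsilon> > 0\<close> B by auto
  show ?thesis
    using has_derivative_at_rightD[OF d\<psi> e(1)] prob_outside_supp[OF e(2), of z]
      eventually_at_right_less[of "0::real"]
  proof eventually_elim
    case (elim d)
    have "(\<integral>y. U d y \<partial>measure_pmf (p d z)) \<le> (\<Sum>y\<in>F. pmf (p d z) y * U d y) + B * measure_pmf.prob (p d z) (- F)"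
      using U B finite_supp by (intro expectation_upper) (auto simp: F_def)
    also have "(\<Sum>y\<in>F. pmf (p d z) y * U d y) \<le> \<psi> d"
      unfolding \<psi>_def using U(3) by (intro sum_mono mult_left_mono) auto
    also have "\<psi> d \<le> V 0 z + (V' z + gen (V 0) z) * d + \<epsilon> / 2 * d"
    proof -
      have "\<psi> d - V 0 z - (V' z + gen (V 0) z) * d \<le> \<epsilon> / 2 * d"
        using elim(1) \<psi>0 by (simp only: abs_le_iff add_0)
      thus ?thesis by linarith
    qed
    also have "B * measure_pmf.prob (p d z) (- F) \<le> \<epsilon> / 2 * d"
    proof -
      have "B * measure_pmf.prob (p d z) (- F) \<le> (B + 1) * (\<epsilon> / (2 * (B + 1)) * d)"
        using elim B by (intro mult_mono) (auto simp: F_def)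
      also have "\<dots> = \<epsilon> / 2 * d"
      proof -
        have "b * (\<epsilon> / (2 * b) * d) = \<epsilon> / 2 * d" if "b \<noteq> 0" for b using that by simp
        thus ?thesis using B by (metis add_nonneg_pos less_irrefl zero_less_one)
      qed
      finally show ?thesis .
    qed
    finally show ?case by (simp add: algebra_simps)
  qed
qed

section \<open>Supermartingales from generator inequalities\<close>

lemma integral_p_add:
  fixes g :: "'s \<Rightarrow> real"
  assumes "0 \<le> s" "0 \<le> t" "\<And>y. 0 \<le> g y" "\<And>y. g y \<le> B"
  shows "(\<integral>y. g y \<partial>measure_pmf (p (s + t) x)) = (\<integral>z. (\<integral>y. g y \<partial>measure_pmf (p t z)) \<partial>measure_pmf (p s x))"
  using assms by (simp add: p_add pmf_expectation_bind_bounded[where B = B])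

text \<open>Truncation at M keeps all integrands bounded and preserves the claim: where V is at
  least M, a truncated expectation cannot exceed M; elsewhere V and its truncation agree at the
  present time, and truncation only lowers the later value. The role of \<open>grow\<close> is to
  bound increments of the truncated function in time uniformly in the state.\<close>

lemma supermartingale_trunc:
  fixes V :: "real \<Rightarrow> 's \<Rightarrow> real"
  assumes V0: "\<And>t x. 0 \<le> V t x"
    and deriv: "\<And>t x. 0 \<le> t \<Longrightarrow> t < b \<Longrightarrow> ((\<lambda>d. V (t + d) x) has_real_derivative V' t x) (at_right 0)"
    and grow: "\<And>t d x. 0 \<le> t \<Longrightarrow> 0 \<le> d \<Longrightarrow> t + d \<le> b \<Longrightarrow> V (t + d) x \<le> exp (L * d) * V t x"
    and L: "0 \<le> L"
    and gen: "\<And>t x. 0 \<le> t \<Longrightarrow> t < b \<Longrightarrow> V' t x + gen (V t) x \<le> 0"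
    and t: "0 \<le> t" "0 \<le> h" "t + h \<le> b" and M: "0 < M"
  shows "(\<integral>y. min (V (t + h) y) M \<partial>measure_pmf (p h x)) \<le> min (V t x) M"
proof -
  define W where "W s y = min (V s y) M" for s y
  have W: "0 \<le> W s y" "W s y \<le> M" for s y using V0 M by (auto simp: W_def)
  define K where "K = M * L * exp L + M * \<Lambda>"
  have Wgrow: "W (s + d) y \<le> W s y + M * L * exp L * d" if "0 \<le> s" "0 \<le> d" "s + d \<le> b" "d \<le> 1" for s d y
  proof (cases "V s y \<ge> M")
    case True
    have "0 \<le> M * L * exp L * d" using M L that by simp
    thus ?thesis using True W(2)[of "s+d" y] by (simp add: W_def)
  next
    case False
    have "1 - L * d \<le> exp (- (L * d))" using exp_ge_add_one_self[of "- (L * d)"] by simp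
    hence "(1 - L * d) * exp (L * d) \<le> exp (- (L * d)) * exp (L * d)" by (intro mult_right_mono) auto
    hence e1: "exp (L * d) - 1 \<le> L * d * exp (L * d)" by (simp add: exp_minus algebra_simps)
    have "L * d \<le> L * 1" using that L by (intro mult_left_mono) auto
    hence "L * d * exp (L * d) \<le> L * d * exp L" using L that by (intro mult_left_mono) auto
    hence e2: "exp (L * d) - 1 \<le> L * d * exp L" using e1 by simp
    have "W (s + d) y \<le> exp (L * d) * V s y" using grow[of s d y] that by (simp add: W_def)
    also have "\<dots> = V s y + (exp (L * d) - 1) * V s y" by (simp add: algebra_simps)
    also have "(exp (L * d) - 1) * V s y \<le> (L * d * exp L) * M"
      using e2 False V0 L that by (intro mult_mono) auto
    finally show ?thesis using False by (simp add: W_def mult_ac)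
  qed
  define f where "f s = (\<integral>y. W (t + s) y \<partial>measure_pmf (p s x))" for s
  define A where "A s d z = (\<integral>y. W (t + s + d) y \<partial>measure_pmf (p d z))" for s d z
  have Ab: "0 \<le> A s d z" "A s d z \<le> M" for s d z
    unfolding A_def using W by (auto intro: pmf_expectation_bounds)
  have fA: "f (s + d) = (\<integral>z. A s d z \<partial>measure_pmf (p s x))" if "0 \<le> s" "0 \<le> d" for s d
    unfolding f_def A_def using that W
    by (subst integral_p_add[where B = M]) (auto simp: add.assoc)
  have Adom: "A s d z \<le> W (t + s) z + K * d" if "0 \<le> s" "0 \<le> d" "s + d \<le> h" "d \<le> 1" for s d z
  proof -
    have "A s d z \<le> W (t + s + d) z + M * \<Lambda> * d"
      unfolding A_def using W that by (intro expectation_jump_bound) auto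
    also have "W (t + s + d) z \<le> W (t + s) z + M * L * exp L * d" using that t by (intro Wgrow) auto
    finally show ?thesis by (simp add: K_def algebra_simps)
  qed
  have K: "0 \<le> K" using M L Lambda_nonneg by (simp add: K_def)
  have fup: "f (s + d) \<le> f s + K * d" if "0 \<le> s" "0 \<le> d" "s + d \<le> h" "d \<le> 1" for s d
  proof -
    have i: "integrable (measure_pmf (p s x)) (\<lambda>z. W (t + s) z)"
      by (rule pmf_bounded_integrable[where B = M]) (use W in \<open>simp add: abs_of_nonneg\<close>)
    have "f (s + d) \<le> (\<integral>z. W (t + s) z + K * d \<partial>measure_pmf (p s x))"
      unfolding fA[OF that(1,2)] using i that
      by (intro integral_mono Adom Bochner_Integration.integrable_add measure_pmf.integrable_const
          pmf_bounded_integrable[of "A s d" M]) (auto simp: abs_of_nonneg Ab)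
    also have "\<dots> = f s + K * d" using i by (simp add: f_def)
    finally show ?thesis .
  qed
  have "f h \<le> f 0"
  proof (rule right_dini_nonincreasing[OF t(2)])
    fix s \<epsilon> :: real assume s: "0 \<le> s" "s < h" "\<epsilon> > 0"
    define A' where "A' d z = (if d \<le> h - s then A s d z else 0)" for d z
    have d_small: "\<forall>\<^sub>F d in at_right 0. d \<in> {0<..<h - s}"
      by (rule eventually_at_right_real) (use s in simp)
    have "\<forall>\<^sub>F d in at_right 0. (\<integral>z. A' d z \<partial>measure_pmf (p s x)) \<le> (\<integral>z. W (t + s) z \<partial>measure_pmf (p s x)) + \<epsilon> * d"
    proof (rule expectation_dini[where B = M and C = K])
      fix z and e :: real assume e: "e > 0"
      have "\<forall>\<^sub>F d in at_right 0. A s d z \<le> W (t + s) z + e * d"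
      proof (cases "V (t + s) z \<ge> M")
        case True
        show ?thesis using eventually_at_right_less[of "0::real"]
        proof eventually_elim
          case (elim d)
          have "0 < e * d" using e elim by simp
          thus ?case using True Ab(2)[of s d z] by (simp add: W_def)
        qed
      next
        case False
        have "\<forall>\<^sub>F d in at_right 0. (\<integral>y. W (t + s + d) y \<partial>measure_pmf (p d z))
            \<le> V (t + s + 0) z + (V' (t + s) z + gen (V (t + s + 0)) z + e) * d"
          by (rule gen_dini[where B = M]) (use W e s t deriv in \<open>auto simp: W_def\<close>)
        thus ?thesis using eventually_at_right_less[of "0::real"]
        proof eventually_elim
          case (elim d)
          have "(V' (t + s) z + gen (V (t + s + 0)) z + e) * d \<le> e * d"
            using gen[of "t + s" z] s t elim by (intro mult_right_mono) auto
          moreover have "W (t + s) z = V (t + s + 0) z" using False by (simp add: W_def)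
          ultimately show ?case using elim(1) unfolding A_def by linarith
        qed
      qed
      thus "\<forall>\<^sub>F d in at_right 0. A' d z \<le> W (t + s) z + e * d"
        using d_small by eventually_elim (simp add: A'_def)
    next
      fix d z assume d: "0 < d" "d \<le> (1::real)"
      show "A' d z \<le> W (t + s) z + K * d"
      proof (cases "d \<le> h - s")
        case True
        thus ?thesis using Adom[of s d z] d s by (simp add: A'_def)
      next
        case False
        have "0 \<le> K * d" using K d by simp
        thus ?thesis using False W(1)[of "t + s" z] by (simp add: A'_def)
      qed
    qed (use W Ab M s in \<open>auto simp: A'_def abs_of_nonneg\<close>)
    thus "\<forall>\<^sub>F d in at_right 0. f (s + d) \<le> f s + \<epsilon> * d"
      using d_small
    proof eventually_elim
      case (elim d)
      hence "(\<integral>z. A' d z \<partial>measure_pmf (p s x)) = f (s + d)" using s fA[of s d] by (simp add: A'_def)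
      thus ?case using elim(1) by (simp add: f_def[of s])
    qed
  next
    fix s \<epsilon> :: real assume s: "0 < s" "s \<le> h" "\<epsilon> > 0"
    have "\<forall>\<^sub>F d in at_right (0::real). d \<in> {0<..<min (min s 1) (\<epsilon> / (K + 1))}"
      by (rule eventually_at_right_real) (use s K in auto)
    thus "\<forall>\<^sub>F d in at_right 0. f s \<le> f (s - d) + \<epsilon>"
    proof eventually_elim
      case (elim d)
      have "f ((s - d) + d) \<le> f (s - d) + K * d" using elim s by (intro fup) auto
      moreover have "(K + 1) * d \<le> \<epsilon>" using elim K by (auto simp: field_simps)
      ultimately show ?case using elim by (simp add: algebra_simps)
    qed
  qed
  thus ?thesis by (simp add: f_def W_def)
qed

text \<open>Monotone convergence in the truncation level. The nonnegative integral gives the claim a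
  meaning before V is known to be integrable.\<close>

lemma supermartingale:
  fixes V :: "real \<Rightarrow> 's \<Rightarrow> real"
  assumes V0: "\<And>t x. 0 \<le> V t x"
    and deriv: "\<And>t x. 0 \<le> t \<Longrightarrow> t < b \<Longrightarrow> ((\<lambda>d. V (t + d) x) has_real_derivative V' t x) (at_right 0)"
    and grow: "\<And>t d x. 0 \<le> t \<Longrightarrow> 0 \<le> d \<Longrightarrow> t + d \<le> b \<Longrightarrow> V (t + d) x \<le> exp (L * d) * V t x"
    and L: "0 \<le> L"
    and gen: "\<And>t x. 0 \<le> t \<Longrightarrow> t < b \<Longrightarrow> V' t x + gen (V t) x \<le> 0"
    and t: "0 \<le> t" "0 \<le> h" "t + h \<le> b"
  shows "(\<integral>\<^sup>+y. ennreal (V (t + h) y) \<partial>measure_pmf (p h x)) \<le> ennreal (V t x)"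
proof -
  have sup: "ennreal v = (SUP n. ennreal (min v (real (Suc n))))" if "0 \<le> v" for v
  proof (rule antisym)
    obtain n where "v \<le> real n" using real_arch_simple by blast
    hence "ennreal v \<le> ennreal (min v (real (Suc n)))" by (intro ennreal_leI) auto
    also have "\<dots> \<le> (SUP n. ennreal (min v (real (Suc n))))" by (rule SUP_upper) simp
    finally show "ennreal v \<le> (SUP n. ennreal (min v (real (Suc n))))" .
    show "(SUP n. ennreal (min v (real (Suc n)))) \<le> ennreal v"
      by (rule SUP_least) (auto intro!: ennreal_leI)
  qed
  have "(\<integral>\<^sup>+y. ennreal (V (t + h) y) \<partial>measure_pmf (p h x))
      = (\<integral>\<^sup>+y. (SUP n. ennreal (min (V (t + h) y) (real (Suc n)))) \<partial>measure_pmf (p h x))"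
    by (simp only: sup[OF V0, symmetric])
  also have "\<dots> = (SUP n. \<integral>\<^sup>+y. ennreal (min (V (t + h) y) (real (Suc n))) \<partial>measure_pmf (p h x))"
    by (rule nn_integral_monotone_convergence_SUP) (auto simp: incseq_def le_fun_def intro!: ennreal_leI)
  also have "\<dots> \<le> ennreal (V t x)"
  proof (rule SUP_least)
    fix n
    have "(\<integral>\<^sup>+y. ennreal (min (V (t + h) y) (real (Suc n))) \<partial>measure_pmf (p h x))
       = ennreal (\<integral>y. min (V (t + h) y) (real (Suc n)) \<partial>measure_pmf (p h x))"
      by (rule nn_integral_eq_integral)
        (auto intro!: pmf_bounded_integrable[where B = "real (Suc n)"] simp: V0 abs_of_nonneg)
    also have "\<dots> \<le> ennreal (min (V t x) (real (Suc n)))"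
      using t by (intro ennreal_leI supermartingale_trunc[OF V0 deriv grow L gen]) auto
    also have "\<dots> \<le> ennreal (V t x)" by (intro ennreal_leI) simp
    finally show "(\<integral>\<^sup>+y. ennreal (min (V (t + h) y) (real (Suc n))) \<partial>measure_pmf (p h x)) \<le> ennreal (V t x)" .
  qed
  finally show ?thesis .
qed

text \<open>A lower bound that depends on x and y only through the rate. Being at y and staying, or
  being at x and jumping, shows that \<open>pmf (p s x) y\<close> grows at least at rate
  \<open>q x y * (1 - \<Lambda> * s)\<close> minus \<Lambda> times itself. The factor
  \<open>exp (c * s)\<close> compensates the loss, and the quadratic term accounts for the chance of
  having left x. The surplus 1 in \<open>c = \<Lambda> + 1\<close> absorbs second order errors in
  \<open>grow\<close>.\<close>

lemma one_jump:
  assumes "y \<noteq> x" "0 \<le> t"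
  shows "exp (- ((\<Lambda> + 1) * t)) * (q x y * t - (\<Lambda> + 1) * q x y * t\<^sup>2) \<le> pmf (p t x) y"
proof -
  define c where "c = \<Lambda> + 1"
  define r where "r = q x y"
  have r: "0 \<le> r" using nonneg assms by (simp add: r_def)
  have c: "1 \<le> c" using Lambda_nonneg by (simp add: c_def)
  define f where "f s = r * s - c * r * s\<^sup>2 - exp (c * s) * pmf (p s x) y" for s
  have sub: "pmf (p s x) y * pmf (p d y) y + pmf (p s x) x * pmf (p d x) y \<le> pmf (p (s + d) x) y" if "0 \<le> s" "0 \<le> d" for s d
    using chapman_kolmogorov_ge[of s d "{y, x}" x y] that assms by simp
  have small: "\<forall>\<^sub>F d in at_right (0::real). d \<in> {0<..<1 / (c * \<Lambda> + 1)}"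
    by (rule eventually_at_right_real) (use c Lambda_nonneg in \<open>auto intro!: add_nonneg_pos\<close>)
  have grow: "exp (c * s) * pmf (p s x) y \<le> exp (c * (s + d)) * (pmf (p s x) y * pmf (p d y) y)"
    if "d \<in> {0<..<1 / (c * \<Lambda> + 1)}" for s d
  proof -
    have d: "0 < d" "(c * \<Lambda> + 1) * d < 1" using that c Lambda_nonneg pos_less_divide_eq[of "c * \<Lambda> + 1" d 1]
      by (auto simp: mult.commute add_nonneg_pos)
    have "1 \<le> 1 + d * (1 - c * \<Lambda> * d)"
    proof -
      have "0 \<le> d * (1 - c * \<Lambda> * d)" using d by (intro mult_nonneg_nonneg) (auto simp: algebra_simps)
      thus ?thesis by simp
    qed
    also have "\<dots> = (1 + c * d) * (1 - \<Lambda> * d)" by (simp add: c_def algebra_simps)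
    also have "\<dots> \<le> exp (c * d) * pmf (p d y) y"
    proof (rule mult_mono)
      have "c * \<Lambda> * d \<ge> \<Lambda> * d" using c Lambda_nonneg d by (simp add: mult_right_mono mult_le_cancel_right1)
      thus "0 \<le> 1 - \<Lambda> * d" using d by (simp add: algebra_simps)
    qed (use stay[of d y] d in \<open>auto intro: exp_ge_add_one_self\<close>)
    finally have "exp (c * s) * pmf (p s x) y * 1 \<le> exp (c * s) * pmf (p s x) y * (exp (c * d) * pmf (p d y) y)"
      by (intro mult_left_mono) auto
    thus ?thesis by (simp add: distrib_left exp_add mult_ac)
  qed
  have "f t \<le> f 0"
  proof (rule right_dini_nonincreasing[OF assms(2)])
    fix s \<epsilon> :: real assume s: "0 \<le> s" "s < t" "\<epsilon> > 0"
    have "\<forall>\<^sub>F d in at_right 0. \<bar>pmf (p (0 + d) x) y - pmf (p 0 x) y - r * d\<bar> \<le> \<epsilon> / 2 * d"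
      unfolding r_def by (rule has_derivative_at_rightD[OF deriv_off]) (use assms s in auto)
    thus "\<forall>\<^sub>F d in at_right 0. f (s + d) \<le> f s + \<epsilon> * d" using small
    proof eventually_elim
      case (elim d)
      have d: "0 < d" using elim by simp
      have "- (pmf (p d x) y - 0 - r * d) \<le> \<epsilon> / 2 * d"
        using elim(1) assms(1) by (simp only: abs_le_iff add_0 p_0 pmf_return indicator_def) simp
      hence "pmf (p d x) y \<ge> r * d - \<epsilon> / 2 * d" by linarith
      hence "pmf (p s x) x * (r * d - \<epsilon> / 2 * d) \<le> pmf (p s x) x * pmf (p d x) y"
        by (intro mult_left_mono) auto
      moreover have "pmf (p s x) x * (\<epsilon> / 2 * d) \<le> 1 * (\<epsilon> / 2 * d)"
        using s d by (intro mult_right_mono) (auto simp: pmf_le_1)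
      moreover have "(1 - c * s) * (r * d) \<le> pmf (p s x) x * (r * d)"
      proof (intro mult_right_mono)
        have "\<Lambda> * s \<le> c * s" using s by (simp add: c_def algebra_simps)
        thus "1 - c * s \<le> pmf (p s x) x" using stay[OF s(1), of x] by linarith
      qed (use r d in auto)
      ultimately have 1: "(1 - c * s) * (r * d) - \<epsilon> / 2 * d \<le> pmf (p s x) x * pmf (p d x) y"
        by (simp add: right_diff_distrib)
      have 2: "pmf (p s x) x * pmf (p d x) y \<le> exp (c * (s + d)) * (pmf (p s x) x * pmf (p d x) y)"
      proof -
        have "1 \<le> exp (c * (s + d))" using c s d by simp
        thus ?thesis using mult_right_mono[of 1 "exp (c * (s + d))" "pmf (p s x) x * pmf (p d x) y"] by simp
      qed
      have "exp (c * (s + d)) * (pmf (p s x) y * pmf (p d y) y + pmf (p s x) x * pmf (p d x) y) \<le> exp (c * (s + d)) * pmf (p (s + d) x) y"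
        using sub s d by (intro mult_left_mono) auto
      hence 3: "exp (c * s) * pmf (p s x) y + (1 - c * s) * (r * d) - \<epsilon> / 2 * d \<le> exp (c * (s + d)) * pmf (p (s + d) x) y"
        using 1 2 grow[OF elim(2), of s] by (simp only: distrib_left)
      have "r * (s + d) - c * r * (s + d)\<^sup>2 = r * s - c * r * s\<^sup>2 + (1 - c * s) * (r * d) - (c * s * (r * d) + c * r * d\<^sup>2)"
        by (simp add: power2_eq_square algebra_simps)
      moreover have "0 \<le> c * s * (r * d) + c * r * d\<^sup>2" using c s r d by simp
      moreover have "0 \<le> \<epsilon> / 2 * d" using s d by simp
      moreover have "\<epsilon> * d = \<epsilon> / 2 * d + \<epsilon> / 2 * d" by simp
      ultimately show ?case using 3 unfolding f_def by linarith
    qed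
  next
    fix s \<epsilon> :: real assume s: "0 < s" "s \<le> t" "\<epsilon> > 0"
    have "\<forall>\<^sub>F d in at_right (0::real). d \<in> {0<..<min s (\<epsilon> / (r + 1))}"
      by (rule eventually_at_right_real) (use s r in auto)
    thus "\<forall>\<^sub>F d in at_right 0. f s \<le> f (s - d) + \<epsilon>" using small
    proof eventually_elim
      case (elim d)
      have d: "0 < d" "d < s" "(r + 1) * d \<le> \<epsilon>" using elim r by (auto simp: field_simps)
      have "pmf (p (s - d) x) y * pmf (p d y) y \<le> pmf (p (s - d + d) x) y"
        using sub[of "s - d" d] d by (smt (verit) mult_nonneg_nonneg pmf_nonneg)
      hence "exp (c * (s - d + d)) * (pmf (p (s - d) x) y * pmf (p d y) y) \<le> exp (c * s) * pmf (p s x) y"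
        by (intro mult_mono) auto
      hence 1: "exp (c * (s - d)) * pmf (p (s - d) x) y \<le> exp (c * s) * pmf (p s x) y"
        using grow[OF elim(2), of "s - d"] by linarith
      have "c * r * (s - d)\<^sup>2 \<le> c * r * s\<^sup>2" using c r d by (intro mult_left_mono power_mono) auto
      moreover have "r * s = r * (s - d) + r * d" by (simp add: algebra_simps)
      moreover have "r * d \<le> \<epsilon>" using d by (simp add: algebra_simps)
      ultimately show ?case using 1 unfolding f_def by linarith
    qed
  qed
  moreover have "f 0 = 0" using assms by (simp add: f_def)
  ultimately have "r * t - c * r * t\<^sup>2 \<le> exp (c * t) * pmf (p t x) y" by (simp add: f_def)
  hence "exp (- (c * t)) * (r * t - c * r * t\<^sup>2) \<le> exp (- (c * t)) * (exp (c * t) * pmf (p t x) y)"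
    by (intro mult_left_mono) auto
  also have "\<dots> = pmf (p t x) y" by (simp add: exp_minus)
  finally show ?thesis by (simp add: c_def r_def)
qed

section \<open>Invariant laws and time reversal\<close>

lemma expectation_dini_gen:
  fixes u :: "'s \<Rightarrow> real"
  assumes "\<And>z. 0 \<le> u z" "\<And>z. u z \<le> 1" "\<epsilon> > 0"
  shows "\<forall>\<^sub>F d in at_right 0. (\<integral>y. u y \<partial>measure_pmf (p d z)) \<le> u z + (gen u z + \<epsilon>) * d"
  using gen_dini[of "\<lambda>_. u" 1 "\<lambda>_. u" "\<lambda>_. 0" \<epsilon> z] assms by simp

lemma gen_bound:
  fixes u :: "'s \<Rightarrow> real"
  assumes "\<And>z. 0 \<le> u z" "\<And>z. u z \<le> 1"
  shows "\<bar>gen u x\<bar> \<le> \<Lambda>"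
proof -
  have "\<bar>gen u x\<bar> \<le> (\<Sum>y\<in>supp x. \<bar>q x y * (u y - u x)\<bar>)" unfolding gen_def by (rule sum_abs)
  also have "\<dots> \<le> (\<Sum>y\<in>supp x. q x y)"
  proof (rule sum_mono)
    fix y assume "y \<in> supp x"
    hence "0 \<le> q x y" by (auto simp: supp_def intro: nonneg)
    moreover have "\<bar>u y - u x\<bar> \<le> 1" using assms[of x] assms[of y] by (simp add: abs_le_iff)
    ultimately show "\<bar>q x y * (u y - u x)\<bar> \<le> q x y" by (simp add: abs_mult mult_left_le)
  qed
  also have "\<dots> \<le> \<Lambda>" using exit_le by (simp add: exit_def)
  finally show ?thesis .
qed

text \<open>Let g evolve backwards: \<open>u s\<close> is g averaged over the chain after time s.
  Then \<open>u (s + d)\<close> arises from \<open>u s\<close> by running the chain for time d, so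
  the right derivative of the \<mu>-average of \<open>u s\<close> is the average of
  \<open>gen (u s)\<close>, which vanishes. All \<open>u s\<close> keep values in the unit interval,
  where \<open>inv\<close> applies.\<close>

lemma invariant_le:
  fixes \<mu> :: "'s pmf" and g :: "'s \<Rightarrow> real"
  assumes inv: "\<And>u. (\<And>z. 0 \<le> u z) \<Longrightarrow> (\<And>z. u z \<le> 1) \<Longrightarrow> (\<integral>z. gen u z \<partial>measure_pmf \<mu>) = 0"
    and g: "\<And>z. 0 \<le> g z" "\<And>z. g z \<le> 1" and t: "0 \<le> t"
  shows "(\<integral>z. g z \<partial>measure_pmf (bind_pmf \<mu> (p t))) \<le> (\<integral>z. g z \<partial>measure_pmf \<mu>)"
proof -
  define u where "u s z = (\<integral>y. g y \<partial>measure_pmf (p s z))" for s z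
  have u: "0 \<le> u s z" "u s z \<le> 1" for s z
    unfolding u_def by (rule pmf_expectation_bounds; rule g)+
  define f where "f s = (\<integral>z. u s z \<partial>measure_pmf \<mu>)" for s
  define A where "A s d z = (\<integral>y. u s y \<partial>measure_pmf (p d z))" for s d z
  have Ab: "0 \<le> A s d z" "A s d z \<le> 1" for s d z
    unfolding A_def by (rule pmf_expectation_bounds; rule u)+
  have fA: "f (s + d) = (\<integral>z. A s d z \<partial>measure_pmf \<mu>)" if "0 \<le> s" "0 \<le> d" for s d
  proof -
    have "u (d + s) z = A s d z" for z
      unfolding u_def A_def using that g by (simp add: integral_p_add[where B = 1])
    thus ?thesis by (simp add: f_def add.commute)
  qed
  have Adom: "A s d z \<le> u s z + \<Lambda> * d" if "0 \<le> d" for s d z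
    using expectation_jump_bound[of "u s" 1 d z] u that by (simp add: A_def)
  have iu: "integrable (measure_pmf \<mu>) (u s)" for s
    by (rule pmf_bounded_integrable[where B = 1]) (use u in \<open>simp add: abs_of_nonneg\<close>)
  have iA: "integrable (measure_pmf \<mu>) (A s d)" for s d
    by (rule pmf_bounded_integrable[where B = 1]) (use Ab in \<open>simp add: abs_of_nonneg\<close>)
  have ig: "integrable (measure_pmf \<mu>) (gen (u s))" for s
    by (rule pmf_bounded_integrable[where B = \<Lambda>]) (use u gen_bound in auto)
  have "f t \<le> f 0"
  proof (rule right_dini_nonincreasing[OF t])
    fix s \<epsilon> :: real assume s: "0 \<le> s" "s < t" "\<epsilon> > 0"
    \<comment> \<open>Subtracting \<open>d * gen (u s) z\<close> removes the pointwise drift, as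
      \<open>expectation_dini\<close> requires, without changing the \<mu>-average.\<close>
    define A' where "A' d z = (if 0 < d \<and> d \<le> 1 then A s d z - d * gen (u s) z else 0)" for d z
    have "\<forall>\<^sub>F d in at_right 0. (\<integral>z. A' d z \<partial>measure_pmf \<mu>) \<le> (\<integral>z. u s z \<partial>measure_pmf \<mu>) + \<epsilon> * d"
    proof (rule expectation_dini[where B = "1 + \<Lambda>" and C = "2 * \<Lambda>"])
      fix z and e :: real assume e: "e > 0"
      have "\<forall>\<^sub>F d in at_right 0. A s d z \<le> u s z + (gen (u s) z + e) * d"
        unfolding A_def using u e by (intro expectation_dini_gen)
      thus "\<forall>\<^sub>F d in at_right 0. A' d z \<le> u s z + e * d"
        using eventually_at_right_real[of 0 "1::real", simplified]
        by eventually_elim (auto simp: A'_def algebra_simps)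
    next
      fix d :: real and z assume d: "0 < d" "d \<le> 1"
      have "\<bar>d * gen (u s) z\<bar> \<le> d * \<Lambda>" unfolding abs_mult using d gen_bound[of "u s" z] u
        by (intro mult_mono) auto
      thus "A' d z \<le> u s z + 2 * \<Lambda> * d" using Adom[of d s z] d by (simp add: A'_def abs_le_iff algebra_simps)
    next
      fix d :: real and z
      have "\<bar>d * gen (u s) z\<bar> \<le> 1 * \<Lambda>" if "0 < d" "d \<le> 1" unfolding abs_mult using that gen_bound[of "u s" z] u
        by (intro mult_mono) auto
      thus "\<bar>A' d z\<bar> \<le> 1 + \<Lambda>" using Ab[of s d z] Lambda_nonneg by (auto simp: A'_def abs_le_iff)
    next
      show "\<bar>u s z\<bar> \<le> 1 + \<Lambda>" for z using u[of s z] Lambda_nonneg by simp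
    qed (use s in auto)
    thus "\<forall>\<^sub>F d in at_right 0. f (s + d) \<le> f s + \<epsilon> * d"
      using eventually_at_right_real[of 0 "1::real", simplified]
    proof eventually_elim
      case (elim d)
      have "(\<integral>z. A' d z \<partial>measure_pmf \<mu>) = (\<integral>z. A s d z - d * gen (u s) z \<partial>measure_pmf \<mu>)"
        using elim by (simp add: A'_def)
      also have "\<dots> = f (s + d) - d * (\<integral>z. gen (u s) z \<partial>measure_pmf \<mu>)"
        using iA ig elim s by (simp add: fA)
      also have "(\<integral>z. gen (u s) z \<partial>measure_pmf \<mu>) = 0" using u by (rule inv)
      finally show ?case using elim by (simp add: f_def)
    qed
  next
    fix s \<epsilon> :: real assume s: "0 < s" "s \<le> t" "\<epsilon> > 0"
    have "\<forall>\<^sub>F d in at_right (0::real). d \<in> {0<..<min s (\<epsilon> / (\<Lambda> + 1))}"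
      by (rule eventually_at_right_real) (use s Lambda_nonneg in auto)
    thus "\<forall>\<^sub>F d in at_right 0. f s \<le> f (s - d) + \<epsilon>"
    proof eventually_elim
      case (elim d)
      have "f ((s - d) + d) = (\<integral>z. A (s - d) d z \<partial>measure_pmf \<mu>)" using elim s by (intro fA) auto
      also have "\<dots> \<le> (\<integral>z. u (s - d) z + \<Lambda> * d \<partial>measure_pmf \<mu>)"
        using iA iu elim by (intro integral_mono Bochner_Integration.integrable_add Adom) auto
      also have "\<dots> = f (s - d) + \<Lambda> * d" using iu by (simp add: f_def)
      finally have "f s \<le> f (s - d) + \<Lambda> * d" by simp
      moreover have "(\<Lambda> + 1) * d \<le> \<epsilon>" using elim Lambda_nonneg by (auto simp: field_simps)
      ultimately show ?case using elim by (simp add: algebra_simps)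
    qed
  qed
  thus ?thesis using g by (simp add: f_def u_def pmf_expectation_bind_bounded[where B = 1])
qed

text \<open>A Dini argument yields only an inequality; applied to a set and to its complement it
  becomes an equality.\<close>

lemma invariant:
  fixes \<mu> :: "'s pmf"
  assumes inv: "\<And>u. (\<And>z. 0 \<le> u z) \<Longrightarrow> (\<And>z. u z \<le> 1) \<Longrightarrow> (\<integral>z. gen u z \<partial>measure_pmf \<mu>) = 0"
    and t: "0 \<le> t"
  shows "bind_pmf \<mu> (p t) = \<mu>"
proof (rule pmf_eqI)
  fix y
  have "measure_pmf.prob (bind_pmf \<mu> (p t)) S \<le> measure_pmf.prob \<mu> S" for S
    using invariant_le[OF inv, of "indicator S" t] t by (simp del: indicator_simps)
  from this[of "{y}"] this[of "- {y}"]
  show "pmf (bind_pmf \<mu> (p t)) y = pmf \<mu> y"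
    using measure_pmf.prob_compl[of "{y}" "bind_pmf \<mu> (p t)"] measure_pmf.prob_compl[of "{y}" \<mu>]
    by (simp add: Compl_eq_Diff_UNIV measure_pmf_single)
qed

text \<open>The reversed kernel is given by Bayes' formula, and invariance of \<pi> is exactly what
  makes it a probability. The off-diagonal rates come from \<open>det\<close>; the assumption
  \<open>exit'\<close> is there because \<open>has_jump_rates\<close> also prescribes the derivative
  on the diagonal.\<close>

lemma reversed_semigroup:
  fixes \<pi> :: "'s pmf"
  assumes pos: "\<And>x. 0 < pmf \<pi> x"
    and inv: "\<And>t. 0 \<le> t \<Longrightarrow> bind_pmf \<pi> (p t) = \<pi>"
    and det: "\<And>x y. x \<noteq> y \<Longrightarrow> pmf \<pi> x * q x y = pmf \<pi> y * q' y x"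
    and exit': "\<And>x. (\<Sum>\<^sub>\<infinity>z\<in>- {x}. q' x z) = exit x"
  obtains p' where "transition_semigroup p'" "has_jump_rates p' q'"
    "\<And>t x y. 0 \<le> t \<Longrightarrow> pmf \<pi> y * pmf (p' t y) x = pmf \<pi> x * pmf (p t x) y"
proof -
  define f where "f t y x = pmf \<pi> x * pmf (p t x) y / pmf \<pi> y" for t y x
  define p' where "p' t y = embed_pmf (f t y)" for t y
  have pmf': "pmf (p' t y) x = f t y x" if "0 \<le> t" for t x y
    unfolding p'_def
  proof (rule pmf_embed_pmf)
    show "0 \<le> f t y x" for x by (simp add: f_def)
    have "(\<integral>\<^sup>+x. ennreal (f t y x) \<partial>count_space UNIV)
        = (\<integral>\<^sup>+x. ennreal (1 / pmf \<pi> y) * (ennreal (pmf \<pi> x) * ennreal (pmf (p t x) y)) \<partial>count_space UNIV)"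
      by (rule nn_integral_cong) (simp add: f_def pos less_imp_le flip: ennreal_mult')
    also have "\<dots> = ennreal (1 / pmf \<pi> y) * (\<integral>\<^sup>+x. ennreal (pmf (p t x) y) \<partial>measure_pmf \<pi>)"
      by (simp add: nn_integral_cmult nn_integral_measure_pmf)
    also have "(\<integral>\<^sup>+x. ennreal (pmf (p t x) y) \<partial>measure_pmf \<pi>) = ennreal (pmf \<pi> y)"
      using inv[OF that] by (simp flip: ennreal_pmf_bind)
    also have "ennreal (1 / pmf \<pi> y) * ennreal (pmf \<pi> y) = 1"
      using pos[of y] by (simp flip: ennreal_mult)
    finally show "(\<integral>\<^sup>+x. ennreal (f t y x) \<partial>count_space UNIV) = 1" .
  qed
  have "transition_semigroup p'"
    unfolding transition_semigroup_def
  proof (intro conjI allI impI)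
    fix y show "p' 0 y = return_pmf y"
      by (rule pmf_eqI) (use pos[of y] in \<open>auto simp: pmf' f_def pmf_return indicator_def\<close>)
  next
    fix s t :: real and y assume st: "0 \<le> s" "0 \<le> t"
    show "p' (s + t) y = bind_pmf (p' s y) (p' t)"
    proof (rule pmf_eqI)
      fix x
      have "ennreal (pmf (bind_pmf (p' s y) (p' t)) x)
          = (\<integral>\<^sup>+z. ennreal (f s y z) * ennreal (f t z x) \<partial>count_space UNIV)"
        using st by (simp add: ennreal_pmf_bind nn_integral_measure_pmf pmf')
      also have "\<dots> = (\<integral>\<^sup>+z. ennreal (pmf \<pi> x / pmf \<pi> y) * (ennreal (pmf (p t x) z) * ennreal (pmf (p s z) y)) \<partial>count_space UNIV)"
      proof (rule nn_integral_cong)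
        fix z
        have "f s y z * f t z x = (pmf \<pi> x / pmf \<pi> y) * (pmf (p t x) z * pmf (p s z) y)"
          using pos[of z] by (simp add: f_def)
        thus "ennreal (f s y z) * ennreal (f t z x) = ennreal (pmf \<pi> x / pmf \<pi> y) * (ennreal (pmf (p t x) z) * ennreal (pmf (p s z) y))"
          by (simp add: f_def flip: ennreal_mult')
      qed
      also have "\<dots> = ennreal (pmf \<pi> x / pmf \<pi> y) * ennreal (pmf (p (t + s) x) y)"
        using st by (simp add: nn_integral_cmult p_add ennreal_pmf_bind nn_integral_measure_pmf)
      also have "\<dots> = ennreal (pmf (p' (s + t) y) x)"
        using st by (simp add: pmf' f_def add.commute flip: ennreal_mult')
      finally show "pmf (p' (s + t) y) x = pmf (bind_pmf (p' s y) (p' t)) x" by simp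
    qed
  qed
  moreover have "has_jump_rates p' q'"
    unfolding has_jump_rates_def
  proof (intro allI)
    fix x y
    have cong: "(g has_real_derivative D) (at_right 0)" if "(h has_real_derivative D) (at_right 0)" "\<And>t. 0 \<le> t \<Longrightarrow> g t = h t" for g h :: "real \<Rightarrow> real" and D
      unfolding has_field_derivative_iff
      by (rule Lim_transform_eventually[OF that(1)[unfolded has_field_derivative_iff]])
        (use that(2) in \<open>auto intro: eventually_mono[OF eventually_at_right_less[of 0]]\<close>)
    show "((\<lambda>h. pmf (p' h x) y) has_real_derivative (if y = x then - (\<Sum>\<^sub>\<infinity>z\<in>- {x}. q' x z) else q' x y)) (at_right 0)"
    proof (cases "y = x")
      case True
      show ?thesis
        by (rule cong[where h = "\<lambda>h. pmf (p h x) x"])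
          (use True deriv_diag[of x] pos[of x] in \<open>auto simp: exit' pmf' f_def\<close>)
    next
      case False
      have e: "q' x y = pmf \<pi> y / pmf \<pi> x * q y x"
        using det[OF False] pos[of x] by (simp add: field_simps)
      have "((\<lambda>h. pmf \<pi> y / pmf \<pi> x * pmf (p h y) x) has_real_derivative pmf \<pi> y / pmf \<pi> x * q y x) (at_right 0)"
        by (rule DERIV_cmult deriv_off)+ (use False in simp)
      hence "((\<lambda>h. pmf \<pi> y / pmf \<pi> x * pmf (p h y) x) has_real_derivative q' x y) (at_right 0)"
        by (simp only: e)
      thus ?thesis unfolding if_not_P[OF False]
        by (rule cong) (simp add: pmf' f_def)
    qed
  qed
  moreover have "pmf \<pi> y * pmf (p' t y) x = pmf \<pi> x * pmf (p t x) y" if "0 \<le> t" for t x y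
    using pos[of y] that by (simp add: pmf' f_def)
  ultimately show ?thesis using that by blast
qed

text \<open>By \<open>det\<close>, the flow of u into the states under q becomes, after exchanging
  the two sums, the exit flow of u under \<open>q'\<close>; the exit rates agree by
  \<open>exit'\<close>, so gain and loss cancel. The exchange is made with nonnegative integrals,
  and the bound by \<Lambda> then allows gain and loss to be subtracted.\<close>

lemma expectation_gen_zero:
  fixes \<pi> :: "'s pmf"
  assumes det: "\<And>x y. x \<noteq> y \<Longrightarrow> pmf \<pi> x * q x y = pmf \<pi> y * q' y x"
    and nonneg': "\<And>x y. y \<noteq> x \<Longrightarrow> 0 \<le> q' x y"
    and fin': "\<And>x. finite {y. y \<noteq> x \<and> q' x y \<noteq> 0}"
    and exit': "\<And>x. (\<Sum>y | y \<noteq> x \<and> q' x y \<noteq> 0. q' x y) = exit x"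
    and u: "\<And>z. 0 \<le> u z" "\<And>z. u z \<le> 1"
  shows "(\<integral>z. gen u z \<partial>measure_pmf \<pi>) = 0"
proof -
  define a where "a x = (\<Sum>y\<in>supp x. q x y * u y)" for x
  have q0: "0 \<le> q x y" if "y \<in> supp x" for x y using that by (auto simp: supp_def intro: nonneg)
  have a0: "0 \<le> a x" for x unfolding a_def using q0 u by (intro sum_nonneg mult_nonneg_nonneg) auto
  have aL: "a x \<le> \<Lambda>" for x
  proof -
    have "a x \<le> (\<Sum>y\<in>supp x. q x y * 1)" unfolding a_def using q0 u by (intro sum_mono mult_left_mono) auto
    thus ?thesis using exit_le[of x] by (simp add: exit_def)
  qed
  have b0: "0 \<le> exit x * u x" "exit x * u x \<le> \<Lambda>" for x
    using exit_nonneg[of x] exit_le[of x] u[of x] by (auto intro: order_trans[OF mult_left_le])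
  have ia: "integrable (measure_pmf \<pi>) a"
    by (rule pmf_bounded_integrable[where B = \<Lambda>]) (use a0 aL in \<open>simp add: abs_of_nonneg\<close>)
  have ib: "integrable (measure_pmf \<pi>) (\<lambda>x. exit x * u x)"
    by (rule pmf_bounded_integrable[where B = \<Lambda>]) (use b0 in \<open>simp add: abs_of_nonneg\<close>)
  \<comment> \<open>Nothing is known about the diagonals of q and \<open>q'\<close>, not even their
    sign, so they are set to zero before summing over all pairs.\<close>
  define Q where "Q x y = (if x = y then 0 else q x y)" for x y
  define Q' where "Q' x y = (if x = y then 0 else q' x y)" for x y
  have QQ: "ennreal (pmf \<pi> x) * (ennreal (Q x y) * c) = ennreal (pmf \<pi> y) * (c * ennreal (Q' y x))" for x y c
  proof (cases "x = y")
    case False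
    hence "ennreal (pmf \<pi> x) * ennreal (Q x y) = ennreal (pmf \<pi> y) * ennreal (Q' y x)"
      using det[OF False] nonneg[of y x] nonneg'[of x y] by (simp add: Q_def Q'_def flip: ennreal_mult)
    thus ?thesis by (metis mult.assoc mult.commute)
  qed (simp add: Q_def Q'_def)
  have a_nn: "ennreal (a x) = (\<integral>\<^sup>+y. ennreal (Q x y) * ennreal (u y) \<partial>count_space UNIV)" for x
  proof -
    have "(\<integral>\<^sup>+y. ennreal (Q x y) * ennreal (u y) \<partial>count_space UNIV) = (\<Sum>y\<in>supp x. ennreal (Q x y) * ennreal (u y))"
      by (rule nn_integral_count_space') (use finite_supp in \<open>auto simp: Q_def supp_def\<close>)
    also have "\<dots> = (\<Sum>y\<in>supp x. ennreal (q x y * u y))"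
      by (rule sum.cong) (use q0 u in \<open>auto simp: Q_def supp_def ennreal_mult\<close>)
    also have "\<dots> = ennreal (a x)" unfolding a_def using q0 u by (intro sum_ennreal) auto
    finally show ?thesis ..
  qed
  have e_nn: "ennreal (exit x) = (\<integral>\<^sup>+y. ennreal (Q' x y) \<partial>count_space UNIV)" for x
  proof -
    have "(\<integral>\<^sup>+y. ennreal (Q' x y) \<partial>count_space UNIV) = (\<Sum>y | y \<noteq> x \<and> q' x y \<noteq> 0. ennreal (Q' x y))"
      by (rule nn_integral_count_space') (use fin' in \<open>auto simp: Q'_def\<close>)
    also have "\<dots> = (\<Sum>y | y \<noteq> x \<and> q' x y \<noteq> 0. ennreal (q' x y))"
      by (rule sum.cong) (auto simp: Q'_def)
    also have "\<dots> = ennreal (exit x)" using nonneg' by (subst sum_ennreal) (auto simp: exit')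
    finally show ?thesis ..
  qed
  have "ennreal (\<integral>x. a x \<partial>measure_pmf \<pi>) = (\<integral>\<^sup>+x. ennreal (a x) \<partial>measure_pmf \<pi>)"
    by (rule pmf_expectation_bounds(3)) (rule a0 aL)+
  also have "\<dots> = (\<integral>\<^sup>+x. \<integral>\<^sup>+y. ennreal (pmf \<pi> x) * (ennreal (Q x y) * ennreal (u y)) \<partial>count_space UNIV \<partial>count_space UNIV)"
    by (simp add: nn_integral_measure_pmf a_nn nn_integral_cmult)
  also have "\<dots> = (\<integral>\<^sup>+y. \<integral>\<^sup>+x. ennreal (pmf \<pi> x) * (ennreal (Q x y) * ennreal (u y)) \<partial>count_space UNIV \<partial>count_space UNIV)"
    by (rule nn_integral_fst_count_space[where f = "\<lambda>(x, y). ennreal (pmf \<pi> x) * (ennreal (Q x y) * ennreal (u y))", simplified, THEN trans])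
       (rule nn_integral_snd_count_space[where f = "\<lambda>(x, y). ennreal (pmf \<pi> x) * (ennreal (Q x y) * ennreal (u y))", simplified, symmetric])
  also have "\<dots> = (\<integral>\<^sup>+y. ennreal (pmf \<pi> y) * (ennreal (exit y * u y)) \<partial>count_space UNIV)"
    by (simp add: QQ nn_integral_cmult flip: e_nn) (simp add: ennreal_mult u exit_nonneg mult.commute)
  also have "\<dots> = (\<integral>\<^sup>+y. ennreal (exit y * u y) \<partial>measure_pmf \<pi>)" by (simp add: nn_integral_measure_pmf)
  also have "\<dots> = ennreal (\<integral>y. exit y * u y \<partial>measure_pmf \<pi>)"
    by (rule pmf_expectation_bounds(3)[symmetric]) (rule b0)+
  finally have "(\<integral>x. a x \<partial>measure_pmf \<pi>) = (\<integral>y. exit y * u y \<partial>measure_pmf \<pi>)"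
    by (subst (asm) ennreal_inj) (auto intro!: integral_nonneg_AE simp: a0 b0)
  moreover have "gen u z = a z - exit z * u z" for z
    by (simp add: gen_def a_def exit_def right_diff_distrib sum_subtractf sum_distrib_right)
  ultimately show ?thesis using ia ib by simp
qed

end

section \<open>Jackson networks and time reversal\<close>

lemma sum_of_bool_pick:
  fixes h :: "'a \<Rightarrow> real"
  assumes "finite S" "\<And>i. i \<in> I \<Longrightarrow> f i \<in> S"
  shows "(\<Sum>y\<in>S. (\<Sum>i\<in>I. c i * of_bool (y = f i)) * h y) = (\<Sum>i\<in>I. c i * h (f i))"
proof -
  have "(\<Sum>y\<in>S. (\<Sum>i\<in>I. c i * of_bool (y = f i)) * h y) = (\<Sum>i\<in>I. \<Sum>y\<in>S. c i * of_bool (y = f i) * h y)"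
    unfolding sum_distrib_right by (rule sum.swap)
  also have "\<dots> = (\<Sum>i\<in>I. c i * h (f i))"
  proof (rule sum.cong[OF refl])
    fix i assume "i \<in> I"
    have "(\<Sum>y\<in>S. c i * of_bool (y = f i) * h y) = (\<Sum>y\<in>S. if y = f i then c i * h (f i) else 0)"
      by (rule sum.cong) auto
    thus "(\<Sum>y\<in>S. c i * of_bool (y = f i) * h y) = c i * h (f i)" using assms \<open>i \<in> I\<close> by simp
  qed
  finally show ?thesis .
qed

text \<open>Also contains \<open>x - axis k 1\<close> and \<open>x - axis k 1 + axis l 1\<close> for empty \<open>k\<close>, where the subtraction truncates;
  such a transition has rate zero.\<close>

definition targets :: "nat ^ 'k \<Rightarrow> (nat ^ 'k) set" where
  "targets x = (\<lambda>k. x + axis k 1) ` UNIV \<union> (\<lambda>(k, l). x - axis k 1 + axis l 1) ` UNIV \<union> (\<lambda>k. x - axis k 1) ` UNIV"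

lemma finite_targets: "finite (targets x)" by (simp add: targets_def)

lemma targets_in:
  "x + axis k 1 \<in> targets x" "x - axis k 1 + axis l 1 \<in> targets x" "x - axis k 1 \<in> targets x"
  by (force simp: targets_def)+

lemma jackson_rate_eq_0: "y \<notin> targets x \<Longrightarrow> jackson_rate lam mu P x y = 0"
proof -
  assume "y \<notin> targets x"
  hence "y \<noteq> x + axis k 1" "y \<noteq> x - axis k 1 + axis l 1" "y \<noteq> x - axis k 1" for k l
    using targets_in[of x] by metis+
  thus ?thesis by (simp add: jackson_rate_def del: One_nat_def)
qed

text \<open>Several events can lead to the same state: all self-transfers lead back to x.
  \<open>jackson_rate\<close> adds their rates, so summing over states amounts to summing over
  events, and no comparison of target states is required.\<close>

lemma sum_targets:
  "(\<Sum>y\<in>targets x. jackson_rate lam mu P x y * h y) =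
     (\<Sum>k\<in>UNIV. lam $ k * h (x + axis k 1)) +
     (\<Sum>k | x $ k > 0. (\<Sum>l\<in>UNIV. mu $ k * P $ k $ l * h (x - axis k 1 + axis l 1)) +
        mu $ k * (1 - (\<Sum>l\<in>UNIV. P $ k $ l)) * h (x - axis k 1))"
proof -
  have 1: "(\<Sum>y\<in>targets x. (\<Sum>k | x $ k > 0. F k y) * h y) = (\<Sum>k | x $ k > 0. \<Sum>y\<in>targets x. F k y * h y)" for F
    unfolding sum_distrib_right by (rule sum.swap)
  have 2: "(\<Sum>y\<in>targets x. (c * of_bool (y = z)) * h y) = c * h z" if "z \<in> targets x" for c z
    using sum_of_bool_pick[OF finite_targets, of "{()}" "\<lambda>_. z" x "\<lambda>_. c" h] that by simp
  have 3: "(\<Sum>y\<in>targets x. ((\<Sum>l\<in>UNIV. mu $ k * P $ k $ l * of_bool (y = x - axis k 1 + axis l 1)) +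
        mu $ k * (1 - (\<Sum>l\<in>UNIV. P $ k $ l)) * of_bool (y = x - axis k 1)) * h y)
     = (\<Sum>l\<in>UNIV. mu $ k * P $ k $ l * h (x - axis k 1 + axis l 1)) + mu $ k * (1 - (\<Sum>l\<in>UNIV. P $ k $ l)) * h (x - axis k 1)" for k
    by (simp only: distrib_right sum.distrib)
      (subst sum_of_bool_pick[OF finite_targets targets_in(2)] 2[OF targets_in(3)] | rule refl)+
  have 4: "(\<Sum>y\<in>targets x. (F y + G y) * h y) = (\<Sum>y\<in>targets x. F y * h y) + (\<Sum>y\<in>targets x. G y * h y)" for F G
    by (simp only: distrib_right sum.distrib)
  show ?thesis
    unfolding jackson_rate_def 4[of "\<lambda>y. \<Sum>k\<in>UNIV. lam $ k * of_bool (y = x + axis k 1)"] 1 3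
      sum_of_bool_pick[OF finite_targets targets_in(1)] ..
qed

lemma jackson_rate_nonneg:
  assumes "\<And>k. 0 \<le> lam $ k" "\<And>k. 0 \<le> mu $ k" "substochastic P"
  shows "0 \<le> jackson_rate lam mu P x y"
  using assms unfolding jackson_rate_def substochastic_def
  by (intro add_nonneg_nonneg sum_nonneg mult_nonneg_nonneg) auto

lemma jackson_gen:
  "(\<Sum>y | y \<noteq> x \<and> jackson_rate lam mu P x y \<noteq> 0. jackson_rate lam mu P x y * (g y - g x)) =
     (\<Sum>k\<in>UNIV. lam $ k * (g (x + axis k 1) - g x)) +
     (\<Sum>k | x $ k > 0. (\<Sum>l\<in>UNIV. mu $ k * P $ k $ l * (g (x - axis k 1 + axis l 1) - g x)) +
        mu $ k * (1 - (\<Sum>l\<in>UNIV. P $ k $ l)) * (g (x - axis k 1) - g x))" (is "?L = _")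
proof -
  have "?L = (\<Sum>y\<in>targets x. jackson_rate lam mu P x y * (g y - g x))"
    by (rule sum.mono_neutral_left[OF finite_targets]) (use jackson_rate_eq_0 in blast, auto)
  thus ?thesis using sum_targets[of lam mu P x "\<lambda>y. g y - g x"] by simp
qed

lemma finite_jackson_supp: "finite {y. y \<noteq> x \<and> jackson_rate lam mu P x y \<noteq> 0}"
  by (rule finite_subset[OF _ finite_targets[of x]]) (use jackson_rate_eq_0 in blast)

lemma jackson_exit_le:
  assumes "\<And>k. 0 \<le> lam $ k" "\<And>k. 0 \<le> mu $ k" "substochastic P"
  shows "(\<Sum>y | y \<noteq> x \<and> jackson_rate lam mu P x y \<noteq> 0. jackson_rate lam mu P x y)
    \<le> (\<Sum>k\<in>UNIV. lam $ k) + (\<Sum>k\<in>UNIV. mu $ k)"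
proof -
  have "(\<Sum>y | y \<noteq> x \<and> jackson_rate lam mu P x y \<noteq> 0. jackson_rate lam mu P x y)
     \<le> (\<Sum>y\<in>targets x. jackson_rate lam mu P x y)"
    by (rule sum_mono2[OF finite_targets]) (use jackson_rate_eq_0 jackson_rate_nonneg[OF assms] in blast)+
  also have "\<dots> = (\<Sum>k\<in>UNIV. lam $ k) + (\<Sum>k | x $ k > 0. mu $ k)"
    using sum_targets[of lam mu P x "\<lambda>_. 1"] by (simp add: right_diff_distrib sum_distrib_left)
  also have "(\<Sum>k | x $ k > 0. mu $ k) \<le> (\<Sum>k\<in>UNIV. mu $ k)"
    by (rule sum_mono2) (use assms in auto)
  finally show ?thesis by simp
qed

text \<open>The exit rate is minus the generator applied to the indicator of x, evaluated at x, so
  the sum over events computes it. Self-transfers drop out, whence \<open>1 - P $ k $ k\<close>;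
  this expression is the same for the dual network, whose routing has the same diagonal.\<close>

lemma jackson_exit:
  "(\<Sum>y | y \<noteq> x \<and> jackson_rate lam mu P x y \<noteq> 0. jackson_rate lam mu P x y)
    = (\<Sum>k\<in>UNIV. lam $ k) + (\<Sum>k | x $ k > 0. mu $ k * (1 - P $ k $ k))"
proof -
  have up: "x + axis k 1 \<noteq> x" for k by (auto simp: vec_eq_iff axis_def)
  have down: "x - axis k 1 \<noteq> x" if "x $ k > 0" for k
  proof
    assume "x - axis k 1 = x"
    hence "(x - axis k 1) $ k = x $ k" by simp
    thus False using that by simp
  qed
  have move: "x - axis k 1 + axis l 1 = x \<longleftrightarrow> l = k" if "x $ k > 0" for k l
  proof
    assume "x - axis k 1 + axis l 1 = x"
    hence "(x - axis k 1 + axis l 1) $ k = x $ k" by simp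
    thus "l = k" using that by (auto simp: axis_def split: if_splits)
  qed (use that in \<open>auto simp: vec_eq_iff axis_def\<close>)
  define g :: "nat ^ 'a \<Rightarrow> real" where "g y = of_bool (y = x)" for y
  have "(\<Sum>y | y \<noteq> x \<and> jackson_rate lam mu P x y \<noteq> 0. jackson_rate lam mu P x y)
     = - (\<Sum>y | y \<noteq> x \<and> jackson_rate lam mu P x y \<noteq> 0. jackson_rate lam mu P x y * (g y - g x))"
    unfolding sum_negf[symmetric] by (rule sum.cong) (auto simp: g_def)
  also have "\<dots> = (\<Sum>k\<in>UNIV. lam $ k) + (\<Sum>k | x $ k > 0. mu $ k * (1 - P $ k $ k))"
  proof -
    have "(\<Sum>k | x $ k > 0. (\<Sum>l\<in>UNIV. mu $ k * P $ k $ l * (g (x - axis k 1 + axis l 1) - g x)) +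
        mu $ k * (1 - (\<Sum>l\<in>UNIV. P $ k $ l)) * (g (x - axis k 1) - g x)) = (\<Sum>k | x $ k > 0. - (mu $ k * (1 - P $ k $ k)))"
    proof (rule sum.cong[OF refl])
      fix k assume "k \<in> {k. x $ k > 0}"
      hence k: "x $ k > 0" by simp
      have "(\<Sum>l\<in>UNIV. mu $ k * P $ k $ l * (g (x - axis k 1 + axis l 1) - g x))
         = (\<Sum>l\<in>UNIV. mu $ k * (if l = k then P $ k $ k else 0) - mu $ k * P $ k $ l)"
        by (rule sum.cong) (auto simp: g_def move[OF k] simp del: One_nat_def)
      also have "\<dots> = mu $ k * P $ k $ k - mu $ k * (\<Sum>l\<in>UNIV. P $ k $ l)"
        by (simp add: sum_subtractf flip: sum_distrib_left)
      finally show "(\<Sum>l\<in>UNIV. mu $ k * P $ k $ l * (g (x - axis k 1 + axis l 1) - g x)) +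
        mu $ k * (1 - (\<Sum>l\<in>UNIV. P $ k $ l)) * (g (x - axis k 1) - g x) = - (mu $ k * (1 - P $ k $ k))"
        using down[OF k] by (simp add: g_def algebra_simps)
    qed
    thus ?thesis unfolding jackson_gen using up by (simp add: g_def sum_negf)
  qed
  finally show ?thesis .
qed

lemma jackson_jump_semigroup:
  assumes "\<And>k. 0 \<le> lam $ k" "\<And>k. 0 \<le> mu $ k" "substochastic P"
    and "transition_semigroup p" "has_jump_rates p (jackson_rate lam mu P)"
  shows "jump_semigroup p (jackson_rate lam mu P) ((\<Sum>k\<in>UNIV. lam $ k) + (\<Sum>k\<in>UNIV. mu $ k))"
  using assms finite_jackson_supp jackson_exit_le jackson_rate_nonneg by unfold_locales blast+

text \<open>\<open>geometric_pmf\<close> counts failures before the first success, so success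
  probability \<open>1 - \<rho> $ k\<close> gives mass proportional to
  \<open>\<rho> $ k ^ n\<close>: the stationary law of an isolated queue with load
  \<open>\<rho> $ k\<close>.\<close>

definition geometric_product :: "real ^ 'k \<Rightarrow> (nat ^ 'k) pmf" where
  "geometric_product \<rho> = map_pmf vec_lambda (Pi_pmf UNIV 0 (\<lambda>k. geometric_pmf (1 - \<rho> $ k)))"

lemma pmf_geometric_product:
  fixes \<rho> :: "real ^ 'k"
  assumes "\<And>k. 0 < \<rho> $ k" "\<And>k. \<rho> $ k < 1"
  shows "pmf (geometric_product \<rho>) x = (\<Prod>k\<in>UNIV. \<rho> $ k ^ (x $ k)) * (\<Prod>k\<in>UNIV. 1 - \<rho> $ k)"
proof -
  have "inj (vec_lambda :: ('k \<Rightarrow> nat) \<Rightarrow> nat ^ 'k)" by (auto intro!: injI simp: vec_lambda_inject)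
  hence "pmf (geometric_product \<rho>) (vec_lambda (vec_nth x)) = pmf (Pi_pmf UNIV 0 (\<lambda>k. geometric_pmf (1 - \<rho> $ k))) (vec_nth x)"
    unfolding geometric_product_def by (rule pmf_map_inj')
  also have "\<dots> = (\<Prod>k\<in>UNIV. pmf (geometric_pmf (1 - \<rho> $ k)) (x $ k))" by (subst pmf_Pi') auto
  also have "\<dots> = (\<Prod>k\<in>UNIV. \<rho> $ k ^ (x $ k) * (1 - \<rho> $ k))"
    by (rule prod.cong) (use assms in \<open>auto simp: pmf_geometric less_imp_le\<close>)
  finally show ?thesis by (simp add: prod.distrib)
qed

text \<open>\<open>spectral_radius\<close> is a \<open>Max\<close>, which bounds its elements only
  for a finite set. Most of the proof establishes that there are finitely many eigenvalues: they are
  the zeros of the characteristic polynomial, which is not the zero polynomial because eigenvalues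
  are bounded by the sum of the moduli of the entries. A kernel vector of \<open>mat 1 - A\<close>
  would then make 1 an eigenvalue.\<close>

lemma invertible_mat_1_minus:
  fixes A :: "real ^ 'k ^ 'k"
  assumes sr: "spectral_radius A < 1"
  shows "invertible (mat 1 - A)"
proof -
  define Ac :: "complex ^ 'k ^ 'k" where "Ac = (\<chi> k l. complex_of_real (A $ k $ l))"
  define E where "E = {z. \<exists>v :: complex ^ 'k. v \<noteq> 0 \<and> Ac *v v = z *s v}"
  \<comment> \<open>The determinant of \<open>Ac - mat z\<close> in Leibniz form, with entries that
    are polynomials in z.\<close>
  define p where "p = (\<Sum>\<pi> | \<pi> permutes (UNIV :: 'k set). [:of_int (sign \<pi>):] * (\<Prod>i\<in>UNIV. [:Ac $ i $ \<pi> i, - of_bool (i = \<pi> i):]))"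
  have poly_p: "poly p z = det (Ac - mat z)" for z
    unfolding p_def det_def poly_sum poly_mult poly_prod
    by (intro sum.cong refl arg_cong2[of _ _ _ _ "(*)"] prod.cong) (auto simp: mat_def)
  have mat_vec: "mat z *v v = z *s v" for z :: complex and v :: "complex ^ 'k"
    by (simp add: vec_eq_iff matrix_vector_mult_def mat_def if_distrib[of "\<lambda>x. x * _"] cong: if_cong)
  have det0: "det (Ac - mat z) = 0 \<longleftrightarrow> z \<in> E" for z
  proof -
    have "z \<in> E \<longleftrightarrow> (\<exists>v. v \<noteq> 0 \<and> (Ac - mat z) *v v = 0)"
      by (simp add: E_def matrix_vector_mult_diff_rdistrib mat_vec)
    also have "\<dots> \<longleftrightarrow> \<not> invertible (Ac - mat z)"
      by (metis invertible_left_inverse matrix_left_invertible_ker)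
    finally show ?thesis by (simp add: invertible_det_nz)
  qed
  have bound: "cmod z \<le> (\<Sum>k\<in>UNIV. \<Sum>l\<in>UNIV. cmod (Ac $ k $ l))" if zE: "z \<in> E" for z
  proof -
    from zE obtain v where v: "v \<noteq> 0" "Ac *v v = z *s v" unfolding E_def by blast
    obtain k where k: "v $ k \<noteq> 0" "\<And>l. cmod (v $ l) \<le> cmod (v $ k)"
    proof -
      obtain k where k: "\<And>l. cmod (v $ l) \<le> cmod (v $ k)"
        using ex_is_arg_min_if_finite[of "UNIV :: 'k set" "\<lambda>l. - cmod (v $ l)"] by (auto simp: is_arg_min_linorder)
      moreover have "v $ k \<noteq> 0" using v(1) k by (metis norm_le_zero_iff norm_zero vec_eq_iff zero_index)
      ultimately show ?thesis using that by blast
    qed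
    have "cmod z * cmod (v $ k) = cmod ((Ac *v v) $ k)" by (simp add: v norm_mult)
    also have "\<dots> \<le> (\<Sum>l\<in>UNIV. cmod (Ac $ k $ l) * cmod (v $ k))"
      unfolding matrix_vector_mult_def
      by (simp add: norm_mult) (intro order_trans[OF norm_sum] sum_mono, simp add: norm_mult k mult_left_mono)
    also have "\<dots> = (\<Sum>l\<in>UNIV. cmod (Ac $ k $ l)) * cmod (v $ k)" by (simp add: sum_distrib_right)
    finally have "cmod z \<le> (\<Sum>l\<in>UNIV. cmod (Ac $ k $ l))" using k(1) by simp
    also have "\<dots> \<le> (\<Sum>k\<in>UNIV. \<Sum>l\<in>UNIV. cmod (Ac $ k $ l))"
      by (rule member_le_sum) (auto intro: sum_nonneg)
    finally show ?thesis .
  qed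
  have "p \<noteq> 0"
  proof
    assume "p = 0"
    define c where "c = (\<Sum>k\<in>UNIV. \<Sum>l\<in>UNIV. cmod (Ac $ k $ l)) + 1"
    have "of_real c \<in> E" using \<open>p = 0\<close> poly_p det0 by (metis poly_0)
    from bound[OF this] have "cmod (of_real c) \<le> c - 1" by (simp add: c_def)
    thus False by (simp only: norm_of_real)
  qed
  have "E = {z. poly p z = 0}" using poly_p det0 by auto
  hence fE: "finite E" using poly_roots_finite[OF \<open>p \<noteq> 0\<close>] by simp
  have sr_eq: "spectral_radius A = Max (cmod ` E)"
    unfolding spectral_radius_def E_def Ac_def by (rule arg_cong[of _ _ Max]) auto
  show ?thesis
  proof (rule ccontr)
    assume "\<not> invertible (mat 1 - A)"
    then obtain v where v: "v \<noteq> 0" "(mat 1 - A) *v v = 0"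
      by (metis invertible_left_inverse matrix_left_invertible_ker)
    hence Av: "A *v v = v" by (simp add: matrix_vector_mult_diff_rdistrib)
    define w :: "complex ^ 'k" where "w = (\<chi> k. complex_of_real (v $ k))"
    have "w \<noteq> 0" using v by (auto simp: w_def vec_eq_iff)
    moreover have "Ac *v w = 1 *s w"
    proof -
      have "(Ac *v w) $ k = complex_of_real ((A *v v) $ k)" for k
        by (simp add: matrix_vector_mult_def Ac_def w_def)
      thus ?thesis by (simp add: Av vec_eq_iff w_def)
    qed
    ultimately have "1 \<in> E" unfolding E_def by blast
    hence "cmod 1 \<le> Max (cmod ` E)" using fE by (intro Max_ge finite_imageI imageI)
    thus False using sr sr_eq by simp
  qed
qed

lemma sub_add_axis: "0 < x $ k \<Longrightarrow> x - axis k 1 + axis k 1 = (x :: nat ^ 'k)"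
  by (auto simp: vec_eq_iff axis_def)

lemma up_iff: "(y :: nat ^ 'k) = x + axis k 1 \<longleftrightarrow> 0 < y $ k \<and> x = y - axis k 1"
proof
  assume "y = x + axis k 1"
  thus "0 < y $ k \<and> x = y - axis k 1" by (simp del: One_nat_def)
qed (use sub_add_axis in metis)

lemma move_imp:
  assumes "0 < x $ k" "(y :: nat ^ 'k) = x - axis k 1 + axis l 1"
  shows "0 < y $ l \<and> x = y - axis l 1 + axis k 1"
proof -
  have "y - axis l 1 = x - axis k 1" unfolding assms(2) by (rule add_diff_cancel_right')
  thus ?thesis using sub_add_axis[OF assms(1)] assms(2) by simp
qed

lemma move_iff:
  "0 < y $ l \<and> x = y - axis l 1 + axis k 1 \<longleftrightarrow> 0 < x $ k \<and> (y :: nat ^ 'k) = x - axis k 1 + axis l 1"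
  using move_imp by blast

lemma jackson_rate_expand:
  "jackson_rate la m R x y = (\<Sum>k\<in>UNIV. la $ k * of_bool (y = x + axis k 1))
     + (\<Sum>k\<in>UNIV. \<Sum>l\<in>UNIV. m $ k * R $ k $ l * of_bool (0 < x $ k \<and> y = x - axis k 1 + axis l 1))
     + (\<Sum>k\<in>UNIV. m $ k * (1 - (\<Sum>l\<in>UNIV. R $ k $ l)) * of_bool (0 < x $ k \<and> y = x - axis k 1))"
proof -
  have 1: "(\<Sum>k | x $ k > 0. F k) = (\<Sum>k\<in>UNIV. of_bool (0 < x $ k) * F k)" for F :: "'a \<Rightarrow> real"
    by (rule sum.mono_neutral_cong_left) auto
  show ?thesis unfolding jackson_rate_def 1
    by (simp only: distrib_left sum.distrib sum_distrib_left of_bool_conj mult_ac add_ac)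
qed

lemma matrix_inv_inverse:
  assumes "invertible A"
  shows "A ** matrix_inv A = mat 1" "matrix_inv A ** A = mat 1"
proof -
  have "A ** matrix_inv A = mat 1 \<and> matrix_inv A ** A = mat 1"
    unfolding matrix_inv_def by (rule someI_ex) (use assms in \<open>simp add: invertible_def\<close>)
  thus "A ** matrix_inv A = mat 1" "matrix_inv A ** A = mat 1" by auto
qed

section \<open>Traffic equations, the product-form weight and the dual network\<close>

locale jackson_network =
  fixes lam mu :: "real ^ 'k" and P :: "real ^ 'k ^ 'k"
  assumes routing: "substochastic P" "spectral_radius P < 1"
    and lam_pos: "\<And>k. lam $ k > 0" and mu_pos: "\<And>k. mu $ k > 0"
    and ergodic: "\<And>k. load lam mu P $ k < 1"
begin

definition nu where "nu = throughput lam P"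
definition rho where "rho = load lam mu P"
definition Pd where "Pd = dual_routing lam P"
definition lamd where "lamd = dual_arrival lam P"

lemma P_nonneg: "0 \<le> P $ k $ l" using routing by (simp add: substochastic_def)
lemma P_row: "(\<Sum>l\<in>UNIV. P $ k $ l) \<le> 1" using routing by (simp add: substochastic_def)

lemma traffic: "nu $ k = lam $ k + (\<Sum>l\<in>UNIV. P $ l $ k * nu $ l)"
proof -
  have "invertible (transpose (mat 1 - P))"
    using invertible_mat_1_minus[OF routing(2)] by (simp add: invertible_det_nz det_transpose)
  moreover have "transpose (mat 1 - P) = mat 1 - transpose P"
    by (simp add: transpose_def vec_eq_iff mat_def)
  ultimately have "(mat 1 - transpose P) ** matrix_inv (mat 1 - transpose P) = mat 1"
    by (simp add: matrix_inv_inverse)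
  hence "(mat 1 - transpose P) *v nu = lam"
    by (simp add: nu_def throughput_def matrix_vector_mul_assoc)
  hence "nu - transpose P *v nu = lam" by (simp add: matrix_vector_mult_diff_rdistrib)
  hence "nu $ k - (transpose P *v nu) $ k = lam $ k" by (metis vector_minus_component)
  thus ?thesis by (simp add: matrix_vector_mult_def transpose_def)
qed

text \<open>The negative parts x of \<open>nu\<close> satisfy
  \<open>x \<le> transpose P *v x\<close>, strictly at a node where \<open>nu\<close> is negative
  because external arrivals are positive. Summed over all nodes this contradicts row sums of at most
  1.\<close>

lemma nu_nonneg: "0 \<le> nu $ k"
proof (rule ccontr)
  assume neg: "\<not> 0 \<le> nu $ k"
  define x where "x l = max 0 (- nu $ l)" for l
  have x0: "0 \<le> x l" for l by (simp add: x_def)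
  have le: "x l \<le> (\<Sum>j\<in>UNIV. P $ j $ l * x j)" for l
  proof (cases "nu $ l < 0")
    case True
    have "- nu $ l = - lam $ l + (\<Sum>j\<in>UNIV. P $ j $ l * (- nu $ j))"
      using traffic[of l] by (simp add: sum_negf)
    also have "\<dots> \<le> (\<Sum>j\<in>UNIV. P $ j $ l * x j)"
    proof -
      have "(\<Sum>j\<in>UNIV. P $ j $ l * (- nu $ j)) \<le> (\<Sum>j\<in>UNIV. P $ j $ l * x j)"
        by (intro sum_mono mult_left_mono) (auto simp: x_def P_nonneg)
      thus ?thesis using lam_pos[of l] by simp
    qed
    finally show ?thesis using True by (simp add: x_def)
  qed (use x0 P_nonneg in \<open>auto simp: x_def intro!: sum_nonneg\<close>)
  have lt: "x k < (\<Sum>j\<in>UNIV. P $ j $ k * x j)"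
  proof -
    have "- nu $ k = - lam $ k + (\<Sum>j\<in>UNIV. P $ j $ k * (- nu $ j))"
      using traffic[of k] by (simp add: sum_negf)
    also have "\<dots> < (\<Sum>j\<in>UNIV. P $ j $ k * (- nu $ j))" using lam_pos[of k] by simp
    also have "\<dots> \<le> (\<Sum>j\<in>UNIV. P $ j $ k * x j)"
      by (intro sum_mono mult_left_mono) (auto simp: x_def P_nonneg)
    finally show ?thesis using neg by (simp add: x_def)
  qed
  have "(\<Sum>l\<in>UNIV. x l) < (\<Sum>l\<in>UNIV. \<Sum>j\<in>UNIV. P $ j $ l * x j)"
    by (rule sum_strict_mono_ex1) (use le lt in auto)
  also have "\<dots> = (\<Sum>j\<in>UNIV. (\<Sum>l\<in>UNIV. P $ j $ l) * x j)"
    by (subst sum.swap) (simp add: sum_distrib_right)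
  also have "\<dots> \<le> (\<Sum>j\<in>UNIV. 1 * x j)" by (intro sum_mono mult_right_mono) (use P_row x0 in auto)
  finally show False by simp
qed

lemma nu_pos: "0 < nu $ k"
proof -
  have "0 \<le> (\<Sum>l\<in>UNIV. P $ l $ k * nu $ l)"
    by (intro sum_nonneg mult_nonneg_nonneg P_nonneg nu_nonneg)
  thus ?thesis using traffic[of k] lam_pos[of k] by linarith
qed

lemma rho_eq: "rho $ k = nu $ k / mu $ k" by (simp add: rho_def load_def nu_def)
lemma rho_pos: "0 < rho $ k" using nu_pos mu_pos by (simp add: rho_eq)
lemma rho_less_1: "rho $ k < 1" using ergodic by (simp add: rho_def)
lemma nu_less_mu: "nu $ k < mu $ k" using rho_less_1[of k] mu_pos[of k] by (simp add: rho_eq)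

lemma Pd_eq: "Pd $ k $ l = nu $ l * P $ l $ k / nu $ k"
  by (simp add: Pd_def dual_routing_def nu_def)
lemma lamd_eq: "lamd $ k = nu $ k * (1 - (\<Sum>l\<in>UNIV. P $ k $ l))"
  by (simp add: lamd_def dual_arrival_def nu_def)

lemma Pd_nonneg: "0 \<le> Pd $ k $ l" using nu_nonneg P_nonneg by (simp add: Pd_eq)
lemma lamd_nonneg: "0 \<le> lamd $ k" using nu_nonneg P_row by (simp add: lamd_eq)

lemma Pd_row: "(\<Sum>l\<in>UNIV. Pd $ k $ l) = 1 - lam $ k / nu $ k"
proof -
  have "(\<Sum>l\<in>UNIV. Pd $ k $ l) = (\<Sum>l\<in>UNIV. P $ l $ k * nu $ l) / nu $ k"
    by (simp add: Pd_eq sum_divide_distrib mult.commute)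
  also have "\<dots> = (nu $ k - lam $ k) / nu $ k" using traffic[of k] by simp
  finally show ?thesis using nu_pos[of k] by (simp add: diff_divide_distrib)
qed

lemma Pd_substochastic: "substochastic Pd"
  using Pd_nonneg Pd_row lam_pos nu_pos by (auto simp: substochastic_def less_imp_le)

definition Lam where "Lam = (\<Sum>k\<in>UNIV. lam $ k) + (\<Sum>k\<in>UNIV. mu $ k)"

lemma sum_lamd: "(\<Sum>k\<in>UNIV. lamd $ k) = (\<Sum>k\<in>UNIV. lam $ k)"
proof -
  have "(\<Sum>k\<in>UNIV. lamd $ k) = (\<Sum>k\<in>UNIV. nu $ k) - (\<Sum>k\<in>UNIV. \<Sum>l\<in>UNIV. P $ k $ l * nu $ k)"
    by (simp add: lamd_eq right_diff_distrib sum_subtractf sum_distrib_left mult.commute)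
  also have "(\<Sum>k\<in>UNIV. \<Sum>l\<in>UNIV. P $ k $ l * nu $ k) = (\<Sum>l\<in>UNIV. \<Sum>k\<in>UNIV. P $ k $ l * nu $ k)"
    by (rule sum.swap)
  also have "(\<Sum>k\<in>UNIV. nu $ k) = (\<Sum>l\<in>UNIV. lam $ l) + (\<Sum>l\<in>UNIV. \<Sum>k\<in>UNIV. P $ k $ l * nu $ k)"
    unfolding sum.distrib[symmetric] by (rule sum.cong[OF refl traffic])
  finally show ?thesis by simp
qed

abbreviation \<pi> where "\<pi> \<equiv> geometric_product rho"
definition wt :: "nat ^ 'k \<Rightarrow> real" where "wt x = (\<Prod>k\<in>UNIV. rho $ k ^ (x $ k))"

lemma pmf_pi: "pmf \<pi> x = wt x * (\<Prod>k\<in>UNIV. 1 - rho $ k)"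
  unfolding wt_def by (rule pmf_geometric_product) (use rho_pos rho_less_1 in auto)

lemma wt_pos: "0 < wt x" unfolding wt_def by (intro prod_pos) (use rho_pos in auto)

lemma pi_pos: "0 < pmf \<pi> x"
  unfolding pmf_pi using wt_pos rho_less_1 by (intro mult_pos_pos prod_pos) auto

lemma wt_up: "wt (x + axis k 1) = wt x * rho $ k"
proof -
  have "wt (x + axis k 1) = (\<Prod>l\<in>UNIV. rho $ l ^ (x $ l) * (if l = k then rho $ k else 1))"
    unfolding wt_def by (rule prod.cong) (auto simp: axis_def)
  thus ?thesis by (simp add: prod.distrib wt_def)
qed

lemma wt_down: "x $ k > 0 \<Longrightarrow> wt (x - axis k 1) * rho $ k = wt x"
proof -
  assume "x $ k > 0"
  hence "x - axis k 1 + axis k 1 = x" by (auto simp: vec_eq_iff axis_def)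
  thus ?thesis using wt_up[of "x - axis k 1" k] by simp
qed

text \<open>The balance holds event by event: an arrival is undone by a departure in the dual
  network (\<open>A\<close>), a departure by an arrival (\<open>B\<close>), a transfer from k to l
  by one from l to k (\<open>C\<close>). Matching the events themselves, not the states, keeps the
  argument free of coincidences between target states.\<close>

lemma detailed:
  "wt x * jackson_rate lam mu P x y = wt y * jackson_rate lamd mu Pd y x"
proof -
  have A: "wt x * (\<Sum>k\<in>UNIV. lam $ k * of_bool (y = x + axis k 1))
     = wt y * (\<Sum>k\<in>UNIV. mu $ k * (1 - (\<Sum>l\<in>UNIV. Pd $ k $ l)) * of_bool (0 < y $ k \<and> x = y - axis k 1))"
    unfolding sum_distrib_left
  proof (rule sum.cong[OF refl])
    fix k
    have "wt x * lam $ k = wt (x + axis k 1) * (mu $ k * (1 - (\<Sum>l\<in>UNIV. Pd $ k $ l)))"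
      unfolding wt_up Pd_row rho_eq using mu_pos[of k] nu_pos[of k] by simp
    thus "wt x * (lam $ k * of_bool (y = x + axis k 1)) =
      wt y * (mu $ k * (1 - (\<Sum>l\<in>UNIV. Pd $ k $ l)) * of_bool (0 < y $ k \<and> x = y - axis k 1))"
      unfolding up_iff[symmetric] by (cases "y = x + axis k 1") (auto simp: mult_ac)
  qed
  have B: "wt x * (\<Sum>k\<in>UNIV. mu $ k * (1 - (\<Sum>l\<in>UNIV. P $ k $ l)) * of_bool (0 < x $ k \<and> y = x - axis k 1))
     = wt y * (\<Sum>k\<in>UNIV. lamd $ k * of_bool (x = y + axis k 1))"
    unfolding sum_distrib_left
  proof (rule sum.cong[OF refl])
    fix k
    have "wt (y + axis k 1) * (mu $ k * (1 - (\<Sum>l\<in>UNIV. P $ k $ l))) = wt y * lamd $ k"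
      unfolding wt_up lamd_eq rho_eq using mu_pos[of k] by simp
    thus "wt x * (mu $ k * (1 - (\<Sum>l\<in>UNIV. P $ k $ l)) * of_bool (0 < x $ k \<and> y = x - axis k 1)) =
      wt y * (lamd $ k * of_bool (x = y + axis k 1))"
      unfolding up_iff[symmetric] by (cases "x = y + axis k 1") (auto simp: mult_ac)
  qed
  have C: "wt x * (\<Sum>k\<in>UNIV. \<Sum>l\<in>UNIV. mu $ k * P $ k $ l * of_bool (0 < x $ k \<and> y = x - axis k 1 + axis l 1))
     = wt y * (\<Sum>l\<in>UNIV. \<Sum>k\<in>UNIV. mu $ l * Pd $ l $ k * of_bool (0 < y $ l \<and> x = y - axis l 1 + axis k 1))"
    unfolding sum_distrib_left
  proof (subst sum.swap, intro sum.cong refl)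
    fix k l
    show "wt x * (mu $ k * P $ k $ l * of_bool (0 < x $ k \<and> y = x - axis k 1 + axis l 1)) =
      wt y * (mu $ l * Pd $ l $ k * of_bool (0 < y $ l \<and> x = y - axis l 1 + axis k 1))"
      unfolding move_iff[of y l x k]
    proof (cases "0 < x $ k \<and> y = x - axis k 1 + axis l 1")
      case True
      define z where "z = x - axis k 1"
      have "wt x = wt z * rho $ k" using wt_down[of x k] True by (simp add: z_def)
      moreover have "wt y = wt z * rho $ l" using True wt_up[of z l] by (simp add: z_def)
      ultimately have "wt x * (mu $ k * P $ k $ l) = wt y * (mu $ l * Pd $ l $ k)"
      proof -
        assume "wt x = wt z * rho $ k" "wt y = wt z * rho $ l"
        hence "wt x * mu $ k = wt z * nu $ k" "wt y * mu $ l = wt z * nu $ l"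
          using mu_pos[of k] mu_pos[of l] by (simp_all add: rho_eq)
        hence "wt x * mu $ k * P $ k $ l = wt z * nu $ k * P $ k $ l" "wt y * mu $ l * Pd $ l $ k = wt z * nu $ l * Pd $ l $ k"
          by simp_all
        thus "wt x * (mu $ k * P $ k $ l) = wt y * (mu $ l * Pd $ l $ k)"
          using nu_pos[of l] by (simp add: Pd_eq mult.assoc)
      qed
      thus "wt x * (mu $ k * P $ k $ l * of_bool (0 < x $ k \<and> y = x - axis k 1 + axis l 1)) =
        wt y * (mu $ l * Pd $ l $ k * of_bool (0 < x $ k \<and> y = x - axis k 1 + axis l 1))" using True by simp
    next
      case False
      hence "of_bool (0 < x $ k \<and> y = x - axis k 1 + axis l 1) = (0::real)" by (simp only: of_bool_eq)
      thus "wt x * (mu $ k * P $ k $ l * of_bool (0 < x $ k \<and> y = x - axis k 1 + axis l 1)) =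
        wt y * (mu $ l * Pd $ l $ k * of_bool (0 < x $ k \<and> y = x - axis k 1 + axis l 1))" by (simp only: mult_zero_right)
    qed
  qed
  have rearr: "a + b + c = c + b + a" for a b c :: real by simp
  show ?thesis
    unfolding jackson_rate_expand[of lam mu P x y] jackson_rate_expand[of lamd mu Pd y x] distrib_left A B C
    by (rule rearr)
qed

lemma exit_eq:
  "(\<Sum>y | y \<noteq> x \<and> jackson_rate lamd mu Pd x y \<noteq> 0. jackson_rate lamd mu Pd x y)
    = (\<Sum>y | y \<noteq> x \<and> jackson_rate lam mu P x y \<noteq> 0. jackson_rate lam mu P x y)"
proof -
  have "Pd $ k $ k = P $ k $ k" for k using nu_pos[of k] by (simp add: Pd_eq)
  thus ?thesis by (simp add: jackson_exit sum_lamd)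
qed

lemma forward:
  assumes "transition_semigroup p" "has_jump_rates p (jackson_rate lam mu P)"
  shows "jump_semigroup p (jackson_rate lam mu P) Lam"
  unfolding Lam_def using assms routing(1) lam_pos mu_pos
  by (intro jackson_jump_semigroup) (auto simp: less_imp_le)

lemma reversal:
  assumes "transition_semigroup p" "has_jump_rates p (jackson_rate lam mu P)"
  obtains p' where "jump_semigroup p' (jackson_rate lamd mu Pd) Lam"
    "\<And>t x y. 0 \<le> t \<Longrightarrow> wt y * pmf (p' t y) x = wt x * pmf (p t x) y"
proof -
  interpret F: jump_semigroup p "jackson_rate lam mu P" Lam using assms by (rule forward)
  define C where "C = (\<Prod>k\<in>UNIV. 1 - rho $ k)"
  have C: "0 < C" unfolding C_def by (intro prod_pos) (use rho_less_1 in auto)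
  have det: "pmf \<pi> x * jackson_rate lam mu P x y = pmf \<pi> y * jackson_rate lamd mu Pd y x" for x y
    using detailed[of x y] unfolding pmf_pi by (metis mult.assoc mult.commute)
  have ex: "(\<Sum>y | y \<noteq> x \<and> jackson_rate lamd mu Pd x y \<noteq> 0. jackson_rate lamd mu Pd x y) = F.exit x" for x
    unfolding exit_eq F.exit_def F.supp_def ..
  have ex': "(\<Sum>\<^sub>\<infinity>z\<in>- {x}. jackson_rate lamd mu Pd x z) = F.exit x" for x
  proof -
    have "(\<Sum>\<^sub>\<infinity>z\<in>- {x}. jackson_rate lamd mu Pd x z) = (\<Sum>\<^sub>\<infinity>z\<in>{y. y \<noteq> x \<and> jackson_rate lamd mu Pd x y \<noteq> 0}. jackson_rate lamd mu Pd x z)"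
      by (rule infsum_cong_neutral) auto
    also have "\<dots> = (\<Sum>y | y \<noteq> x \<and> jackson_rate lamd mu Pd x y \<noteq> 0. jackson_rate lamd mu Pd x y)"
      by (rule infsum_finite[OF finite_jackson_supp])
    finally show ?thesis using ex by simp
  qed
  have inv: "bind_pmf \<pi> (p t) = \<pi>" if "0 \<le> t" for t
    by (rule F.invariant[OF F.expectation_gen_zero[OF det _ finite_jackson_supp ex] that])
      (auto intro: jackson_rate_nonneg lamd_nonneg Pd_substochastic mu_pos less_imp_le)
  obtain p' where p': "transition_semigroup p'" "has_jump_rates p' (jackson_rate lamd mu Pd)"
    "\<And>t x y. 0 \<le> t \<Longrightarrow> pmf \<pi> y * pmf (p' t y) x = pmf \<pi> x * pmf (p t x) y"
    using F.reversed_semigroup[OF pi_pos inv det ex'] by blast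
  show ?thesis
  proof
    show "jump_semigroup p' (jackson_rate lamd mu Pd) Lam"
      unfolding Lam_def sum_lamd[symmetric] using p' Pd_substochastic lamd_nonneg mu_pos
      by (intro jackson_jump_semigroup) (auto simp: less_imp_le)
    show "wt y * pmf (p' t y) x = wt x * pmf (p t x) y" if "0 \<le> t" for t x y
      using p'(3)[OF that, of y x] C unfolding pmf_pi C_def[symmetric] by simp
  qed
qed

end

section \<open>The fluid trajectory\<close>

lemma null_set_open_cover:
  fixes \<delta> :: real
  assumes N: "N \<in> null_sets (lborel :: real measure)" and "\<delta> > 0"
  obtains U where "open U" "N \<subseteq> U" "emeasure lborel U < ennreal \<delta>"
proof -
  have "N \<in> sets borel" using N by auto
  then obtain U where U: "open U" "N \<subseteq> U" "emeasure lborel (U - N) < ennreal \<delta>"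
    using outer_regular_lborel[of N \<delta>] \<open>\<delta> > 0\<close> by blast
  have "emeasure lborel U = emeasure lborel (U - N)"
    using N U(1) by (intro emeasure_Diff_null_set[symmetric]) auto
  thus ?thesis using that U by simp
qed

lemma disjoint_intervals_total_length:
  fixes D :: "(real \<times> real) set"
  assumes D: "finite D" "\<And>u v. (u, v) \<in> D \<Longrightarrow> u \<le> v \<and> {u<..<v} \<subseteq> U"
    and disj: "disjoint_family_on (\<lambda>(u, v). {u<..<v}) D"
    and U: "open U" "emeasure lborel U < ennreal \<delta>"
  shows "(\<Sum>(u, v)\<in>D. v - u) < \<delta>"
proof -
  have "ennreal (\<Sum>(u, v)\<in>D. v - u) = (\<Sum>i\<in>D. ennreal (case i of (u, v) \<Rightarrow> v - u))"
    by (rule sum_ennreal[symmetric]) (use D in auto)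
  also have "\<dots> = (\<Sum>i\<in>D. emeasure lborel (case i of (u, v) \<Rightarrow> {u<..<v}))"
    by (rule sum.cong) (use D in auto)
  also have "\<dots> = emeasure lborel (\<Union>i\<in>D. case i of (u, v) \<Rightarrow> {u<..<v})"
    by (rule sum_emeasure) (use D disj in auto)
  also have "\<dots> \<le> emeasure lborel U"
    by (rule emeasure_mono) (use D U in auto)
  also note U(2)
  finally show ?thesis by (simp add: ennreal_less_iff D sum_nonneg split_beta)
qed

lemma abs_continuous_onE:
  assumes ac: "abs_continuous_on a b f" and e: "e > 0"
  obtains \<delta> where "\<delta> > 0" "\<forall>D. finite D \<and> (\<forall>(u, v)\<in>D. a \<le> u \<and> u \<le> v \<and> v \<le> b) \<and>
        disjoint_family_on (\<lambda>(u, v). {u<..<v}) D \<and> (\<Sum>(u, v)\<in>D. v - u) < \<delta> \<longrightarrow> (\<Sum>(u, v)\<in>D. dist (f u) (f v)) < e"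
proof -
  show ?thesis using ac[unfolded abs_continuous_on_def, THEN spec, THEN mp, OF e] that by (elim exE conjE)
qed

text \<open>A Dini argument in place of a covering theorem. The exceptional null set lies in an open
  U so small that the increments of f over disjoint intervals inside U sum to at most e;
  \<open>V t\<close> is the supremum of such sums up to t. Then \<open>f t - e * t - V t\<close> has
  nonpositive right Dini derivative everywhere: in U the growth of V dominates that of f, and
  outside U the derivative of f is zero.\<close>

lemma abs_continuous_zero_derivative:
  fixes \<phi> :: "real \<Rightarrow> real ^ 'k"
  assumes ab: "a \<le> b" and ac: "abs_continuous_on a b \<phi>"
    and mono: "mono_on {a..b} (\<lambda>t. \<phi> t $ l)"
    and cont: "continuous_on {a..b} (\<lambda>t. \<phi> t $ l)"
    and deriv: "AE t in lborel. a < t \<and> t < b \<longrightarrow> ((\<lambda>t. \<phi> t $ l) has_real_derivative 0) (at t)"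
  shows "\<phi> b $ l = \<phi> a $ l"
proof -
  define f where "f t = \<phi> t $ l" for t
  have fmono: "f s \<le> f t" if "a \<le> s" "s \<le> t" "t \<le> b" for s t
    using mono that unfolding f_def by (auto simp: mono_on_def)
  obtain N0 where N0: "N0 \<in> null_sets lborel" "\<And>t. a < t \<Longrightarrow> t < b \<Longrightarrow> t \<notin> N0 \<Longrightarrow> (f has_real_derivative 0) (at t)"
    using deriv unfolding f_def[symmetric] by (auto elim!: AE_E3)
  \<comment> \<open>No derivative is assumed at the left end point, so it has to be covered by U as
    well.\<close>
  define N where "N = insert a N0"
  have N: "N \<in> null_sets lborel" unfolding N_def using N0(1) by (subst insert_is_Un) (intro null_sets.Un N0(1) finite_imp_null_set_lborel, simp)
  have "f b \<le> f a + e * (b - a + 1)" if e: "e > 0" for e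
  proof -
    obtain \<delta> where \<delta>0: "\<delta> > 0" "\<forall>D. finite D \<and> (\<forall>(u, v)\<in>D. a \<le> u \<and> u \<le> v \<and> v \<le> b) \<and>
        disjoint_family_on (\<lambda>(u, v). {u<..<v}) D \<and> (\<Sum>(u, v)\<in>D. v - u) < \<delta> \<longrightarrow> (\<Sum>(u, v)\<in>D. dist (\<phi> u) (\<phi> v)) < e"
      by (rule abs_continuous_onE[OF ac e])
    note \<delta> = \<delta>0(1) \<delta>0(2)[THEN spec, THEN mp, OF conjI[OF _ conjI[OF _ conjI]]]
    obtain U where U: "open U" "N \<subseteq> U" "emeasure lborel U < ennreal \<delta>"
      using null_set_open_cover[OF N \<delta>(1)] .
    define adm where "adm t D \<longleftrightarrow> finite D \<and> (\<forall>(u, v)\<in>D. a \<le> u \<and> u < v \<and> v \<le> t \<and> {u..v} \<subseteq> U) \<and>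
        disjoint_family_on (\<lambda>(u, v). {u<..<v}) D" for t and D :: "(real \<times> real) set"
    define V where "V t = Sup {(\<Sum>(u, v)\<in>D. f v - f u) | D. adm t D}" for t
    have adm_bound: "(\<Sum>(u, v)\<in>D. f v - f u) \<le> e" if D: "adm t D" "t \<le> b" for t D
    proof -
      have "(\<Sum>(u, v)\<in>D. v - u) < \<delta>"
        by (rule disjoint_intervals_total_length[OF _ _ _ U(1,3)])
          (use D in \<open>force simp: adm_def\<close>)+
      hence "(\<Sum>(u, v)\<in>D. dist (\<phi> u) (\<phi> v)) < e"
        using D by (intro \<delta>(2)) (force simp: adm_def)+
      moreover have "(\<Sum>(u, v)\<in>D. f v - f u) \<le> (\<Sum>(u, v)\<in>D. dist (\<phi> u) (\<phi> v))"
      proof (rule sum_mono)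
        fix i assume "i \<in> D"
        have "f v - f u \<le> dist (\<phi> u) (\<phi> v)" for u v
          using component_le_norm_cart[of "\<phi> v - \<phi> u" l] unfolding f_def dist_norm
          by (simp add: norm_minus_commute)
        thus "(case i of (u, v) \<Rightarrow> f v - f u) \<le> (case i of (u, v) \<Rightarrow> dist (\<phi> u) (\<phi> v))"
          by (cases i) simp
      qed
      ultimately show ?thesis by simp
    qed
    have adm_empty: "adm t {}" for t by (simp add: adm_def disjoint_family_on_def)
    have bdd: "bdd_above {(\<Sum>(u, v)\<in>D. f v - f u) | D. adm t D}" if "t \<le> b" for t
      by (rule bdd_aboveI[of _ e]) (use adm_bound that in auto)
    have V_upper: "(\<Sum>(u, v)\<in>D. f v - f u) \<le> V t" if "adm t D" "t \<le> b" for t D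
      unfolding V_def using that by (intro cSup_upper bdd) auto
    have V_least: "V t \<le> c" if "\<And>D. adm t D \<Longrightarrow> (\<Sum>(u, v)\<in>D. f v - f u) \<le> c" for t c
      unfolding V_def using adm_empty[of t] that by (intro cSup_least) auto
    have V_e: "V b \<le> e" by (rule V_least) (use adm_bound in auto)
    have V_0: "0 \<le> V a" using V_upper[OF adm_empty, of a] ab by simp
    have V_mono: "V s \<le> V t" if "s \<le> t" "t \<le> b" for s t
    proof (rule V_least)
      fix D assume "adm s D"
      hence "adm t D" using that by (force simp: adm_def)
      thus "(\<Sum>(u, v)\<in>D. f v - f u) \<le> V t" using that by (intro V_upper)
    qed
    have V_add: "V t + (f (t + d) - f t) \<le> V (t + d)" if d: "a \<le> t" "0 < d" "t + d \<le> b" "{t..t + d} \<subseteq> U" for t d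
    proof -
      have "V t \<le> V (t + d) - (f (t + d) - f t)"
      proof (rule V_least)
        fix D assume D: "adm t D"
        have notin: "(t, t + d) \<notin> D" using D d by (force simp: adm_def)
        have "adm (t + d) (insert (t, t + d) D)"
          unfolding adm_def
        proof (intro conjI)
          show "disjoint_family_on (\<lambda>(u, v). {u<..<v}) (insert (t, t + d) D)"
          proof -
            have "{t<..<t + d} \<inter> {u<..<v} = {}" if "(u, v) \<in> D" for u v
            proof -
              have "v \<le> t" using D that by (force simp: adm_def)
              thus ?thesis by auto
            qed
            thus ?thesis using D notin by (subst disjoint_family_on_insert) (auto simp: adm_def)
          qed
        qed (use D d in \<open>force simp: adm_def\<close>)+
        from V_upper[OF this] notin D d show "(\<Sum>(u, v)\<in>D. f v - f u) \<le> V (t + d) - (f (t + d) - f t)"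
          by (simp add: adm_def)
      qed
      thus ?thesis by simp
    qed
    define G where "G t = f t - e * t - V t" for t
    have "G b \<le> G a"
    proof (rule right_dini_nonincreasing[OF ab])
      fix t \<epsilon> :: real assume t: "a \<le> t" "t < b" "\<epsilon> > 0"
      have small: "\<forall>\<^sub>F d in at_right (0::real). d \<in> {0<..<b - t}"
        by (rule eventually_at_right_real) (use t in simp)
      show "\<forall>\<^sub>F d in at_right 0. G (t + d) \<le> G t + \<epsilon> * d"
      proof (cases "t \<in> U")
        case True
        obtain d0 where d0: "d0 > 0" "cball t d0 \<subseteq> U" using U(1) True open_contains_cball by blast
        have "\<forall>\<^sub>F d in at_right (0::real). d \<in> {0<..<d0}"
          by (rule eventually_at_right_real) (use d0 in simp)
        thus ?thesis using small
        proof eventually_elim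
          case (elim d)
          have "{t..t + d} \<subseteq> cball t d0" using elim by (auto simp: dist_real_def)
          hence "V t + (f (t + d) - f t) \<le> V (t + d)" using d0 elim t by (intro V_add) auto
          moreover have "0 \<le> e * d" "0 \<le> \<epsilon> * d" using e t elim by auto
          ultimately show ?case by (simp add: G_def algebra_simps)
        qed
      next
        case False
        hence "a < t" "t \<notin> N0" using t U(2) by (auto simp: N_def less_le)
        hence "(f has_real_derivative 0) (at t)" using N0(2) t by auto
        hence "(f has_real_derivative 0) (at_right t)" by (rule has_field_derivative_at_within)
        hence "\<forall>\<^sub>F d in at_right 0. \<bar>f (t + d) - f t - 0 * d\<bar> \<le> e * d"
          using e by (rule has_derivative_at_rightD)
        thus ?thesis using small
        proof eventually_elim
          case (elim d)
          have "V t \<le> V (t + d)" using elim by (intro V_mono) auto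
          moreover have "0 \<le> \<epsilon> * d" using t elim by auto
          ultimately show ?case using elim(1) by (simp add: G_def algebra_simps abs_le_iff)
        qed
      qed
    next
      fix t \<epsilon> :: real assume t: "a < t" "t \<le> b" "\<epsilon> > 0"
      have "continuous (at t within {a..b}) f" using cont t by (auto simp: continuous_on_eq_continuous_within f_def[abs_def])
      then obtain d0 where d0: "d0 > 0" "\<And>s. s \<in> {a..b} \<Longrightarrow> dist s t < d0 \<Longrightarrow> dist (f s) (f t) < \<epsilon>"
        using t(3) unfolding continuous_within_eps_delta by blast
      have "\<forall>\<^sub>F d in at_right (0::real). d \<in> {0<..<min d0 (t - a)}"
        by (rule eventually_at_right_real) (use d0 t in simp)
      thus "\<forall>\<^sub>F d in at_right 0. G t \<le> G (t - d) + \<epsilon>"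
      proof eventually_elim
        case (elim d)
        have "dist (f (t - d)) (f t) < \<epsilon>" using elim t by (intro d0(2)) (auto simp: dist_real_def)
        hence "f t \<le> f (t - d) + \<epsilon>" by (simp add: dist_real_def)
        moreover have "V (t - d) \<le> V t" using elim t by (intro V_mono) auto
        moreover have "e * (t - d) \<le> e * t" using e elim by (intro mult_left_mono) auto
        ultimately show ?case by (simp add: G_def)
      qed
    qed
    hence "f b \<le> f a + e * (b - a) + e" using V_e V_0 by (simp add: G_def algebra_simps)
    thus ?thesis by (simp add: algebra_simps)
  qed
  hence le: "f b \<le> f a + e * (b - a + 1)" if "e > 0" for e using that by simp
  have "f b \<le> f a"
  proof (rule field_le_epsilon)
    fix e :: real assume "e > 0"
    hence "f b \<le> f a + e / (b - a + 1) * (b - a + 1)" using ab by (intro le) auto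
    thus "f b \<le> f a + e" using ab by simp
  qed
  thus ?thesis using fmono[of a b] ab by (simp add: f_def)
qed

lemma abs_continuous_on_subset:
  "abs_continuous_on a b f \<Longrightarrow> a \<le> c \<Longrightarrow> d \<le> b \<Longrightarrow> abs_continuous_on c d f"
proof -
  assume ac: "abs_continuous_on a b f" and le: "a \<le> c" "d \<le> b"
  have *: "(\<forall>(u, v)\<in>D. a \<le> u \<and> u \<le> v \<and> v \<le> b)" if "(\<forall>(u, v)\<in>D. c \<le> u \<and> u \<le> v \<and> v \<le> d)" for D
  proof clarify
    fix u v assume "(u, v) \<in> D"
    hence "c \<le> u \<and> u \<le> v \<and> v \<le> d" using that by blast
    thus "a \<le> u \<and> u \<le> v \<and> v \<le> b" using le by linarith
  qed
  show ?thesis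
    unfolding abs_continuous_on_def
  proof (intro allI impI)
    fix e :: real assume e: "e > 0"
    obtain \<delta> where \<delta>0: "\<delta> > 0" "\<forall>D. finite D \<and> (\<forall>(u, v)\<in>D. a \<le> u \<and> u \<le> v \<and> v \<le> b) \<and>
        disjoint_family_on (\<lambda>(u, v). {u<..<v}) D \<and> (\<Sum>(u, v)\<in>D. v - u) < \<delta> \<longrightarrow> (\<Sum>(u, v)\<in>D. dist (f u) (f v)) < e"
      by (rule abs_continuous_onE[OF ac e])
    note \<delta> = \<delta>0(1) \<delta>0(2)[THEN spec, THEN mp, OF conjI[OF _ conjI[OF _ conjI]]]
    show "\<exists>\<delta>>0. \<forall>D. finite D \<and> (\<forall>(u, v)\<in>D. c \<le> u \<and> u \<le> v \<and> v \<le> d) \<and>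
        disjoint_family_on (\<lambda>(u, v). {u<..<v}) D \<and> (\<Sum>(u, v)\<in>D. v - u) < \<delta> \<longrightarrow> (\<Sum>(u, v)\<in>D. dist (f u) (f v)) < e"
      using \<delta>(1) \<delta>(2)[OF _ *] by blast
  qed
qed

lemma abs_continuous_imp_continuous:
  assumes ac: "abs_continuous_on a b f"
  shows "continuous_on {a..b} f"
  unfolding continuous_on_iff
proof (intro ballI allI impI)
  fix x and e :: real assume x: "x \<in> {a..b}" and e: "e > 0"
  obtain \<delta> where \<delta>0: "\<delta> > 0" "\<forall>D. finite D \<and> (\<forall>(u, v)\<in>D. a \<le> u \<and> u \<le> v \<and> v \<le> b) \<and>
        disjoint_family_on (\<lambda>(u, v). {u<..<v}) D \<and> (\<Sum>(u, v)\<in>D. v - u) < \<delta> \<longrightarrow> (\<Sum>(u, v)\<in>D. dist (f u) (f v)) < e"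
    by (rule abs_continuous_onE[OF ac e])
  note \<delta> = \<delta>0(1) \<delta>0(2)[THEN spec, THEN mp, OF conjI[OF _ conjI[OF _ conjI]]]
  have *: "dist (f u) (f v) < e" if "a \<le> u" "u \<le> v" "v \<le> b" "v - u < \<delta>" for u v
    using \<delta>(2)[of "{(u, v)}"] that by (simp add: disjoint_family_on_def)
  show "\<exists>d>0. \<forall>x'\<in>{a..b}. dist x' x < d \<longrightarrow> dist (f x') (f x) < e"
  proof (intro exI[of _ \<delta>] conjI ballI impI)
    fix y assume "y \<in> {a..b}" "dist y x < \<delta>"
    thus "dist (f y) (f x) < e"
      using *[of x y] *[of y x] x by (cases "x \<le> y") (auto simp: dist_real_def dist_commute)
  qed (rule \<delta>)
qed

section \<open>The inverse of the dual reflection matrix\<close>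

context jackson_network begin

definition DD :: "real ^ 'k ^ 'k" where "DD = mat 1 - transpose Pd"
definition R :: "real ^ 'k ^ 'k" where "R = matrix_inv DD"
definition cc :: "real ^ 'k" where "cc = R *v 1"

lemma DD_nth: "(DD *v x) $ k = x $ k - (\<Sum>l\<in>UNIV. Pd $ l $ k * x $ l)"
  by (simp add: DD_def matrix_vector_mult_diff_rdistrib) (simp add: vector_matrix_mult_def mult.commute)

text \<open>Every node of the dual network loses a share \<open>lam $ l / nu $ l > 0\<close> of its
  customers to the outside, so summing \<open>y \<le> transpose Pd *v y\<close> over the nodes
  leaves no room for a positive y. Both invertibility of \<open>DD\<close> and nonnegativity of its
  inverse come from this.\<close>

lemma subinvariant_zero:
  assumes y0: "\<And>k. 0 \<le> y k" and y: "\<And>k. y k \<le> (\<Sum>l\<in>UNIV. Pd $ l $ k * y l)"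
  shows "y k = 0"
proof -
  have "(\<Sum>k\<in>UNIV. y k) \<le> (\<Sum>k\<in>UNIV. \<Sum>l\<in>UNIV. Pd $ l $ k * y l)" by (rule sum_mono) (rule y)
  also have "\<dots> = (\<Sum>l\<in>UNIV. (\<Sum>k\<in>UNIV. Pd $ l $ k) * y l)"
    by (subst sum.swap) (simp add: sum_distrib_right)
  also have "\<dots> = (\<Sum>l\<in>UNIV. y l) - (\<Sum>l\<in>UNIV. lam $ l / nu $ l * y l)"
    by (simp add: Pd_row left_diff_distrib sum_subtractf)
  finally have "(\<Sum>l\<in>UNIV. lam $ l / nu $ l * y l) \<le> 0" by simp
  moreover have nn: "0 \<le> lam $ l / nu $ l * y l" for l
    using y0 lam_pos[of l] nu_pos[of l] by simp
  ultimately have "(\<Sum>l\<in>UNIV. lam $ l / nu $ l * y l) = 0" by (simp add: antisym sum_nonneg)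
  hence "lam $ k / nu $ k * y k = 0" using nn by (simp add: sum_nonneg_eq_0_iff)
  thus ?thesis using lam_pos[of k] nu_pos[of k] by simp
qed

lemma DD_invertible: "invertible DD"
proof -
  have "x = 0" if x: "DD *v x = 0" for x
  proof -
    have "\<bar>x $ k\<bar> \<le> (\<Sum>l\<in>UNIV. Pd $ l $ k * \<bar>x $ l\<bar>)" for k
    proof -
      have "x $ k = (\<Sum>l\<in>UNIV. Pd $ l $ k * x $ l)" using DD_nth[of x k] x by simp
      hence "\<bar>x $ k\<bar> \<le> (\<Sum>l\<in>UNIV. \<bar>Pd $ l $ k * x $ l\<bar>)" by (metis sum_abs)
      thus ?thesis by (simp add: abs_mult Pd_nonneg)
    qed
    from subinvariant_zero[OF _ this] show ?thesis by (simp add: vec_eq_iff)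
  qed
  thus ?thesis by (metis invertible_left_inverse matrix_left_invertible_ker)
qed

lemma R_DD: "R *v (DD *v x) = x" and DD_R: "DD *v (R *v x) = x"
  using matrix_inv_inverse[OF DD_invertible] by (simp_all add: R_def matrix_vector_mul_assoc)

lemma R_mult_nonneg:
  assumes "\<And>k. 0 \<le> b $ k"
  shows "b $ k \<le> (R *v b) $ k"
proof -
  define x where "x = R *v b"
  have x: "x $ k = b $ k + (\<Sum>l\<in>UNIV. Pd $ l $ k * x $ l)" for k
    using DD_nth[of x k] DD_R[of b] by (simp add: x_def)
  have "max 0 (- x $ k) = 0" for k
  proof (rule subinvariant_zero)
    fix k
    have "- x $ k \<le> (\<Sum>l\<in>UNIV. Pd $ l $ k * (- x $ l))"
      using x[of k] assms[of k] by (simp add: sum_negf)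
    also have "\<dots> \<le> (\<Sum>l\<in>UNIV. Pd $ l $ k * max 0 (- x $ l))"
      by (intro sum_mono mult_left_mono) (auto simp: Pd_nonneg)
    finally show "max 0 (- x $ k) \<le> (\<Sum>l\<in>UNIV. Pd $ l $ k * max 0 (- x $ l))"
      by (auto intro!: sum_nonneg simp: Pd_nonneg)
  qed simp
  hence x0: "0 \<le> x $ k" for k by (metis max.cobounded2 neg_le_0_iff_le)
  have "0 \<le> (\<Sum>l\<in>UNIV. Pd $ l $ k * x $ l)" using x0 Pd_nonneg by (intro sum_nonneg) auto
  thus ?thesis using x[of k] by (simp add: x_def)
qed

lemma R_nonneg: "0 \<le> R $ k $ l"
proof -
  have "(R *v axis l 1) $ k = R $ k $ l"
    by (simp add: matrix_vector_mult_def axis_def if_distrib[of "\<lambda>x. _ * x"] cong: if_cong)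
  moreover have "axis l (1::real) $ k \<le> (R *v axis l 1) $ k" by (rule R_mult_nonneg) (simp add: axis_def)
  moreover have "0 \<le> axis l (1::real) $ k" by (simp add: axis_def)
  ultimately show ?thesis by simp
qed

text \<open>The surplus 1 is the origin of the fixed proportion in the deviation estimate: if
  \<open>\<bar>v $ k\<bar> \<le> M * cc $ k\<close> for all k, then the coordinate l of
  \<open>transpose Pd *v v\<close> is at most \<open>M * (cc $ l - 1)\<close> in modulus.\<close>

lemma cc_eq: "cc $ k = 1 + (\<Sum>l\<in>UNIV. Pd $ l $ k * cc $ l)"
  using DD_nth[of cc k] DD_R[of 1] by (simp add: cc_def)

lemma cc_ge_1: "1 \<le> cc $ k"
  using R_mult_nonneg[of 1 k] by (simp add: cc_def)

lemma cc_pos: "0 < cc $ l" using cc_ge_1[of l] by simp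

text \<open>The traffic equations of the dual network: its throughput is again \<open>nu\<close>. So
  in the coordinates \<open>R x\<close> external arrivals produce the drift
  \<open>nu\<close>.\<close>

lemma R_lamd: "R *v lamd = nu"
proof -
  have "DD *v nu = lamd"
  proof (rule vec_eq_iff[THEN iffD2, rule_format])
    fix k
    have "(\<Sum>l\<in>UNIV. Pd $ l $ k * nu $ l) = (\<Sum>l\<in>UNIV. nu $ k * P $ k $ l)"
    proof (rule sum.cong[OF refl])
      fix l show "Pd $ l $ k * nu $ l = nu $ k * P $ k $ l" using nu_pos[of l] by (simp add: Pd_eq)
    qed
    also have "\<dots> = nu $ k * (\<Sum>l\<in>UNIV. P $ k $ l)" by (rule sum_distrib_left[symmetric])
    finally show "(DD *v nu) $ k = lamd $ k" unfolding DD_nth lamd_eq by (simp add: right_diff_distrib)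
  qed
  thus ?thesis using R_DD by metis
qed

text \<open>The identity \<open>R ** DD = mat 1\<close> read along column k: the left side is the
  mean change of the coordinate l of \<open>R x\<close> caused by one service at node k.\<close>

lemma R_column: "(\<Sum>m\<in>UNIV. Pd $ k $ m * R $ l $ m) - R $ l $ k = - of_bool (l = k)"
proof -
  have "axis k 1 = DD *v (axis k 1) + (\<chi> m. Pd $ k $ m)"
  proof (rule vec_eq_iff[THEN iffD2, rule_format])
    fix m
    have "(\<Sum>j\<in>UNIV. Pd $ j $ m * axis k 1 $ j) = Pd $ k $ m"
      by (simp add: axis_def if_distrib[of "\<lambda>x. _ * x"] cong: if_cong)
    thus "(axis k 1 :: real ^ 'k) $ m = (DD *v (axis k 1) + (\<chi> m. Pd $ k $ m)) $ m"
      by (simp add: DD_nth)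
  qed
  hence "R *v axis k 1 = axis k 1 + R *v (\<chi> m. Pd $ k $ m)"
    by (metis R_DD matrix_vector_right_distrib)
  hence "(R *v axis k 1) $ l = (axis k 1 + R *v (\<chi> m. Pd $ k $ m)) $ l" by simp
  moreover have "(R *v axis k 1) $ l = R $ l $ k"
    by (simp add: matrix_vector_mult_def axis_def if_distrib[of "\<lambda>x. _ * x"] cong: if_cong)
  moreover have "(R *v (\<chi> m. Pd $ k $ m)) $ l = (\<Sum>m\<in>UNIV. Pd $ k $ m * R $ l $ m)"
    by (simp add: matrix_vector_mult_def mult.commute)
  ultimately show ?thesis by (auto simp: axis_def)
qed

end

section \<open>The fluid path in the coordinates \<open>R z\<close>\<close>

locale jackson_fluid = jackson_network lam mu P
  for lam mu :: "real ^ 'k" and P :: "real ^ 'k ^ 'k" +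
  fixes r :: "real ^ 'k" and z \<phi> :: "real \<Rightarrow> real ^ 'k"
  assumes z_eq: "\<And>t. 0 \<le> t \<Longrightarrow> z t = r + t *\<^sub>R (lamd - DD *v mu) + DD *v \<phi> t"
    and z_nonneg: "\<And>t k. 0 \<le> t \<Longrightarrow> 0 \<le> z t $ k"
    and phi_0: "\<phi> 0 = 0"
    and phi_ac: "\<And>b. 0 \<le> b \<Longrightarrow> abs_continuous_on 0 b \<phi>"
    and phi_mono: "\<And>k. mono_on {0..} (\<lambda>t. \<phi> t $ k)"
    and phi_ae: "AE t in lborel. 0 < t \<longrightarrow>
           (\<exists>D. (\<phi> has_vector_derivative D) (at t) \<and> (\<forall>k. z t $ k * D $ k = 0))"
begin

definition w where "w t = R *v z t"

lemma z_w: "z t = DD *v w t" by (simp add: w_def DD_R)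

lemma z_0: "z 0 = r" using z_eq[OF order_refl] by (simp only: phi_0) simp

text \<open>The oblique reflection becomes diagonal: each coordinate has constant speed
  \<open>nu $ l - mu $ l\<close> and is pushed only by its own component of \<phi>.\<close>

lemma w_eq: assumes "0 \<le> t" shows "w t = R *v r + t *\<^sub>R (nu - mu) + \<phi> t"
  unfolding w_def z_eq[OF assms]
  by (simp add: matrix_vector_right_distrib matrix_vector_mult_diff_distrib R_DD R_lamd matrix_vector_mult_scaleR)

lemma w_nth: "0 \<le> t \<Longrightarrow> w t $ l = (R *v r) $ l + t * (nu $ l - mu $ l) + \<phi> t $ l"
  by (simp add: w_eq)

lemma w_nonneg: "0 \<le> t \<Longrightarrow> 0 \<le> w t $ k"
  using R_mult_nonneg[of "z t" k] z_nonneg[of t] unfolding w_def by (meson order_trans)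

lemma phi_cont: "continuous_on {0..} \<phi>"
proof -
  have "continuous (at x within {0..}) \<phi>" if "0 \<le> x" for x
  proof -
    have "continuous (at x within {0..x + 1}) \<phi>"
      using abs_continuous_imp_continuous[OF phi_ac[of "x + 1"]] that by (auto simp: continuous_on_eq_continuous_within)
    moreover have "at x within {0..x + 1} = at x within {0..}"
      by (rule at_within_nhd[of _ "{..<x + 1}"]) auto
    ultimately show ?thesis by simp
  qed
  thus ?thesis by (simp add: continuous_on_eq_continuous_within)
qed

lemma w_cont: "continuous_on {0..} w"
proof -
  have "continuous_on {0..} (\<lambda>t. R *v r + t *\<^sub>R (nu - mu) + \<phi> t)"
    by (intro continuous_intros phi_cont)
  thus ?thesis by (rule continuous_on_eq) (simp add: w_eq)
qed

lemma z_cont: "continuous_on {0..} z"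
proof -
  have "continuous_on {0..} (\<lambda>t. DD *v w t)"
    by (rule linear_continuous_on_compose[OF w_cont]) (rule matrix_vector_mul_linear)
  thus ?thesis by (simp add: z_w[symmetric])
qed

lemma phi_increasing: "0 \<le> s \<Longrightarrow> s \<le> t \<Longrightarrow> \<phi> s $ k \<le> \<phi> t $ k"
  using phi_mono[of k] by (auto simp: mono_on_def)

text \<open>Complementarity is given for almost every time only, so a vanishing derivative alone
  would not yield constancy; absolute continuity closes this gap.\<close>

lemma phi_const:
  assumes "0 \<le> a" "a \<le> b" and pos: "\<And>t. a \<le> t \<Longrightarrow> t \<le> b \<Longrightarrow> 0 < z t $ l"
  shows "\<phi> b $ l = \<phi> a $ l"
proof (rule abs_continuous_zero_derivative[OF assms(2)])
  show "abs_continuous_on a b \<phi>" using abs_continuous_on_subset[OF phi_ac[of b]] assms by auto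
  show "mono_on {a..b} (\<lambda>t. \<phi> t $ l)" using phi_increasing assms by (auto simp: mono_on_def)
  show "continuous_on {a..b} (\<lambda>t. \<phi> t $ l)"
    using continuous_on_subset[OF phi_cont, of "{a..b}"] assms by (auto intro!: bounded_linear.continuous_on[OF bounded_linear_vec_nth])
  show "AE t in lborel. a < t \<and> t < b \<longrightarrow> ((\<lambda>t. \<phi> t $ l) has_real_derivative 0) (at t)"
    using phi_ae
  proof eventually_elim
    case (elim t)
    show ?case
    proof
      assume t: "a < t \<and> t < b"
      then obtain D where D: "(\<phi> has_vector_derivative D) (at t)" "z t $ l * D $ l = 0" using elim assms by force
      have "((\<lambda>t. \<phi> t $ l) has_vector_derivative D $ l) (at t)"
        using bounded_linear.has_vector_derivative[OF bounded_linear_vec_nth D(1)] .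
      moreover have "D $ l = 0" using D(2) pos[of t] t by simp
      ultimately show "((\<lambda>t. \<phi> t $ l) has_real_derivative 0) (at t)"
        by (simp add: has_real_derivative_iff_has_vector_derivative)
    qed
  qed
qed

definition wmax where "wmax t = Max (range (\<lambda>l. w t $ l / cc $ l))"

lemma w_le_wmax: "w t $ l / cc $ l \<le> wmax t" unfolding wmax_def by (rule Max_ge) auto



text \<open>Hence \<open>\<phi>\<close> does not increase in a coordinate that attains \<open>wmax\<close>, and \<open>wmax\<close> decreases at a rate
  bounded away from zero until \<open>z\<close> vanishes.\<close>

lemma z_pos_at_max:
  assumes "w t $ l / cc $ l = wmax t"
  shows "wmax t \<le> z t $ l"
proof -
  have "w t $ k \<le> wmax t * cc $ k" for k using w_le_wmax[of t k] cc_pos[of k] by (simp add: field_simps)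
  hence "(\<Sum>k\<in>UNIV. Pd $ k $ l * w t $ k) \<le> (\<Sum>k\<in>UNIV. Pd $ k $ l * (wmax t * cc $ k))"
    by (intro sum_mono mult_left_mono Pd_nonneg)
  also have "\<dots> = wmax t * (\<Sum>k\<in>UNIV. Pd $ k $ l * cc $ k)" by (simp add: sum_distrib_left mult.left_commute)
  also have "\<dots> = wmax t * (cc $ l - 1)" using cc_eq[of l] by simp
  finally show ?thesis
    using assms cc_pos[of l] DD_nth[of "w t" l] z_w[of t] by (simp add: field_simps)
qed

lemma reaches_zero: "\<exists>t\<ge>0. z t = 0"
proof (rule ccontr)
  assume no: "\<not> (\<exists>t\<ge>0. z t = 0)"
  have wpos: "0 < wmax t" if "0 \<le> t" for t
  proof -
    have "w t \<noteq> 0" using no that z_w[of t] by auto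
    then obtain l where "w t $ l \<noteq> 0" by (auto simp: vec_eq_iff)
    hence "0 < w t $ l / cc $ l" using w_nonneg[OF that, of l] cc_pos[of l] by simp
    thus ?thesis using w_le_wmax[of t l] by linarith
  qed
  define \<kappa> where "\<kappa> = Min (range (\<lambda>l. (mu $ l - nu $ l) / cc $ l))"
  have \<kappa>: "0 < \<kappa>" unfolding \<kappa>_def using nu_less_mu cc_pos by (subst Min_gr_iff) auto
  have \<kappa>_le: "\<kappa> \<le> (mu $ l - nu $ l) / cc $ l" for l unfolding \<kappa>_def by (rule Min_le) auto
  \<comment> \<open>Decreasing at rate \<kappa>, \<open>wmax\<close> would be used up at time B,
    although it stays positive as long as z does not vanish.\<close>
  define B where "B = wmax 0 / \<kappa>"
  have B: "0 \<le> B" using wpos[of 0] \<kappa> by (simp add: B_def)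
  define f where "f t = wmax t + \<kappa> * t" for t
  have wl_cont: "\<exists>\<delta>>0. \<forall>s\<ge>0. \<bar>s - t\<bar> < \<delta> \<longrightarrow> \<bar>w s $ l / cc $ l - w t $ l / cc $ l\<bar> < e"
    "\<exists>\<delta>>0. \<forall>s\<ge>0. \<bar>s - t\<bar> < \<delta> \<longrightarrow> \<bar>z s $ l - z t $ l\<bar> < e" if "0 \<le> t" "e > 0" for t l e
  proof -
    have "continuous_on {0..} (\<lambda>t. w t $ l / cc $ l)" using cc_pos[of l]
      by (intro continuous_intros bounded_linear.continuous_on[OF bounded_linear_vec_nth] w_cont) auto
    thus "\<exists>\<delta>>0. \<forall>s\<ge>0. \<bar>s - t\<bar> < \<delta> \<longrightarrow> \<bar>w s $ l / cc $ l - w t $ l / cc $ l\<bar> < e"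
      unfolding continuous_on_iff dist_real_def using that by (simp add: Ball_def)
    have "continuous_on {0..} (\<lambda>t. z t $ l)" by (intro bounded_linear.continuous_on[OF bounded_linear_vec_nth] z_cont)
    thus "\<exists>\<delta>>0. \<forall>s\<ge>0. \<bar>s - t\<bar> < \<delta> \<longrightarrow> \<bar>z s $ l - z t $ l\<bar> < e"
      unfolding continuous_on_iff dist_real_def using that by (simp add: Ball_def)
  qed
  have "f B \<le> f 0"
  proof (rule right_dini_nonincreasing[OF B])
    fix t \<epsilon> :: real assume t: "0 \<le> t" "t < B" "\<epsilon> > 0"
    have "\<forall>\<^sub>F d in at_right 0. \<forall>l\<in>UNIV. w (t + d) $ l / cc $ l \<le> wmax t - \<kappa> * d"
    proof (rule eventually_ball_finite[OF finite ballI])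
      fix l
      show "\<forall>\<^sub>F d in at_right 0. w (t + d) $ l / cc $ l \<le> wmax t - \<kappa> * d"
      proof (cases "w t $ l / cc $ l = wmax t")
        case True
        have zl: "0 < z t $ l" using z_pos_at_max[OF True] wpos[OF t(1)] by simp
        obtain \<delta> where \<delta>: "\<delta> > 0" "\<And>s. 0 \<le> s \<Longrightarrow> \<bar>s - t\<bar> < \<delta> \<Longrightarrow> \<bar>z s $ l - z t $ l\<bar> < z t $ l"
          using wl_cont(2)[OF t(1) zl, of l] by blast
        have "\<forall>\<^sub>F d in at_right (0::real). d \<in> {0<..<\<delta>}" by (rule eventually_at_right_real[OF \<delta>(1)])
        thus ?thesis
        proof eventually_elim
          case (elim d)
          have "0 < z s $ l" if "t \<le> s" "s \<le> t + d" for s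
          proof -
            have "\<bar>z s $ l - z t $ l\<bar> < z t $ l" using that elim t by (intro \<delta>(2)) auto
            thus ?thesis by linarith
          qed
          hence "\<phi> (t + d) $ l = \<phi> t $ l" using elim t by (intro phi_const) auto
          hence "w (t + d) $ l = w t $ l - (mu $ l - nu $ l) * d"
            using w_nth[of t l] w_nth[of "t + d" l] t elim by (simp add: algebra_simps)
          hence "w (t + d) $ l / cc $ l = wmax t - (mu $ l - nu $ l) / cc $ l * d"
            using True by (simp add: diff_divide_distrib left_diff_distrib)
          moreover have "\<kappa> * d \<le> (mu $ l - nu $ l) / cc $ l * d" using \<kappa>_le elim by (intro mult_right_mono) auto
          ultimately show ?case by linarith
        qed
      next
        case False
        \<comment> \<open>A coordinate strictly below the maximum may be pushed up by \<phi>, but by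
          continuity it needs time to catch up, and for small d it stays below the decreasing bound.
          Only maximal coordinates need the argument with \<phi> constant.\<close>
        define e where "e = (wmax t - w t $ l / cc $ l) / 2"
        have e: "e > 0" using False w_le_wmax[of t l] by (simp add: e_def)
        obtain \<delta> where \<delta>: "\<delta> > 0" "\<And>s. 0 \<le> s \<Longrightarrow> \<bar>s - t\<bar> < \<delta> \<Longrightarrow> \<bar>w s $ l / cc $ l - w t $ l / cc $ l\<bar> < e"
          using wl_cont(1)[OF t(1) e, of l] by blast
        have "\<forall>\<^sub>F d in at_right (0::real). d \<in> {0<..<min \<delta> (e / \<kappa>)}"
          by (rule eventually_at_right_real) (use \<delta> e \<kappa> in auto)
        thus ?thesis
        proof eventually_elim
          case (elim d)
          have "\<bar>w (t + d) $ l / cc $ l - w t $ l / cc $ l\<bar> < e" using elim t by (intro \<delta>(2)) auto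
          moreover have "\<kappa> * d \<le> e" using elim \<kappa> by (auto simp: field_simps)
          moreover have "wmax t = w t $ l / cc $ l + e + e" by (simp add: e_def field_simps)
          ultimately show ?case by linarith
        qed
      qed
    qed
    thus "\<forall>\<^sub>F d in at_right 0. f (t + d) \<le> f t + \<epsilon> * d" using eventually_at_right_less[of "0::real"]
    proof eventually_elim
      case (elim d)
      have "wmax (t + d) \<le> wmax t - \<kappa> * d"
        unfolding wmax_def[of "t + d"] using elim by (subst Max_le_iff) auto
      moreover have "0 \<le> \<epsilon> * d" using elim t by simp
      ultimately show ?case by (simp add: f_def algebra_simps)
    qed
  next
    fix t \<epsilon> :: real assume t: "0 < t" "t \<le> B" "\<epsilon> > 0"
    have "\<forall>\<^sub>F d in at_right 0. \<forall>l\<in>UNIV. w t $ l / cc $ l \<le> wmax (t - d) + \<epsilon> / 2"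
    proof (rule eventually_ball_finite[OF finite ballI])
      fix l
      obtain \<delta> where \<delta>: "\<delta> > 0" "\<And>s. 0 \<le> s \<Longrightarrow> \<bar>s - t\<bar> < \<delta> \<Longrightarrow> \<bar>w s $ l / cc $ l - w t $ l / cc $ l\<bar> < \<epsilon> / 2"
        using wl_cont(1)[of t "\<epsilon> / 2" l] t by auto
      have "\<forall>\<^sub>F d in at_right (0::real). d \<in> {0<..<min \<delta> t}"
        by (rule eventually_at_right_real) (use \<delta> t in auto)
      thus "\<forall>\<^sub>F d in at_right 0. w t $ l / cc $ l \<le> wmax (t - d) + \<epsilon> / 2"
      proof eventually_elim
        case (elim d)
        have "\<bar>w (t - d) $ l / cc $ l - w t $ l / cc $ l\<bar> < \<epsilon> / 2" using elim t by (intro \<delta>(2)) auto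
        thus ?case using w_le_wmax[of "t - d" l] by linarith
      qed
    qed
    moreover have "\<forall>\<^sub>F d in at_right (0::real). d \<in> {0<..<\<epsilon> / (2 * \<kappa>)}"
      by (rule eventually_at_right_real) (use \<kappa> t in auto)
    ultimately show "\<forall>\<^sub>F d in at_right 0. f t \<le> f (t - d) + \<epsilon>"
    proof eventually_elim
      case (elim d)
      have "wmax t \<le> wmax (t - d) + \<epsilon> / 2"
        unfolding wmax_def[of t] using elim(1) by (subst Max_le_iff) auto
      moreover have "\<kappa> * d \<le> \<epsilon> / 2" using elim(2) \<kappa> by (auto simp: field_simps)
      ultimately show ?case by (simp add: f_def algebra_simps)
    qed
  qed
  moreover have "\<kappa> * B = wmax 0" using \<kappa> by (simp add: B_def)
  ultimately have "wmax B \<le> 0" by (simp add: f_def)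
  thus False using wpos[OF B] by simp
qed

lemma first_zero:
  shows "0 \<le> first_zero_time z" "z (first_zero_time z) = 0"
    "\<And>t. 0 \<le> t \<Longrightarrow> t < first_zero_time z \<Longrightarrow> z t \<noteq> 0"
proof -
  define S where "S = {t. 0 \<le> t \<and> z t = 0}"
  have "S = {0..} \<inter> z -` {0}" by (auto simp: S_def)
  hence "closed S" using continuous_closed_preimage[OF z_cont closed_atLeast closed_singleton] by simp
  moreover have "S \<noteq> {}" using reaches_zero by (auto simp: S_def)
  moreover have bdd: "bdd_below S" by (rule bdd_belowI[of _ 0]) (auto simp: S_def)
  ultimately have "Inf S \<in> S" by (intro closed_contains_Inf)
  thus "0 \<le> first_zero_time z" "z (first_zero_time z) = 0" by (auto simp: S_def first_zero_time_def)
  fix t assume "0 \<le> t" "t < first_zero_time z"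
  thus "z t \<noteq> 0" using cInf_lower[OF _ bdd, of t] by (auto simp: S_def first_zero_time_def)
qed

end

section \<open>The exponential supermartingale\<close>

lemma exp_le_quadratic:
  fixes u :: real
  assumes "\<bar>u\<bar> \<le> 1"
  shows "exp u - 1 \<le> u + u\<^sup>2"
proof (cases "0 \<le> u")
  case True
  thus ?thesis using exp_bound[of u] assms by simp
next
  case False
  define y where "y = - u"
  have y: "0 < y" "y \<le> 1" using False assms by (auto simp: y_def)
  have "1 \<le> (1 - y + y\<^sup>2) * (1 + y)" using y by (simp add: power2_eq_square algebra_simps)
  also have "\<dots> \<le> (1 - y + y\<^sup>2) * exp y"
    using y exp_ge_add_one_self[of y] by (intro mult_left_mono) auto
  finally have "exp (- y) * 1 \<le> exp (- y) * ((1 - y + y\<^sup>2) * exp y)" by (intro mult_left_mono) auto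
  also have "\<dots> = 1 - y + y\<^sup>2" by (simp add: exp_minus)
  finally show ?thesis by (simp add: y_def)
qed

definition lin :: "real ^ 'k \<Rightarrow> nat ^ 'k \<Rightarrow> real" where
  "lin a x = (\<Sum>k\<in>UNIV. a $ k * real (x $ k))"

lemma lin_up: "lin a (x + axis k 1) = lin a x + a $ k"
proof -
  have "lin a (x + axis k 1) = (\<Sum>l\<in>UNIV. a $ l * real (x $ l) + (if l = k then a $ k else 0))"
    unfolding lin_def by (rule sum.cong) (auto simp: axis_def algebra_simps)
  thus ?thesis by (simp add: sum.distrib lin_def)
qed

lemma lin_down: "0 < x $ k \<Longrightarrow> lin a (x - axis k 1) = lin a x - a $ k"
  using lin_up[of a "x - axis k 1" k] sub_add_axis[of x k] by simp

text \<open>The Hamiltonian of the chain: the generator applied to \<open>exp (lin a x)\<close>,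
  divided by this exponential. It depends on x only through the set of nonempty nodes.\<close>

definition psi :: "real ^ 'k \<Rightarrow> real ^ 'k \<Rightarrow> real ^ 'k ^ 'k \<Rightarrow> real ^ 'k \<Rightarrow> nat ^ 'k \<Rightarrow> real" where
  "psi la m R a x = (\<Sum>k\<in>UNIV. la $ k * (exp (a $ k) - 1)) +
     (\<Sum>k | x $ k > 0. (\<Sum>l\<in>UNIV. m $ k * R $ k $ l * (exp (a $ l - a $ k) - 1)) +
        m $ k * (1 - (\<Sum>l\<in>UNIV. R $ k $ l)) * (exp (- a $ k) - 1))"

lemma jackson_gen_exp:
  "(\<Sum>y | y \<noteq> x \<and> jackson_rate la m R x y \<noteq> 0. jackson_rate la m R x y * (exp (lin a y + b) - exp (lin a x + b)))
    = psi la m R a x * exp (lin a x + b)"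
proof -
  define E where "E = exp (lin a x + b)"
  have ex: "exp (lin a x + d + b) - E = (exp d - 1) * E" for d
    by (simp add: E_def exp_add algebra_simps)
  have up: "exp (lin a (x + axis k 1) + b) - E = (exp (a $ k) - 1) * E" for k
    using ex[of "a $ k"] by (simp only: lin_up)
  have down: "exp (lin a (x - axis k 1) + b) - E = (exp (- a $ k) - 1) * E" if "x $ k > 0" for k
    using ex[of "- a $ k"] lin_down[OF that, of a] by (simp del: One_nat_def)
  have move: "exp (lin a (x - axis k 1 + axis l 1) + b) - E = (exp (a $ l - a $ k) - 1) * E" if "x $ k > 0" for k l
  proof -
    have "lin a (x - axis k 1 + axis l 1) = lin a x + (a $ l - a $ k)"
      using lin_down[OF that, of a] by (simp only: lin_up)
    thus ?thesis using ex[of "a $ l - a $ k"] by (simp only:)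
  qed
  have "(\<Sum>k | x $ k > 0. (\<Sum>l\<in>UNIV. m $ k * R $ k $ l * (exp (lin a (x - axis k 1 + axis l 1) + b) - E)) +
        m $ k * (1 - (\<Sum>l\<in>UNIV. R $ k $ l)) * (exp (lin a (x - axis k 1) + b) - E))
    = (\<Sum>k | x $ k > 0. (\<Sum>l\<in>UNIV. m $ k * R $ k $ l * ((exp (a $ l - a $ k) - 1) * E)) +
        m $ k * (1 - (\<Sum>l\<in>UNIV. R $ k $ l)) * ((exp (- a $ k) - 1) * E))"
    by (intro sum.cong refl) (simp add: down move del: One_nat_def)
  note down_move = this
  show ?thesis
    using jackson_gen[where x = x and lam = la and mu = m and P = R and g = "\<lambda>y. exp (lin a y + b)"] unfolding E_def[symmetric] down_move up psi_def
    by (simp add: distrib_right sum_distrib_right mult.assoc del: One_nat_def)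
qed

lemma psi_mono_bound:
  assumes la: "\<And>k. 0 \<le> la $ k" and m: "\<And>k. 0 \<le> m $ k" and R: "substochastic R"
    and f: "\<And>k. exp (a $ k) - 1 \<le> f1 k" "\<And>k l. exp (a $ l - a $ k) - 1 \<le> f2 k l" "\<And>k. exp (- a $ k) - 1 \<le> f3 k"
  shows "psi la m R a x \<le> (\<Sum>k\<in>UNIV. la $ k * f1 k) +
     (\<Sum>k | x $ k > 0. (\<Sum>l\<in>UNIV. m $ k * R $ k $ l * f2 k l) + m $ k * (1 - (\<Sum>l\<in>UNIV. R $ k $ l)) * f3 k)"
  unfolding psi_def using R la m
  by (intro add_mono sum_mono mult_left_mono f) (auto simp: substochastic_def)

lemma psi_crude:
  assumes la: "\<And>k. 0 \<le> la $ k" and m: "\<And>k. 0 \<le> m $ k" and R: "substochastic R"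
    and a: "\<And>k. \<bar>a $ k\<bar> \<le> s"
  shows "psi la m R a x \<le> ((\<Sum>k\<in>UNIV. la $ k) + (\<Sum>k\<in>UNIV. m $ k)) * (exp (2 * s) - 1)"
proof -
  have s: "0 \<le> s" using a abs_ge_zero order_trans by blast
  have e: "exp u - 1 \<le> exp (2 * s) - 1" if "u \<le> 2 * s" for u using that by simp
  have a': "a $ k \<le> s" "- s \<le> a $ k" for k using a[of k] by (auto simp: abs_le_iff)
  have "psi la m R a x \<le> (\<Sum>k\<in>UNIV. la $ k * (exp (2 * s) - 1)) +
     (\<Sum>k | x $ k > 0. (\<Sum>l\<in>UNIV. m $ k * R $ k $ l * (exp (2 * s) - 1)) + m $ k * (1 - (\<Sum>l\<in>UNIV. R $ k $ l)) * (exp (2 * s) - 1))"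
  proof (rule psi_mono_bound[OF la m R])
    show "exp (a $ k) - 1 \<le> exp (2 * s) - 1" for k using a'[of k] s by (intro e) linarith
    show "exp (a $ l - a $ k) - 1 \<le> exp (2 * s) - 1" for k l using a'[of k] a'[of l] by (intro e) linarith
    show "exp (- a $ k) - 1 \<le> exp (2 * s) - 1" for k using a'[of k] s by (intro e) linarith
  qed
  also have "\<dots> = ((\<Sum>k\<in>UNIV. la $ k) + (\<Sum>k | x $ k > 0. m $ k)) * (exp (2 * s) - 1)"
  proof -
    have "(\<Sum>l\<in>UNIV. m $ k * R $ k $ l * E) + m $ k * (1 - (\<Sum>l\<in>UNIV. R $ k $ l)) * E = m $ k * E" for k E
    proof -
      have "(\<Sum>l\<in>UNIV. m $ k * R $ k $ l * E) = m $ k * (\<Sum>l\<in>UNIV. R $ k $ l) * E"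
        by (simp add: sum_distrib_left sum_distrib_right)
      thus ?thesis by (simp add: algebra_simps)
    qed
    thus ?thesis by (simp add: sum_distrib_right distrib_right)
  qed
  also have "\<dots> \<le> ((\<Sum>k\<in>UNIV. la $ k) + (\<Sum>k\<in>UNIV. m $ k)) * (exp (2 * s) - 1)"
    using s m by (intro mult_right_mono add_left_mono sum_mono2) auto
  finally show ?thesis .
qed

text \<open>Every exponent that occurs is an entry of a or a difference of two entries, hence at
  most \<open>2 * s\<close>; the second order remainder is therefore \<open>(2 * s)\<^sup>2\<close>
  times the total rate.\<close>

lemma psi_quadratic:
  assumes la: "\<And>k. 0 \<le> la $ k" and m: "\<And>k. 0 \<le> m $ k" and R: "substochastic R"
    and a: "\<And>k. \<bar>a $ k\<bar> \<le> s" and s: "2 * s \<le> 1"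
  shows "psi la m R a x \<le> (\<Sum>k\<in>UNIV. la $ k * a $ k) + (\<Sum>k | x $ k > 0. m $ k * ((\<Sum>l\<in>UNIV. R $ k $ l * a $ l) - a $ k))
    + ((\<Sum>k\<in>UNIV. la $ k) + (\<Sum>k\<in>UNIV. m $ k)) * (2 * s)\<^sup>2"
proof -
  define S where "S = (2 * s)\<^sup>2"
  have s0: "0 \<le> s" using a abs_ge_zero order_trans by blast
  have e: "exp u - 1 \<le> u + S" if "\<bar>u\<bar> \<le> 2 * s" for u
  proof -
    have "exp u - 1 \<le> u + u\<^sup>2" using that s by (intro exp_le_quadratic) linarith
    also have "u\<^sup>2 \<le> S" using that s0 unfolding S_def by (metis abs_le_square_iff abs_of_nonneg mult_nonneg_nonneg zero_le_numeral)
    finally show ?thesis by simp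
  qed
  have a': "a $ k \<le> s" "- s \<le> a $ k" for k using a[of k] by (auto simp: abs_le_iff)
  have "psi la m R a x \<le> (\<Sum>k\<in>UNIV. la $ k * (a $ k + S)) +
     (\<Sum>k | x $ k > 0. (\<Sum>l\<in>UNIV. m $ k * R $ k $ l * (a $ l - a $ k + S)) + m $ k * (1 - (\<Sum>l\<in>UNIV. R $ k $ l)) * (- a $ k + S))"
  proof (rule psi_mono_bound[OF la m R])
    show "exp (a $ k) - 1 \<le> a $ k + S" for k using a'[of k] s0 by (intro e) (simp add: abs_le_iff)
    show "exp (a $ l - a $ k) - 1 \<le> a $ l - a $ k + S" for k l
      using a'[of k] a'[of l] by (intro e) (simp add: abs_le_iff)
    show "exp (- a $ k) - 1 \<le> - a $ k + S" for k using a'[of k] s0 by (intro e) (simp add: abs_le_iff)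
  qed
  also have "(\<Sum>k\<in>UNIV. la $ k * (a $ k + S)) = (\<Sum>k\<in>UNIV. la $ k * a $ k) + (\<Sum>k\<in>UNIV. la $ k) * S"
    by (simp add: distrib_left sum.distrib sum_distrib_right)
  also have "(\<Sum>k | x $ k > 0. (\<Sum>l\<in>UNIV. m $ k * R $ k $ l * (a $ l - a $ k + S)) + m $ k * (1 - (\<Sum>l\<in>UNIV. R $ k $ l)) * (- a $ k + S))
     = (\<Sum>k | x $ k > 0. m $ k * ((\<Sum>l\<in>UNIV. R $ k $ l * a $ l) - a $ k) + m $ k * S)"
  proof (rule sum.cong[OF refl])
    fix k
    have "(\<Sum>l\<in>UNIV. m $ k * R $ k $ l * (a $ l - a $ k + S))
      = m $ k * (\<Sum>l\<in>UNIV. R $ k $ l * a $ l) + m $ k * (\<Sum>l\<in>UNIV. R $ k $ l) * (- a $ k + S)"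
      by (simp add: sum_distrib_left sum_distrib_right sum.distrib[symmetric] algebra_simps sum_subtractf[symmetric])
    thus "(\<Sum>l\<in>UNIV. m $ k * R $ k $ l * (a $ l - a $ k + S)) + m $ k * (1 - (\<Sum>l\<in>UNIV. R $ k $ l)) * (- a $ k + S)
      = m $ k * ((\<Sum>l\<in>UNIV. R $ k $ l * a $ l) - a $ k) + m $ k * S"
      by (simp add: algebra_simps)
  qed
  also have "\<dots> = (\<Sum>k | x $ k > 0. m $ k * ((\<Sum>l\<in>UNIV. R $ k $ l * a $ l) - a $ k)) + (\<Sum>k | x $ k > 0. m $ k) * S"
    by (simp add: sum.distrib sum_distrib_right)
  also have "(\<Sum>k | x $ k > 0. m $ k) * S \<le> (\<Sum>k\<in>UNIV. m $ k) * S"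
    using m by (intro mult_right_mono sum_mono2) (auto simp: S_def)
  finally show ?thesis by (simp add: S_def algebra_simps)
qed

context jackson_network begin

text \<open>The exponent for which \<open>lin (tilt b l) x = b * (R x)\<^sub>l / c\<^sub>l\<close>: a service at \<open>k \<noteq> l\<close>
  leaves it unchanged on average.\<close>

definition tilt :: "real \<Rightarrow> 'k \<Rightarrow> real ^ 'k" where
  "tilt b l = (\<chi> k. b * R $ l $ k / cc $ l)"

lemma cc_row: "cc $ l = (\<Sum>k\<in>UNIV. R $ l $ k)" by (simp add: cc_def matrix_vector_mult_def)

lemma R_le_cc: "R $ l $ k \<le> cc $ l"
  unfolding cc_row by (rule member_le_sum) (use R_nonneg in auto)

lemma tilt_bound: "\<bar>tilt b l $ k\<bar> \<le> \<bar>b\<bar>"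
proof -
  have "\<bar>b\<bar> * (R $ l $ k / cc $ l) \<le> \<bar>b\<bar> * 1"
    using R_le_cc cc_pos[of l] by (intro mult_left_mono) auto
  thus ?thesis using R_nonneg[of l k] cc_pos[of l] by (simp add: tilt_def abs_mult)
qed

text \<open>By \<open>R_column\<close> the first order part sees node l alone: arrivals contribute
  \<open>nu $ l\<close>, and service \<open>- mu $ l\<close> only while the node is busy. This is
  the drift of the coordinate l of the fluid path except for what happens at the boundary.\<close>

lemma psi_tilt:
  assumes "2 * \<bar>b\<bar> \<le> 1"
  shows "psi lamd mu Pd (tilt b l) x \<le> b / cc $ l * (nu $ l - mu $ l * of_bool (0 < x $ l)) + 4 * Lam * b\<^sup>2"
proof -
  have "psi lamd mu Pd (tilt b l) x \<le> (\<Sum>k\<in>UNIV. lamd $ k * tilt b l $ k)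
     + (\<Sum>k | x $ k > 0. mu $ k * ((\<Sum>m\<in>UNIV. Pd $ k $ m * tilt b l $ m) - tilt b l $ k))
     + ((\<Sum>k\<in>UNIV. lamd $ k) + (\<Sum>k\<in>UNIV. mu $ k)) * (2 * \<bar>b\<bar>)\<^sup>2"
    using assms lamd_nonneg mu_pos Pd_substochastic tilt_bound by (intro psi_quadratic) (auto simp: less_imp_le)
  also have "(\<Sum>k\<in>UNIV. lamd $ k * tilt b l $ k) = b / cc $ l * (R *v lamd) $ l"
    by (simp add: tilt_def matrix_vector_mult_def sum_distrib_left mult_ac)
  also have "\<dots> = b / cc $ l * nu $ l" by (simp add: R_lamd)
  also have "(\<Sum>k | x $ k > 0. mu $ k * ((\<Sum>m\<in>UNIV. Pd $ k $ m * tilt b l $ m) - tilt b l $ k))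
     = (\<Sum>k | x $ k > 0. if k = l then - (b / cc $ l * mu $ l) else 0)"
  proof (rule sum.cong[OF refl])
    fix k
    have "(\<Sum>m\<in>UNIV. Pd $ k $ m * tilt b l $ m) - tilt b l $ k = b / cc $ l * ((\<Sum>m\<in>UNIV. Pd $ k $ m * R $ l $ m) - R $ l $ k)"
      by (simp add: tilt_def sum_distrib_left right_diff_distrib mult_ac)
    thus "mu $ k * ((\<Sum>m\<in>UNIV. Pd $ k $ m * tilt b l $ m) - tilt b l $ k) = (if k = l then - (b / cc $ l * mu $ l) else 0)"
      by (simp add: R_column)
  qed
  also have "\<dots> = - (b / cc $ l * (mu $ l * of_bool (0 < x $ l)))" by simp
  also have "((\<Sum>k\<in>UNIV. lamd $ k) + (\<Sum>k\<in>UNIV. mu $ k)) * (2 * \<bar>b\<bar>)\<^sup>2 = 4 * Lam * b\<^sup>2"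
    by (simp add: sum_lamd Lam_def power_mult_distrib)
  finally show ?thesis by (simp add: right_diff_distrib)
qed

lemma lin_tilt: "lin (tilt b l) x = b * (R *v (\<chi> k. real (x $ k))) $ l / cc $ l"
  by (simp add: lin_def tilt_def matrix_vector_mult_def sum_distrib_left sum_divide_distrib mult_ac)

end

lemma has_derivative_at_right_shift:
  fixes f :: "real \<Rightarrow> real"
  assumes "(f has_real_derivative D) (at t within {t..t + 1})"
  shows "((\<lambda>d. f (t + d)) has_real_derivative D) (at_right 0)"
proof -
  have "((\<lambda>y. (f y - f t) / (y - t)) \<longlongrightarrow> D) (at_right t)"
    using assms by (simp add: has_field_derivative_iff at_within_Icc_at_right)
  hence "((\<lambda>d. (f (d + t) - f t) / d) \<longlongrightarrow> D) (at_right 0)"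
    by (simp add: filterlim_at_right_to_0[of _ _ t])
  thus ?thesis by (simp add: has_field_derivative_iff add.commute)
qed

section \<open>The averaged fluid path\<close>

context jackson_fluid begin

definition Wi :: "'k \<Rightarrow> real \<Rightarrow> real" where "Wi l t = integral {0..t} (\<lambda>s. w s $ l)"

text \<open>\<open>w\<close> is differentiable only almost everywhere; its averages over intervals of length \<open>\<eta>\<close> are \<open>C\<^sup>1\<close>.\<close>

definition what :: "real \<Rightarrow> real \<Rightarrow> real ^ 'k" where
  "what \<eta> s = (\<chi> l. (Wi l (s + \<eta>) - Wi l s) / \<eta>)"

lemma Wi_deriv:
  assumes "0 \<le> t" "t \<le> b"
  shows "(Wi l has_real_derivative w t $ l) (at t within {0..b})"
proof -
  have "continuous_on {0..b} (\<lambda>s. w s $ l)"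
    by (intro bounded_linear.continuous_on[OF bounded_linear_vec_nth] continuous_on_subset[OF w_cont]) auto
  thus ?thesis unfolding Wi_def[abs_def] using assms by (intro integral_has_real_derivative) auto
qed

lemma Wi_deriv_right:
  assumes "0 \<le> t"
  shows "((\<lambda>d. Wi l (t + d)) has_real_derivative w t $ l) (at_right 0)"
  by (rule has_derivative_at_right_shift, rule DERIV_subset[OF Wi_deriv[of t "t + 1"]]) (use assms in auto)

lemma what_deriv_right:
  assumes "0 \<le> s" "0 < \<eta>" "0 < n"
  shows "((\<lambda>d. n * what \<eta> (s + d / n) $ l) has_real_derivative (w (s + \<eta>) $ l - w s $ l) / \<eta>) (at_right 0)"
proof -
  have scale: "((\<lambda>d. Wi l (t + d / n)) has_real_derivative w t $ l / n) (at_right 0)" if "0 \<le> t" for t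
  proof -
    have "((\<lambda>d. (Wi l (t + d) - Wi l t) / d) \<longlongrightarrow> w t $ l) (at_right 0)"
      using Wi_deriv_right[OF that, of l] by (simp add: has_field_derivative_iff)
    moreover have "filterlim (\<lambda>d. d / n) (at_right 0) (at_right 0)"
      using assms(3) unfolding filterlim_at
      by (auto intro!: tendsto_eq_intros eventually_mono[OF eventually_at_right_less[of 0]])
    ultimately have "((\<lambda>d. (Wi l (t + d / n) - Wi l t) / (d / n)) \<longlongrightarrow> w t $ l) (at_right 0)"
      by (rule filterlim_compose)
    hence "((\<lambda>d. (Wi l (t + d / n) - Wi l t) / (d / n) / n) \<longlongrightarrow> w t $ l / n) (at_right 0)"
      using assms(3) by (intro tendsto_intros) auto
    thus ?thesis using assms(3) by (simp add: has_field_derivative_iff)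
  qed
  have "((\<lambda>d. n * ((Wi l (s + \<eta> + d / n) - Wi l (s + d / n)) / \<eta>)) has_real_derivative
      n * ((w (s + \<eta>) $ l / n - w s $ l / n) / \<eta>)) (at_right 0)"
    using assms by (intro DERIV_cmult DERIV_cdivide DERIV_diff scale) auto
  moreover have "n * ((w (s + \<eta>) $ l / n - w s $ l / n) / \<eta>) = (w (s + \<eta>) $ l - w s $ l) / \<eta>"
    using assms by (simp add: field_simps)
  moreover have "(\<lambda>d. n * what \<eta> (s + d / n) $ l) = (\<lambda>d. n * ((Wi l (s + \<eta> + d / n) - Wi l (s + d / n)) / \<eta>))"
    by (simp add: what_def add_ac)
  ultimately show ?thesis by (simp only:)
qed

text \<open>\<open>DD\<close> commutes with averaging, so \<open>DD *v what \<eta> s\<close> is the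
  average of z over \<open>{s..s + \<eta>}\<close>. In this way sign and smallness of z pass to the
  smoothed path.\<close>

lemma z_what_integral:
  assumes "0 \<le> s" "0 < \<eta>"
  shows "((\<lambda>t. z t $ l) has_integral \<eta> * (DD *v what \<eta> s) $ l) {s..s + \<eta>}"
proof -
  define G where "G t = Wi l t - (\<Sum>k\<in>UNIV. Pd $ k $ l * Wi k t)" for t
  have "(G has_real_derivative z t $ l) (at t within {s..s + \<eta>})" if "s \<le> t" "t \<le> s + \<eta>" for t
  proof -
    have d: "(Wi k has_real_derivative w t $ k) (at t within {s..s + \<eta>})" for k
      by (rule DERIV_subset[OF Wi_deriv[of t "s + \<eta>"]]) (use assms that in auto)
    have "(G has_real_derivative w t $ l - (\<Sum>k\<in>UNIV. Pd $ k $ l * w t $ k)) (at t within {s..s + \<eta>})"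
      unfolding G_def[abs_def] by (intro DERIV_diff DERIV_sum DERIV_cmult d)
    thus ?thesis using DD_nth[of "w t" l] z_w[of t] by simp
  qed
  hence "((\<lambda>t. z t $ l) has_integral G (s + \<eta>) - G s) {s..s + \<eta>}"
    using assms by (intro fundamental_theorem_of_calculus)
      (auto simp: has_real_derivative_iff_has_vector_derivative)
  moreover have "G (s + \<eta>) - G s = \<eta> * (DD *v what \<eta> s) $ l"
  proof -
    have e: "\<eta> * what \<eta> s $ k = Wi k (s + \<eta>) - Wi k s" for k using assms by (simp add: what_def)
    have "\<eta> * (DD *v what \<eta> s) $ l = \<eta> * what \<eta> s $ l - (\<Sum>k\<in>UNIV. Pd $ k $ l * (\<eta> * what \<eta> s $ k))"
      by (simp add: DD_nth right_diff_distrib sum_distrib_left mult_ac)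
    thus ?thesis unfolding e by (simp add: G_def right_diff_distrib sum_subtractf)
  qed
  ultimately show ?thesis by simp
qed

lemma z_what_bounds:
  assumes "0 \<le> s" "0 < \<eta>" "\<And>t. s \<le> t \<Longrightarrow> t \<le> s + \<eta> \<Longrightarrow> a \<le> z t $ l \<and> z t $ l \<le> b"
  shows "a \<le> (DD *v what \<eta> s) $ l" "(DD *v what \<eta> s) $ l \<le> b"
proof -
  have c: "((\<lambda>_. u) has_integral \<eta> * u) {s..s + \<eta>}" for u :: real
    using has_integral_const_real[of u s "s + \<eta>"] assms by simp
  have "\<eta> * a \<le> \<eta> * (DD *v what \<eta> s) $ l"
    by (rule has_integral_le[OF c z_what_integral]) (use assms in auto)
  thus "a \<le> (DD *v what \<eta> s) $ l" using assms by simp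
  have "\<eta> * (DD *v what \<eta> s) $ l \<le> \<eta> * b"
    by (rule has_integral_le[OF z_what_integral c]) (use assms in auto)
  thus "(DD *v what \<eta> s) $ l \<le> b" using assms by simp
qed

lemma what_lipschitz:
  assumes "0 < \<eta>" "0 \<le> H"
  obtains L where "0 \<le> L" "\<And>s t l. 0 \<le> s \<Longrightarrow> s \<le> t \<Longrightarrow> t \<le> H \<Longrightarrow> \<bar>what \<eta> t $ l - what \<eta> s $ l\<bar> \<le> L * (t - s)"
proof -
  have "compact (w ` {0..H + \<eta>})"
    by (intro compact_continuous_image continuous_on_subset[OF w_cont]) auto
  hence "bounded (w ` {0..H + \<eta>})" by (rule compact_imp_bounded)
  then obtain B where B': "\<forall>v\<in>w ` {0..H + \<eta>}. norm v \<le> B" unfolding bounded_iff by blast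
  have B: "norm (w t) \<le> B" if "0 \<le> t" "t \<le> H + \<eta>" for t using B' that by simp
  have B0: "0 \<le> B" using order_trans[OF norm_ge_zero B[of 0]] assms by simp
  have lip: "\<bar>Wi l t - Wi l s\<bar> \<le> B * (t - s)" if "0 \<le> s" "s \<le> t" "t \<le> H + \<eta>" for s t l
  proof -
    have "norm (Wi l t - Wi l s) \<le> B * norm (t - s)"
    proof (rule field_differentiable_bound[of "{0..H + \<eta>}" "Wi l" "\<lambda>t. w t $ l"])
      fix x assume x: "x \<in> {0..H + \<eta>}"
      show "(Wi l has_field_derivative w x $ l) (at x within {0..H + \<eta>})" using x by (intro Wi_deriv) auto
      show "norm (w x $ l) \<le> B" using B[of x] x component_le_norm_cart[of "w x" l] by simp
    qed (use that assms in auto)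
    thus ?thesis using that by simp
  qed
  show ?thesis
  proof
    show "0 \<le> 2 * B / \<eta>" using B0 assms by simp
    fix s t l assume st: "0 \<le> s" "s \<le> t" "t \<le> H"
    have "what \<eta> t $ l - what \<eta> s $ l = ((Wi l (t + \<eta>) - Wi l (s + \<eta>)) - (Wi l t - Wi l s)) / \<eta>"
      by (simp add: what_def diff_divide_distrib add_divide_distrib add_ac)
    hence "\<bar>what \<eta> t $ l - what \<eta> s $ l\<bar> = \<bar>(Wi l (t + \<eta>) - Wi l (s + \<eta>)) - (Wi l t - Wi l s)\<bar> / \<eta>"
      using assms by simp
    also have "\<dots> \<le> (B * (t - s) + B * (t - s)) / \<eta>"
      using lip[of "s + \<eta>" "t + \<eta>" l] lip[of s t l] st assms by (intro divide_right_mono) auto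
    finally show "\<bar>what \<eta> t $ l - what \<eta> s $ l\<bar> \<le> 2 * B / \<eta> * (t - s)" by simp
  qed
qed

text \<open>The left side is a boundary term with a large factor G but with an exponent reduced by
  the proportion \<kappa>. With \<open>q = ln (G / \<beta>) + a\<close>, either
  \<open>q \<le> \<kappa> * (\<beta> * M)\<close> and the reduction pays for the factor, or
  \<open>\<beta> * M\<close> is below \<open>q / \<kappa>\<close> and the whole term is bounded by a
  constant. This constant becomes the summand C added to V.\<close>

lemma exp_balance:
  fixes G \<beta> \<kappa> M a :: real
  assumes "0 < \<beta>" "\<beta> \<le> G" "0 < \<kappa>" "\<kappa> \<le> 1" "0 \<le> M" "0 \<le> a"
  shows "G * exp (\<beta> * ((1 - \<kappa>) * M) + a) \<le> \<beta> * (exp (\<beta> * M) + exp ((1 + 1 / \<kappa>) * (ln (G / \<beta>) + a)))"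
proof -
  define q where "q = ln (G / \<beta>) + a"
  have q: "0 \<le> q" using assms by (simp add: q_def)
  have "G = \<beta> * exp (ln (G / \<beta>))" using assms by simp
  hence "G * exp (\<beta> * ((1 - \<kappa>) * M) + a) = \<beta> * exp (q + \<beta> * ((1 - \<kappa>) * M))"
    unfolding q_def by (metis add.assoc add.commute exp_add mult.assoc)
  also have "\<dots> \<le> \<beta> * (exp (\<beta> * M) + exp ((1 + 1 / \<kappa>) * q))"
  proof (rule mult_left_mono)
    show "exp (q + \<beta> * ((1 - \<kappa>) * M)) \<le> exp (\<beta> * M) + exp ((1 + 1 / \<kappa>) * q)"
    proof (cases "q \<le> \<kappa> * (\<beta> * M)")
      case True
      hence "q + \<beta> * ((1 - \<kappa>) * M) \<le> \<beta> * M" by (simp add: algebra_simps)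
      thus ?thesis by (intro add_increasing2) auto
    next
      case False
      hence 1: "\<beta> * M \<le> q / \<kappa>" using assms by (simp add: field_simps)
      have "(1 - \<kappa>) * (\<beta> * M) \<le> 1 * (\<beta> * M)" using assms by (intro mult_right_mono) auto
      hence "q + \<beta> * ((1 - \<kappa>) * M) \<le> q + q / \<kappa>" using 1 by (simp add: mult.left_commute)
      also have "\<dots> = (1 + 1 / \<kappa>) * q" by (simp add: algebra_simps)
      finally show ?thesis by (intro add_increasing) auto
    qed
  qed (use assms in auto)
  finally show ?thesis by (simp add: q_def)
qed

section \<open>The exponential sum and its drift\<close>

definition Y :: "real \<Rightarrow> real \<Rightarrow> real \<Rightarrow> 'k \<Rightarrow> nat ^ 'k \<Rightarrow> real" where
  "Y n \<eta> t l x = ((R *v (\<chi> k. real (x $ k))) $ l - n * what \<eta> (t / n) $ l) / cc $ l"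

definition V where
  "V n \<eta> \<beta> t x = (\<Sum>l\<in>UNIV. exp (\<beta> * Y n \<eta> t l x) + exp (- \<beta> * Y n \<eta> t l x))"

definition Ymax where "Ymax n \<eta> t x = Max (range (\<lambda>l. \<bar>Y n \<eta> t l x\<bar>))"

lemma Y_le_Ymax: "\<bar>Y n \<eta> t l x\<bar> \<le> Ymax n \<eta> t x" unfolding Ymax_def by (rule Max_ge) auto

lemma exp_Ymax_le_V: "0 \<le> \<beta> \<Longrightarrow> exp (\<beta> * Ymax n \<eta> t x) \<le> V n \<eta> \<beta> t x"
proof -
  assume "0 \<le> \<beta>"
  have "Ymax n \<eta> t x \<in> range (\<lambda>l. \<bar>Y n \<eta> t l x\<bar>)" unfolding Ymax_def by (rule Max_in) auto
  then obtain l where l: "Ymax n \<eta> t x = \<bar>Y n \<eta> t l x\<bar>" by auto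
  have "exp (\<beta> * Ymax n \<eta> t x) \<le> exp (\<beta> * Y n \<eta> t l x) + exp (- \<beta> * Y n \<eta> t l x)"
    unfolding l by (cases "0 \<le> Y n \<eta> t l x") auto
  also have "\<dots> \<le> V n \<eta> \<beta> t x" unfolding V_def by (rule member_le_sum) auto
  finally show ?thesis .
qed

text \<open>Missing service at an empty node drives Y up; growth of \<phi> drives it down. In the
  first case \<open>x $ l = 0\<close> makes
  \<open>u = x $ l - n * (DD *v what \<eta> (t / n)) $ l\<close> nonpositive. In the second, z
  vanishes somewhere in the window, so by the oscillation bound its average is at most
  \<open>2 * \<omega>\<close>, once \<omega> to the left end and once more to any other point. In
  both cases what is left of \<open>cc $ l * Y\<close> is the routed part, at most
  \<open>(cc $ l - 1)\<close> times the maximum by \<open>cc_eq\<close>.\<close>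

lemma Y_side_bounds:
  assumes \<kappa>: "\<And>l. \<kappa> * cc $ l \<le> 1" "0 \<le> \<kappa>" and n: "0 < n" and t: "0 \<le> t" and \<eta>: "0 < \<eta>"
    and osc: "\<And>s l. t / n \<le> s \<Longrightarrow> s \<le> t / n + \<eta> \<Longrightarrow> \<bar>z s $ l - z (t / n) $ l\<bar> \<le> \<omega>"
  shows "x $ l = 0 \<Longrightarrow> Y n \<eta> t l x \<le> (1 - \<kappa>) * Ymax n \<eta> t x"
    "\<phi> (t / n) $ l < \<phi> (t / n + \<eta>) $ l \<Longrightarrow> - Y n \<eta> t l x \<le> (1 - \<kappa>) * Ymax n \<eta> t x + 2 * n * \<omega>"
proof -
  define M where "M = Ymax n \<eta> t x"
  have M: "\<bar>Y n \<eta> t k x\<bar> \<le> M" for k unfolding M_def by (rule Y_le_Ymax)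
  have M0: "0 \<le> M" using M abs_ge_zero order_trans by blast
  define u where "u = real (x $ l) - n * (DD *v what \<eta> (t / n)) $ l"
  have s: "0 \<le> t / n" using t n by simp
  have Yk: "cc $ k * Y n \<eta> t k x = (R *v (\<chi> k. real (x $ k)) - n *\<^sub>R what \<eta> (t / n)) $ k" for k
    using cc_pos[of k] by (simp add: Y_def)
  have "u = (DD *v (R *v (\<chi> k. real (x $ k)) - n *\<^sub>R what \<eta> (t / n))) $ l"
    by (simp add: u_def matrix_vector_mult_diff_distrib DD_R matrix_vector_mult_scaleR)
  also have "\<dots> = cc $ l * Y n \<eta> t l x - (\<Sum>k\<in>UNIV. Pd $ k $ l * (cc $ k * Y n \<eta> t k x))"
    by (simp only: DD_nth Yk)
  finally have u: "cc $ l * Y n \<eta> t l x = u + (\<Sum>k\<in>UNIV. Pd $ k $ l * (cc $ k * Y n \<eta> t k x))" by simp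
  have "\<bar>\<Sum>k\<in>UNIV. Pd $ k $ l * (cc $ k * Y n \<eta> t k x)\<bar> \<le> (\<Sum>k\<in>UNIV. \<bar>Pd $ k $ l * (cc $ k * Y n \<eta> t k x)\<bar>)" by (rule sum_abs)
  also have "\<dots> \<le> (\<Sum>k\<in>UNIV. Pd $ k $ l * (cc $ k * M))"
    using Pd_nonneg cc_pos by (intro sum_mono) (auto simp: abs_mult less_imp_le intro!: mult_left_mono M)
  also have "\<dots> = M * (\<Sum>k\<in>UNIV. Pd $ k $ l * cc $ k)" by (simp add: sum_distrib_left mult_ac)
  also have "\<dots> = M * (cc $ l - 1)" using cc_eq[of l] by simp
  finally have S: "\<bar>\<Sum>k\<in>UNIV. Pd $ k $ l * (cc $ k * Y n \<eta> t k x)\<bar> \<le> M * (cc $ l - 1)" .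
  have key: "M * (cc $ l - 1) \<le> cc $ l * ((1 - \<kappa>) * M)"
    using mult_right_mono[OF \<kappa>(1)[of l] M0] by (simp add: algebra_simps)
  show "Y n \<eta> t l x \<le> (1 - \<kappa>) * Ymax n \<eta> t x" if "x $ l = 0"
  proof -
    have "0 \<le> (DD *v what \<eta> (t / n)) $ l"
    proof -
      have "0 \<le> z a $ l \<and> z a $ l \<le> z (t / n) $ l + \<omega>" if "t / n \<le> a" "a \<le> t / n + \<eta>" for a
        using osc[OF that, of l] z_nonneg[of a l] s that by (auto simp: abs_le_iff)
      thus ?thesis using z_what_bounds(1)[OF s \<eta>] by blast
    qed
    hence "u \<le> 0" using that n by (simp add: u_def)
    hence "cc $ l * Y n \<eta> t l x \<le> cc $ l * ((1 - \<kappa>) * M)" using u S key by linarith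
    thus ?thesis using cc_pos[of l] unfolding M_def by simp
  qed
  show "- Y n \<eta> t l x \<le> (1 - \<kappa>) * Ymax n \<eta> t x + 2 * n * \<omega>" if inc: "\<phi> (t / n) $ l < \<phi> (t / n + \<eta>) $ l"
  proof -
    obtain a where a: "t / n \<le> a" "a \<le> t / n + \<eta>" "z a $ l \<le> 0"
      using phi_const[of "t / n" "t / n + \<eta>" l] inc s \<eta> by force
    have "z (t / n) $ l \<le> \<omega>" using osc[OF a(1,2), of l] a(3) by (simp add: abs_le_iff)
    hence "0 \<le> z a $ l \<and> z a $ l \<le> 2 * \<omega>" if "t / n \<le> a" "a \<le> t / n + \<eta>" for a
      using osc[OF that, of l] z_nonneg[of a l] s that by (auto simp: abs_le_iff)
    hence "(DD *v what \<eta> (t / n)) $ l \<le> 2 * \<omega>" using z_what_bounds(2)[OF s \<eta>] by blast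
    hence "n * (DD *v what \<eta> (t / n)) $ l \<le> n * (2 * \<omega>)" using n by (intro mult_left_mono) auto
    hence u2: "- u \<le> 2 * n * \<omega>" by (simp add: u_def)
    have \<omega>0: "0 \<le> 2 * n * \<omega>" using osc[of "t / n" l] n \<eta> by simp
    have "2 * n * \<omega> \<le> cc $ l * (2 * n * \<omega>)" using mult_right_mono[OF cc_ge_1[of l] \<omega>0] by simp
    hence "cc $ l * (- Y n \<eta> t l x) \<le> cc $ l * ((1 - \<kappa>) * M + 2 * n * \<omega>)"
      using u u2 S key by (simp only: distrib_left)
    thus ?thesis using cc_pos[of l] unfolding M_def by (simp only: mult_le_cancel_left_pos)
  qed
qed

lemma V_pos: "0 < V n \<eta> \<beta> t x"
  unfolding V_def by (rule sum_pos) (auto intro: add_pos_pos)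

lemma gen_V:
  assumes js: "jump_semigroup p' (jackson_rate lamd mu Pd) Lam"
  shows "jump_semigroup.gen (jackson_rate lamd mu Pd) (\<lambda>x. E * (V n \<eta> \<beta> t x + C)) x
    = E * (\<Sum>l\<in>UNIV. psi lamd mu Pd (tilt \<beta> l) x * exp (\<beta> * Y n \<eta> t l x)
        + psi lamd mu Pd (tilt (- \<beta>) l) x * exp (- \<beta> * Y n \<eta> t l x))"
proof -
  interpret D: jump_semigroup p' "jackson_rate lamd mu Pd" Lam by (rule js)
  define b where "b l = - (\<beta> * (n * what \<eta> (t / n) $ l) / cc $ l)" for l
  have Y1: "\<beta> * Y n \<eta> t l y = lin (tilt \<beta> l) y + b l" for l y
    by (simp add: Y_def lin_tilt b_def diff_divide_distrib right_diff_distrib)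
  have Y2: "- \<beta> * Y n \<eta> t l y = lin (tilt (- \<beta>) l) y + - b l" for l y
    by (simp add: Y_def lin_tilt b_def diff_divide_distrib right_diff_distrib)
  define J where "J = jackson_rate lamd mu Pd x"
  have "D.gen (\<lambda>x. E * (V n \<eta> \<beta> t x + C)) x
    = (\<Sum>y\<in>D.supp x. E * (\<Sum>l\<in>UNIV. J y * (exp (\<beta> * Y n \<eta> t l y) - exp (\<beta> * Y n \<eta> t l x))
        + J y * (exp (- \<beta> * Y n \<eta> t l y) - exp (- \<beta> * Y n \<eta> t l x))))"
    unfolding D.gen_def J_def[symmetric]
  proof (rule sum.cong[OF refl])
    fix y
    have "V n \<eta> \<beta> t y - V n \<eta> \<beta> t x = (\<Sum>l\<in>UNIV. (exp (\<beta> * Y n \<eta> t l y) - exp (\<beta> * Y n \<eta> t l x))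
        + (exp (- \<beta> * Y n \<eta> t l y) - exp (- \<beta> * Y n \<eta> t l x)))"
      unfolding V_def sum_subtractf[symmetric] by (rule sum.cong) auto
    hence "J y * (V n \<eta> \<beta> t y - V n \<eta> \<beta> t x) = (\<Sum>l\<in>UNIV. J y * (exp (\<beta> * Y n \<eta> t l y) - exp (\<beta> * Y n \<eta> t l x))
        + J y * (exp (- \<beta> * Y n \<eta> t l y) - exp (- \<beta> * Y n \<eta> t l x)))"
      by (simp add: sum_distrib_left distrib_left)
    thus "J y * (E * (V n \<eta> \<beta> t y + C) - E * (V n \<eta> \<beta> t x + C)) = E * (\<Sum>l\<in>UNIV. J y * (exp (\<beta> * Y n \<eta> t l y) - exp (\<beta> * Y n \<eta> t l x))
        + J y * (exp (- \<beta> * Y n \<eta> t l y) - exp (- \<beta> * Y n \<eta> t l x)))"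
      by (simp add: algebra_simps)
  qed
  also have "\<dots> = E * (\<Sum>l\<in>UNIV. (\<Sum>y\<in>D.supp x. J y * (exp (\<beta> * Y n \<eta> t l y) - exp (\<beta> * Y n \<eta> t l x)))
        + (\<Sum>y\<in>D.supp x. J y * (exp (- \<beta> * Y n \<eta> t l y) - exp (- \<beta> * Y n \<eta> t l x))))"
    unfolding sum_distrib_left[symmetric] sum.distrib[symmetric] by (subst sum.swap) (rule refl)
  also have "\<dots> = E * (\<Sum>l\<in>UNIV. psi lamd mu Pd (tilt \<beta> l) x * exp (\<beta> * Y n \<eta> t l x)
        + psi lamd mu Pd (tilt (- \<beta>) l) x * exp (- \<beta> * Y n \<eta> t l x))"
    unfolding Y1 Y2 J_def D.supp_def jackson_gen_exp ..
  finally show ?thesis .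
qed

definition Vd where
  "Vd n \<eta> \<beta> t x = (\<Sum>l\<in>UNIV. - (\<beta> * ((w (t / n + \<eta>) $ l - w (t / n) $ l) / \<eta>) / cc $ l)
     * (exp (\<beta> * Y n \<eta> t l x) - exp (- \<beta> * Y n \<eta> t l x)))"

lemma V_deriv:
  assumes "0 < n" "0 < \<eta>" "0 \<le> t"
  shows "((\<lambda>d. V n \<eta> \<beta> (t + d) x) has_real_derivative Vd n \<eta> \<beta> t x) (at_right 0)"
proof -
  define W where "W l = (w (t / n + \<eta>) $ l - w (t / n) $ l) / \<eta>" for l
  have dY: "((\<lambda>d. Y n \<eta> (t + d) l x) has_real_derivative - W l / cc $ l) (at_right 0)" for l
  proof -
    have "((\<lambda>d. n * what \<eta> (t / n + d / n) $ l) has_real_derivative W l) (at_right 0)"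
      unfolding W_def by (rule what_deriv_right) (use assms in auto)
    hence "((\<lambda>d. ((R *v (\<chi> k. real (x $ k))) $ l - n * what \<eta> (t / n + d / n) $ l) / cc $ l) has_real_derivative (0 - W l) / cc $ l) (at_right 0)"
      by (intro DERIV_cdivide DERIV_diff DERIV_const)
    thus ?thesis by (simp add: Y_def add_divide_distrib)
  qed
  have "((\<lambda>d. exp (\<beta> * Y n \<eta> (t + d) l x) + exp (- \<beta> * Y n \<eta> (t + d) l x)) has_real_derivative
     exp (\<beta> * Y n \<eta> t l x) * (\<beta> * (- W l / cc $ l)) + exp (- \<beta> * Y n \<eta> t l x) * (- \<beta> * (- W l / cc $ l))) (at_right 0)" for l
    using DERIV_chain2[OF DERIV_exp DERIV_cmult[OF dY[of l], of \<beta>]] DERIV_chain2[OF DERIV_exp DERIV_cmult[OF dY[of l], of "- \<beta>"]]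
    by (intro DERIV_add) simp_all
  hence "((\<lambda>d. V n \<eta> \<beta> (t + d) x) has_real_derivative
     (\<Sum>l\<in>UNIV. exp (\<beta> * Y n \<eta> t l x) * (\<beta> * (- W l / cc $ l)) + exp (- \<beta> * Y n \<eta> t l x) * (- \<beta> * (- W l / cc $ l)))) (at_right 0)"
    unfolding V_def by (intro DERIV_sum)
  also have "(\<Sum>l\<in>UNIV. exp (\<beta> * Y n \<eta> t l x) * (\<beta> * (- W l / cc $ l)) + exp (- \<beta> * Y n \<eta> t l x) * (- \<beta> * (- W l / cc $ l))) = Vd n \<eta> \<beta> t x"
    unfolding Vd_def W_def[symmetric] by (rule sum.cong) (auto simp: algebra_simps)
  finally show ?thesis .
qed

lemma V_grow:
  assumes "0 < n" "0 < \<eta>" "0 \<le> H" "0 \<le> \<beta>"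
  obtains L where "0 \<le> L" "\<And>t d x. 0 \<le> t \<Longrightarrow> 0 \<le> d \<Longrightarrow> t + d \<le> n * H \<Longrightarrow> V n \<eta> \<beta> (t + d) x \<le> exp (L * d) * V n \<eta> \<beta> t x"
proof -
  obtain L where L: "0 \<le> L" "\<And>s t l. 0 \<le> s \<Longrightarrow> s \<le> t \<Longrightarrow> t \<le> H \<Longrightarrow> \<bar>what \<eta> t $ l - what \<eta> s $ l\<bar> \<le> L * (t - s)"
    using what_lipschitz[OF assms(2,3)] by metis
  show ?thesis
  proof
    show "0 \<le> \<beta> * L" using L assms by simp
    fix t d x assume t: "0 \<le> t" "0 \<le> d" "t + d \<le> n * H"
    have Yd: "\<bar>Y n \<eta> (t + d) l x - Y n \<eta> t l x\<bar> \<le> L * d" for l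
    proof -
      have "Y n \<eta> (t + d) l x - Y n \<eta> t l x = - (n * (what \<eta> ((t + d) / n) $ l - what \<eta> (t / n) $ l) / cc $ l)"
        by (simp add: Y_def diff_divide_distrib right_diff_distrib)
      hence "\<bar>Y n \<eta> (t + d) l x - Y n \<eta> t l x\<bar> = n * \<bar>what \<eta> ((t + d) / n) $ l - what \<eta> (t / n) $ l\<bar> / cc $ l"
        using assms cc_pos[of l] by (simp add: abs_mult)
      also have "\<dots> \<le> n * (L * ((t + d) / n - t / n)) / cc $ l"
        using t assms cc_pos[of l] by (intro divide_right_mono mult_left_mono L) (auto simp: divide_right_mono field_simps)
      also have "n * (L * ((t + d) / n - t / n)) = L * d" using assms by (simp add: add_divide_distrib)
      also have "L * d / cc $ l \<le> L * d"
      proof -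
        have "L * d * 1 \<le> L * d * cc $ l" using L t cc_ge_1[of l] by (intro mult_left_mono) auto
        thus ?thesis using cc_pos[of l] by (simp add: divide_le_eq)
      qed
      finally show ?thesis .
    qed
    have e: "exp (a * Y n \<eta> (t + d) l x) \<le> exp (\<beta> * L * d) * exp (a * Y n \<eta> t l x)" if "\<bar>a\<bar> = \<beta>" for a l
    proof -
      have "a * Y n \<eta> (t + d) l x - a * Y n \<eta> t l x \<le> \<bar>a * (Y n \<eta> (t + d) l x - Y n \<eta> t l x)\<bar>" by (simp add: right_diff_distrib)
      also have "\<dots> \<le> \<beta> * (L * d)" unfolding abs_mult that using Yd assms by (intro mult_left_mono) auto
      finally show ?thesis by (simp flip: exp_add)
    qed
    show "V n \<eta> \<beta> (t + d) x \<le> exp (\<beta> * L * d) * V n \<eta> \<beta> t x"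
      unfolding V_def sum_distrib_left distrib_left
      by (intro sum_mono add_mono e) (use assms in auto)
  qed
qed

text \<open>With i indicating a busy node and g the mean growth of \<phi> over the window, the
  drifts of chain and averaged fluid cancel up to \<open>mu * (1 - i) - g\<close>. Against the two
  exponentials only \<open>mu * (1 - i)\<close> with \<open>exp (\<beta> * Y)\<close> and g with
  \<open>exp (- \<beta> * Y)\<close> are harmful, and these are the two cases of
  \<open>Y_side_bounds\<close>. The part \<open>4 * Lam\<close> of the rate is the second order
  remainder; the 1 comes from \<open>exp_balance\<close>.\<close>

lemma V_drift:
  assumes n: "0 < n" and \<eta>: "0 < \<eta>" and t: "0 \<le> t" and \<beta>: "0 < \<beta>" "2 * \<beta> \<le> 1" and \<beta>G: "\<beta> \<le> G"
    and \<kappa>: "\<And>l. \<kappa> * cc $ l \<le> 1" "0 < \<kappa>" "\<kappa> \<le> 1"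
    and osc: "\<And>s l. t / n \<le> s \<Longrightarrow> s \<le> t / n + \<eta> \<Longrightarrow> \<bar>z s $ l - z (t / n) $ l\<bar> \<le> \<omega>"
    and G: "(\<Sum>l\<in>UNIV. mu $ l + (\<phi> (t / n + \<eta>) $ l - \<phi> (t / n) $ l) / \<eta>) \<le> G"
    and C: "C = exp ((1 + 1 / \<kappa>) * (ln (G / \<beta>) + \<beta> * (2 * n * \<omega>)))"
  shows "Vd n \<eta> \<beta> t x + (\<Sum>l\<in>UNIV. psi lamd mu Pd (tilt \<beta> l) x * exp (\<beta> * Y n \<eta> t l x)
        + psi lamd mu Pd (tilt (- \<beta>) l) x * exp (- \<beta> * Y n \<eta> t l x)) \<le> (4 * Lam + 1) * \<beta>\<^sup>2 * (V n \<eta> \<beta> t x + C)"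
proof -
  define g where "g l = (\<phi> (t / n + \<eta>) $ l - \<phi> (t / n) $ l) / \<eta>" for l
  have s: "0 \<le> t / n" using t n by simp
  have g0: "0 \<le> g l" for l using phi_increasing[of "t / n" "t / n + \<eta>" l] s \<eta> by (simp add: g_def)
  have \<omega>0: "0 \<le> \<omega>" using osc[of "t / n"] \<eta> by auto
  define M where "M = Ymax n \<eta> t x"
  have M0: "0 \<le> M" unfolding M_def using Y_le_Ymax abs_ge_zero order_trans by blast
  define B where "B = exp (\<beta> * ((1 - \<kappa>) * M) + \<beta> * (2 * n * \<omega>))"
  have W: "(w (t / n + \<eta>) $ l - w (t / n) $ l) / \<eta> = nu $ l - mu $ l + g l" for l
  proof -
    have "w (u + \<eta>) $ l - w u $ l = \<eta> * (nu $ l - mu $ l) + (\<phi> (u + \<eta>) $ l - \<phi> u $ l)" if "0 \<le> u" for u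
      using w_nth[OF that, of l] w_nth[of "u + \<eta>" l] that \<eta> by (simp add: algebra_simps)
    from this[OF s] show ?thesis using \<eta> by (simp add: g_def add_divide_distrib)
  qed
  define Lq where "Lq = 4 * Lam * \<beta>\<^sup>2"
  have tm: "- (\<beta> * (nu $ l - mu $ l + g l) / cc $ l) * (exp (\<beta> * Y n \<eta> t l x) - exp (- \<beta> * Y n \<eta> t l x))
      + (psi lamd mu Pd (tilt \<beta> l) x * exp (\<beta> * Y n \<eta> t l x) + psi lamd mu Pd (tilt (- \<beta>) l) x * exp (- \<beta> * Y n \<eta> t l x))
      \<le> Lq * (exp (\<beta> * Y n \<eta> t l x) + exp (- \<beta> * Y n \<eta> t l x)) + \<beta> * (mu $ l + g l) * B" for l
  proof -
    define i where "i = (of_bool (0 < x $ l) :: real)"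
    define bc where "bc = \<beta> / cc $ l"
    have bc: "0 < bc" "bc \<le> \<beta>" using \<beta> cc_pos[of l] cc_ge_1[of l] by (auto simp: bc_def divide_le_eq)
    have p1: "psi lamd mu Pd (tilt \<beta> l) x \<le> bc * (nu $ l - mu $ l * i) + Lq"
      using psi_tilt[of \<beta> l x] \<beta> by (simp add: bc_def i_def Lq_def)
    have p2: "psi lamd mu Pd (tilt (- \<beta>) l) x \<le> - bc * (nu $ l - mu $ l * i) + Lq"
      using psi_tilt[of "- \<beta>" l x] \<beta> by (simp add: bc_def i_def Lq_def)
    have b1: "(mu $ l * (1 - i) - g l) * exp (\<beta> * Y n \<eta> t l x) \<le> mu $ l * B"
    proof (cases "x $ l = 0")
      case True
      have "Y n \<eta> t l x \<le> (1 - \<kappa>) * M" unfolding M_def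
        using Y_side_bounds(1)[OF \<kappa>(1) _ n t \<eta> osc True] \<kappa> by simp
      moreover have "0 \<le> \<beta> * (2 * n * \<omega>)" using \<beta> n \<omega>0 by simp
      ultimately have "\<beta> * Y n \<eta> t l x \<le> \<beta> * ((1 - \<kappa>) * M) + \<beta> * (2 * n * \<omega>)"
        using \<beta> by (intro add_increasing2 mult_left_mono) auto
      hence "exp (\<beta> * Y n \<eta> t l x) \<le> B" unfolding B_def by simp
      moreover have "(mu $ l * (1 - i) - g l) \<le> mu $ l" using g0[of l] True by (simp add: i_def)
      ultimately show ?thesis using mu_pos[of l] by (intro mult_mono) (auto simp: less_imp_le)
    next
      case False
      hence "(mu $ l * (1 - i) - g l) * exp (\<beta> * Y n \<eta> t l x) \<le> 0" using g0[of l] by (simp add: i_def)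
      also have "0 \<le> mu $ l * B" using mu_pos[of l] by (simp add: B_def)
      finally show ?thesis .
    qed
    have b2: "(g l - mu $ l * (1 - i)) * exp (- \<beta> * Y n \<eta> t l x) \<le> g l * B"
    proof (cases "\<phi> (t / n) $ l < \<phi> (t / n + \<eta>) $ l")
      case True
      have "- Y n \<eta> t l x \<le> (1 - \<kappa>) * M + 2 * n * \<omega>" unfolding M_def
        using Y_side_bounds(2)[OF \<kappa>(1) _ n t \<eta> osc True] \<kappa> by simp
      hence "\<beta> * (- Y n \<eta> t l x) \<le> \<beta> * ((1 - \<kappa>) * M + 2 * n * \<omega>)" using \<beta> by (intro mult_left_mono) auto
      hence "exp (- \<beta> * Y n \<eta> t l x) \<le> B" unfolding B_def by (simp add: distrib_left)
      moreover have "g l - mu $ l * (1 - i) \<le> g l" using mu_pos[of l] by (simp add: i_def)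
      ultimately show ?thesis using g0[of l] by (intro mult_mono) auto
    next
      case False
      hence "g l = 0" using phi_increasing[of "t / n" "t / n + \<eta>" l] s \<eta> by (simp add: g_def)
      thus ?thesis using mu_pos[of l] by (simp add: i_def)
    qed
    define e1 e2 where "e1 = exp (\<beta> * Y n \<eta> t l x)" and "e2 = exp (- \<beta> * Y n \<eta> t l x)"
    have e: "0 < e1" "0 < e2" by (auto simp: e1_def e2_def)
    have q1: "psi lamd mu Pd (tilt \<beta> l) x * e1 \<le> (bc * (nu $ l - mu $ l * i) + Lq) * e1"
      using e p1 by (intro mult_right_mono) auto
    have q2: "psi lamd mu Pd (tilt (- \<beta>) l) x * e2 \<le> (- bc * (nu $ l - mu $ l * i) + Lq) * e2"
      using e p2 by (intro mult_right_mono) auto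
    have q3: "- (\<beta> * (nu $ l - mu $ l + g l) / cc $ l) * (e1 - e2) + ((bc * (nu $ l - mu $ l * i) + Lq) * e1 + (- bc * (nu $ l - mu $ l * i) + Lq) * e2)
      = Lq * (e1 + e2) + bc * ((mu $ l * (1 - i) - g l) * e1 + (g l - mu $ l * (1 - i)) * e2)"
    proof -
      have "\<beta> * (nu $ l - mu $ l + g l) / cc $ l = bc * (nu $ l - mu $ l + g l)" by (simp add: bc_def)
      thus ?thesis by (simp only:) (simp add: algebra_simps)
    qed
    have "bc * ((mu $ l * (1 - i) - g l) * e1 + (g l - mu $ l * (1 - i)) * e2) \<le> bc * (mu $ l * B + g l * B)"
      using b1 b2 bc unfolding e1_def[symmetric] e2_def[symmetric] by (intro mult_left_mono add_mono) auto
    also have "\<dots> \<le> \<beta> * (mu $ l * B + g l * B)"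
      using bc mu_pos[of l] g0[of l] by (intro mult_right_mono) (auto simp: B_def)
    also have "\<dots> = \<beta> * (mu $ l + g l) * B" by (simp add: algebra_simps)
    finally have q4: "bc * ((mu $ l * (1 - i) - g l) * e1 + (g l - mu $ l * (1 - i)) * e2) \<le> \<beta> * (mu $ l + g l) * B" .
    show ?thesis unfolding e1_def[symmetric] e2_def[symmetric]
      by (rule order_trans[OF add_left_mono[OF add_mono[OF q1 q2]]]) (unfold q3, rule add_left_mono[OF q4])
  qed
  have "Vd n \<eta> \<beta> t x + (\<Sum>l\<in>UNIV. psi lamd mu Pd (tilt \<beta> l) x * exp (\<beta> * Y n \<eta> t l x)
        + psi lamd mu Pd (tilt (- \<beta>) l) x * exp (- \<beta> * Y n \<eta> t l x))
    \<le> (\<Sum>l\<in>UNIV. Lq * (exp (\<beta> * Y n \<eta> t l x) + exp (- \<beta> * Y n \<eta> t l x)) + \<beta> * (mu $ l + g l) * B)"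
    unfolding Vd_def W sum.distrib[symmetric] by (rule sum_mono) (rule tm)
  also have "\<dots> = Lq * V n \<eta> \<beta> t x + \<beta> * (\<Sum>l\<in>UNIV. mu $ l + g l) * B"
    by (simp only: sum.distrib[of _ _ UNIV] V_def sum_distrib_left sum_distrib_right distrib_left distrib_right)
  also have "\<beta> * (\<Sum>l\<in>UNIV. mu $ l + g l) * B \<le> \<beta> * G * B"
    using G \<beta> by (intro mult_right_mono mult_left_mono) (auto simp: g_def B_def)
  also have "\<beta> * G * B \<le> \<beta> * (\<beta> * (V n \<eta> \<beta> t x + C))"
  proof -
    have "G * B \<le> \<beta> * (exp (\<beta> * M) + C)"
      unfolding B_def C by (rule exp_balance) (use \<beta> \<beta>G \<kappa> M0 n \<omega>0 in auto)
    also have "\<dots> \<le> \<beta> * (V n \<eta> \<beta> t x + C)"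
      using exp_Ymax_le_V[of \<beta> n \<eta> t x] \<beta> by (intro mult_left_mono) (auto simp: M_def)
    finally show ?thesis using \<beta> by (simp add: mult.assoc)
  qed
  finally have "Vd n \<eta> \<beta> t x + (\<Sum>l\<in>UNIV. psi lamd mu Pd (tilt \<beta> l) x * exp (\<beta> * Y n \<eta> t l x)
        + psi lamd mu Pd (tilt (- \<beta>) l) x * exp (- \<beta> * Y n \<eta> t l x)) \<le> Lq * V n \<eta> \<beta> t x + \<beta> * (\<beta> * (V n \<eta> \<beta> t x + C))" by simp
  also have "\<dots> \<le> (4 * Lam + 1) * \<beta>\<^sup>2 * (V n \<eta> \<beta> t x + C)"
  proof -
    have "0 \<le> Lam" unfolding Lam_def
      by (intro add_nonneg_nonneg sum_nonneg) (simp_all add: less_imp_le lam_pos mu_pos)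
    hence "0 \<le> Lq * C" by (simp add: Lq_def C)
    moreover have "(4 * Lam + 1) * \<beta>\<^sup>2 * (V n \<eta> \<beta> t x + C) = Lq * V n \<eta> \<beta> t x + \<beta> * (\<beta> * (V n \<eta> \<beta> t x + C)) + Lq * C"
      by (simp add: Lq_def power2_eq_square algebra_simps)
    ultimately show ?thesis by linarith
  qed
  finally show ?thesis .
qed

lemma DD_bound:
  obtains B where "0 < B" "\<And>u m. (\<And>l. \<bar>u $ l\<bar> \<le> cc $ l * m) \<Longrightarrow> 0 \<le> m \<Longrightarrow> norm (DD *v u) \<le> B * m"
proof
  define B where "B = onorm ((*v) DD) * (\<Sum>l\<in>UNIV. cc $ l) + 1"
  have bl: "bounded_linear ((*v) DD)" by (rule matrix_vector_mul_bounded_linear)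
  have on: "0 \<le> onorm ((*v) DD)" using onorm_pos_le[OF bl] .
  show "0 < B" unfolding B_def using on cc_pos by (intro add_nonneg_pos mult_nonneg_nonneg sum_nonneg) (auto simp: less_imp_le)
  fix u m assume u: "\<And>l. \<bar>u $ l\<bar> \<le> cc $ l * m" and m: "0 \<le> m"
  have "norm (DD *v u) \<le> onorm ((*v) DD) * norm u" by (rule onorm[OF bl])
  also have "norm u \<le> (\<Sum>l\<in>UNIV. \<bar>u $ l\<bar>)" by (rule norm_le_l1_cart)
  also have "\<dots> \<le> (\<Sum>l\<in>UNIV. cc $ l) * m" unfolding sum_distrib_right by (rule sum_mono) (rule u)
  finally have "norm (DD *v u) \<le> onorm ((*v) DD) * ((\<Sum>l\<in>UNIV. cc $ l) * m)" using on by (simp add: mult_left_mono)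
  also have "\<dots> \<le> B * m" using m by (simp add: B_def algebra_simps)
  finally show "norm (DD *v u) \<le> B * m" .
qed

lemma exp_supermartingale:
  assumes js: "jump_semigroup p' (jackson_rate lamd mu Pd) Lam"
    and n: "0 < n" and \<eta>: "0 < \<eta>" and H: "0 \<le> H" and \<beta>: "0 < \<beta>" "2 * \<beta> \<le> 1" and \<beta>G: "\<beta> \<le> G"
    and \<kappa>: "\<And>l. \<kappa> * cc $ l \<le> 1" "0 < \<kappa>" "\<kappa> \<le> 1"
    and osc: "\<And>s t l. 0 \<le> s \<Longrightarrow> s \<le> H \<Longrightarrow> s \<le> t \<Longrightarrow> t \<le> s + \<eta> \<Longrightarrow> \<bar>z t $ l - z s $ l\<bar> \<le> \<omega>"
    and G: "\<And>s. 0 \<le> s \<Longrightarrow> s \<le> H \<Longrightarrow> (\<Sum>l\<in>UNIV. mu $ l + (\<phi> (s + \<eta>) $ l - \<phi> s $ l) / \<eta>) \<le> G"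
    and C: "C = exp ((1 + 1 / \<kappa>) * (ln (G / \<beta>) + \<beta> * (2 * n * \<omega>)))"
    and c: "c = (4 * Lam + 1) * \<beta>\<^sup>2"
    and t: "0 \<le> t" "0 \<le> h" "t + h \<le> n * H"
  shows "(\<integral>\<^sup>+y. ennreal (exp (- c * (t + h)) * (V n \<eta> \<beta> (t + h) y + C)) \<partial>measure_pmf (p' h x))
    \<le> ennreal (exp (- c * t) * (V n \<eta> \<beta> t x + C))"
proof -
  interpret D: jump_semigroup p' "jackson_rate lamd mu Pd" Lam by (rule js)
  obtain L where L: "0 \<le> L" "\<And>t d x. 0 \<le> t \<Longrightarrow> 0 \<le> d \<Longrightarrow> t + d \<le> n * H \<Longrightarrow> V n \<eta> \<beta> (t + d) x \<le> exp (L * d) * V n \<eta> \<beta> t x"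
    using V_grow[OF n \<eta> H] \<beta> by (metis less_imp_le)
  have C0: "0 < C" by (simp add: C)
  have c0: "0 \<le> c" using D.Lambda_nonneg by (simp add: c)
  show ?thesis
  proof (rule D.supermartingale[where b = "n * H" and L = L and V = "\<lambda>t x. exp (- c * t) * (V n \<eta> \<beta> t x + C)"
        and V' = "\<lambda>t x. exp (- c * t) * Vd n \<eta> \<beta> t x - c * exp (- c * t) * (V n \<eta> \<beta> t x + C)"])
    show "0 \<le> exp (- c * t) * (V n \<eta> \<beta> t x + C)" for t x
      using V_pos[of n \<eta> \<beta> t x] C0 by (intro mult_nonneg_nonneg add_nonneg_nonneg) auto
    show "((\<lambda>d. exp (- c * (t + d)) * (V n \<eta> \<beta> (t + d) x + C)) has_real_derivative
        exp (- c * t) * Vd n \<eta> \<beta> t x - c * exp (- c * t) * (V n \<eta> \<beta> t x + C)) (at_right 0)" if "0 \<le> t" for t x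
    proof -
      have e: "((\<lambda>d. exp (- c * (t + d))) has_real_derivative exp (- c * t) * (- c)) (at_right 0)"
        by (auto intro!: derivative_eq_intros)
      have v: "((\<lambda>d. V n \<eta> \<beta> (t + d) x + C) has_real_derivative Vd n \<eta> \<beta> t x + 0) (at_right 0)"
        by (intro DERIV_add V_deriv DERIV_const n \<eta> that)
      show ?thesis using DERIV_mult'[OF e v] by (simp add: algebra_simps)
    qed
    show "exp (- c * (t + d)) * (V n \<eta> \<beta> (t + d) x + C) \<le> exp (L * d) * (exp (- c * t) * (V n \<eta> \<beta> t x + C))"
      if "0 \<le> t" "0 \<le> d" "t + d \<le> n * H" for t d x
    proof -
      have "V n \<eta> \<beta> (t + d) x + C \<le> exp (L * d) * V n \<eta> \<beta> t x + exp (L * d) * C"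
        using L(2)[OF that] L(1) that C0 by (intro add_mono) auto
      moreover have "exp (- c * (t + d)) \<le> exp (- c * t)" using c0 that by (simp add: mult_left_mono)
      ultimately have "exp (- c * (t + d)) * (V n \<eta> \<beta> (t + d) x + C) \<le> exp (- c * t) * (exp (L * d) * V n \<eta> \<beta> t x + exp (L * d) * C)"
        using V_pos[of n \<eta> \<beta> "t + d" x] C0 by (intro mult_mono) (auto intro: add_nonneg_nonneg)
      thus ?thesis by (simp add: algebra_simps)
    qed
    show "0 \<le> L" by (rule L)
    show "exp (- c * t) * Vd n \<eta> \<beta> t x - c * exp (- c * t) * (V n \<eta> \<beta> t x + C)
       + D.gen (\<lambda>x. exp (- c * t) * (V n \<eta> \<beta> t x + C)) x \<le> 0" if "0 \<le> t" "t < n * H" for t x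
    proof -
      have s: "0 \<le> t / n" "t / n \<le> H" using that n by (auto simp: divide_le_eq mult.commute)
      define S where "S = (\<Sum>l\<in>UNIV. psi lamd mu Pd (tilt \<beta> l) x * exp (\<beta> * Y n \<eta> t l x)
        + psi lamd mu Pd (tilt (- \<beta>) l) x * exp (- \<beta> * Y n \<eta> t l x))"
      have "Vd n \<eta> \<beta> t x + S \<le> c * (V n \<eta> \<beta> t x + C)"
        unfolding S_def c
        by (rule V_drift[where G = G and \<kappa> = \<kappa> and \<omega> = \<omega>]) (use n \<eta> that \<beta> \<beta>G \<kappa> C s osc[OF s] G[OF s] in auto)
      hence "exp (- c * t) * (Vd n \<eta> \<beta> t x + S) \<le> exp (- c * t) * (c * (V n \<eta> \<beta> t x + C))"
        by (intro mult_left_mono) auto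
      thus ?thesis unfolding gen_V[OF js] S_def[symmetric] by (simp add: algebra_simps)
    qed
  qed (use t in auto)
qed

text \<open>Z is the discounted sum, normalised so that a deviating state has value at least 1 at
  any time while a start near \<open>n * r\<close> has an exponentially small value. Along a grid
  this feeds the maximal inequality, at a single time Markov's inequality.\<close>

lemma deviation_supermartingale:
  assumes js: "jump_semigroup p' (jackson_rate lamd mu Pd) Lam" and \<delta>: "0 < \<delta>" and H: "0 < H"
  obtains \<gamma> \<epsilon> :: real where "0 < \<gamma>" "0 < \<epsilon>" 
    "\<forall>\<^sub>F n :: nat in sequentially. \<exists>Z :: real \<Rightarrow> nat ^ 'k \<Rightarrow> real. (\<forall>t x. 0 \<le> Z t x) \<and>
      (\<forall>t h x. 0 \<le> t \<longrightarrow> 0 \<le> h \<longrightarrow> t + h \<le> real n * H \<longrightarrow>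
         (\<integral>\<^sup>+y. ennreal (Z (t + h) y) \<partial>measure_pmf (p' h x)) \<le> ennreal (Z t x)) \<and>
      (\<forall>t x. 0 \<le> t \<longrightarrow> t \<le> real n * H \<longrightarrow> \<delta> < norm ((\<chi> k. real (x $ k) / real n) - z (t / real n)) \<longrightarrow> 1 \<le> Z t x) \<and>
      (\<forall>x. (\<forall>k. \<bar>real (x $ k) - real n * r $ k\<bar> \<le> \<epsilon> * real n) \<longrightarrow> Z 0 x \<le> exp (- \<gamma> * real n))"
proof -
  obtain B where B: "0 < B" "\<And>u m. (\<And>l. \<bar>u $ l\<bar> \<le> cc $ l * m) \<Longrightarrow> 0 \<le> m \<Longrightarrow> norm (DD *v u) \<le> B * m"
    using DD_bound by blast
  have Lam0: "0 \<le> Lam" using jump_semigroup.Lambda_nonneg[OF js] .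
  define Kc where "Kc = real CARD('k)"
  have Kc: "1 \<le> Kc" by (simp add: Kc_def Suc_leI)
  \<comment> \<open>Half of \<delta> is reserved for replacing z by its average. The remaining
    deviation of more than \<open>\<delta> / 2\<close>, divided by the norm bound B, forces some
    \<open>\<bar>Y\<bar>\<close> to reach \<open>n * \<delta>1\<close>.\<close>
  define \<delta>1 where "\<delta>1 = \<delta> / (2 * B)"
  have \<delta>1: "0 < \<delta>1" using \<delta> B by (simp add: \<delta>1_def)
  define \<kappa> where "\<kappa> = 1 / (\<Sum>l\<in>UNIV. cc $ l)"
  have cc_le: "cc $ l \<le> (\<Sum>l\<in>UNIV. cc $ l)" for l
    by (rule member_le_sum) (auto simp: cc_pos less_imp_le)
  hence sc: "1 \<le> (\<Sum>l\<in>UNIV. cc $ l)" using cc_ge_1 order_trans by blast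
  have \<kappa>: "\<kappa> * cc $ l \<le> 1" "0 < \<kappa>" "\<kappa> \<le> 1" for l using cc_le[of l] sc by (auto simp: \<kappa>_def divide_le_eq)
  define K where "K = 1 + 1 / \<kappa>"
  have K: "1 \<le> K" using \<kappa> by (simp add: K_def)
  \<comment> \<open>The second entry keeps the total discount \<open>c * (n * H)\<close> below a
    quarter of the gain \<open>\<beta> * n * \<delta>1\<close>; the first keeps the exponents in the
    range of the quadratic bound.\<close>
  define \<beta> where "\<beta> = min (1 / 2) (\<delta>1 / (4 * (4 * Lam + 1) * H))"
  have \<beta>: "0 < \<beta>" "2 * \<beta> \<le> 1" using \<delta>1 H Lam0 by (auto simp: \<beta>_def)
  define c where "c = (4 * Lam + 1) * \<beta>\<^sup>2"
  have cH: "c * H \<le> \<beta> * \<delta>1 / 4"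
  proof -
    have "\<beta> \<le> \<delta>1 / (4 * (4 * Lam + 1) * H)" by (simp add: \<beta>_def)
    hence "\<beta> * (4 * (4 * Lam + 1) * H) \<le> \<delta>1" using H Lam0 by (subst (asm) pos_le_divide_eq) auto
    hence "\<beta> * (\<beta> * (4 * (4 * Lam + 1) * H)) \<le> \<beta> * \<delta>1" using \<beta> by (intro mult_left_mono) auto
    thus ?thesis by (simp add: c_def power2_eq_square algebra_simps)
  qed
  \<comment> \<open>The first entry bounds the averaging error by \<open>\<delta> / 2\<close>; the
    second keeps the exponent \<open>2 * \<beta> * n * K * \<omega>\<close> inside the constant C
    below \<open>\<gamma> * n\<close>.\<close>
  define \<omega> where "\<omega> = min (\<delta> / (2 * Kc)) (\<delta>1 / (16 * K))"
  have \<omega>: "0 < \<omega>" "Kc * \<omega> \<le> \<delta> / 2" "K * \<omega> \<le> \<delta>1 / 16"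
  proof -
    show "0 < \<omega>" using \<delta> Kc \<delta>1 K by (simp add: \<omega>_def)
    have "Kc * \<omega> \<le> Kc * (\<delta> / (2 * Kc))" using Kc by (intro mult_left_mono) (auto simp: \<omega>_def)
    thus "Kc * \<omega> \<le> \<delta> / 2" using Kc by simp
    have "K * \<omega> \<le> K * (\<delta>1 / (16 * K))" using K by (intro mult_left_mono) (auto simp: \<omega>_def)
    thus "K * \<omega> \<le> \<delta>1 / 16" using K by simp
  qed
  have \<omega>16: "\<omega> \<le> \<delta>1 / 16"
  proof -
    have "1 * \<omega> \<le> K * \<omega>" using K \<omega>(1) by (intro mult_right_mono) auto
    thus ?thesis using \<omega>(3) by linarith
  qed
  have "uniformly_continuous_on {0..H + 1} z"
    by (intro compact_uniformly_continuous continuous_on_subset[OF z_cont]) auto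
  then obtain d where d: "0 < d" "\<And>s t. s \<in> {0..H + 1} \<Longrightarrow> t \<in> {0..H + 1} \<Longrightarrow> dist t s < d \<Longrightarrow> dist (z t) (z s) < \<omega>"
    using \<omega>(1) unfolding uniformly_continuous_on_def by metis
  define \<eta> where "\<eta> = min (d / 2) 1"
  have \<eta>: "0 < \<eta>" "\<eta> < d" "\<eta> \<le> 1" using d by (auto simp: \<eta>_def)
  have osc: "\<bar>z t $ l - z s $ l\<bar> \<le> \<omega>" if "0 \<le> s" "s \<le> H" "s \<le> t" "t \<le> s + \<eta>" for s t l
  proof -
    have "dist (z t) (z s) < \<omega>" using that \<eta> by (intro d(2)) (auto simp: dist_real_def)
    thus ?thesis using component_le_norm_cart[of "z t - z s" l] by (simp add: dist_norm)
  qed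
  \<comment> \<open>The increment of \<phi> over a window is bounded by its total growth from 0. The
    possibly huge factor \<open>1 / \<eta>\<close> is harmless: G enters only through a constant
    independent of n. The maximum with \<beta> secures \<open>\<beta> \<le> G\<close> for
    \<open>exp_balance\<close>.\<close>
  define G where "G = max \<beta> (\<Sum>l\<in>UNIV. mu $ l + \<phi> (H + \<eta>) $ l / \<eta>)"
  have G: "(\<Sum>l\<in>UNIV. mu $ l + (\<phi> (s + \<eta>) $ l - \<phi> s $ l) / \<eta>) \<le> G" if "0 \<le> s" "s \<le> H" for s
  proof -
    have "(\<Sum>l\<in>UNIV. mu $ l + (\<phi> (s + \<eta>) $ l - \<phi> s $ l) / \<eta>) \<le> (\<Sum>l\<in>UNIV. mu $ l + \<phi> (H + \<eta>) $ l / \<eta>)"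
    proof (intro sum_mono add_left_mono divide_right_mono)
      fix l
      show "\<phi> (s + \<eta>) $ l - \<phi> s $ l \<le> \<phi> (H + \<eta>) $ l"
        using phi_increasing[of "s + \<eta>" "H + \<eta>" l] phi_increasing[of 0 s l] that \<eta> by (simp add: phi_0)
    qed (use \<eta> in auto)
    thus ?thesis by (simp add: G_def)
  qed
  have \<beta>G: "\<beta> \<le> G" by (simp add: G_def)
  define A0 where "A0 = exp (K * ln (G / \<beta>))"
  define \<gamma> where "\<gamma> = \<beta> * \<delta>1 / 4"
  have \<gamma>: "0 < \<gamma>" using \<beta> \<delta>1 by (simp add: \<gamma>_def)
  define \<epsilon> where "\<epsilon> = \<delta>1 / 8"
  show ?thesis
  proof (rule that[OF \<gamma>])
    show "0 < \<epsilon>" using \<delta>1 by (simp add: \<epsilon>_def)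
    have "\<forall>\<^sub>F n :: nat in sequentially. max 1 (ln (2 * Kc + A0) / \<gamma>) \<le> real n"
      using filterlim_real_sequentially unfolding filterlim_at_top by blast
    thus "\<forall>\<^sub>F n :: nat in sequentially. \<exists>Z :: real \<Rightarrow> nat ^ 'k \<Rightarrow> real. (\<forall>t x. 0 \<le> Z t x) \<and>
      (\<forall>t h x. 0 \<le> t \<longrightarrow> 0 \<le> h \<longrightarrow> t + h \<le> real n * H \<longrightarrow>
         (\<integral>\<^sup>+y. ennreal (Z (t + h) y) \<partial>measure_pmf (p' h x)) \<le> ennreal (Z t x)) \<and>
      (\<forall>t x. 0 \<le> t \<longrightarrow> t \<le> real n * H \<longrightarrow> \<delta> < norm ((\<chi> k. real (x $ k) / real n) - z (t / real n)) \<longrightarrow> 1 \<le> Z t x) \<and>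
      (\<forall>x. (\<forall>k. \<bar>real (x $ k) - real n * r $ k\<bar> \<le> \<epsilon> * real n) \<longrightarrow> Z 0 x \<le> exp (- \<gamma> * real n))"
    proof eventually_elim
      case (elim n)
      define m where "m = real n"
      have m: "1 \<le> m" "ln (2 * Kc + A0) \<le> \<gamma> * m" using elim \<gamma> by (auto simp: m_def divide_le_eq mult.commute)
      define C where "C = exp (K * (ln (G / \<beta>) + \<beta> * (2 * m * \<omega>)))"
      have C0: "0 < C" by (simp add: C_def)
      \<comment> \<open>The reciprocal of the least discounted value of a deviating state. Since
        \<gamma> is a quarter of \<open>\<beta> * \<delta>1\<close>, S is at most
        \<open>exp (- 3 * \<gamma> * m)\<close>, while the sum at the start is at most
        \<open>exp (2 * \<gamma> * m)\<close>: one \<gamma> for the initial distance, one for the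
        constants.\<close>
      define S where "S = exp (c * (m * H) - \<beta> * (m * \<delta>1))"
      define Z where "Z t x = S * (exp (- c * t) * (V m \<eta> \<beta> t x + C))" for t x
      have pos: "0 \<le> exp (- c * t) * (V m \<eta> \<beta> t x + C)" for t x
        using V_pos[of m \<eta> \<beta> t x] C0 by (intro mult_nonneg_nonneg add_nonneg_nonneg) auto
      have S0: "0 < S" by (simp add: S_def)
      show ?case unfolding m_def[symmetric]
      proof (intro exI[of _ Z] conjI allI impI)
        show "0 \<le> Z t x" for t x using pos S0 by (simp add: Z_def)
      next
        fix t h x assume t: "0 \<le> t" "0 \<le> h" "t + h \<le> m * H"
        have "(\<integral>\<^sup>+y. ennreal (Z (t + h) y) \<partial>measure_pmf (p' h x))
          = ennreal S * (\<integral>\<^sup>+y. ennreal (exp (- c * (t + h)) * (V m \<eta> \<beta> (t + h) y + C)) \<partial>measure_pmf (p' h x))"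
          using S0 pos unfolding Z_def by (simp add: ennreal_mult nn_integral_cmult del: mult_minus_left)
        also have "\<dots> \<le> ennreal S * ennreal (exp (- c * t) * (V m \<eta> \<beta> t x + C))"
        proof (rule mult_left_mono)
          show "(\<integral>\<^sup>+y. ennreal (exp (- c * (t + h)) * (V m \<eta> \<beta> (t + h) y + C)) \<partial>measure_pmf (p' h x))
            \<le> ennreal (exp (- c * t) * (V m \<eta> \<beta> t x + C))"
            by (rule exp_supermartingale[OF js, where G = G and \<kappa> = \<kappa> and \<omega> = \<omega> and H = H])
              (use m \<eta> H \<beta> \<beta>G \<kappa> osc G t C_def c_def K_def in auto)
        qed simp
        also have "\<dots> = ennreal (Z t x)" using S0 pos unfolding Z_def by (simp add: ennreal_mult del: mult_minus_left)
        finally show "(\<integral>\<^sup>+y. ennreal (Z (t + h) y) \<partial>measure_pmf (p' h x)) \<le> ennreal (Z t x)" .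
      next
        fix t x assume t: "0 \<le> t" "t \<le> m * H" and bad: "\<delta> < norm ((\<chi> k. real (x $ k) / m) - z (t / m))"
        define s where "s = t / m"
        have s: "0 \<le> s" "s \<le> H" using t m by (auto simp: s_def divide_le_eq mult.commute)
        define u where "u = (1 / m) *\<^sub>R (R *v (\<chi> k. real (x $ k))) - what \<eta> s"
        have u: "\<bar>u $ l\<bar> \<le> cc $ l * (Ymax m \<eta> t x / m)" for l
        proof -
          have "u $ l = cc $ l * Y m \<eta> t l x / m" using cc_pos[of l] m by (simp add: u_def Y_def s_def field_simps)
          thus ?thesis using Y_le_Ymax[of m \<eta> t l x] cc_pos[of l] m by (simp add: abs_mult divide_right_mono)
        qed
        have Y0: "0 \<le> Ymax m \<eta> t x" using Y_le_Ymax abs_ge_zero order_trans by blast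
        have n1: "norm (DD *v u) \<le> B * (Ymax m \<eta> t x / m)" using Y0 m by (intro B u) auto
        have du: "DD *v u = (\<chi> k. real (x $ k) / m) - DD *v what \<eta> s"
        proof -
          have "DD *v u = (1 / m) *\<^sub>R (\<chi> k. real (x $ k)) - DD *v what \<eta> s"
            unfolding u_def by (simp only: matrix_vector_mult_diff_distrib matrix_vector_mult_scaleR DD_R)
          moreover have "(1 / m) *\<^sub>R (\<chi> k. real (x $ k)) = (\<chi> k. real (x $ k) / m)" by (simp add: vec_eq_iff)
          ultimately show ?thesis by simp
        qed
        have n2: "norm (DD *v what \<eta> s - z s) \<le> Kc * \<omega>"
        proof -
          have "norm (DD *v what \<eta> s - z s) \<le> (\<Sum>l\<in>UNIV. \<bar>(DD *v what \<eta> s - z s) $ l\<bar>)" by (rule norm_le_l1_cart)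
          also have "\<dots> \<le> (\<Sum>l\<in>(UNIV :: 'k set). \<omega>)"
          proof (rule sum_mono)
            fix l
            have "z s $ l - \<omega> \<le> z a $ l \<and> z a $ l \<le> z s $ l + \<omega>" if "s \<le> a" "a \<le> s + \<eta>" for a
              using osc[OF s that, of l] by (auto simp: abs_le_iff)
            from z_what_bounds[OF s(1) \<eta>(1) this] show "\<bar>(DD *v what \<eta> s - z s) $ l\<bar> \<le> \<omega>"
              by (simp add: abs_le_iff)
          qed
          finally show ?thesis by (simp add: Kc_def)
        qed
        have "\<delta> < norm (DD *v u + (DD *v what \<eta> s - z s))" using bad unfolding du s_def[symmetric] by simp
        also have "\<dots> \<le> norm (DD *v u) + norm (DD *v what \<eta> s - z s)" by (rule norm_triangle_ineq)
        also have "\<dots> \<le> B * (Ymax m \<eta> t x / m) + \<delta> / 2" using n1 n2 \<omega>(2) by linarith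
        finally have "\<delta> / 2 < B * (Ymax m \<eta> t x / m)" by linarith
        hence Ybig: "m * \<delta>1 \<le> Ymax m \<eta> t x" using B m by (simp add: \<delta>1_def field_simps)
        have "1 = S * (exp (- c * (m * H)) * exp (\<beta> * (m * \<delta>1)))" by (simp add: S_def flip: exp_add)
        also have "\<dots> \<le> S * (exp (- c * t) * (V m \<eta> \<beta> t x + C))"
        proof (intro mult_left_mono mult_mono)
          have "0 \<le> c" using Lam0 by (simp add: c_def)
          thus "exp (- c * (m * H)) \<le> exp (- c * t)" using t by (simp add: mult_left_mono)
          have "exp (\<beta> * (m * \<delta>1)) \<le> exp (\<beta> * Ymax m \<eta> t x)" using Ybig \<beta> by simp
          also have "\<dots> \<le> V m \<eta> \<beta> t x" using \<beta> by (intro exp_Ymax_le_V) auto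
          finally show "exp (\<beta> * (m * \<delta>1)) \<le> V m \<eta> \<beta> t x + C" using C0 by simp
        qed (use S0 in auto)
        finally show "1 \<le> Z t x" by (simp add: Z_def)
      next
        fix x assume x: "\<forall>k. \<bar>real (x $ k) - m * r $ k\<bar> \<le> \<epsilon> * m"
        have Yb: "\<bar>Y m \<eta> 0 l x\<bar> \<le> m * (\<delta>1 / 4)" for l
        proof -
          define v where "v = (\<chi> k. real (x $ k)) - m *\<^sub>R (DD *v what \<eta> 0)"
          have v: "\<bar>v $ k\<bar> \<le> m * (\<delta>1 / 4)" for k
          proof -
            have "z 0 $ k - \<omega> \<le> z a $ k \<and> z a $ k \<le> z 0 $ k + \<omega>" if "0 \<le> a" "a \<le> 0 + \<eta>" for a
              using osc[of 0 a k] that H by (auto simp: abs_le_iff)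
            from z_what_bounds[OF order_refl \<eta>(1) this] have "\<bar>r $ k - (DD *v what \<eta> 0) $ k\<bar> \<le> \<omega>"
              by (simp add: abs_le_iff z_0)
            hence "m * \<bar>r $ k - (DD *v what \<eta> 0) $ k\<bar> \<le> m * \<omega>" using m by (intro mult_left_mono) auto
            hence 1: "\<bar>m * (r $ k - (DD *v what \<eta> 0) $ k)\<bar> \<le> m * \<omega>" using m by (simp add: abs_mult)
            have "v $ k = (real (x $ k) - m * r $ k) + m * (r $ k - (DD *v what \<eta> 0) $ k)"
              by (simp add: v_def right_diff_distrib)
            hence "\<bar>v $ k\<bar> \<le> \<epsilon> * m + m * \<omega>" using 1 x[rule_format, of k] by linarith
            also have "\<dots> = m * (\<epsilon> + \<omega>)" by (simp add: algebra_simps)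
            also have "\<dots> \<le> m * (\<delta>1 / 4)" using m \<omega>16 \<delta>1 by (intro mult_left_mono) (auto simp: \<epsilon>_def)
            finally show ?thesis .
          qed
          have "R *v v = R *v (\<chi> k. real (x $ k)) - m *\<^sub>R what \<eta> 0"
            unfolding v_def by (simp only: matrix_vector_mult_diff_distrib matrix_vector_mult_scaleR R_DD)
          hence "Y m \<eta> 0 l x = (R *v v) $ l / cc $ l" by (simp add: Y_def)
          also have "\<bar>\<dots>\<bar> = \<bar>\<Sum>k\<in>UNIV. R $ l $ k * v $ k\<bar> / cc $ l"
            using cc_pos[of l] by (simp add: matrix_vector_mult_def)
          also have "\<dots> \<le> (\<Sum>k\<in>UNIV. R $ l $ k * (m * (\<delta>1 / 4))) / cc $ l"
            proof (intro divide_right_mono order_trans[OF sum_abs] sum_mono)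
            fix k show "\<bar>R $ l $ k * v $ k\<bar> \<le> R $ l $ k * (m * (\<delta>1 / 4))"
              unfolding abs_mult abs_of_nonneg[OF R_nonneg] by (rule mult_left_mono[OF v R_nonneg])
          qed (use cc_pos[of l] in simp)
          also have "\<dots> = m * (\<delta>1 / 4)"
          proof -
            have "(\<Sum>k\<in>UNIV. R $ l $ k * (m * (\<delta>1 / 4))) = cc $ l * (m * (\<delta>1 / 4))"
              unfolding cc_row by (rule sum_distrib_right[symmetric])
            thus ?thesis using cc_pos[of l] by simp
          qed
          finally show ?thesis .
        qed
        have "V m \<eta> \<beta> 0 x \<le> (\<Sum>l\<in>(UNIV :: 'k set). exp (\<beta> * (m * (\<delta>1 / 4))) + exp (\<beta> * (m * (\<delta>1 / 4))))"
          unfolding V_def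
        proof (intro sum_mono add_mono)
          fix l
          have "\<beta> * \<bar>Y m \<eta> 0 l x\<bar> \<le> \<beta> * (m * (\<delta>1 / 4))" using \<beta> Yb by (intro mult_left_mono) auto
          moreover have "\<beta> * Y m \<eta> 0 l x \<le> \<beta> * \<bar>Y m \<eta> 0 l x\<bar>" "\<beta> * (- Y m \<eta> 0 l x) \<le> \<beta> * \<bar>Y m \<eta> 0 l x\<bar>"
            using \<beta> by (intro mult_left_mono; simp)+
          ultimately show "exp (\<beta> * Y m \<eta> 0 l x) \<le> exp (\<beta> * (m * (\<delta>1 / 4)))"
            "exp (- \<beta> * Y m \<eta> 0 l x) \<le> exp (\<beta> * (m * (\<delta>1 / 4)))" by auto
        qed
        also have "\<dots> = 2 * Kc * exp (\<gamma> * m)" by (simp add: Kc_def \<gamma>_def algebra_simps)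
        finally have V1: "V m \<eta> \<beta> 0 x \<le> 2 * Kc * exp (\<gamma> * m)" .
        have "C = A0 * exp (2 * \<beta> * m * (K * \<omega>))" by (simp add: C_def A0_def algebra_simps flip: exp_add)
        also have "\<dots> \<le> A0 * exp (\<gamma> * m)"
        proof -
          have "2 * \<beta> * m * (K * \<omega>) \<le> 2 * \<beta> * m * (\<delta>1 / 16)" using \<beta> m \<omega> by (intro mult_left_mono) auto
          also have "\<dots> \<le> \<gamma> * m" using \<beta> m \<delta>1 by (simp add: \<gamma>_def)
          finally show ?thesis by (simp add: A0_def)
        qed
        finally have "V m \<eta> \<beta> 0 x + C \<le> (2 * Kc + A0) * exp (\<gamma> * m)" using V1 by (simp add: algebra_simps)
        also have "2 * Kc + A0 \<le> exp (\<gamma> * m)"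
        proof -
          have "0 < 2 * Kc + A0" using Kc by (auto simp: A0_def intro!: add_pos_pos)
          hence "2 * Kc + A0 = exp (ln (2 * Kc + A0))" by simp
          thus ?thesis using m(2) by (metis exp_le_cancel_iff)
        qed
        finally have VC: "V m \<eta> \<beta> 0 x + C \<le> exp (\<gamma> * m) * exp (\<gamma> * m)" by (simp add: mult_right_mono)
        have "m * (c * H) \<le> m * (\<beta> * \<delta>1 / 4)" using cH m by (intro mult_left_mono) auto
        hence "S \<le> exp (\<gamma> * m - 4 * (\<gamma> * m))" unfolding S_def by (simp add: \<gamma>_def algebra_simps)
        hence "Z 0 x \<le> exp (\<gamma> * m - 4 * (\<gamma> * m)) * (exp (\<gamma> * m) * exp (\<gamma> * m))"
          unfolding Z_def by (rule mult_mono) (use VC pos[of 0 x] in auto)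
        also have "\<dots> = exp (- \<gamma> * m)" by (simp add: algebra_simps flip: exp_add)
        finally show "Z 0 x \<le> exp (- \<gamma> * m)" .
      qed
    qed
  qed
qed

end

section \<open>Maximal inequalities on grids\<close>

lemma pred_sets:
  assumes "f \<in> measurable M (count_space UNIV)"
  shows "{\<omega> \<in> space M. S (f \<omega>)} \<in> sets M"
proof -
  have "{\<omega> \<in> space M. S (f \<omega>)} = f -` Collect S \<inter> space M" by auto
  thus ?thesis using measurable_sets[OF assms, of "Collect S"] by simp
qed

text \<open>Doob's maximal inequality by induction on the number of remaining steps, conditioning on
  the path so far. Path probabilities are only bounded above by an initial weight \<open>a\<close>
  times transition probabilities, and \<open>a\<close> need not be a probability: this is the form
  in which the reversed path is available, with the unnormalised weight as \<open>a\<close>. The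
  initial state y is kept fixed so that the sum over y can be restricted later.\<close>

lemma maximal_inequality:
  fixes R :: "nat \<Rightarrow> 'w \<Rightarrow> 's::countable" and \<kappa> :: "'s \<Rightarrow> 's pmf" and Z :: "nat \<Rightarrow> 's \<Rightarrow> real"
  assumes "prob_space M"
    and meas: "\<And>i. i \<le> J \<Longrightarrow> R i \<in> measurable M (count_space UNIV)"
    and fd: "\<And>n x. n \<le> J \<Longrightarrow> measure M {\<omega> \<in> space M. \<forall>i\<le>n. R i \<omega> = x i} \<le> a (x 0) * (\<Prod>i<n. pmf (\<kappa> (x i)) (x (Suc i)))"
    and a: "\<And>x. 0 \<le> a x"
    and super: "\<And>j x. j < J \<Longrightarrow> (\<integral>\<^sup>+y. ennreal (Z (Suc j) y) \<partial>measure_pmf (\<kappa> x)) \<le> ennreal (Z j x)"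
    and bad: "\<And>j x. j \<le> J \<Longrightarrow> B j x \<Longrightarrow> 1 \<le> Z j x"
  shows "emeasure M {\<omega> \<in> space M. R 0 \<omega> = y \<and> (\<exists>j\<le>J. B j (R j \<omega>))} \<le> ennreal (a y) * ennreal (Z 0 y)"
proof -
  interpret prob_space M by fact
  define pr where "pr n x = a (x 0) * (\<Prod>i<n. pmf (\<kappa> (x i)) (x (Suc i)))" for n and x :: "nat \<Rightarrow> 's"
  have pr0: "0 \<le> pr n x" for n x unfolding pr_def using a by (intro mult_nonneg_nonneg prod_nonneg) auto
  define E where "E j m x = {\<omega> \<in> space M. (\<forall>i\<le>j. R i \<omega> = x i) \<and> (\<exists>i. j \<le> i \<and> i \<le> j + m \<and> B i (R i \<omega>))}" for j m x
  have cyl: "{\<omega> \<in> space M. \<forall>i\<le>j. R i \<omega> = x i} \<in> sets M" if "j \<le> J" for j x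
  proof -
    have "{\<omega> \<in> space M. \<forall>i\<in>{..j}. R i \<omega> = x i} \<in> sets M"
    proof (rule sets.sets_Collect_finite_All')
      fix i assume "i \<in> {..j}"
      thus "{\<omega> \<in> space M. R i \<omega> = x i} \<in> sets M"
        using pred_sets[OF meas, of i "\<lambda>v. v = x i"] that by simp
    qed auto
    thus ?thesis unfolding Ball_def atMost_iff .
  qed
  have Em: "E j m x \<in> sets M" if "j + m \<le> J" for j m x
  proof -
    have "E j m x = {\<omega> \<in> space M. \<forall>i\<le>j. R i \<omega> = x i} \<inter> (\<Union>i\<in>{j..j+m}. {\<omega> \<in> space M. B i (R i \<omega>)})"
      by (auto simp: E_def)
    moreover have "(\<Union>i\<in>{j..j+m}. {\<omega> \<in> space M. B i (R i \<omega>)}) \<in> sets M"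
    proof (rule sets.finite_UN)
      fix i assume "i \<in> {j..j+m}"
      thus "{\<omega> \<in> space M. B i (R i \<omega>)} \<in> sets M"
        using pred_sets[OF meas, of i "B i"] that by simp
    qed simp
    moreover have "j \<le> J" using that by simp
    ultimately show ?thesis using sets.Int[OF cyl[of j x]] by (simp only:)
  qed
  have main: "emeasure M (E j m x) \<le> ennreal (pr j x) * ennreal (Z j (x j))" if "j + m \<le> J" for j m x
    using that
  proof (induction m arbitrary: j x)
    case (0 j x)
    show ?case
    proof (cases "B j (x j)")
      case True
      have "emeasure M (E j 0 x) \<le> emeasure M {\<omega> \<in> space M. \<forall>i\<le>j. R i \<omega> = x i}"
        using 0 by (intro emeasure_mono cyl) (auto simp: E_def)
      also have "\<dots> \<le> ennreal (pr j x) * 1"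
        using 0 fd[of j x] by (simp add: emeasure_eq_measure pr_def ennreal_leI)
      also have "\<dots> \<le> ennreal (pr j x) * ennreal (Z j (x j))"
        using bad[OF _ True] 0 by (intro mult_left_mono) (auto simp: ennreal_leI simp flip: ennreal_1)
      finally show ?thesis .
    next
      case False
      hence "E j 0 x = {}" by (auto simp: E_def)
      thus ?thesis by simp
    qed
  next
    case (Suc m j x)
    show ?case
    proof (cases "B j (x j)")
      case True
      have "emeasure M (E j (Suc m) x) \<le> emeasure M {\<omega> \<in> space M. \<forall>i\<le>j. R i \<omega> = x i}"
        using Suc.prems by (intro emeasure_mono cyl) (auto simp: E_def)
      also have "\<dots> \<le> ennreal (pr j x) * 1"
        using Suc.prems fd[of j x] by (simp add: emeasure_eq_measure pr_def ennreal_leI)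
      also have "\<dots> \<le> ennreal (pr j x) * ennreal (Z j (x j))"
        using bad[OF _ True] Suc.prems by (intro mult_left_mono) (auto simp: ennreal_leI simp flip: ennreal_1)
      finally show ?thesis .
    next
      case False
      define x' where "x' v = x(Suc j := v)" for v
      have "E j (Suc m) x \<subseteq> (\<Union>v. E (Suc j) m (x' v))"
      proof
        fix \<omega> assume w: "\<omega> \<in> E j (Suc m) x"
        then obtain i where i: "j \<le> i" "i \<le> j + Suc m" "B i (R i \<omega>)" by (auto simp: E_def)
        have c: "\<forall>i\<le>j. R i \<omega> = x i" and sp: "\<omega> \<in> space M" using w unfolding E_def by blast+
        have "R j \<omega> = x j" using c by blast
        hence "i \<noteq> j" using i False by metis
        hence i': "Suc j \<le> i" "i \<le> Suc j + m" using i by simp_all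
        have "\<forall>l\<le>Suc j. R l \<omega> = x' (R (Suc j) \<omega>) l" using c by (simp add: x'_def le_Suc_eq)
        hence "\<omega> \<in> E (Suc j) m (x' (R (Suc j) \<omega>))" unfolding E_def using sp i' i(3) by blast
        thus "\<omega> \<in> (\<Union>v. E (Suc j) m (x' v))" by blast
      qed
      hence "emeasure M (E j (Suc m) x) \<le> emeasure M (\<Union>v. E (Suc j) m (x' v))"
        using Em Suc.prems by (intro emeasure_mono sets.countable_UN') auto
      also have "\<dots> = (\<integral>\<^sup>+v. emeasure M (E (Suc j) m (x' v)) \<partial>count_space UNIV)"
      proof (rule emeasure_UN_countable)
        have key: "R (Suc j) \<omega> = v" if "\<omega> \<in> E (Suc j) m (x' v)" for \<omega> v
        proof -
          have "\<forall>i\<le>Suc j. R i \<omega> = x' v i" using that unfolding E_def by blast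
          hence "R (Suc j) \<omega> = x' v (Suc j)" by blast
          thus ?thesis by (simp add: x'_def)
        qed
        show "disjoint_family_on (\<lambda>v. E (Suc j) m (x' v)) UNIV"
          unfolding disjoint_family_on_def using key by blast
      qed (use Em Suc.prems in simp_all)
      also have "\<dots> \<le> (\<integral>\<^sup>+v. ennreal (pr (Suc j) (x' v)) * ennreal (Z (Suc j) (x' v (Suc j))) \<partial>count_space UNIV)"
        using Suc.prems by (intro nn_integral_mono Suc.IH) auto
      also have "\<dots> = (\<integral>\<^sup>+v. ennreal (pr j x) * (ennreal (pmf (\<kappa> (x j)) v) * ennreal (Z (Suc j) v)) \<partial>count_space UNIV)"
      proof (rule nn_integral_cong)
        fix v
        have "pr (Suc j) (x' v) = pr j x * pmf (\<kappa> (x j)) v" by (simp add: pr_def x'_def)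
        thus "ennreal (pr (Suc j) (x' v)) * ennreal (Z (Suc j) (x' v (Suc j))) = ennreal (pr j x) * (ennreal (pmf (\<kappa> (x j)) v) * ennreal (Z (Suc j) v))"
          using pr0 by (simp add: ennreal_mult x'_def mult.assoc)
      qed
      also have "\<dots> = ennreal (pr j x) * (\<integral>\<^sup>+v. ennreal (Z (Suc j) v) \<partial>measure_pmf (\<kappa> (x j)))"
        by (simp add: nn_integral_cmult nn_integral_measure_pmf)
      also have "\<dots> \<le> ennreal (pr j x) * ennreal (Z j (x j))"
        using Suc.prems by (intro mult_left_mono super) auto
      finally show ?thesis .
    qed
  qed
  have "{\<omega> \<in> space M. R 0 \<omega> = y \<and> (\<exists>j\<le>J. B j (R j \<omega>))} = E 0 J (\<lambda>_. y)" by (auto simp: E_def)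
  thus ?thesis using main[of 0 J "\<lambda>_. y"] by (simp add: pr_def)
qed

text \<open>Grids of mesh \<open>1 / 2 ^ m\<close> are nested, so the bound, which does not depend
  on m, passes to the increasing union of the events.\<close>

lemma dyadic_maximal_inequality:
  fixes R :: "real \<Rightarrow> 'w \<Rightarrow> 's::countable" and \<kappa> :: "real \<Rightarrow> 's \<Rightarrow> 's pmf" and Z :: "real \<Rightarrow> 's \<Rightarrow> real" and y :: 's
  assumes M: "prob_space M"
    and meas: "\<And>s. 0 \<le> s \<Longrightarrow> s \<le> S \<Longrightarrow> R s \<in> measurable M (count_space UNIV)"
    and fd: "\<And>n h x. 0 < h \<Longrightarrow> real n * h \<le> S \<Longrightarrow>
       measure M {\<omega> \<in> space M. \<forall>i\<le>n. R (real i * h) \<omega> = x i} \<le> a (x 0) * (\<Prod>i<n. pmf (\<kappa> h (x i)) (x (Suc i)))"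
    and a: "\<And>x. 0 \<le> a x" and S: "0 \<le> S"
    and super: "\<And>s h x. 0 \<le> s \<Longrightarrow> 0 \<le> h \<Longrightarrow> s + h \<le> S \<Longrightarrow> (\<integral>\<^sup>+y. ennreal (Z (s + h) y) \<partial>measure_pmf (\<kappa> h x)) \<le> ennreal (Z s x)"
    and bad: "\<And>s x. 0 \<le> s \<Longrightarrow> s \<le> S \<Longrightarrow> B s x \<Longrightarrow> 1 \<le> Z s x"
  defines "E \<equiv> {\<omega> \<in> space M. R 0 \<omega> = y \<and> (\<exists>m j :: nat. real j / 2 ^ m \<le> S \<and> B (real j / 2 ^ m) (R (real j / 2 ^ m) \<omega>))}"
  shows "E \<in> sets M" "emeasure M E \<le> ennreal (a y) * ennreal (Z 0 y)"
proof -
  interpret prob_space M by fact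
  define Em where "Em m = {\<omega> \<in> space M. R 0 \<omega> = y \<and> (\<exists>j\<le>nat \<lfloor>S * 2 ^ m\<rfloor>. B (real j / 2 ^ m) (R (real j / 2 ^ m) \<omega>))}" for m :: nat
  have le_iff: "j \<le> nat \<lfloor>S * 2 ^ m\<rfloor> \<longleftrightarrow> real j / 2 ^ m \<le> S" for j m :: nat
    using S by (simp add: divide_le_eq le_nat_iff le_floor_iff)
  have EU: "E = (\<Union>m. Em m)" unfolding E_def Em_def le_iff by auto
  have sets: "Em m \<in> sets M" for m
  proof -
    have "Em m = {\<omega> \<in> space M. R 0 \<omega> = y} \<inter> (\<Union>j\<in>{..nat \<lfloor>S * 2 ^ m\<rfloor>}. {\<omega> \<in> space M. B (real j / 2 ^ m) (R (real j / 2 ^ m) \<omega>)})"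
      by (auto simp: Em_def)
    moreover have "(\<Union>j\<in>{..nat \<lfloor>S * 2 ^ m\<rfloor>}. {\<omega> \<in> space M. B (real j / 2 ^ m) (R (real j / 2 ^ m) \<omega>)}) \<in> sets M"
    proof (rule sets.finite_UN)
      fix j assume "j \<in> {..nat \<lfloor>S * 2 ^ m\<rfloor>}"
      hence "real j / 2 ^ m \<le> S" using le_iff by simp
      thus "{\<omega> \<in> space M. B (real j / 2 ^ m) (R (real j / 2 ^ m) \<omega>)} \<in> sets M"
        using pred_sets[OF meas, of "real j / 2 ^ m" "B (real j / 2 ^ m)"] by simp
    qed simp
    ultimately show ?thesis using pred_sets[OF meas[of 0], of "\<lambda>x. x = y"] S by auto
  qed
  show "E \<in> sets M" unfolding EU using sets by auto
  have inc: "incseq Em"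
  proof (rule incseq_SucI)
    fix m show "Em m \<subseteq> Em (Suc m)"
    proof
      fix \<omega> assume "\<omega> \<in> Em m"
      then obtain j where j: "real j / 2 ^ m \<le> S" "B (real j / 2 ^ m) (R (real j / 2 ^ m) \<omega>)" and w: "\<omega> \<in> space M" "R 0 \<omega> = y"
        unfolding Em_def le_iff by auto
      have "real (2 * j) / 2 ^ Suc m = real j / 2 ^ m" by simp
      thus "\<omega> \<in> Em (Suc m)" unfolding Em_def le_iff using j w by (auto intro!: exI[of _ "2 * j"])
    qed
  qed
  have bound: "emeasure M (Em m) \<le> ennreal (a y) * ennreal (Z 0 y)" for m
  proof -
    define h where "h = 1 / (2 :: real) ^ m"
    define J where "J = nat \<lfloor>S * 2 ^ m\<rfloor>"
    have h: "0 < h" by (simp add: h_def)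
    have J: "real j * h \<le> S" if "j \<le> J" for j using that by (simp add: J_def le_iff h_def)
    have "emeasure M {\<omega> \<in> space M. R (real 0 * h) \<omega> = y \<and> (\<exists>j\<le>J. B (real j * h) (R (real j * h) \<omega>))} \<le> ennreal (a y) * ennreal (Z (real 0 * h) y)"
    proof (rule maximal_inequality[where R = "\<lambda>i. R (real i * h)" and Z = "\<lambda>i. Z (real i * h)" and B = "\<lambda>i. B (real i * h)" and \<kappa> = "\<kappa> h", OF M _ fd a])
      fix j x assume "j < J"
      hence "real j * h + h \<le> S" using J[of "Suc j"] by (simp add: algebra_simps)
      thus "(\<integral>\<^sup>+y. ennreal (Z (real (Suc j) * h) y) \<partial>measure_pmf (\<kappa> h x)) \<le> ennreal (Z (real j * h) x)"
        using super[of "real j * h" h x] h by (simp add: algebra_simps)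
    qed (use J h in \<open>auto intro!: meas bad\<close>)
    thus ?thesis by (simp add: Em_def J_def h_def)
  qed
  have "emeasure M E = (SUP m. emeasure M (Em m))"
    unfolding EU using sets inc by (intro SUP_emeasure_incseq[symmetric]) auto
  also have "\<dots> \<le> ennreal (a y) * ennreal (Z 0 y)" by (rule SUP_least) (rule bound)
  finally show "emeasure M E \<le> ennreal (a y) * ennreal (Z 0 y)" .
qed

section \<open>One-dimensional laws and right continuity\<close>

locale markov_process = prob_space M for M :: "'w measure" +
  fixes X :: "real \<Rightarrow> 'w \<Rightarrow> 's::countable" and p :: "real \<Rightarrow> 's \<Rightarrow> 's pmf" and o0 :: 's
  assumes meas: "\<And>t. 0 \<le> t \<Longrightarrow> X t \<in> measurable M (count_space UNIV)"
    and right_cont: "\<And>\<omega> t. \<omega> \<in> space M \<Longrightarrow> 0 \<le> t \<Longrightarrow> \<forall>\<^sub>F s in at_right t. X s \<omega> = X t \<omega>"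
    and fdd: "\<And>n (t :: nat \<Rightarrow> real) (x :: nat \<Rightarrow> 's). 0 \<le> t 0 \<Longrightarrow> (\<forall>i\<le>n. t i \<le> t (Suc i)) \<Longrightarrow>
           \<P>(\<omega> in M. \<forall>i\<le>Suc n. X (t i) \<omega> = x i) =
           \<P>(\<omega> in M. \<forall>i\<le>n. X (t i) \<omega> = x i) * pmf (p (t (Suc n) - t n) (x n)) (x (Suc n))"
    and start: "AE \<omega> in M. X 0 \<omega> = o0"
begin

lemma fdd_grid:
  assumes "0 \<le> t0" "0 \<le> h"
  shows "\<P>(\<omega> in M. \<forall>i\<le>n. X (t0 + real i * h) \<omega> = x i) = \<P>(\<omega> in M. X t0 \<omega> = x 0) * (\<Prod>i<n. pmf (p h (x i)) (x (Suc i)))"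
proof (induction n)
  case (Suc n)
  have "\<P>(\<omega> in M. \<forall>i\<le>Suc n. X (t0 + real i * h) \<omega> = x i) =
      \<P>(\<omega> in M. \<forall>i\<le>n. X (t0 + real i * h) \<omega> = x i) * pmf (p (t0 + real (Suc n) * h - (t0 + real n * h)) (x n)) (x (Suc n))"
    by (rule fdd) (use assms in \<open>simp_all add: mult_right_mono\<close>)
  moreover have "t0 + real (Suc n) * h - (t0 + real n * h) = h" by (simp add: algebra_simps)
  ultimately show ?case by (simp add: Suc.IH mult.assoc)
qed simp

text \<open>The axiom \<open>fdd\<close> relates laws at two or more times, so the law at t is read
  off from the pair of times 0 and t, the first carrying an almost surely fixed state.\<close>

lemma marginal:
  assumes t: "0 \<le> t"
  shows "\<P>(\<omega> in M. X t \<omega> = y) = pmf (p t o0) y"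
proof -
  define x :: "nat \<Rightarrow> 's" where "x i = (if i = 0 then o0 else y)" for i
  define s :: "nat \<Rightarrow> real" where "s i = (if i = 0 then 0 else t)" for i
  have m0: "{\<omega> \<in> space M. X 0 \<omega> = o0} \<in> sets M" by (intro pred_sets meas) simp
  have 1: "\<P>(\<omega> in M. \<forall>i\<le>0. X (s i) \<omega> = x i) = 1"
    using start m0 by (simp add: s_def x_def prob_eq_1)
  have "\<P>(\<omega> in M. \<forall>i\<le>Suc 0. X (s i) \<omega> = x i) = \<P>(\<omega> in M. X t \<omega> = y)"
  proof (rule finite_measure_eq_AE)
    show "AE \<omega> in M. (\<omega> \<in> {\<omega> \<in> space M. \<forall>i\<le>Suc 0. X (s i) \<omega> = x i}) = (\<omega> \<in> {\<omega> \<in> space M. X t \<omega> = y})"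
      using start by eventually_elim (auto simp: s_def x_def le_Suc_eq)
    have "{\<omega> \<in> space M. \<forall>i\<le>Suc 0. X (s i) \<omega> = x i} = {\<omega> \<in> space M. X 0 \<omega> = o0} \<inter> {\<omega> \<in> space M. X t \<omega> = y}"
      by (auto simp: s_def x_def le_Suc_eq)
    moreover have m1: "{\<omega> \<in> space M. X t \<omega> = y} \<in> sets M" using t by (intro pred_sets meas)
    ultimately show "{\<omega> \<in> space M. \<forall>i\<le>Suc 0. X (s i) \<omega> = x i} \<in> sets M" using m0 by auto
    show "{\<omega> \<in> space M. X t \<omega> = y} \<in> sets M" by (rule m1)
  qed
  moreover have "\<P>(\<omega> in M. \<forall>i\<le>Suc 0. X (s i) \<omega> = x i) = 1 * pmf (p (s (Suc 0) - s 0) (x 0)) (x (Suc 0))"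
    using fdd[of s 0 x] t 1 by (simp add: s_def)
  ultimately show ?thesis by (simp add: s_def x_def)
qed

lemma prob_marginal:
  assumes t: "0 \<le> t"
  shows "\<P>(\<omega> in M. X t \<omega> \<in> S) = measure_pmf.prob (p t o0) S"
proof -
  have m: "X t -` S' \<inter> space M \<in> sets M" for S' using measurable_sets[OF meas[OF t]] by simp
  have "emeasure M (X t -` S \<inter> space M) = (\<integral>\<^sup>+y. emeasure M (X t -` {y} \<inter> space M) \<partial>count_space S)"
  proof -
    have "X t -` S \<inter> space M = (\<Union>y\<in>S. X t -` {y} \<inter> space M)" by auto
    thus ?thesis using m by (simp only:) (intro emeasure_UN_countable, auto simp: disjoint_family_on_def)
  qed
  also have "\<dots> = (\<integral>\<^sup>+y. ennreal (pmf (p t o0) y) \<partial>count_space S)"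
  proof (rule nn_integral_cong)
    fix y
    have "X t -` {y} \<inter> space M = {\<omega> \<in> space M. X t \<omega> = y}" by auto
    thus "emeasure M (X t -` {y} \<inter> space M) = ennreal (pmf (p t o0) y)"
      using marginal[OF t, of y] by (simp add: emeasure_eq_measure)
  qed
  also have "\<dots> = emeasure (measure_pmf (p t o0)) S" by (rule nn_integral_pmf)
  finally have "measure M (X t -` S \<inter> space M) = measure_pmf.prob (p t o0) S"
    by (simp add: emeasure_eq_measure measure_pmf.emeasure_eq_measure)
  moreover have "X t -` S \<inter> space M = {\<omega> \<in> space M. X t \<omega> \<in> S}" by auto
  ultimately show ?thesis by simp
qed

lemma right_cont_dyadic:
  assumes w: "\<omega> \<in> space M" and t: "0 \<le> t" "t < T"
  obtains s where "t < s" "s < T" "\<forall>u\<in>{t..s}. X u \<omega> = X t \<omega>"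
proof -
  obtain b where b: "b > t" "\<And>y. t < y \<Longrightarrow> y < b \<Longrightarrow> X y \<omega> = X t \<omega>"
    using right_cont[OF w t(1)] unfolding eventually_at_right_field by auto
  define m where "m = min b T"
  have m: "t < m" "m \<le> b" "m \<le> T" using b(1) t by (auto simp: m_def)
  show ?thesis
  proof (rule that)
    show "t < (t + m) / 2" "(t + m) / 2 < T" using m by simp_all
    show "\<forall>u\<in>{t..(t + m) / 2}. X u \<omega> = X t \<omega>"
    proof
      fix u assume u: "u \<in> {t..(t + m) / 2}"
      show "X u \<omega> = X t \<omega>"
      proof (cases "u = t")
        case False
        show ?thesis by (rule b(2)) (use False u m in simp_all)
      qed simp
    qed
  qed
qed

end

section \<open>The overflow time\<close>

lemma is_norm_bound:
  fixes N :: "real ^ 'k \<Rightarrow> real"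
  assumes N: "is_norm N"
  obtains C where "0 < C" "\<And>x. N x \<le> C * norm x"
proof
  have N0: "0 \<le> N x" and Nadd: "N (x + y) \<le> N x + N y" and Nsc: "N (c *\<^sub>R x) = \<bar>c\<bar> * N x" and Nz: "N 0 = 0" for x y c
    using N by (auto simp: is_norm_def)
  define C where "C = (\<Sum>k\<in>UNIV. N (axis k 1)) + 1"
  show "0 < C" unfolding C_def by (intro add_nonneg_pos sum_nonneg N0) simp
  fix x
  have Nsum: "N (\<Sum>k\<in>S. f k) \<le> (\<Sum>k\<in>S. N (f k))" if "finite S" for S :: "'k set" and f
    using that by induction (auto simp: Nz intro: order_trans[OF Nadd])
  have "N x = N (\<Sum>k\<in>UNIV. x $ k *\<^sub>R axis k 1)"
    by (rule arg_cong[of _ _ N]) (simp add: vec_eq_iff axis_def if_distrib[of "\<lambda>y. _ * y"] cong: if_cong)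
  also have "\<dots> \<le> (\<Sum>k\<in>UNIV. N (x $ k *\<^sub>R axis k 1))" by (rule Nsum) simp
  also have "\<dots> \<le> (\<Sum>k\<in>UNIV. norm x * N (axis k 1))"
    unfolding Nsc by (intro sum_mono mult_right_mono N0) (simp add: component_le_norm_cart)
  also have "\<dots> \<le> C * norm x" by (simp add: C_def algebra_simps flip: sum_distrib_left)
  finally show "N x \<le> C * norm x" .
qed

lemma is_norm_continuous:
  fixes N :: "real ^ 'k \<Rightarrow> real"
  assumes N: "is_norm N"
  shows "continuous_on S N"
proof -
  obtain C where C: "0 < C" "\<And>x. N x \<le> C * norm x" using is_norm_bound[OF N] by blast
  have tri: "N x \<le> N (x - y) + N y" for x y
    using N unfolding is_norm_def by (metis diff_add_cancel)
  have sym: "N (x - y) = N (y - x)" for x y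
    using N unfolding is_norm_def by (metis abs_minus_cancel abs_one minus_diff_eq mult_1 scaleR_minus1_left)
  have "\<bar>N x - N y\<bar> \<le> C * norm (x - y)" for x y
    using tri[of x y] tri[of y x] sym[of x y] C(2)[of "x - y"] by (simp add: abs_le_iff)
  hence "C-lipschitz_on S N" using C by (intro lipschitz_onI) (auto simp: dist_norm)
  thus ?thesis by (rule lipschitz_on_continuous_on)
qed

context markov_process begin

text \<open>The dyadic approximation uses floor plus one, so that \<sigma> is approached strictly
  from the right, where the path is eventually constant. At each level only countably many
  deterministic times occur.\<close>

lemma random_time_measurable:
  fixes g :: "'s \<Rightarrow> real"
  assumes \<sigma>[measurable]: "\<sigma> \<in> borel_measurable M" and pos: "\<And>\<omega>. \<omega> \<in> space M \<Longrightarrow> 0 \<le> \<sigma> \<omega>"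
  shows "(\<lambda>\<omega>. g (X (\<sigma> \<omega>) \<omega>)) \<in> borel_measurable M"
proof (rule borel_measurable_LIMSEQ_real)
  define j where "j m \<omega> = nat \<lfloor>\<sigma> \<omega> * 2 ^ m\<rfloor>" for m :: nat and \<omega>
  show "(\<lambda>\<omega>. g (X ((real (j m \<omega>) + 1) / 2 ^ m) \<omega>)) \<in> borel_measurable M" for m
  proof (rule measurable_compose_countable[where f = "\<lambda>i \<omega>. g (X ((real i + 1) / 2 ^ m) \<omega>)"])
    show "(\<lambda>\<omega>. g (X ((real i + 1) / 2 ^ m) \<omega>)) \<in> borel_measurable M" for i
      by (rule measurable_compose[OF meas]) auto
    show "j m \<in> measurable M (count_space UNIV)" unfolding j_def by measurable
  qed
  fix \<omega> assume w: "\<omega> \<in> space M"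
  define v where "v m = (real (j m \<omega>) + 1) / 2 ^ m" for m
  have j: "real (j m \<omega>) = of_int \<lfloor>\<sigma> \<omega> * 2 ^ m\<rfloor>" for m using pos[OF w] by (simp add: j_def)
  have gt: "\<sigma> \<omega> < v m" for m
  proof -
    have "\<sigma> \<omega> * 2 ^ m < real (j m \<omega>) + 1" unfolding j by linarith
    thus ?thesis by (simp add: v_def less_divide_eq)
  qed
  have le: "v m \<le> \<sigma> \<omega> + (1 / 2) ^ m" for m
  proof -
    have "real (j m \<omega>) + 1 \<le> \<sigma> \<omega> * 2 ^ m + 1" unfolding j by linarith
    thus ?thesis by (simp add: v_def divide_le_eq power_divide distrib_right)
  qed
  have "(\<lambda>m. \<sigma> \<omega> + (1 / 2) ^ m) \<longlonglongrightarrow> \<sigma> \<omega> + 0" by (intro tendsto_add tendsto_const LIMSEQ_power_zero) simp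
  hence "v \<longlonglongrightarrow> \<sigma> \<omega>"
    by (intro tendsto_sandwich[of "\<lambda>_. \<sigma> \<omega>" v _ "\<lambda>m. \<sigma> \<omega> + (1 / 2) ^ m"]) (auto simp: gt less_imp_le le)
  hence "filterlim v (at_right (\<sigma> \<omega>)) sequentially"
    using gt by (simp add: filterlim_at less_imp_neq[THEN not_sym])
  with right_cont[OF w pos[OF w]] have "\<forall>\<^sub>F m in sequentially. X (v m) \<omega> = X (\<sigma> \<omega>) \<omega>"
    unfolding filterlim_iff by blast
  hence "\<forall>\<^sub>F m in sequentially. g (X (\<sigma> \<omega>) \<omega>) = g (X (v m) \<omega>)" by eventually_elim simp
  thus "(\<lambda>m. g (X ((real (j m \<omega>) + 1) / 2 ^ m) \<omega>)) \<longlonglongrightarrow> g (X (\<sigma> \<omega>) \<omega>)"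
    unfolding v_def[symmetric] by (rule Lim_transform_eventually[OF tendsto_const])
qed

end

section \<open>The overflow time and the path event as measurable objects\<close>

locale queue_process = markov_process M Q p 0
  for M :: "'w measure" and Q :: "real \<Rightarrow> 'w \<Rightarrow> nat ^ 'k" and p +
  fixes A :: real and n :: nat
  assumes A: "0 < A" and n: "0 < n"
begin

definition tot :: "real \<Rightarrow> 'w \<Rightarrow> real" where "tot t \<omega> = (\<Sum>k\<in>UNIV. real (Q (real n * t) \<omega> $ k))"

abbreviation \<tau> where "\<tau> \<equiv> overflow_time Q A n"

lemma \<tau>_eq: "\<tau> \<omega> = Inf {ereal t | t. 0 \<le> t \<and> real n * A \<le> tot t \<omega>}"
  by (simp add: overflow_time_def tot_def)

lemma right_const:
  assumes w: "\<omega> \<in> space M" and t: "0 \<le> t" "t < T"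
  obtains s where "t < s" "s < T" "\<forall>u\<in>{t..s}. Q (real n * u) \<omega> = Q (real n * t) \<omega>"
proof -
  have lt: "real n * t < real n * T" using t n by simp
  obtain s where s: "real n * t < s" "s < real n * T" "\<forall>u\<in>{real n * t..s}. Q u \<omega> = Q (real n * t) \<omega>"
    by (rule right_cont_dyadic[OF w mult_nonneg_nonneg[OF of_nat_0_le_iff t(1)] lt])
  show ?thesis
  proof
    show "t < s / real n" "s / real n < T" using s n by (auto simp: field_simps)
    show "\<forall>u\<in>{t..s / real n}. Q (real n * u) \<omega> = Q (real n * t) \<omega>"
      using n by (intro ballI s(3)[THEN bspec]) (auto simp: field_simps)
  qed
qed

lemma \<tau>_nonneg: "0 \<le> \<tau> \<omega>" unfolding \<tau>_eq by (rule Inf_greatest) auto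

lemma before_\<tau>: "0 \<le> u \<Longrightarrow> ereal u < \<tau> \<omega> \<Longrightarrow> tot u \<omega> < real n * A"
  unfolding \<tau>_eq by (metis (mono_tags, lifting) Inf_lower linorder_not_less mem_Collect_eq)

lemma \<tau>_le: "0 \<le> u \<Longrightarrow> real n * A \<le> tot u \<omega> \<Longrightarrow> \<tau> \<omega> \<le> ereal u"
  unfolding \<tau>_eq by (rule Inf_lower) auto

text \<open>The infimum is attained: the state at a finite overflow time persists for a short while,
  so a state below the level there would postpone the infimum.\<close>

lemma at_\<tau>:
  assumes w: "\<omega> \<in> space M" and t: "\<tau> \<omega> = ereal t"
  shows "0 \<le> t" "real n * A \<le> tot t \<omega>"
proof -
  show t0: "0 \<le> t" using \<tau>_nonneg[of \<omega>] t by simp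
  show "real n * A \<le> tot t \<omega>"
  proof (rule ccontr)
    assume no: "\<not> real n * A \<le> tot t \<omega>"
    obtain s where s: "t < s" "s < t + 1" "\<forall>u\<in>{t..s}. Q (real n * u) \<omega> = Q (real n * t) \<omega>"
      by (rule right_const[OF w t0 less_add_one])
    have "ereal s \<le> \<tau> \<omega>" unfolding \<tau>_eq
    proof (rule Inf_greatest)
      fix e assume "e \<in> {ereal t |t. 0 \<le> t \<and> real n * A \<le> tot t \<omega>}"
      then obtain u where u: "e = ereal u" "0 \<le> u" "real n * A \<le> tot u \<omega>" by auto
      have "t \<le> u" using before_\<tau>[of u \<omega>] u t by fastforce
      have "s < u"
      proof (rule ccontr)
        assume "\<not> s < u"
        hence "tot u \<omega> = tot t \<omega>" using s(3)[THEN bspec, of u] \<open>t \<le> u\<close> by (simp add: tot_def)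
        thus False using no u by simp
      qed
      thus "ereal s \<le> e" using u by simp
    qed
    thus False using s(1) t by simp
  qed
qed

lemma tot_measurable: "0 \<le> t \<Longrightarrow> tot t \<in> borel_measurable M"
  unfolding tot_def[abs_def]
  by (rule measurable_compose[OF meas, of _ "\<lambda>x. \<Sum>k\<in>UNIV. real (x $ k)"]) (use n in auto)

lemma \<tau>_measurable: "\<tau> \<in> borel_measurable M"
proof -
  \<comment> \<open>Any time at which the level is reached is followed immediately by rational ones,
    so rational times determine the infimum. \<open>max 0\<close> sends negative indices to time 0,
    and the countable index set is a whole type.\<close>
  define f where "f u \<omega> = (if real n * A \<le> tot (max 0 (of_rat u)) \<omega> then ereal (max 0 (of_rat u)) else \<infinity>)" for u :: rat and \<omega>
  have "f u \<in> borel_measurable M" for u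
    unfolding f_def[abs_def] using tot_measurable[of "max 0 (of_rat u)"] by measurable
  hence "(\<lambda>\<omega>. INF u. f u \<omega>) \<in> borel_measurable M" by measurable
  moreover have "\<tau> \<omega> = (INF u. f u \<omega>)" if w: "\<omega> \<in> space M" for \<omega>
  proof (rule antisym)
    show "\<tau> \<omega> \<le> (INF u. f u \<omega>)" 
    proof (rule INF_greatest)
      fix u show "\<tau> \<omega> \<le> f u \<omega>" using \<tau>_le[of "max 0 (of_rat u)" \<omega>] by (simp add: f_def)
    qed
    show "(INF u. f u \<omega>) \<le> \<tau> \<omega>" unfolding \<tau>_eq
    proof (rule Inf_greatest)
      fix e assume "e \<in> {ereal t |t. 0 \<le> t \<and> real n * A \<le> tot t \<omega>}"
      then obtain t where t: "e = ereal t" "0 \<le> t" "real n * A \<le> tot t \<omega>" by auto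
      show "(INF u. f u \<omega>) \<le> e" unfolding t(1)
      proof (rule ereal_le_epsilon2[rule_format])
        fix d :: real assume "0 < d"
        obtain s where s: "t < s" "s < t + d" "\<forall>u\<in>{t..s}. Q (real n * u) \<omega> = Q (real n * t) \<omega>"
          by (rule right_const[OF w t(2) less_add_same_cancel1[THEN iffD2, OF \<open>0 < d\<close>]])
        obtain u where u: "t < of_rat u" "of_rat u < s" using of_rat_dense[OF s(1)] by blast
        have "0 \<le> real_of_rat u" using u(1) t(2) by linarith
        hence "0 \<le> u" by simp
        hence "f u \<omega> = ereal (of_rat u)" using u t s(3)[THEN bspec, of "of_rat u"] by (simp add: f_def tot_def max_def)
        moreover have "(INF u. f u \<omega>) \<le> f u \<omega>" by (rule INF_lower) simp
        ultimately show "(INF u. f u \<omega>) \<le> ereal t + ereal d" using u s by (auto intro: order_trans)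
      qed
    qed
  qed
  ultimately show ?thesis by (simp cong: measurable_cong)
qed

text \<open>By right continuity, the supremum in \<open>follows_path\<close> may be taken over the points that divide the random
  time interval in a rational ratio.\<close>

lemma follows_measurable:
  fixes N :: "real ^ 'k \<Rightarrow> real" and qs z :: "real \<Rightarrow> real ^ 'k"
  assumes N: "is_norm N" and Ts: "0 \<le> Ts" and z: "continuous_on {0..} z"
    and qs: "\<And>t. 0 \<le> t \<Longrightarrow> t \<le> Ts \<Longrightarrow> qs t = z (Ts - t)"
  shows "{\<omega> \<in> space M. follows_path N Q A n Ts qs \<delta> \<omega> \<and> \<tau> \<omega> \<le> ereal T} \<in> sets M"
proof -
  define tr where "tr \<omega> = real_of_ereal (\<tau> \<omega>)" for \<omega>
  define s0 where "s0 \<omega> = max (tr \<omega> - Ts) 0" for \<omega>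
  have tr_m[measurable]: "tr \<in> borel_measurable M" unfolding tr_def[abs_def] using \<tau>_measurable by measurable
  have s0_m[measurable]: "s0 \<in> borel_measurable M" unfolding s0_def[abs_def] by measurable
  have tr0: "0 \<le> tr \<omega>" for \<omega> using \<tau>_nonneg[of \<omega>] by (simp add: tr_def real_of_ereal_pos)
  have s0: "0 \<le> s0 \<omega>" "s0 \<omega> \<le> tr \<omega>" "tr \<omega> - s0 \<omega> \<le> Ts" for \<omega> using tr0[of \<omega>] Ts by (auto simp: s0_def)
  define f where "f \<omega> t = N (scaled Q n t \<omega> - z (max 0 (Ts - (t - s0 \<omega>))))" for \<omega> t
  define st where "st u \<omega> = s0 \<omega> + u * (tr \<omega> - s0 \<omega>)" for u \<omega>
  have fm: "(\<lambda>\<omega>. f \<omega> (st u \<omega>)) \<in> borel_measurable M" if u: "0 \<le> u" for u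
  proof -
    have st_m[measurable]: "st u \<in> borel_measurable M" unfolding st_def[abs_def] by measurable
    have st0: "0 \<le> st u \<omega>" for \<omega> using s0[of \<omega>] u by (simp add: st_def)
    have Qm: "(\<lambda>\<omega>. real (Q (real n * st u \<omega>) \<omega> $ k)) \<in> borel_measurable M" for k
      by (rule random_time_measurable[where g = "\<lambda>x. real (x $ k)" and \<sigma> = "\<lambda>\<omega>. real n * st u \<omega>"]) (use st0 in auto)
    have sc: "scaled Q n (st u \<omega>) \<omega> = (\<Sum>k\<in>UNIV. (real (Q (real n * st u \<omega>) \<omega> $ k) / real n) *\<^sub>R axis k 1)" for \<omega>
      by (simp add: vec_eq_iff scaled_def axis_def if_distrib[of "\<lambda>y. _ * y"] cong: if_cong)
    have m1: "(\<lambda>\<omega>. scaled Q n (st u \<omega>) \<omega>) \<in> borel_measurable M"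
      unfolding sc using Qm by measurable
    have "continuous_on UNIV (\<lambda>t. z (max 0 t))"
      by (rule continuous_on_compose2[OF z]) (auto intro!: continuous_intros)
    hence "(\<lambda>t. z (max 0 t)) \<in> borel_measurable borel" by (rule borel_measurable_continuous_onI)
    from measurable_compose[OF _ this, of "\<lambda>\<omega>. Ts - (st u \<omega> - s0 \<omega>)" M]
    have m2: "(\<lambda>\<omega>. z (max 0 (Ts - (st u \<omega> - s0 \<omega>)))) \<in> borel_measurable M" by measurable
    have "N \<in> borel_measurable borel" by (rule borel_measurable_continuous_onI[OF is_norm_continuous[OF N]])
    from measurable_compose[OF _ this] show ?thesis unfolding f_def using m1 m2 by measurable
  qed
  define U where "U = {u \<in> \<rat>. 0 \<le> u \<and> u \<le> (1 :: real)}"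
  \<comment> \<open>The strict bound on a supremum is not a pointwise strict bound; the uniform
    margin \<open>1 / (real m + 1)\<close> expresses it through countably many conditions.\<close>
  have iff: "follows_path N Q A n Ts qs \<delta> \<omega> \<longleftrightarrow> (\<exists>m :: nat. \<forall>u\<in>U. f \<omega> (st u \<omega>) \<le> \<delta> - 1 / (real m + 1))"
    if w: "\<omega> \<in> space M" and fin: "\<tau> \<omega> \<le> ereal T" for \<omega>
  proof -
    have teq: "\<tau> \<omega> = ereal (tr \<omega>)" using fin \<tau>_nonneg[of \<omega>] by (cases "\<tau> \<omega>") (auto simp: tr_def)
    have fp: "follows_path N Q A n Ts qs \<delta> \<omega> \<longleftrightarrow> (SUP t\<in>{s0 \<omega>..tr \<omega>}. f \<omega> t) < \<delta>"
    proof -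
      have "(SUP t\<in>{s0 \<omega>..tr \<omega>}. N (scaled Q n t \<omega> - qs (t - s0 \<omega>))) = (SUP t\<in>{s0 \<omega>..tr \<omega>}. f \<omega> t)"
        by (rule SUP_cong) (use s0[of \<omega>] in \<open>auto simp: f_def qs\<close>)
      thus ?thesis by (simp add: follows_path_def Let_def tr_def s0_def)
    qed
    have st_in: "st u \<omega> \<in> {s0 \<omega>..tr \<omega>}" if "0 \<le> u" "u \<le> 1" for u
    proof -
      have "u * (tr \<omega> - s0 \<omega>) \<le> 1 * (tr \<omega> - s0 \<omega>)" using that s0[of \<omega>] by (intro mult_right_mono) auto
      thus ?thesis using that s0[of \<omega>] by (simp add: st_def)
    qed
    \<comment> \<open>A real supremum is informative only for a bounded set. Before the overflow
      time the population is below \<open>n * A\<close>; the value at the overflow time may be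
      larger and enters separately.\<close>
    have bdd: "bdd_above (f \<omega> ` {s0 \<omega>..tr \<omega>})"
    proof -
      obtain C where C: "0 < C" "\<And>x. N x \<le> C * norm x" using is_norm_bound[OF N] by blast
      have "compact (z ` {0..Ts})" by (intro compact_continuous_image continuous_on_subset[OF z]) auto
      hence "bounded (z ` {0..Ts})" by (rule compact_imp_bounded)
      then obtain B where B: "\<forall>v\<in>z ` {0..Ts}. norm v \<le> B" unfolding bounded_iff by blast
      have "f \<omega> t \<le> C * (max A (tot (tr \<omega>) \<omega> / real n) + B)" if t: "t \<in> {s0 \<omega>..tr \<omega>}" for t
      proof -
        have sc: "norm (scaled Q n t \<omega>) \<le> tot t \<omega> / real n"
          by (rule order_trans[OF norm_le_l1_cart]) (simp add: scaled_def tot_def sum_divide_distrib)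
        have tt: "tot t \<omega> / real n \<le> max A (tot (tr \<omega>) \<omega> / real n)"
        proof (cases "t = tr \<omega>")
          case False
          hence "tot t \<omega> < real n * A" using t s0[of \<omega>] teq by (intro before_\<tau>) auto
          hence "tot t \<omega> / real n < A" using n by (simp add: divide_less_eq mult.commute)
          thus ?thesis by simp
        qed simp
        have "max 0 (Ts - (t - s0 \<omega>)) \<in> {0..Ts}" using t s0[of \<omega>] Ts by auto
        hence "norm (z (max 0 (Ts - (t - s0 \<omega>)))) \<le> B" using B by blast
        hence "norm (scaled Q n t \<omega> - z (max 0 (Ts - (t - s0 \<omega>)))) \<le> max A (tot (tr \<omega>) \<omega> / real n) + B"
          using sc tt by (intro order_trans[OF norm_triangle_ineq4]) linarith
        thus ?thesis unfolding f_def using C by (intro order_trans[OF C(2)] mult_left_mono) auto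
      qed
      thus ?thesis by (intro bdd_aboveI2)
    qed
    show ?thesis
    proof
      assume "follows_path N Q A n Ts qs \<delta> \<omega>"
      hence lt: "(SUP t\<in>{s0 \<omega>..tr \<omega>}. f \<omega> t) < \<delta>" using fp by simp
      then obtain m where m: "1 / real (Suc m) < \<delta> - (SUP t\<in>{s0 \<omega>..tr \<omega>}. f \<omega> t)"
        using nat_approx_posE[of "\<delta> - (SUP t\<in>{s0 \<omega>..tr \<omega>}. f \<omega> t)"] by auto
      show "\<exists>m :: nat. \<forall>u\<in>U. f \<omega> (st u \<omega>) \<le> \<delta> - 1 / (real m + 1)"
      proof (intro exI[of _ m] ballI)
        fix u assume "u \<in> U"
        hence "f \<omega> (st u \<omega>) \<le> (SUP t\<in>{s0 \<omega>..tr \<omega>}. f \<omega> t)"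
          by (intro cSUP_upper bdd st_in) (auto simp: U_def)
        moreover have "1 / (real m + 1) < \<delta> - (SUP t\<in>{s0 \<omega>..tr \<omega>}. f \<omega> t)" using m by (simp add: add.commute)
        ultimately show "f \<omega> (st u \<omega>) \<le> \<delta> - 1 / (real m + 1)" by linarith
      qed
    next
      assume "\<exists>m :: nat. \<forall>u\<in>U. f \<omega> (st u \<omega>) \<le> \<delta> - 1 / (real m + 1)"
      then obtain m :: nat where m: "\<And>u. u \<in> U \<Longrightarrow> f \<omega> (st u \<omega>) \<le> \<delta> - 1 / (real m + 1)" by blast
      have "f \<omega> t \<le> \<delta> - 1 / (real m + 1)" if t: "t \<in> {s0 \<omega>..tr \<omega>}" for t
      \<comment> \<open>The right end point cannot be approached from the right inside the interval;
        it belongs to the ratio 1.\<close>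
      proof (cases "t = tr \<omega>")
        case True
        have "st 1 \<omega> = t" using True by (simp add: st_def)
        thus ?thesis using m[of 1] by (simp add: U_def)
      next
        case False
        hence t': "s0 \<omega> \<le> t" "t < tr \<omega>" "0 \<le> t" using t s0[of \<omega>] by auto
        define D where "D = tr \<omega> - s0 \<omega>"
        have D: "0 < D" using t' by (simp add: D_def)
        show ?thesis
        proof (rule field_le_epsilon)
          fix e :: real assume e: "0 < e"
          obtain s where s: "t < s" "s < tr \<omega>" "\<forall>u\<in>{t..s}. Q (real n * u) \<omega> = Q (real n * t) \<omega>"
            by (rule right_const[OF w t'(3,2)])
          define g where "g u = N (scaled Q n t \<omega> - z (max 0 (Ts - (u - s0 \<omega>))))" for u
          have "continuous_on UNIV (\<lambda>u. z (max 0 (Ts - (u - s0 \<omega>))))"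
            by (rule continuous_on_compose2[OF z]) (auto intro!: continuous_intros)
          hence "continuous_on UNIV g" unfolding g_def[abs_def]
            by (intro continuous_on_compose2[OF is_norm_continuous[OF N, of UNIV]] continuous_intros) auto
          then obtain d where d: "0 < d" "\<And>u. dist u t < d \<Longrightarrow> dist (g u) (g t) < e"
            using e unfolding continuous_on_iff by (metis UNIV_I)
          have "(t - s0 \<omega>) / D < (min s (t + d) - s0 \<omega>) / D" using s d D by (intro divide_strict_right_mono) auto
          then obtain v where v: "(t - s0 \<omega>) / D < of_rat v" "of_rat v < (min s (t + d) - s0 \<omega>) / D"
            using of_rat_dense by blast
          define u where "u = (of_rat v :: real)"
          have u1: "t < st u \<omega>" using v(1) D unfolding u_def[symmetric] by (simp add: st_def D_def[symmetric] divide_less_eq)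
          have u2: "st u \<omega> < min s (t + d)" 
          proof -
            have "u * D < min s (t + d) - s0 \<omega>" using v(2) D unfolding u_def[symmetric] by (simp only: pos_less_divide_eq)
            thus ?thesis unfolding st_def D_def[symmetric] by linarith
          qed
          have "0 \<le> (t - s0 \<omega>) / D" using t' D by simp
          moreover have "(min s (t + d) - s0 \<omega>) / D \<le> 1" using s D by (simp add: divide_le_eq D_def)
          ultimately have "0 \<le> u" "u \<le> 1" using v unfolding u_def[symmetric] by linarith+
          hence "u \<in> U" by (simp add: U_def u_def)
          hence "f \<omega> (st u \<omega>) \<le> \<delta> - 1 / (real m + 1)" by (rule m)
          moreover have "f \<omega> (st u \<omega>) = g (st u \<omega>)"
            using s(3)[THEN bspec, of "st u \<omega>"] u1 u2 by (simp add: f_def g_def scaled_def)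
          moreover have "dist (g (st u \<omega>)) (g t) < e" using u1 u2 by (intro d(2)) (simp add: dist_real_def)
          moreover have "g t = f \<omega> t" by (simp add: f_def g_def)
          ultimately show "f \<omega> t \<le> \<delta> - 1 / (real m + 1) + e" by (simp add: dist_real_def)
        qed
      qed
      hence "(SUP t\<in>{s0 \<omega>..tr \<omega>}. f \<omega> t) \<le> \<delta> - 1 / (real m + 1)" using s0[of \<omega>] by (intro cSUP_least) auto
      also have "\<dots> < \<delta>" by simp
      finally show "follows_path N Q A n Ts qs \<delta> \<omega>" using fp by simp
    qed
  qed
  have "{\<omega> \<in> space M. follows_path N Q A n Ts qs \<delta> \<omega> \<and> \<tau> \<omega> \<le> ereal T}
     = {\<omega> \<in> space M. \<tau> \<omega> \<le> ereal T} \<inter> (\<Union>m :: nat. {\<omega> \<in> space M. \<forall>u\<in>U. f \<omega> (st u \<omega>) \<le> \<delta> - 1 / (real m + 1)})"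
    using iff by auto
  moreover have "{\<omega> \<in> space M. \<tau> \<omega> \<le> ereal T} \<in> sets M" using \<tau>_measurable by measurable
  moreover have "{\<omega> \<in> space M. \<forall>u\<in>U. f \<omega> (st u \<omega>) \<le> \<delta> - 1 / (real m + 1)} \<in> sets M" for m :: nat
  proof -
    have "{\<omega> \<in> space M. \<forall>u\<in>U. f \<omega> (st u \<omega>) \<le> \<delta> - 1 / (real m + 1)}
      = {\<omega> \<in> space M. \<forall>v. 0 \<le> v \<and> v \<le> 1 \<longrightarrow> f \<omega> (st (of_rat v) \<omega>) \<le> \<delta> - 1 / (real m + 1)}"
      unfolding U_def Rats_def by auto
    moreover have "\<dots> \<in> sets M"
    proof (rule sets.sets_Collect_countable_All)
      fix v :: rat
      show "{\<omega> \<in> space M. 0 \<le> v \<and> v \<le> 1 \<longrightarrow> f \<omega> (st (of_rat v) \<omega>) \<le> \<delta> - 1 / (real m + 1)} \<in> sets M"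
      proof (cases "0 \<le> v \<and> v \<le> 1")
        case True
        have [measurable]: "(\<lambda>\<omega>. f \<omega> (st (of_rat v) \<omega>)) \<in> borel_measurable M" using True by (intro fm) simp
        show ?thesis using True by simp
      next
        case False
        hence "{\<omega> \<in> space M. 0 \<le> v \<and> v \<le> 1 \<longrightarrow> f \<omega> (st (of_rat v) \<omega>) \<le> \<delta> - 1 / (real m + 1)} = space M" by auto
        thus ?thesis by simp
      qed
    qed
    ultimately show ?thesis by simp
  qed
  ultimately show ?thesis by auto
qed

end

section \<open>Weights, reversed paths and oscillation over unit intervals\<close>

locale jackson_process = jackson_fluid lam mu P r z \<phi> + markov_process M Q p "0 :: nat ^ 'k"
  for lam mu r :: "real ^ 'k" and P :: "real ^ 'k ^ 'k" and z \<phi> :: "real \<Rightarrow> real ^ 'k"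
    and M :: "'w measure" and Q :: "real \<Rightarrow> 'w \<Rightarrow> nat ^ 'k" and p +
  fixes p'
  assumes fwd: "jump_semigroup p (jackson_rate lam mu P) Lam"
    and bwd: "jump_semigroup p' (jackson_rate lamd mu Pd) Lam"
    and rev: "\<And>t x y. 0 \<le> t \<Longrightarrow> wt y * pmf (p' t y) x = wt x * pmf (p t x) y"
begin

lemma wt_0: "wt 0 = 1" by (simp add: wt_def)

lemma pmf_le_wt: "0 \<le> t \<Longrightarrow> pmf (p t 0) y \<le> wt y"
  using rev[of t y 0] mult_left_mono[OF pmf_le_1[of "p' t y" 0], of "wt y"] wt_pos[of y] by (simp add: wt_0)

lemma wt_le_1: "wt x \<le> 1"
  unfolding wt_def by (rule prod_le_1) (use rho_pos rho_less_1 in \<open>auto simp: less_imp_le power_le_one\<close>)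

definition \<theta> where "\<theta> = theta_star lam mu P"

lemma theta_nth: "\<theta> $ k = - ln (rho $ k)" by (simp add: \<theta>_def theta_star_def rho_def)

lemma theta_pos: "0 < \<theta> $ k" using rho_pos[of k] rho_less_1[of k] by (simp add: theta_nth)

lemma wt_exp: "wt x = exp (- lin \<theta> x)"
proof -
  have "wt x = (\<Prod>k\<in>UNIV. exp (- \<theta> $ k * real (x $ k)))"
    unfolding wt_def
  proof (rule prod.cong[OF refl])
    fix k
    have "rho $ k ^ (x $ k) = exp (ln (rho $ k)) ^ (x $ k)" using rho_pos by simp
    also have "\<dots> = exp (- \<theta> $ k * real (x $ k))" by (simp add: theta_nth mult.commute flip: exp_of_nat_mult)
    finally show "rho $ k ^ (x $ k) = exp (- \<theta> $ k * real (x $ k))" .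
  qed
  also have "\<dots> = exp (\<Sum>k\<in>UNIV. - \<theta> $ k * real (x $ k))" by (simp add: exp_sum)
  finally show ?thesis by (simp add: lin_def sum_negf)
qed

text \<open>Split the weight as \<open>exp (- (1 - \<eta>) * lin \<theta> x) * exp (- \<eta> * lin
  \<theta> x)\<close>. The first factor is bounded on the tail; the second is again of product form,
  with ratios \<open>rho $ k powr \<eta> < 1\<close>, and has a finite sum. Counting lattice points
  is avoided at the price of a small share \<eta> of the exponent.\<close>

lemma weighted_tail:
  assumes \<eta>: "0 < \<eta>" "\<eta> \<le> 1"
  obtains S where "0 < S" "\<And>B. (\<integral>\<^sup>+x. ennreal (wt x) * indicator {x. B \<le> lin \<theta> x} x \<partial>count_space UNIV) \<le> ennreal (S * exp (- (1 - \<eta>) * B))"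
proof
  define \<sigma> :: "real ^ 'k" where "\<sigma> = (\<chi> k. rho $ k powr \<eta>)"
  have \<sigma>: "0 < \<sigma> $ k" "\<sigma> $ k < 1" for k
    using rho_pos[of k] rho_less_1[of k] \<eta> powr_less_mono2[of \<eta> "rho $ k" 1] by (auto simp: \<sigma>_def)
  define D where "D = (\<Prod>k\<in>UNIV. 1 - \<sigma> $ k)"
  have D: "0 < D" unfolding D_def by (intro prod_pos) (use \<sigma> in auto)
  have e: "exp (- \<eta> * lin \<theta> x) = (1 / D) * pmf (geometric_product \<sigma>) x" for x
  proof -
    have "(\<Prod>k\<in>UNIV. \<sigma> $ k ^ (x $ k)) = (\<Prod>k\<in>UNIV. exp (- \<eta> * (\<theta> $ k * real (x $ k))))"
    proof (rule prod.cong[OF refl])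
      fix k
      have "\<sigma> $ k = exp (- \<eta> * \<theta> $ k)" using rho_pos[of k] by (simp add: \<sigma>_def powr_def theta_nth)
      thus "\<sigma> $ k ^ (x $ k) = exp (- \<eta> * (\<theta> $ k * real (x $ k)))" by (simp add: mult_ac flip: exp_of_nat_mult)
    qed
    also have "\<dots> = exp (- \<eta> * lin \<theta> x)" by (simp add: lin_def sum_distrib_left flip: exp_sum sum_negf)
    finally show ?thesis using D by (simp add: pmf_geometric_product[OF \<sigma>] D_def[symmetric])
  qed
  show "0 < 1 / D" using D by simp
  fix B
  have "(\<integral>\<^sup>+x. ennreal (wt x) * indicator {x. B \<le> lin \<theta> x} x \<partial>count_space UNIV)
    \<le> (\<integral>\<^sup>+x. ennreal (1 / D * exp (- (1 - \<eta>) * B)) * ennreal (pmf (geometric_product \<sigma>) x) \<partial>count_space UNIV)"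
  proof (rule nn_integral_mono)
    fix x
    show "ennreal (wt x) * indicator {x. B \<le> lin \<theta> x} x \<le> ennreal (1 / D * exp (- (1 - \<eta>) * B)) * ennreal (pmf (geometric_product \<sigma>) x)"
    proof (cases "B \<le> lin \<theta> x")
      case True
      have "wt x = exp (- (1 - \<eta>) * lin \<theta> x) * exp (- \<eta> * lin \<theta> x)" by (simp add: wt_exp algebra_simps flip: exp_add)
      also have "\<dots> \<le> exp (- (1 - \<eta>) * B) * exp (- \<eta> * lin \<theta> x)"
        using True \<eta> by (intro mult_right_mono) (auto intro!: mult_left_mono_neg)
      finally have "wt x \<le> 1 / D * exp (- (1 - \<eta>) * B) * pmf (geometric_product \<sigma>) x" unfolding e by (simp add: mult_ac)
      hence "ennreal (wt x) \<le> ennreal (1 / D * exp (- (1 - \<eta>) * B) * pmf (geometric_product \<sigma>) x)" by (rule ennreal_leI)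
      also have "\<dots> = ennreal (1 / D * exp (- (1 - \<eta>) * B)) * ennreal (pmf (geometric_product \<sigma>) x)"
        using D by (intro ennreal_mult) auto
      finally show ?thesis using True by simp
    qed simp
  qed
  also have "\<dots> = ennreal (1 / D * exp (- (1 - \<eta>) * B))" by (simp add: nn_integral_cmult nn_integral_pmf)
  finally show "(\<integral>\<^sup>+x. ennreal (wt x) * indicator {x. B \<le> lin \<theta> x} x \<partial>count_space UNIV) \<le> ennreal (1 / D * exp (- (1 - \<eta>) * B))" .
qed

lemma fd_forward:
  assumes "0 \<le> i" "0 < h"
  shows "\<P>(\<omega> in M. \<forall>l\<le>m. Q (i + real l * h) \<omega> = x l) \<le> pmf (p i 0) (x 0) * (\<Prod>l<m. pmf (p h (x l)) (x (Suc l)))"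
  using fdd_grid[of i h m x] assms by (simp add: marginal)

text \<open>Index 0 is the latest time i. The law at the earliest time is dominated by
  \<open>wt\<close>, and \<open>rev\<close> then moves the weight along the path, one transition
  after the other, to its final state.\<close>

lemma fd_backward:
  assumes h: "0 < h" and mh: "real m * h \<le> i"
  shows "\<P>(\<omega> in M. \<forall>l\<le>m. Q (i - real l * h) \<omega> = x l) \<le> wt (x 0) * (\<Prod>l<m. pmf (p' h (x l)) (x (Suc l)))"
proof -
  define t0 where "t0 = i - real m * h"
  have t0: "0 \<le> t0" using mh by (simp add: t0_def)
  have all: "(\<forall>l\<le>m. Q (i - real l * h) \<omega> = x l) \<longleftrightarrow> (\<forall>l\<le>m. Q (t0 + real l * h) \<omega> = x (m - l))" for \<omega>
  proof
    assume a: "\<forall>l\<le>m. Q (i - real l * h) \<omega> = x l"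
    show "\<forall>l\<le>m. Q (t0 + real l * h) \<omega> = x (m - l)"
    proof (intro allI impI)
      fix l assume "l \<le> m"
      hence "t0 + real l * h = i - real (m - l) * h" by (simp add: t0_def of_nat_diff algebra_simps)
      thus "Q (t0 + real l * h) \<omega> = x (m - l)" using a by simp
    qed
  next
    assume a: "\<forall>l\<le>m. Q (t0 + real l * h) \<omega> = x (m - l)"
    show "\<forall>l\<le>m. Q (i - real l * h) \<omega> = x l"
    proof (intro allI impI)
      fix l assume l: "l \<le> m"
      hence "i - real l * h = t0 + real (m - l) * h" by (simp add: t0_def of_nat_diff algebra_simps)
      thus "Q (i - real l * h) \<omega> = x l" using a[rule_format, of "m - l"] l by simp
    qed
  qed
  have "\<P>(\<omega> in M. \<forall>l\<le>m. Q (i - real l * h) \<omega> = x l)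
     = pmf (p t0 0) (x m) * (\<Prod>l<m. pmf (p h (x (m - l))) (x (m - Suc l)))"
    unfolding all using fdd_grid[of t0 h m "\<lambda>l. x (m - l)"] t0 h by (simp add: marginal)
  also have "(\<Prod>l<m. pmf (p h (x (m - l))) (x (m - Suc l))) = (\<Prod>l<m. pmf (p h (x (Suc l))) (x l))"
    by (rule prod.reindex_bij_witness[of _ "\<lambda>l. m - Suc l" "\<lambda>l. m - Suc l"]) (auto simp: Suc_diff_Suc)
  also have "pmf (p t0 0) (x m) * (\<Prod>l<m. pmf (p h (x (Suc l))) (x l)) \<le> wt (x m) * (\<Prod>l<m. pmf (p h (x (Suc l))) (x l))"
    using t0 by (intro mult_right_mono pmf_le_wt prod_nonneg) auto
  also have "\<dots> = wt (x 0) * (\<Prod>l<m. pmf (p' h (x l)) (x (Suc l)))"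
  proof (induction m)
    case (Suc m)
    have "wt (x (Suc m)) * (\<Prod>l<Suc m. pmf (p h (x (Suc l))) (x l))
       = (wt (x (Suc m)) * pmf (p h (x (Suc m))) (x m)) * (\<Prod>l<m. pmf (p h (x (Suc l))) (x l))" by simp
    also have "wt (x (Suc m)) * pmf (p h (x (Suc m))) (x m) = wt (x m) * pmf (p' h (x m)) (x (Suc m))"
      using rev[of h "x m" "x (Suc m)"] h by simp
    also have "\<dots> * (\<Prod>l<m. pmf (p h (x (Suc l))) (x l)) = (wt (x m) * (\<Prod>l<m. pmf (p h (x (Suc l))) (x l))) * pmf (p' h (x m)) (x (Suc m))"
      by simp
    finally show ?case unfolding Suc.IH by simp
  qed simp
  finally show ?thesis .
qed

lemma exp_lin_supermartingale:
  assumes a: "\<And>k. \<bar>a $ k\<bar> \<le> \<beta>" and h: "0 \<le> h"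
  shows "(\<integral>\<^sup>+y. ennreal (exp (lin a y + b)) \<partial>measure_pmf (p h x)) \<le> ennreal (exp (Lam * (exp (2 * \<beta>) - 1) * h) * exp (lin a x + b))"
proof -
  interpret F: jump_semigroup p "jackson_rate lam mu P" Lam by (rule fwd)
  define c where "c = Lam * (exp (2 * \<beta>) - 1)"
  have \<beta>: "0 \<le> \<beta>" using a abs_ge_zero order_trans by blast
  have c: "0 \<le> c" using F.Lambda_nonneg \<beta> by (simp add: c_def)
  have gen: "F.gen (\<lambda>y. E * exp (lin a y + b)) x = E * (psi lam mu P a x * exp (lin a x + b))" for E x
    unfolding jackson_gen_exp[symmetric] F.gen_def F.supp_def sum_distrib_left
    by (rule sum.cong) (auto simp: algebra_simps)
  have psi: "psi lam mu P a x \<le> c" for x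
    unfolding c_def Lam_def by (rule psi_crude) (use lam_pos mu_pos routing a in \<open>auto simp: less_imp_le\<close>)
  have "(\<integral>\<^sup>+y. ennreal (exp (- c * (0 + h)) * exp (lin a y + b)) \<partial>measure_pmf (p h x)) \<le> ennreal (exp (- c * 0) * exp (lin a x + b))"
  proof (rule F.supermartingale[where b = h and L = 0 and V' = "\<lambda>t x. - c * exp (- c * t) * exp (lin a x + b)" and V = "\<lambda>t x. exp (- c * t) * exp (lin a x + b)"])
    show "((\<lambda>d. exp (- c * (t + d)) * exp (lin a x + b)) has_real_derivative - c * exp (- c * t) * exp (lin a x + b)) (at_right 0)" for t x
      by (auto intro!: derivative_eq_intros)
    show "- c * exp (- c * t) * exp (lin a x + b) + F.gen (\<lambda>x. exp (- c * t) * exp (lin a x + b)) x \<le> 0" for t x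
    proof -
      have "exp (- c * t) * (psi lam mu P a x * exp (lin a x + b)) \<le> exp (- c * t) * (c * exp (lin a x + b))"
        using psi by (intro mult_left_mono mult_right_mono) auto
      thus ?thesis unfolding gen by (simp add: algebra_simps)
    qed
  qed (use h c in \<open>auto simp: mult_left_mono\<close>)
  hence le: "(\<integral>\<^sup>+y. ennreal (exp (- c * h) * exp (lin a y + b)) \<partial>measure_pmf (p h x)) \<le> ennreal (exp (lin a x + b))" by simp
  have "(\<integral>\<^sup>+y. ennreal (exp (lin a y + b)) \<partial>measure_pmf (p h x)) = (\<integral>\<^sup>+y. ennreal (exp (c * h)) * ennreal (exp (- c * h) * exp (lin a y + b)) \<partial>measure_pmf (p h x))"
    by (rule nn_integral_cong) (simp add: exp_minus flip: ennreal_mult mult.assoc)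
  also have "\<dots> = ennreal (exp (c * h)) * (\<integral>\<^sup>+y. ennreal (exp (- c * h) * exp (lin a y + b)) \<partial>measure_pmf (p h x))"
    by (rule nn_integral_cmult) simp
  also have "\<dots> \<le> ennreal (exp (c * h)) * ennreal (exp (lin a x + b))" using le by (rule mult_left_mono) simp
  finally show ?thesis by (simp add: c_def flip: ennreal_mult)
qed

definition osc_event :: "real \<Rightarrow> nat \<Rightarrow> 'w set" where
  "osc_event d i = {\<omega> \<in> space M. \<exists>m j :: nat. real j / 2 ^ m \<le> 1 \<and>
     (\<exists>k. d < \<bar>real (Q (real i + real j / 2 ^ m) \<omega> $ k) - real (Q (real i) \<omega> $ k)\<bar>)}"

text \<open>A Chernoff bound with free \<beta>. In its uses d is proportional to n and \<beta> is
  fixed but large, so that the probability decays faster than any prescribed exponential in n. The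
  factor \<open>exp (c - c * s)\<close> in Z keeps the discounted sum at least 1 on the event up to
  the end of the unit interval.\<close>

lemma osc_bound:
  assumes \<beta>: "0 \<le> \<beta>"
  shows "osc_event d i \<in> sets M"
    "measure M (osc_event d i) \<le> 2 * real CARD('k) * exp (Lam * (exp (2 * \<beta>) - 1)) * exp (- \<beta> * d)"
proof -
  define c where "c = Lam * (exp (2 * \<beta>) - 1)"
  interpret F: jump_semigroup p "jackson_rate lam mu P" Lam by (rule fwd)
  have c: "0 \<le> c" using F.Lambda_nonneg \<beta> by (simp add: c_def)
  define C where "C = 2 * real CARD('k) * exp c * exp (- \<beta> * d)"
  define Z where "Z y s x = (\<Sum>k\<in>UNIV. exp (c - \<beta> * d - c * s) * exp (lin (axis k \<beta>) x + - \<beta> * real (y $ k))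
     + exp (c - \<beta> * d - c * s) * exp (lin (axis k (- \<beta>)) x + \<beta> * real (y $ k)))" for y :: "nat ^ 'k" and s x
  define E where "E y = {\<omega> \<in> space M. Q (real i + 0) \<omega> = y \<and> (\<exists>m j :: nat. real j / 2 ^ m \<le> 1 \<and>
     (\<exists>k. d < \<bar>real (Q (real i + real j / 2 ^ m) \<omega> $ k) - real (y $ k)\<bar>))}" for y :: "nat ^ 'k"
  have lax: "lin (axis k b) x = b * real (x $ k)" for k b x
    by (simp add: lin_def axis_def if_distrib[of "\<lambda>y. y * _"] cong: if_cong)
  have aab: "\<bar>axis k b $ l\<bar> \<le> \<beta>" if "\<bar>b\<bar> = \<beta>" for k l b using that \<beta> by (simp add: axis_def)
  have E: "E y \<in> sets M" "emeasure M (E y) \<le> ennreal (pmf (p (real i) 0) y) * ennreal (Z y 0 y)" for y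
  proof -
    have super: "(\<integral>\<^sup>+v. ennreal (Z y (s + h) v) \<partial>measure_pmf (p h x)) \<le> ennreal (Z y s x)" if "0 \<le> s" "0 \<le> h" for s h x
    proof -
      define e where "e = exp (c - \<beta> * d - c * (s + h))"
      have e0: "0 \<le> e" by (simp add: e_def)
      have ee: "e * exp (c * h) = exp (c - \<beta> * d - c * s)" by (simp add: e_def algebra_simps flip: exp_add)
      have one: "(\<integral>\<^sup>+v. ennreal (e * exp (lin (axis k b) v + b')) \<partial>measure_pmf (p h x)) \<le> ennreal (exp (c - \<beta> * d - c * s) * exp (lin (axis k b) x + b'))"
        if "\<bar>b\<bar> = \<beta>" for k b b'
      proof -
        have "(\<integral>\<^sup>+v. ennreal (e * exp (lin (axis k b) v + b')) \<partial>measure_pmf (p h x)) = ennreal e * (\<integral>\<^sup>+v. ennreal (exp (lin (axis k b) v + b')) \<partial>measure_pmf (p h x))"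
          using e0 by (simp add: ennreal_mult nn_integral_cmult)
        also have "\<dots> \<le> ennreal e * ennreal (exp (c * h) * exp (lin (axis k b) x + b'))"
          unfolding c_def using aab[OF that] \<open>0 \<le> h\<close> by (intro mult_left_mono exp_lin_supermartingale) auto
        also have "\<dots> = ennreal (e * exp (c * h) * exp (lin (axis k b) x + b'))"
          using e0 by (simp add: mult.assoc flip: ennreal_mult)
        finally show ?thesis unfolding ee .
      qed
      have "(\<integral>\<^sup>+v. ennreal (Z y (s + h) v) \<partial>measure_pmf (p h x)) = (\<integral>\<^sup>+v. (\<Sum>k\<in>UNIV. ennreal (e * exp (lin (axis k \<beta>) v + - \<beta> * real (y $ k)))
          + ennreal (e * exp (lin (axis k (- \<beta>)) v + \<beta> * real (y $ k)))) \<partial>measure_pmf (p h x))"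
        unfolding Z_def e_def[symmetric] by (intro nn_integral_cong) (use e0 in \<open>simp flip: ennreal_plus sum_ennreal\<close>)
      also have "\<dots> = (\<Sum>k\<in>UNIV. (\<integral>\<^sup>+v. ennreal (e * exp (lin (axis k \<beta>) v + - \<beta> * real (y $ k))) \<partial>measure_pmf (p h x))
          + (\<integral>\<^sup>+v. ennreal (e * exp (lin (axis k (- \<beta>)) v + \<beta> * real (y $ k))) \<partial>measure_pmf (p h x)))"
        by (simp add: nn_integral_sum nn_integral_add)
      also have "\<dots> \<le> (\<Sum>k\<in>UNIV. ennreal (exp (c - \<beta> * d - c * s) * exp (lin (axis k \<beta>) x + - \<beta> * real (y $ k)))
          + ennreal (exp (c - \<beta> * d - c * s) * exp (lin (axis k (- \<beta>)) x + \<beta> * real (y $ k))))"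
        by (intro sum_mono add_mono one) (use \<beta> in auto)
      also have "\<dots> = ennreal (Z y s x)" unfolding Z_def by (simp flip: ennreal_plus sum_ennreal)
      finally show ?thesis .
    qed
    have bad: "1 \<le> Z y s x" if s: "0 \<le> s" "s \<le> 1" and k: "\<exists>k. d < \<bar>real (x $ k) - real (y $ k)\<bar>" for s x
    proof -
      obtain k where k: "d < \<bar>real (x $ k) - real (y $ k)\<bar>" using k by blast
      define e where "e = exp (c - \<beta> * d - c * s)"
      have "exp (- \<beta> * d) \<le> e" unfolding e_def using s c by (simp add: mult_left_le)
      have g: "1 \<le> e * exp u" if "\<beta> * d \<le> u" for u
      proof -
        have "c * s \<le> c" using s c by (simp add: mult_left_le)
        thus ?thesis using that unfolding e_def by (simp flip: exp_add)
      qed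
      have "1 \<le> e * exp (lin (axis k \<beta>) x + - \<beta> * real (y $ k)) + e * exp (lin (axis k (- \<beta>)) x + \<beta> * real (y $ k))"
      proof (cases "real (y $ k) \<le> real (x $ k)")
        case True
        have "\<beta> * d \<le> \<beta> * (real (x $ k) - real (y $ k))" using k True \<beta> by (intro mult_left_mono) auto
        hence "1 \<le> e * exp (lin (axis k \<beta>) x + - \<beta> * real (y $ k))" by (intro g) (simp add: lax algebra_simps)
        thus ?thesis by (simp add: e_def add_increasing2)
      next
        case False
        have "\<beta> * d \<le> \<beta> * (real (y $ k) - real (x $ k))" using k False \<beta> by (intro mult_left_mono) auto
        hence "1 \<le> e * exp (lin (axis k (- \<beta>)) x + \<beta> * real (y $ k))" by (intro g) (simp add: lax algebra_simps)
        thus ?thesis by (simp add: e_def add_increasing)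
      qed
      also have "\<dots> \<le> Z y s x" unfolding Z_def e_def by (rule member_le_sum) auto
      finally show ?thesis .
    qed
    note D = dyadic_maximal_inequality[of M 1 "\<lambda>s. Q (real i + s)" "\<lambda>x. pmf (p (real i) 0) x" p "Z y" "\<lambda>s x. \<exists>k. d < \<bar>real (x $ k) - real (y $ k)\<bar>" y,
       OF prob_space_axioms]
    show "E y \<in> sets M" unfolding E_def
      by (rule D(1)) (auto intro!: meas fd_forward super bad)
    show "emeasure M (E y) \<le> ennreal (pmf (p (real i) 0) y) * ennreal (Z y 0 y)" unfolding E_def
      by (rule D(2)) (auto intro!: meas fd_forward super bad)
  qed
  have ZC: "Z y 0 y = C" for y
    by (simp add: Z_def lax C_def exp_diff exp_minus field_simps)
  have U: "osc_event d i = (\<Union>y. E y)" by (auto simp: osc_event_def E_def)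
  show "osc_event d i \<in> sets M" unfolding U using E(1) by auto
  have "emeasure M (osc_event d i) = (\<integral>\<^sup>+y. emeasure M (E y) \<partial>count_space UNIV)"
    unfolding U using E(1) by (intro emeasure_UN_countable) (auto simp: disjoint_family_on_def E_def)
  also have "\<dots> \<le> (\<integral>\<^sup>+y. ennreal (pmf (p (real i) 0) y) * ennreal C \<partial>count_space UNIV)"
    using E(2) unfolding ZC by (intro nn_integral_mono) auto
  also have "\<dots> = ennreal C" by (simp add: nn_integral_multc nn_integral_pmf)
  finally have "emeasure M (osc_event d i) \<le> ennreal C" .
  thus "measure M (osc_event d i) \<le> 2 * real CARD('k) * exp (Lam * (exp (2 * \<beta>) - 1)) * exp (- \<beta> * d)"
    unfolding emeasure_eq_measure C_def c_def by (subst (asm) ennreal_le_iff) auto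
qed

end

lemma dyadic_dense:
  fixes a b :: real
  assumes "0 \<le> a" "a < b"
  obtains m j :: nat where "a < real j / 2 ^ m" "real j / 2 ^ m < b"
proof -
  obtain m where m: "(1 / 2 :: real) ^ m < b - a" using real_arch_pow_inv[of "b - a" "1 / 2"] assms by auto
  define j where "j = nat \<lfloor>a * 2 ^ m\<rfloor> + 1"
  have j: "real j = of_int \<lfloor>a * 2 ^ m\<rfloor> + 1" using assms by (simp add: j_def)
  have "a * 2 ^ m < real j" "real j \<le> a * 2 ^ m + 1" unfolding j by linarith+
  hence "a < real j / 2 ^ m" "real j / 2 ^ m \<le> a + (1 / 2) ^ m"
    by (simp_all add: less_divide_eq divide_le_eq power_divide distrib_right)
  thus ?thesis using that[of j m] m by simp
qed

section \<open>Deviation of the reversed path from the fluid path\<close>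

context jackson_process begin

lemma energy_prob:
  assumes S: "\<And>B. (\<integral>\<^sup>+x. ennreal (wt x) * indicator {x. B \<le> lin \<theta> x} x \<partial>count_space UNIV) \<le> ennreal (S * exp (- (1 - \<eta>) * B))"
    and t: "0 \<le> t" and S0: "0 < S"
  shows "\<P>(\<omega> in M. B \<le> lin \<theta> (Q t \<omega>)) \<le> S * exp (- (1 - \<eta>) * B)"
proof -
  have "\<P>(\<omega> in M. Q t \<omega> \<in> {x. B \<le> lin \<theta> x}) = measure_pmf.prob (p t 0) {x. B \<le> lin \<theta> x}"
    by (rule prob_marginal[OF t])
  hence "ennreal \<P>(\<omega> in M. B \<le> lin \<theta> (Q t \<omega>)) = (\<integral>\<^sup>+x. indicator {x. B \<le> lin \<theta> x} x \<partial>measure_pmf (p t 0))"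
    by (simp add: measure_pmf.emeasure_eq_measure)
  also have "\<dots> = (\<integral>\<^sup>+x. ennreal (pmf (p t 0) x) * indicator {x. B \<le> lin \<theta> x} x \<partial>count_space UNIV)"
    by (rule nn_integral_measure_pmf)
  also have "\<dots> \<le> (\<integral>\<^sup>+x. ennreal (wt x) * indicator {x. B \<le> lin \<theta> x} x \<partial>count_space UNIV)"
    by (intro nn_integral_mono mult_right_mono ennreal_leI pmf_le_wt t) simp
  also note S
  finally show ?thesis using S0 by (subst (asm) ennreal_le_iff) auto
qed

text \<open>The reversal starts at time i in the state y and cannot go back beyond time 0, whence
  the minimum with \<open>real i\<close>. The form with \<open>real i - 0\<close> and dyadic times
  is that of the dyadic maximal inequality.\<close>

definition dev_event :: "real \<Rightarrow> real \<Rightarrow> nat \<Rightarrow> nat \<Rightarrow> nat ^ 'k \<Rightarrow> 'w set" where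
  "dev_event \<delta> H n i y = {\<omega> \<in> space M. Q (real i - 0) \<omega> = y \<and> (\<exists>m j :: nat. real j / 2 ^ m \<le> min (real i) (real n * H) \<and>
     \<delta> < norm ((\<chi> k. real (Q (real i - real j / 2 ^ m) \<omega> $ k) / real n) - z (real j / 2 ^ m / real n)))}"

lemma dev_bound:
  assumes super: "\<And>t h x. 0 \<le> t \<Longrightarrow> 0 \<le> h \<Longrightarrow> t + h \<le> real n * H \<Longrightarrow>
         (\<integral>\<^sup>+y. ennreal (Z (t + h) y) \<partial>measure_pmf (p' h x)) \<le> ennreal (Z t x)"
    and bad: "\<And>t x. 0 \<le> t \<Longrightarrow> t \<le> real n * H \<Longrightarrow> \<delta> < norm ((\<chi> k. real (x $ k) / real n) - z (t / real n)) \<Longrightarrow> 1 \<le> Z t x"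
    and H: "0 \<le> H"
  shows "dev_event \<delta> H n i y \<in> sets M" "emeasure M (dev_event \<delta> H n i y) \<le> ennreal (wt y) * ennreal (Z 0 y)"
proof -
  have nH: "0 \<le> real n * H" using H by simp
  note D = dyadic_maximal_inequality[of M "min (real i) (real n * H)" "\<lambda>s. Q (real i - s)" wt p' Z
     "\<lambda>s x. \<delta> < norm ((\<chi> k. real (x $ k) / real n) - z (s / real n))" y, OF prob_space_axioms]
  show "dev_event \<delta> H n i y \<in> sets M" unfolding dev_event_def
    by (rule D(1)) (auto intro!: meas fd_backward super bad nH simp: less_imp_le wt_pos)
  show "emeasure M (dev_event \<delta> H n i y) \<le> ennreal (wt y) * ennreal (Z 0 y)" unfolding dev_event_def
    by (rule D(2)) (auto intro!: meas fd_backward super bad nH simp: less_imp_le wt_pos)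
qed

text \<open>Events with different final states are disjoint, so their weights add up to a tail sum
  of \<open>wt\<close>: the gain c of the deviation multiplies the probability of ending in the
  tail.\<close>

lemma dev_event_union:
  assumes dev: "\<And>y. y \<in> U \<Longrightarrow> dev_event \<delta> H n i y \<in> sets M"
     "\<And>y. y \<in> U \<Longrightarrow> emeasure M (dev_event \<delta> H n i y) \<le> ennreal (wt y) * ennreal c"
    and S: "\<And>B. (\<integral>\<^sup>+x. ennreal (wt x) * indicator {x. B \<le> lin \<theta> x} x \<partial>count_space UNIV) \<le> ennreal (S * exp (- (1 - \<eta>) * B))"
    and S0: "0 < S" and c: "0 \<le> c" and U: "\<And>y. y \<in> U \<Longrightarrow> B \<le> lin \<theta> y"
  shows "(\<Union>y\<in>U. dev_event \<delta> H n i y) \<in> sets M" "measure M (\<Union>y\<in>U. dev_event \<delta> H n i y) \<le> S * exp (- (1 - \<eta>) * B) * c"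
proof -
  show "(\<Union>y\<in>U. dev_event \<delta> H n i y) \<in> sets M" using dev(1) by (intro sets.countable_UN') auto
  have "emeasure M (\<Union>y\<in>U. dev_event \<delta> H n i y) = (\<integral>\<^sup>+y. emeasure M (dev_event \<delta> H n i y) \<partial>count_space U)"
    by (rule emeasure_UN_countable) (use dev(1) in \<open>auto simp: disjoint_family_on_def dev_event_def\<close>)
  also have "\<dots> \<le> (\<integral>\<^sup>+y. ennreal (wt y) * ennreal c \<partial>count_space U)"
    by (rule nn_integral_mono) (use dev(2) in simp)
  also have "\<dots> = (\<integral>\<^sup>+y. ennreal (wt y) * ennreal c * indicator U y \<partial>count_space UNIV)"
    by (rule nn_integral_count_space_indicator) simp
  also have "\<dots> \<le> (\<integral>\<^sup>+y. ennreal (wt y) * indicator {x. B \<le> lin \<theta> x} y * ennreal c \<partial>count_space UNIV)"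
    by (rule nn_integral_mono) (use U in \<open>auto simp: indicator_def\<close>)
  also have "\<dots> = (\<integral>\<^sup>+y. ennreal (wt y) * indicator {x. B \<le> lin \<theta> x} y \<partial>count_space UNIV) * ennreal c"
    by (rule nn_integral_multc) simp
  also have "\<dots> \<le> ennreal (S * exp (- (1 - \<eta>) * B)) * ennreal c" by (intro mult_right_mono S) simp
  also have "\<dots> = ennreal (S * exp (- (1 - \<eta>) * B) * c)" using S0 c by (simp add: ennreal_mult)
  finally show "measure M (\<Union>y\<in>U. dev_event \<delta> H n i y) \<le> S * exp (- (1 - \<eta>) * B) * c"
    unfolding emeasure_eq_measure using S0 c by (subst (asm) ennreal_le_iff) auto
qed

lemma no_osc:
  assumes w: "\<omega> \<in> space M" and no: "\<omega> \<notin> osc_event d i" and s: "0 \<le> s" "s \<le> 1"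
  shows "\<bar>real (Q (real i + s) \<omega> $ k) - real (Q (real i) \<omega> $ k)\<bar> \<le> d"
proof -
  have dy: "\<bar>real (Q (real i + real j / 2 ^ m) \<omega> $ k) - real (Q (real i) \<omega> $ k)\<bar> \<le> d" if "real j / 2 ^ m \<le> 1" for j m :: nat
  proof (rule ccontr)
    assume "\<not> ?thesis"
    hence "d < \<bar>real (Q (real i + real j / 2 ^ m) \<omega> $ k) - real (Q (real i) \<omega> $ k)\<bar>" by simp
    thus False using no w that unfolding osc_event_def by blast
  qed
  show ?thesis
  proof (cases "s = 1")
    case True
    thus ?thesis using dy[of 1 0] by simp
  next
    case False
    hence "real i + s < real i + 1" using s by simp
    then obtain u where u: "real i + s < u" "u < real i + 1" "\<forall>v\<in>{real i + s..u}. Q v \<omega> = Q (real i + s) \<omega>"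
      using right_cont_dyadic[OF w, of "real i + s" "real i + 1"] s by (metis add_nonneg_nonneg of_nat_0_le_iff)
    obtain m j :: nat where mj: "s < real j / 2 ^ m" "real j / 2 ^ m < u - real i"
      by (rule dyadic_dense[of s "u - real i"]) (use s u(1) in auto)
    have "Q (real i + real j / 2 ^ m) \<omega> = Q (real i + s) \<omega>" using mj by (intro u(3)[THEN bspec]) auto
    moreover have "real j / 2 ^ m \<le> 1" using mj u(2) by linarith
    ultimately show ?thesis using dy[of j m] by simp
  qed
qed

text \<open>The reversed path is continuous from the left in s, so an arbitrary s is approached by
  smaller dyadic numbers, on which the state is the same and the fluid path is close. For
  \<open>s = 0\<close> there is no smaller one, but 0 is dyadic itself.\<close>

lemma no_dev:
  assumes w: "\<omega> \<in> space M" and no: "\<omega> \<notin> dev_event \<delta> H n i (Q (real i) \<omega>)" and s: "0 \<le> s" "s \<le> real i" "s \<le> real n * H" and n: "0 < n"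
  shows "norm ((\<chi> k. real (Q (real i - s) \<omega> $ k) / real n) - z (s / real n)) \<le> \<delta>"
proof -
  have dy: "norm ((\<chi> k. real (Q (real i - real j / 2 ^ m) \<omega> $ k) / real n) - z (real j / 2 ^ m / real n)) \<le> \<delta>"
    if "real j / 2 ^ m \<le> min (real i) (real n * H)" for j m :: nat
  proof (rule ccontr)
    assume "\<not> ?thesis"
    hence "\<delta> < norm ((\<chi> k. real (Q (real i - real j / 2 ^ m) \<omega> $ k) / real n) - z (real j / 2 ^ m / real n))" by simp
    moreover have "Q (real i - 0) \<omega> = Q (real i) \<omega>" by simp
    ultimately show False using no w that unfolding dev_event_def by blast
  qed
  show ?thesis
  proof (cases "s = 0")
    case True
    thus ?thesis using dy[of 0 0] s by simp
  next
    case False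
    hence s0: "0 < s" using s by simp
    show ?thesis
    proof (rule field_le_epsilon)
      fix e :: real assume e: "0 < e"
      obtain u where u: "real i - s < u" "\<forall>v\<in>{real i - s..u}. Q v \<omega> = Q (real i - s) \<omega>"
        using right_cont_dyadic[OF w, of "real i - s" "real i - s + 1"] s by (metis diff_ge_0_iff_ge less_add_one)
      have "continuous (at (s / real n) within {0..}) z"
        using z_cont s by (simp add: continuous_on_eq_continuous_within)
      then obtain d where d: "0 < d" "\<And>a. 0 \<le> a \<Longrightarrow> dist a (s / real n) < d \<Longrightarrow> dist (z a) (z (s / real n)) < e"
        using e unfolding continuous_within_eps_delta by fastforce
      define a where "a = max 0 (max (real i - u) (s - d))"
      have "0 \<le> a" "a < s" using s0 u(1) d(1) by (auto simp: a_def)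
      then obtain m j :: nat where mj: "a < real j / 2 ^ m" "real j / 2 ^ m < s" by (rule dyadic_dense)
      define v where "v = real j / 2 ^ m"
      have v: "0 \<le> v" "v < s" "real i - u < v" "s - d < v" using mj by (auto simp: v_def a_def)
      have "Q (real i - v) \<omega> = Q (real i - s) \<omega>" using v by (intro u(2)[THEN bspec]) auto
      moreover have "norm ((\<chi> k. real (Q (real i - v) \<omega> $ k) / real n) - z (v / real n)) \<le> \<delta>"
        unfolding v_def by (rule dy) (use v s in \<open>simp add: v_def[symmetric]\<close>)
      moreover have "dist (z (v / real n)) (z (s / real n)) < e"
      proof (rule d(2))
        have "\<bar>v / real n - s / real n\<bar> = (s - v) / real n" using v n by (simp add: diff_divide_distrib abs_if divide_strict_right_mono)
        also have "\<dots> \<le> (s - v) / 1" using n v by (intro divide_left_mono) auto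
        finally show "dist (v / real n) (s / real n) < d" using v by (simp add: dist_real_def)
      qed (use v n in simp)
      moreover have "norm ((\<chi> k. real (Q (real i - s) \<omega> $ k) / real n) - z (s / real n))
        \<le> norm ((\<chi> k. real (Q (real i - s) \<omega> $ k) / real n) - z (v / real n)) + norm (z (v / real n) - z (s / real n))"
        using norm_triangle_ineq[of "(\<chi> k. real (Q (real i - s) \<omega> $ k) / real n) - z (v / real n)" "z (v / real n) - z (s / real n)"] by simp
      ultimately show "norm ((\<chi> k. real (Q (real i - s) \<omega> $ k) / real n) - z (s / real n)) \<le> \<delta> + e"
        by (simp add: dist_norm)
    qed
  qed
qed

end

section \<open>Asymptotics of the overflow probability\<close>

locale jackson_overflow = jackson_process lam mu r P z \<phi> M Q p p'
  for lam mu r :: "real ^ 'k" and P :: "real ^ 'k ^ 'k" and z \<phi> :: "real \<Rightarrow> real ^ 'k"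
    and M :: "'w measure" and Q :: "real \<Rightarrow> 'w \<Rightarrow> nat ^ 'k" and p p' +
  fixes A :: real and j :: 'k
  assumes A: "0 < A" and r: "r = A *\<^sub>R axis j 1" and min_theta: "\<And>k. k \<noteq> j \<Longrightarrow> \<theta> $ j < \<theta> $ k"
begin

definition J where "J = \<theta> $ j * A"

lemma J_pos: "0 < J" using theta_pos[of j] A by (simp add: J_def)

definition size :: "nat ^ 'k \<Rightarrow> real" where "size x = (\<Sum>k\<in>UNIV. real (x $ k))"

text \<open>The inserted 1 keeps the minimum meaningful for a network with a single node.\<close>

definition gap where "gap = Min (insert 1 ((\<lambda>k. \<theta> $ k - \<theta> $ j) ` (- {j})))"

lemma gap: "0 < gap" "k \<noteq> j \<Longrightarrow> \<theta> $ j + gap \<le> \<theta> $ k"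
proof -
  show "0 < gap" unfolding gap_def using min_theta by (subst Min_gr_iff) auto
  show "\<theta> $ j + gap \<le> \<theta> $ k" if "k \<noteq> j"
  proof -
    have "gap \<le> \<theta> $ k - \<theta> $ j" unfolding gap_def by (rule Min_le) (use that in auto)
    thus ?thesis by simp
  qed
qed

lemma lin_size: "\<theta> $ j * size x + gap * (\<Sum>k\<in>-{j}. real (x $ k)) \<le> lin \<theta> x"
proof -
  have split: "(\<Sum>k\<in>UNIV. f k) = f j + (\<Sum>k\<in>-{j}. f k)" for f :: "'k \<Rightarrow> real"
    by (subst sum.remove[of UNIV j]) (auto simp: Compl_eq_Diff_UNIV)
  have "\<theta> $ j * size x + gap * (\<Sum>k\<in>-{j}. real (x $ k)) = \<theta> $ j * real (x $ j) + (\<Sum>k\<in>-{j}. (\<theta> $ j + gap) * real (x $ k))"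
    unfolding size_def split by (simp add: algebra_simps sum_distrib_left sum.distrib)
  also have "\<dots> \<le> \<theta> $ j * real (x $ j) + (\<Sum>k\<in>-{j}. \<theta> $ k * real (x $ k))"
    by (intro add_left_mono sum_mono mult_right_mono gap) auto
  also have "\<dots> = lin \<theta> x" unfolding lin_def split by simp
  finally show ?thesis .
qed

lemma lin_ge_size: "\<theta> $ j * size x \<le> lin \<theta> x"
proof -
  have "0 \<le> gap * (\<Sum>k\<in>-{j}. real (x $ k))" using gap(1) by (intro mult_nonneg_nonneg sum_nonneg) auto
  thus ?thesis using lin_size[of x] by linarith
qed

text \<open>A population of at least \<open>m * A - s\<close> costs at least
  \<open>\<theta> $ j * (m * A - s)\<close>, and every customer outside node j costs
  \<open>gap\<close> on top of that. An energy below \<open>m * J + g\<close> thus leaves room for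
  few such customers, and also bounds the excess of the population over
  \<open>m * A\<close>.\<close>

lemma near_target:
  assumes g0: "0 \<le> g" and s0: "0 \<le> s" and size: "m * A - s \<le> size x" and energy: "lin \<theta> x < m * J + g"
  shows "\<bar>real (x $ k) - m * r $ k\<bar> \<le> (g + \<theta> $ j * s) / gap + s + g / \<theta> $ j"
proof -
  define R' where "R' = (\<Sum>k\<in>-{j}. real (x $ k))"
  have R0: "0 \<le> R'" unfolding R'_def by (rule sum_nonneg) simp
  have t: "0 < \<theta> $ j" by (rule theta_pos)
  have sz: "size x = real (x $ j) + R'"
    unfolding size_def R'_def by (subst sum.remove[of UNIV j]) (auto simp: Compl_eq_Diff_UNIV)
  have e: "\<theta> $ j * size x + gap * R' < m * J + g" using lin_size[of x] energy unfolding R'_def by linarith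
  have mJ: "m * J = \<theta> $ j * (m * A)" by (simp add: J_def)
  have "\<theta> $ j * (m * A - s) \<le> \<theta> $ j * size x" using size t by (intro mult_left_mono) auto
  hence "gap * R' \<le> g + \<theta> $ j * s" using e mJ by (simp add: right_diff_distrib)
  hence R1: "R' \<le> (g + \<theta> $ j * s) / gap" using gap(1) by (simp add: pos_le_divide_eq mult.commute)
  have "0 \<le> gap * R'" using gap(1) R0 by simp
  hence "\<theta> $ j * (size x - m * A) \<le> g" using e mJ by (simp add: right_diff_distrib)
  hence S1: "size x - m * A \<le> g / \<theta> $ j" using t by (simp add: pos_le_divide_eq mult.commute)
  have gt: "0 \<le> g / \<theta> $ j" using g0 t by simp
  show ?thesis
  proof (cases "k = j")
    case True
    have mr: "m * r $ j = m * A" by (simp add: r axis_def)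
    have "\<bar>real (x $ j) - m * A\<bar> \<le> (g + \<theta> $ j * s) / gap + s + g / \<theta> $ j"
      using sz size R1 R0 S1 s0 gt unfolding abs_le_iff by linarith
    thus ?thesis unfolding True mr .
  next
    case False
    have "real (x $ k) \<le> R'" unfolding R'_def by (rule member_le_sum) (use False in auto)
    moreover have mr: "m * r $ k = 0" using False by (simp add: r axis_def)
    ultimately show ?thesis unfolding mr using R1 s0 gt by simp
  qed
qed

lemma size_change:
  assumes "\<And>k. \<bar>real (x $ k) - real (y $ k)\<bar> \<le> d"
  shows "size y - real CARD('k) * d \<le> size x"
proof -
  have "size y - size x = (\<Sum>k\<in>UNIV. real (y $ k) - real (x $ k))" by (simp add: size_def sum_subtractf)
  also have "\<dots> \<le> (\<Sum>k\<in>(UNIV :: 'k set). d)"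
  proof (rule sum_mono)
    fix k show "real (y $ k) - real (x $ k) \<le> d" using assms[of k] by (simp add: abs_le_iff)
  qed
  finally show ?thesis by simp
qed

lemma queue: "0 < n \<Longrightarrow> queue_process M Q p A n"
  by unfold_locales (use A in auto)

text \<open>Reversing time from the random overflow time is not possible directly; reversing from each of the \<open>O(n)\<close>
  integer times instead costs only a polynomial factor.\<close>

lemma next_integer_time:
  assumes n: "0 < n" and w: "\<omega> \<in> space M" and Q0: "Q 0 \<omega> = 0" and t: "overflow_time Q A n \<omega> = ereal t"
    and no: "\<And>i. real i \<le> real n * t \<Longrightarrow> \<omega> \<notin> osc_event d i"
  obtains i :: nat where "real n * t \<le> real i" "real i < real n * t + 1" "real n * A - 2 * real CARD('k) * d \<le> size (Q (real i) \<omega>)"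
proof -
  interpret queue_process M Q p A n using n by (rule queue)
  have tot: "tot u \<omega> = size (Q (real n * u) \<omega>)" for u by (simp add: tot_def size_def)
  have t0: "0 \<le> t" and hit: "real n * A \<le> size (Q (real n * t) \<omega>)" using at_\<tau>[OF w t] by (auto simp: tot)
  have nA: "0 < real n * A" using n A by simp
  have "t \<noteq> 0"
  proof
    assume "t = 0"
    hence "size (Q (real n * t) \<omega>) = 0" using Q0 by (simp add: size_def)
    thus False using hit nA by simp
  qed
  hence nt: "0 < real n * t" using t0 n by simp
  \<comment> \<open>Oscillations are measured from integer times, so the states at
    \<open>real n * t\<close> and at i are both compared with the state at \<open>i - 1\<close>;
    this explains the factor 2 and why \<open>t \<noteq> 0\<close> had to be shown first.\<close>
  define i where "i = nat \<lceil>real n * t\<rceil>"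
  have i: "real n * t \<le> real i" "real i < real n * t + 1" "1 \<le> i"
    using nt by (auto simp: i_def) linarith+
  have i1: "real (i - 1) = real i - 1" using i(3) by simp
  have no': "\<omega> \<notin> osc_event d (i - 1)" using i i1 by (intro no) linarith
  have o1: "\<bar>real (Q (real i) \<omega> $ k) - real (Q (real (i - 1)) \<omega> $ k)\<bar> \<le> d" for k
    using no_osc[OF w no', of 1 k] i1 by simp
  have o2: "\<bar>real (Q (real n * t) \<omega> $ k) - real (Q (real (i - 1)) \<omega> $ k)\<bar> \<le> d" for k
    using no_osc[OF w no', of "real n * t - real (i - 1)" k] i i1 by simp
  have "\<bar>real (Q (real i) \<omega> $ k) - real (Q (real n * t) \<omega> $ k)\<bar> \<le> 2 * d" for k
    using o1[of k] o2[of k] by linarith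
  from size_change[of "Q (real i) \<omega>" "Q (real n * t) \<omega>", OF this]
  have "real n * A - 2 * real CARD('k) * d \<le> size (Q (real i) \<omega>)" using hit by simp
  thus ?thesis using that i by blast
qed

text \<open>The delicate case is an overflow earlier than \<open>Ts\<close>, where the path is
  compared from time 0 on and the time shift \<open>Ts - t\<close> might be large. Reversed down to
  time 0 the queue is empty, so closeness to the fluid path gives
  \<open>norm (z (t + e)) \<le> \<delta>1\<close>, and \<open>away\<close> then forces t to be
  within \<eta> of \<open>Ts\<close>.\<close>

lemma follows_if_no_deviation:
  fixes N :: "real ^ 'k \<Rightarrow> real"
  defines "Ts \<equiv> first_zero_time z"
  assumes N: "is_norm N" and C: "0 < C" "\<And>x. N x \<le> C * norm x"
    and qs: "\<And>t. 0 \<le> t \<Longrightarrow> t \<le> Ts \<Longrightarrow> qs t = z (Ts - t)"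
    and n: "0 < n" and w: "\<omega> \<in> space M" and Q0: "Q 0 \<omega> = 0" and t: "overflow_time Q A n \<omega> = ereal t"
    and i: "real n * t \<le> real i" "real i < real n * t + 1"
    and no: "\<omega> \<notin> dev_event \<delta>1 (Ts + 1) n i (Q (real i) \<omega>)"
    and cont: "\<And>a b. 0 \<le> a \<Longrightarrow> a \<le> Ts + 1 \<Longrightarrow> 0 \<le> b \<Longrightarrow> b \<le> Ts + 1 \<Longrightarrow> \<bar>a - b\<bar> \<le> \<eta> \<Longrightarrow> norm (z a - z b) \<le> \<delta>2"
    and away: "\<And>a. 0 \<le> a \<Longrightarrow> a \<le> Ts - \<eta> / 2 \<Longrightarrow> \<delta>1 < norm (z a)"
    and small: "1 / real n \<le> \<eta> / 2" and \<delta>: "C * (\<delta>1 + \<delta>2) < \<delta>"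
  shows "follows_path N Q A n Ts qs \<delta> \<omega>"
proof -
  interpret qp: queue_process M Q p A n using n by (rule queue)
  have Ts: "0 \<le> Ts" unfolding Ts_def by (rule first_zero)
  have t0: "0 \<le> t" using qp.at_\<tau>[OF w t] by simp
  have n1: "1 \<le> real n" using n by simp
  define s0 where "s0 = max (t - Ts) 0"
  have s0: "0 \<le> s0" "s0 \<le> t" "t - s0 \<le> Ts" using Ts t0 by (auto simp: s0_def)
  \<comment> \<open>The rounding error of the overflow time, in fluid time.\<close>
  define e where "e = (real i - real n * t) / real n"
  have e: "0 \<le> e" "e \<le> 1 / real n" using i n by (auto simp: e_def divide_right_mono)
  have en: "e \<le> \<eta> / 2" using e small by linarith
  have e1: "e \<le> 1"
  proof -
    have "1 / real n \<le> 1" using n1 by simp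
    thus ?thesis using e by linarith
  qed
  have near: "norm (scaled Q n u \<omega> - z (t - u + e)) \<le> \<delta>1" if u: "s0 \<le> u" "u \<le> t" for u
  proof -
    define s where "s = real i - real n * u"
    have "real n * u \<le> real n * t" using u n by (intro mult_left_mono) auto
    hence s1: "0 \<le> s" using i by (simp add: s_def)
    have "0 \<le> real n * u" using u s0 by simp
    hence s2: "s \<le> real i" by (simp add: s_def)
    have "s \<le> real n * (t - u) + 1" using i by (simp add: s_def algebra_simps)
    also have "\<dots> \<le> real n * Ts + real n * 1" using u s0 n1 by (intro add_mono mult_left_mono) auto
    finally have s3: "s \<le> real n * (Ts + 1)" by (simp add: distrib_left)
    have "s / real n = t - u + e" using n by (simp add: s_def e_def diff_divide_distrib)
    thus ?thesis using no_dev[OF w no s1 s2 s3 n] by (simp add: scaled_def s_def)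
  qed
  have arg: "norm (z (t - u + e) - z (Ts - (u - s0))) \<le> \<delta>2" if u: "s0 \<le> u" "u \<le> t" for u
  proof (rule cont)
    show "0 \<le> t - u + e" "t - u + e \<le> Ts + 1" using u e e1 s0 by auto
    show "0 \<le> Ts - (u - s0)" "Ts - (u - s0) \<le> Ts + 1" using u s0 Ts by auto
    show "\<bar>t - u + e - (Ts - (u - s0))\<bar> \<le> \<eta>"
    proof (cases "Ts \<le> t")
      case True
      hence "t - u + e - (Ts - (u - s0)) = e" by (simp add: s0_def)
      thus ?thesis using e en small by simp
    next
      case False
      hence z0: "s0 = 0" by (simp add: s0_def)
      have "norm (scaled Q n 0 \<omega> - z (t - 0 + e)) \<le> \<delta>1" using t0 z0 by (intro near) auto
      moreover have "scaled Q n 0 \<omega> = 0" using Q0 by (simp add: scaled_def vec_eq_iff)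
      ultimately have "norm (z (t + e)) \<le> \<delta>1" by simp
      hence "\<not> t + e \<le> Ts - \<eta> / 2" using away[of "t + e"] t0 e by auto
      hence "Ts - t \<le> \<eta>" using en by linarith
      moreover have "t - u + e - (Ts - (u - s0)) = e - (Ts - t)" by (simp add: z0)
      ultimately show ?thesis using False e en by (simp add: abs_le_iff)
    qed
  qed
  have "(SUP u\<in>{s0..t}. N (scaled Q n u \<omega> - qs (u - s0))) \<le> C * (\<delta>1 + \<delta>2)"
  proof (rule cSUP_least)
    show "{s0..t} \<noteq> {}" using s0 by simp
    fix u assume u: "u \<in> {s0..t}"
    have q: "qs (u - s0) = z (Ts - (u - s0))" using u s0 by (intro qs) auto
    have "norm (scaled Q n u \<omega> - qs (u - s0)) \<le> norm (scaled Q n u \<omega> - z (t - u + e)) + norm (z (t - u + e) - z (Ts - (u - s0)))"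
      unfolding q using norm_triangle_ineq[of "scaled Q n u \<omega> - z (t - u + e)" "z (t - u + e) - z (Ts - (u - s0))"] by simp
    also have "\<dots> \<le> \<delta>1 + \<delta>2" using near arg u by (intro add_mono) auto
    finally have "C * norm (scaled Q n u \<omega> - qs (u - s0)) \<le> C * (\<delta>1 + \<delta>2)" using C by (intro mult_left_mono) auto
    thus "N (scaled Q n u \<omega> - qs (u - s0)) \<le> C * (\<delta>1 + \<delta>2)"
      using C(2)[of "scaled Q n u \<omega> - qs (u - s0)"] by simp
  qed
  also note \<delta>
  finally show ?thesis unfolding follows_path_def Let_def t by (simp add: s0_def)
qed

end

section \<open>Exponential upper bounds\<close>

lemma linear_times_exp:
  fixes C a \<gamma> :: real
  assumes "0 < \<gamma>" "0 \<le> C"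
  shows "\<forall>\<^sub>F n :: nat in sequentially. C * (real n + 1) * exp (- real n * (a + \<gamma>)) \<le> exp (- real n * a)"
proof -
  have "\<forall>\<^sub>F n :: nat in sequentially. max 1 (8 * C / \<gamma>\<^sup>2) \<le> real n"
    using filterlim_real_sequentially unfolding filterlim_at_top by blast
  thus ?thesis
  proof eventually_elim
    case (elim n)
    have n: "1 \<le> real n" "8 * C \<le> real n * \<gamma>\<^sup>2" using elim assms by (auto simp: divide_le_eq)
    have "C * (real n + 1) \<le> C * (2 * real n)" using n assms by (intro mult_left_mono) auto
    also have "\<dots> = 8 * C * real n / 4" by simp
    also have "\<dots> \<le> (real n * \<gamma>\<^sup>2) * real n / 4" using n by (intro divide_right_mono mult_right_mono) auto
    also have "\<dots> = (real n * \<gamma> / 2)\<^sup>2" by (simp add: power2_eq_square)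
    also have "\<dots> \<le> (exp (real n * \<gamma> / 2))\<^sup>2"
    proof (rule power_mono)
      show "real n * \<gamma> / 2 \<le> exp (real n * \<gamma> / 2)" using exp_ge_add_one_self[of "real n * \<gamma> / 2"] by linarith
    qed (use assms in simp)
    also have "\<dots> = exp (real n * \<gamma>)" by (simp flip: exp_double)
    finally have "C * (real n + 1) * exp (- real n * (a + \<gamma>)) \<le> exp (real n * \<gamma>) * exp (- real n * (a + \<gamma>))"
      by (intro mult_right_mono) auto
    also have "\<dots> = exp (- real n * a)" by (simp add: algebra_simps flip: exp_add)
    finally show ?case .
  qed
qed

context jackson_overflow begin

text \<open>There are at most \<open>real n * T + 2\<close> integers from 0 up to the rounded value
  of \<open>real n * T\<close>. At each of them either the queue oscillates too much in the
  following unit interval or the event \<open>G i\<close> covers what remains. Only the covering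
  sets have to be measurable; E is arbitrary.\<close>

lemma union_bound:
  assumes n: "0 < n" and T: "0 \<le> T" and \<beta>: "0 \<le> \<beta>"
    and G: "\<And>i. G i \<in> sets M" "\<And>i. measure M (G i) \<le> g"
    and cover: "\<And>\<omega> t i. \<omega> \<in> space M \<Longrightarrow> Q 0 \<omega> = 0 \<Longrightarrow> overflow_time Q A n \<omega> = ereal t \<Longrightarrow> E \<omega> \<Longrightarrow>
       real n * t \<le> real i \<Longrightarrow> real i < real n * t + 1 \<Longrightarrow>
       real n * A - 2 * real CARD('k) * d \<le> size (Q (real i) \<omega>) \<Longrightarrow> \<omega> \<in> G i"
  shows "\<P>(\<omega> in M. E \<omega> \<and> overflow_time Q A n \<omega> \<le> ereal T)
    \<le> (real n * T + 2) * (2 * real CARD('k) * exp (Lam * (exp (2 * \<beta>) - 1)) * exp (- \<beta> * d) + g)"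
proof -
  interpret qp: queue_process M Q p A n using n by (rule queue)
  define c where "c = 2 * real CARD('k) * exp (Lam * (exp (2 * \<beta>) - 1)) * exp (- \<beta> * d)"
  define I where "I = nat \<lceil>real n * T\<rceil>"
  define H where "H i = osc_event d i \<union> G i" for i
  have H: "H i \<in> sets M" "measure M (H i) \<le> c + g" for i
  proof -
    show "H i \<in> sets M" unfolding H_def using osc_bound(1)[OF \<beta>] G by auto
    have "measure M (H i) \<le> measure M (osc_event d i) + measure M (G i)"
      unfolding H_def using osc_bound(1)[OF \<beta>] G by (intro measure_Un_le) auto
    thus "measure M (H i) \<le> c + g" using osc_bound(2)[OF \<beta>, of d i] G(2)[of i] unfolding c_def by linarith
  qed
  define N0 where "N0 = {\<omega> \<in> space M. Q 0 \<omega> \<noteq> 0}"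
  have N0s: "N0 \<in> sets M" unfolding N0_def by (intro pred_sets meas) simp
  have "measure M N0 = 0"
  proof -
    have "AE \<omega> in M. \<omega> \<notin> N0" using start by eventually_elim (simp add: N0_def)
    thus ?thesis using N0s by (simp add: AE_iff_measurable measure_eq_emeasure_eq_ennreal prob_eq_0)
  qed
  have "{\<omega> \<in> space M. E \<omega> \<and> overflow_time Q A n \<omega> \<le> ereal T} \<subseteq> N0 \<union> (\<Union>i\<in>{..I}. H i)"
  proof
    fix \<omega> assume "\<omega> \<in> {\<omega> \<in> space M. E \<omega> \<and> overflow_time Q A n \<omega> \<le> ereal T}"
    hence w: "\<omega> \<in> space M" "E \<omega>" "overflow_time Q A n \<omega> \<le> ereal T" by auto
    show "\<omega> \<in> N0 \<union> (\<Union>i\<in>{..I}. H i)"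
    proof (rule ccontr)
      assume no: "\<omega> \<notin> N0 \<union> (\<Union>i\<in>{..I}. H i)"
      hence Q0: "Q 0 \<omega> = 0" using w by (simp add: N0_def)
      obtain t where t: "overflow_time Q A n \<omega> = ereal t" "t \<le> T"
        using w(3) qp.\<tau>_nonneg[of \<omega>] by (cases "overflow_time Q A n \<omega>") auto
      have nt: "real n * t \<le> real n * T" using t n by (intro mult_left_mono) auto
      have IT: "real n * T \<le> real I" unfolding I_def using T by (simp add: le_of_int_ceiling)
      have noo: "\<omega> \<notin> osc_event d i" if "real i \<le> real n * t" for i
      proof -
        have "i \<le> I" using that nt IT by linarith
        thus ?thesis using no by (auto simp: H_def)
      qed
      obtain i :: nat where i: "real n * t \<le> real i" "real i < real n * t + 1" "real n * A - 2 * real CARD('k) * d \<le> size (Q (real i) \<omega>)"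
        by (rule next_integer_time[OF n w(1) Q0 t(1) noo])
      have "real i < real I + 1" using i(2) nt IT by linarith
      hence "i \<le> I" by linarith
      moreover have "\<omega> \<in> G i" by (rule cover[OF w(1) Q0 t(1) w(2) i])
      ultimately show False using no by (auto simp: H_def)
    qed
  qed
  hence "\<P>(\<omega> in M. E \<omega> \<and> overflow_time Q A n \<omega> \<le> ereal T) \<le> measure M (N0 \<union> (\<Union>i\<in>{..I}. H i))"
    using H N0s by (intro finite_measure_mono) auto
  also have "\<dots> \<le> measure M N0 + measure M (\<Union>i\<in>{..I}. H i)"
    using H N0s by (intro measure_Un_le) auto
  also have "measure M (\<Union>i\<in>{..I}. H i) \<le> (\<Sum>i\<in>{..I}. measure M (H i))"
    using H by (intro finite_measure_subadditive_finite) auto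
  also have "\<dots> \<le> (\<Sum>i\<in>{..I}. c + g)" by (rule sum_mono) (rule H)
  also have "\<dots> = (real I + 1) * (c + g)" by simp
  also have "\<dots> \<le> (real n * T + 2) * (c + g)"
  proof (rule mult_right_mono)
    have "0 \<le> real n * T" using T by simp
    hence "real I \<le> real n * T + 1" unfolding I_def by linarith
    thus "real I + 1 \<le> real n * T + 2" by simp
    show "0 \<le> c + g" using H(2)[of 0] measure_nonneg[of M "H 0"] by linarith
  qed
  finally show ?thesis using \<open>measure M N0 = 0\<close> by (simp add: c_def)
qed

lemma overflow_upper:
  assumes T: "0 \<le> T" and \<gamma>: "0 < \<gamma>"
  shows "\<forall>\<^sub>F n :: nat in sequentially. \<P>(\<omega> in M. overflow_time Q A n \<omega> \<le> ereal T) \<le> exp (- real n * (J - \<gamma>))"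
proof -
  define K where "K = real CARD('k)"
  have K: "1 \<le> K" by (simp add: K_def Suc_leI)
  have tj: "0 < \<theta> $ j" by (rule theta_pos)
  \<comment> \<open>An oscillation of \<open>\<epsilon> * n\<close> per coordinate can hide
    \<open>2 * K * \<epsilon> * n\<close> customers at the integer time, which lowers the exponent
    by \<open>\<gamma> / 4\<close>. The tail sum costs another \<open>\<gamma> / 4\<close> through
    \<eta>, and the remaining half of \<gamma> absorbs the linear factor.\<close>
  define \<epsilon> where "\<epsilon> = \<gamma> / (8 * K * \<theta> $ j)"
  have \<epsilon>: "0 < \<epsilon>" "\<theta> $ j * (2 * K * \<epsilon>) = \<gamma> / 4" using \<gamma> K tj by (auto simp: \<epsilon>_def)
  define \<eta> where "\<eta> = min 1 (\<gamma> / (4 * J))"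
  have \<eta>: "0 < \<eta>" "\<eta> \<le> 1" using \<gamma> J_pos by (auto simp: \<eta>_def)
  have \<eta>J: "\<eta> * J \<le> \<gamma> / 4"
  proof -
    have "\<eta> * J \<le> \<gamma> / (4 * J) * J" using J_pos by (intro mult_right_mono) (auto simp: \<eta>_def)
    thus ?thesis using J_pos by simp
  qed
  obtain S where S: "0 < S" "\<And>B. (\<integral>\<^sup>+x. ennreal (wt x) * indicator {x. B \<le> lin \<theta> x} x \<partial>count_space UNIV) \<le> ennreal (S * exp (- (1 - \<eta>) * B))"
    using weighted_tail[OF \<eta>] by blast
  \<comment> \<open>Chosen so that an oscillation of \<open>\<epsilon> * n\<close> has probability
    of order \<open>exp (- n * J)\<close>.\<close>
  define \<beta> where "\<beta> = J / \<epsilon>"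
  have \<beta>: "0 \<le> \<beta>" "\<beta> * \<epsilon> = J" using J_pos \<epsilon> by (auto simp: \<beta>_def)
  define C1 where "C1 = 2 * K * exp (Lam * (exp (2 * \<beta>) - 1))"
  have C1: "0 \<le> C1" using K by (simp add: C1_def)
  have "\<forall>\<^sub>F n :: nat in sequentially. ((T + 2) * (C1 + S)) * (real n + 1) * exp (- real n * ((J - \<gamma>) + \<gamma> / 2)) \<le> exp (- real n * (J - \<gamma>))"
    using \<gamma> T C1 S(1) by (intro linear_times_exp mult_nonneg_nonneg) auto
  thus ?thesis using eventually_gt_at_top[of 0]
  proof eventually_elim
    case (elim n)
    have n: "0 < n" by (rule elim(2))
    define B where "B = real n * (J - \<gamma> / 4)"
    define G where "G i = {\<omega> \<in> space M. B \<le> lin \<theta> (Q (real i) \<omega>)}" for i :: nat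
    have "\<P>(\<omega> in M. True \<and> overflow_time Q A n \<omega> \<le> ereal T) \<le> (real n * T + 2) * (2 * real CARD('k) * exp (Lam * (exp (2 * \<beta>) - 1)) * exp (- \<beta> * (\<epsilon> * real n)) + S * exp (- (1 - \<eta>) * B))"
    proof (rule union_bound[OF n T \<beta>(1), where G = G])
      show "G i \<in> sets M" for i unfolding G_def by (intro pred_sets meas) simp
      show "measure M (G i) \<le> S * exp (- (1 - \<eta>) * B)" for i
        unfolding G_def by (rule energy_prob[OF S(2) _ S(1)]) simp
      fix \<omega> t i assume w: "\<omega> \<in> space M" and sz: "real n * A - 2 * real CARD('k) * (\<epsilon> * real n) \<le> size (Q (real i) \<omega>)"
      have "B = \<theta> $ j * (real n * A - 2 * real CARD('k) * (\<epsilon> * real n))"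
        unfolding B_def J_def \<epsilon>(2)[symmetric] K_def by (simp add: algebra_simps)
      also have "\<dots> \<le> \<theta> $ j * size (Q (real i) \<omega>)" using sz tj by (intro mult_left_mono) auto
      also have "\<dots> \<le> lin \<theta> (Q (real i) \<omega>)" by (rule lin_ge_size)
      finally show "\<omega> \<in> G i" using w by (simp add: G_def)
    qed
    also have "2 * real CARD('k) * exp (Lam * (exp (2 * \<beta>) - 1)) * exp (- \<beta> * (\<epsilon> * real n)) + S * exp (- (1 - \<eta>) * B)
      \<le> (C1 + S) * exp (- real n * (J - \<gamma> / 2))"
    proof -
      have "exp (- \<beta> * (\<epsilon> * real n)) \<le> exp (- real n * (J - \<gamma> / 2))"
        using \<beta>(2) \<gamma> by (simp add: algebra_simps flip: mult.assoc)
      moreover have "exp (- (1 - \<eta>) * B) \<le> exp (- real n * (J - \<gamma> / 2))"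
      proof -
        have "J - \<gamma> / 2 \<le> J - \<gamma> / 4 - \<eta> * J" using \<eta>J by simp
        also have "\<dots> \<le> (1 - \<eta>) * (J - \<gamma> / 4)" using \<eta> \<gamma> by (simp add: algebra_simps)
        finally have "real n * (J - \<gamma> / 2) \<le> real n * ((1 - \<eta>) * (J - \<gamma> / 4))" by (intro mult_left_mono) auto
        moreover have "- (1 - \<eta>) * B = - (real n * ((1 - \<eta>) * (J - \<gamma> / 4)))"
          unfolding B_def mult_minus_left by (simp only: mult.left_commute)
        ultimately show ?thesis by simp
      qed
      ultimately show ?thesis using C1 S(1) unfolding distrib_right C1_def K_def
        by (intro add_mono mult_left_mono) auto
    qed
    also have "(real n * T + 2) * ((C1 + S) * exp (- real n * (J - \<gamma> / 2))) \<le> ((T + 2) * (C1 + S)) * (real n + 1) * exp (- real n * ((J - \<gamma>) + \<gamma> / 2))"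
    proof -
      have "real n * T + 2 \<le> (T + 2) * (real n + 1)" using T by (simp add: algebra_simps)
      hence "(real n * T + 2) * ((C1 + S) * exp (- real n * (J - \<gamma> / 2))) \<le> ((T + 2) * (real n + 1)) * ((C1 + S) * exp (- real n * (J - \<gamma> / 2)))"
        using C1 S(1) by (intro mult_right_mono) auto
      moreover have "(J - \<gamma>) + \<gamma> / 2 = J - \<gamma> / 2" by simp
      ultimately show ?thesis by (simp only: mult_ac)
    qed
    also note elim(1)
    finally show ?case using T by (simp add: mult_left_mono)
  qed
qed

lemma z_away_from_zero:
  assumes "0 < \<eta>"
  obtains \<zeta> where "0 < \<zeta>" "\<And>a. 0 \<le> a \<Longrightarrow> a \<le> first_zero_time z - \<eta> \<Longrightarrow> \<zeta> \<le> norm (z a)"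
proof (cases "0 \<le> first_zero_time z - \<eta>")
  case True
  have "continuous_on {0..first_zero_time z - \<eta>} (\<lambda>a. norm (z a))"
    by (intro continuous_intros continuous_on_subset[OF z_cont]) auto
  then obtain a where a: "a \<in> {0..first_zero_time z - \<eta>}" "\<forall>b\<in>{0..first_zero_time z - \<eta>}. norm (z a) \<le> norm (z b)"
    using continuous_attains_inf[of "{0..first_zero_time z - \<eta>}" "\<lambda>a. norm (z a)"] True by auto
  have "z a \<noteq> 0" using a assms by (intro first_zero(3)) auto
  thus ?thesis using that[of "norm (z a)"] a by auto
next
  case False
  show ?thesis by (rule that[of 1]) (use False in auto)
qed

text \<open>At the integer time after overflow either the energy exceeds \<open>n * (J + g)\<close>,
  which is already less likely than overflow by an exponential factor, or \<open>near_target\<close>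
  places the state so close to \<open>n * r\<close> that the deviation supermartingale starts small
  and gains \<open>exp (- \<gamma>1 * n)\<close>.\<close>

lemma deviation_upper:
  fixes N :: "real ^ 'k \<Rightarrow> real"
  defines "Ts \<equiv> first_zero_time z"
  assumes T: "0 \<le> T" and N: "is_norm N" and \<delta>: "0 < \<delta>"
    and qs: "\<And>t. 0 \<le> t \<Longrightarrow> t \<le> Ts \<Longrightarrow> qs t = z (Ts - t)"
  obtains \<gamma> where "0 < \<gamma>"
    "\<forall>\<^sub>F n :: nat in sequentially. \<P>(\<omega> in M. \<not> follows_path N Q A n Ts qs \<delta> \<omega> \<and> overflow_time Q A n \<omega> \<le> ereal T) \<le> exp (- real n * (J + \<gamma>))"
proof -
  have Ts: "0 \<le> Ts" unfolding Ts_def by (rule first_zero)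
  obtain C where C: "0 < C" "\<And>x. N x \<le> C * norm x" using is_norm_bound[OF N] by blast
  have "uniformly_continuous_on {0..Ts + 1} z"
    by (intro compact_uniformly_continuous continuous_on_subset[OF z_cont]) auto
  moreover have "0 < \<delta> / (4 * C)" using \<delta> C by simp
  ultimately obtain \<eta>0 where \<eta>0: "0 < \<eta>0" "\<And>a b. a \<in> {0..Ts + 1} \<Longrightarrow> b \<in> {0..Ts + 1} \<Longrightarrow> dist b a < \<eta>0 \<Longrightarrow> dist (z b) (z a) < \<delta> / (4 * C)"
    unfolding uniformly_continuous_on_def by metis
  obtain \<zeta> where \<zeta>: "0 < \<zeta>" "\<And>a. 0 \<le> a \<Longrightarrow> a \<le> Ts - \<eta>0 / 4 \<Longrightarrow> \<zeta> \<le> norm (z a)"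
    unfolding Ts_def using z_away_from_zero[of "\<eta>0 / 4"] \<eta>0 by auto
  define \<delta>2 where "\<delta>2 = \<delta> / (4 * C)"
  define \<eta> where "\<eta> = \<eta>0 / 2"
  \<comment> \<open>The bound by \<zeta> ensures that a fluid state of norm at most
    \<open>\<delta>1\<close> occurs only near or after the time \<open>Ts\<close>; this settles
    overflows earlier than \<open>Ts\<close>.\<close>
  define \<delta>1 where "\<delta>1 = min \<delta>2 (\<zeta> / 2)"
  have \<delta>1: "0 < \<delta>1" "C * (\<delta>1 + \<delta>2) < \<delta>" "\<delta>1 < \<zeta>"
  proof -
    show "0 < \<delta>1" "\<delta>1 < \<zeta>" using \<delta> C \<zeta> by (auto simp: \<delta>1_def \<delta>2_def)
    have "C * (\<delta>1 + \<delta>2) \<le> C * (\<delta>2 + \<delta>2)" using C by (intro mult_left_mono) (auto simp: \<delta>1_def)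
    thus "C * (\<delta>1 + \<delta>2) < \<delta>" using C \<delta> by (simp add: \<delta>2_def)
  qed
  have \<eta>: "0 < \<eta>" using \<eta>0 by (simp add: \<eta>_def)
  have cont: "norm (z a - z b) \<le> \<delta>2" if "0 \<le> a" "a \<le> Ts + 1" "0 \<le> b" "b \<le> Ts + 1" "\<bar>a - b\<bar> \<le> \<eta>" for a b
  proof -
    have "dist (z a) (z b) < \<delta>2" unfolding \<delta>2_def
      by (rule \<eta>0(2)) (use that \<eta>0(1) in \<open>auto simp: dist_real_def \<eta>_def\<close>)
    thus ?thesis by (simp add: dist_norm)
  qed
  have away: "\<delta>1 < norm (z a)" if "0 \<le> a" "a \<le> Ts - \<eta> / 2" for a
    using \<zeta>(2)[of a] that \<delta>1(3) by (simp add: \<eta>_def)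
  \<comment> \<open>The reversal starts at the integer after overflow, up to one unit of fluid time
    too late, so it is followed for one unit more than \<open>Ts\<close>.\<close>
  have H: "0 < Ts + 1" using Ts by simp
  obtain \<gamma>1 \<epsilon> :: real where \<gamma>1: "0 < \<gamma>1" and \<epsilon>: "0 < \<epsilon>" and ev:
    "\<forall>\<^sub>F n :: nat in sequentially. \<exists>Z :: real \<Rightarrow> nat ^ 'k \<Rightarrow> real. (\<forall>t x. 0 \<le> Z t x) \<and>
      (\<forall>t h x. 0 \<le> t \<longrightarrow> 0 \<le> h \<longrightarrow> t + h \<le> real n * (Ts + 1) \<longrightarrow>
         (\<integral>\<^sup>+y. ennreal (Z (t + h) y) \<partial>measure_pmf (p' h x)) \<le> ennreal (Z t x)) \<and>
      (\<forall>t x. 0 \<le> t \<longrightarrow> t \<le> real n * (Ts + 1) \<longrightarrow> \<delta>1 < norm ((\<chi> k. real (x $ k) / real n) - z (t / real n)) \<longrightarrow> 1 \<le> Z t x) \<and>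
      (\<forall>x. (\<forall>k. \<bar>real (x $ k) - real n * r $ k\<bar> \<le> \<epsilon> * real n) \<longrightarrow> Z 0 x \<le> exp (- \<gamma>1 * real n))"
    by (rule deviation_supermartingale[OF bwd \<delta>1(1) H])
  define K where "K = real CARD('k)"
  have K: "1 \<le> K" by (simp add: K_def Suc_leI)
  have tj: "0 < \<theta> $ j" by (rule theta_pos)
  \<comment> \<open>s is the population lost by rounding and g the tolerated excess of energy, both
    per unit of n. Each of the four terms that \<open>near_target\<close> produces gets a quarter of
    \<epsilon>; the last entry of s limits the loss of exponent to
    \<open>\<gamma>1 / 4\<close>.\<close>
  define s where "s = min (min (\<epsilon> / 4) (gap * \<epsilon> / (4 * \<theta> $ j))) (\<gamma>1 / (4 * \<theta> $ j))"
  define g where "g = min (gap * \<epsilon> / 4) (\<theta> $ j * \<epsilon> / 4)"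
  have s: "0 < s" "s \<le> \<epsilon> / 4" "\<theta> $ j * s / gap \<le> \<epsilon> / 4" "\<theta> $ j * s \<le> \<gamma>1 / 4"
  proof -
    show "0 < s" "s \<le> \<epsilon> / 4" using \<epsilon> gap(1) tj \<gamma>1 by (auto simp: s_def)
    have "\<theta> $ j * s \<le> \<theta> $ j * (gap * \<epsilon> / (4 * \<theta> $ j))" using tj by (intro mult_left_mono) (auto simp: s_def)
    thus "\<theta> $ j * s / gap \<le> \<epsilon> / 4" using tj gap(1) by (simp add: divide_le_eq mult.commute)
    have "\<theta> $ j * s \<le> \<theta> $ j * (\<gamma>1 / (4 * \<theta> $ j))" using tj by (intro mult_left_mono) (auto simp: s_def)
    thus "\<theta> $ j * s \<le> \<gamma>1 / 4" using tj by simp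
  qed
  have g: "0 < g" "g / gap \<le> \<epsilon> / 4" "g / \<theta> $ j \<le> \<epsilon> / 4"
    using \<epsilon> gap(1) tj by (auto simp: g_def divide_le_eq min_le_iff_disj mult.commute)
  define d where "d = s / (2 * K)"
  have d: "0 < d" "2 * K * d = s" using s(1) K by (auto simp: d_def)
  \<comment> \<open>The share of the exponent given up in \<open>weighted_tail\<close>: at most
    \<open>\<gamma>1 / 4\<close> for ends near the target, and at most half of g for ends of
    excessive energy.\<close>
  define \<kappa> where "\<kappa> = min 1 (min (\<gamma>1 / (4 * J)) (g / (2 * (J + g))))"
  have \<kappa>: "0 < \<kappa>" "\<kappa> \<le> 1" "\<kappa> * J \<le> \<gamma>1 / 4" "\<kappa> * (J + g) \<le> g / 2"
  proof -
    show "0 < \<kappa>" "\<kappa> \<le> 1" using \<gamma>1 J_pos g(1) by (auto simp: \<kappa>_def)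
    have "\<kappa> * J \<le> \<gamma>1 / (4 * J) * J" using J_pos by (intro mult_right_mono) (auto simp: \<kappa>_def)
    thus "\<kappa> * J \<le> \<gamma>1 / 4" using J_pos by simp
    have "\<kappa> * (J + g) \<le> g / (2 * (J + g)) * (J + g)" using J_pos g(1) by (intro mult_right_mono) (auto simp: \<kappa>_def)
    also have "\<dots> = g / 2" using J_pos g(1) by (simp add: field_simps)
    finally show "\<kappa> * (J + g) \<le> g / 2" .
  qed
  obtain S where S: "0 < S" "\<And>B. (\<integral>\<^sup>+x. ennreal (wt x) * indicator {x. B \<le> lin \<theta> x} x \<partial>count_space UNIV) \<le> ennreal (S * exp (- (1 - \<kappa>) * B))"
    using weighted_tail[OF \<kappa>(1,2)] by blast
  define \<beta> where "\<beta> = (J + 1) / d"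
  have \<beta>: "0 \<le> \<beta>" "\<beta> * d = J + 1" using J_pos d by (auto simp: \<beta>_def)
  define C1 where "C1 = 2 * K * exp (Lam * (exp (2 * \<beta>) - 1))"
  have C1: "0 \<le> C1" using K by (simp add: C1_def)
  \<comment> \<open>The three contributions have exponents at least \<open>J + 1\<close>
    (oscillation), \<open>J + g / 2\<close> (energy) and \<open>J + \<gamma>1 / 2\<close>
    (deviation). All are at least \<open>J + 2 * \<gamma>\<close>, and one \<gamma> is spent on the
    linear factor.\<close>
  define \<gamma> where "\<gamma> = min 1 (min (g / 2) (\<gamma>1 / 2)) / 2"
  have \<gamma>: "0 < \<gamma>" "2 * \<gamma> \<le> 1" "2 * \<gamma> \<le> g / 2" "2 * \<gamma> \<le> \<gamma>1 / 2" using g(1) \<gamma>1 by (auto simp: \<gamma>_def)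
  show ?thesis
  proof (rule that[OF \<gamma>(1)])
    have poly: "\<forall>\<^sub>F n :: nat in sequentially. ((T + 2) * (C1 + (S + S))) * (real n + 1) * exp (- real n * ((J + \<gamma>) + \<gamma>)) \<le> exp (- real n * (J + \<gamma>))"
      using \<gamma> T C1 S(1) by (intro linear_times_exp mult_nonneg_nonneg) auto
    have big: "\<forall>\<^sub>F n :: nat in sequentially. max 1 (2 / \<eta>) \<le> real n"
      using filterlim_real_sequentially unfolding filterlim_at_top by blast
    show "\<forall>\<^sub>F n :: nat in sequentially. \<P>(\<omega> in M. \<not> follows_path N Q A n Ts qs \<delta> \<omega> \<and> overflow_time Q A n \<omega> \<le> ereal T) \<le> exp (- real n * (J + \<gamma>))"
      using poly big ev
    proof eventually_elim
      case (elim n)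
      have n: "0 < n" using elim(2) by (cases n) auto
      have small: "1 / real n \<le> \<eta> / 2" using elim(2) \<eta> n by (simp add: field_simps)
      obtain Z :: "real \<Rightarrow> nat ^ 'k \<Rightarrow> real" where Z: "\<And>t x. 0 \<le> Z t x"
        "\<And>t h x. 0 \<le> t \<Longrightarrow> 0 \<le> h \<Longrightarrow> t + h \<le> real n * (Ts + 1) \<Longrightarrow>
         (\<integral>\<^sup>+y. ennreal (Z (t + h) y) \<partial>measure_pmf (p' h x)) \<le> ennreal (Z t x)"
        "\<And>t x. 0 \<le> t \<Longrightarrow> t \<le> real n * (Ts + 1) \<Longrightarrow> \<delta>1 < norm ((\<chi> k. real (x $ k) / real n) - z (t / real n)) \<Longrightarrow> 1 \<le> Z t x"
        "\<And>x. (\<forall>k. \<bar>real (x $ k) - real n * r $ k\<bar> \<le> \<epsilon> * real n) \<Longrightarrow> Z 0 x \<le> exp (- \<gamma>1 * real n)"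
        using elim(3) by blast
      define U where "U = {y. (\<forall>k. \<bar>real (y $ k) - real n * r $ k\<bar> \<le> \<epsilon> * real n) \<and> real n * (J - \<theta> $ j * s) \<le> lin \<theta> y}"
      define G1 where "G1 i = {\<omega> \<in> space M. real n * (J + g) \<le> lin \<theta> (Q (real i) \<omega>)}" for i :: nat
      define G2 where "G2 i = (\<Union>y\<in>U. dev_event \<delta>1 (Ts + 1) n i y)" for i
      have dev: "dev_event \<delta>1 (Ts + 1) n i y \<in> sets M" "emeasure M (dev_event \<delta>1 (Ts + 1) n i y) \<le> ennreal (wt y) * ennreal (Z 0 y)" for i y
        by (rule dev_bound[OF Z(2,3)]; use H in simp)+
      have devU: "emeasure M (dev_event \<delta>1 (Ts + 1) n i y) \<le> ennreal (wt y) * ennreal (exp (- \<gamma>1 * real n))" if "y \<in> U" for i y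
      proof (rule order_trans[OF dev(2)])
        have "Z 0 y \<le> exp (- \<gamma>1 * real n)" using that by (intro Z(4)) (simp add: U_def)
        thus "ennreal (wt y) * ennreal (Z 0 y) \<le> ennreal (wt y) * ennreal (exp (- \<gamma>1 * real n))"
          by (intro mult_left_mono ennreal_leI) auto
      qed
      have G2: "G2 i \<in> sets M" "measure M (G2 i) \<le> S * exp (- (1 - \<kappa>) * (real n * (J - \<theta> $ j * s))) * exp (- \<gamma>1 * real n)" for i
      proof -
        have U: "real n * (J - \<theta> $ j * s) \<le> lin \<theta> y" if "y \<in> U" for y using that by (simp add: U_def)
        show "G2 i \<in> sets M" "measure M (G2 i) \<le> S * exp (- (1 - \<kappa>) * (real n * (J - \<theta> $ j * s))) * exp (- \<gamma>1 * real n)"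
          unfolding G2_def by (rule dev_event_union[OF dev(1) devU S(2) S(1) _ U]; simp)+
      qed
      have G1: "G1 i \<in> sets M" "measure M (G1 i) \<le> S * exp (- (1 - \<kappa>) * (real n * (J + g)))" for i
      proof -
        show "G1 i \<in> sets M" unfolding G1_def by (intro pred_sets meas) simp
        show "measure M (G1 i) \<le> S * exp (- (1 - \<kappa>) * (real n * (J + g)))"
          unfolding G1_def by (rule energy_prob[OF S(2) _ S(1)]) simp
      qed
      have e1: "exp (- (1 - \<kappa>) * (real n * (J + g))) \<le> exp (- real n * (J + 2 * \<gamma>))"
      proof -
        have "J + 2 * \<gamma> \<le> (J + g) - \<kappa> * (J + g)" using \<kappa>(4) \<gamma>(3) by linarith
        also have "\<dots> = (1 - \<kappa>) * (J + g)" by (simp add: algebra_simps)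
        finally have "real n * (J + 2 * \<gamma>) \<le> real n * ((1 - \<kappa>) * (J + g))" by (intro mult_left_mono) auto
        moreover have "- (1 - \<kappa>) * (real n * (J + g)) = - (real n * ((1 - \<kappa>) * (J + g)))"
          unfolding mult_minus_left by (simp only: mult.left_commute)
        ultimately show ?thesis by simp
      qed
      have e2: "exp (- (1 - \<kappa>) * (real n * (J - \<theta> $ j * s))) * exp (- \<gamma>1 * real n) \<le> exp (- real n * (J + 2 * \<gamma>))"
      proof -
        have "0 \<le> \<kappa> * (\<theta> $ j * s)" using \<kappa>(1) tj s(1) by simp
        hence "J + 2 * \<gamma> \<le> J - \<theta> $ j * s - \<kappa> * J + \<kappa> * (\<theta> $ j * s) + \<gamma>1" using \<kappa>(3) \<gamma>(4) s(4) by linarith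
        also have "\<dots> = (1 - \<kappa>) * (J - \<theta> $ j * s) + \<gamma>1" by (simp add: algebra_simps)
        finally have "real n * (J + 2 * \<gamma>) \<le> real n * ((1 - \<kappa>) * (J - \<theta> $ j * s) + \<gamma>1)" by (intro mult_left_mono) auto
        also have "\<dots> = (1 - \<kappa>) * (real n * (J - \<theta> $ j * s)) + \<gamma>1 * real n" by (simp add: algebra_simps)
        finally have le: "real n * (J + 2 * \<gamma>) \<le> (1 - \<kappa>) * (real n * (J - \<theta> $ j * s)) + \<gamma>1 * real n" .
        have eq: "- (1 - \<kappa>) * (real n * (J - \<theta> $ j * s)) + - \<gamma>1 * real n = - ((1 - \<kappa>) * (real n * (J - \<theta> $ j * s)) + \<gamma>1 * real n)"
          by (simp only: mult_minus_left minus_add_distrib)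
        show ?thesis unfolding exp_add[symmetric] eq using le by simp
      qed
      have e3: "exp (- \<beta> * (d * real n)) \<le> exp (- real n * (J + 2 * \<gamma>))"
      proof -
        have "real n * (J + 2 * \<gamma>) \<le> real n * (\<beta> * d)" using \<beta>(2) \<gamma>(2) by (intro mult_left_mono) auto
        thus ?thesis by (simp add: mult_ac)
      qed
      have "\<P>(\<omega> in M. \<not> follows_path N Q A n Ts qs \<delta> \<omega> \<and> overflow_time Q A n \<omega> \<le> ereal T)
         \<le> (real n * T + 2) * (2 * real CARD('k) * exp (Lam * (exp (2 * \<beta>) - 1)) * exp (- \<beta> * (d * real n))
           + (S * exp (- (1 - \<kappa>) * (real n * (J + g))) + S * exp (- (1 - \<kappa>) * (real n * (J - \<theta> $ j * s))) * exp (- \<gamma>1 * real n)))"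
      proof (rule union_bound[OF n T \<beta>(1), where G = "\<lambda>i. G1 i \<union> G2 i"])
        show "G1 i \<union> G2 i \<in> sets M" for i using G1 G2 by auto
        show "measure M (G1 i \<union> G2 i) \<le> S * exp (- (1 - \<kappa>) * (real n * (J + g))) + S * exp (- (1 - \<kappa>) * (real n * (J - \<theta> $ j * s))) * exp (- \<gamma>1 * real n)" for i
          by (rule order_trans[OF measure_Un_le[OF G1(1) G2(1)] add_mono[OF G1(2) G2(2)]])
        fix \<omega> t i
        assume w: "\<omega> \<in> space M" and Q0: "Q 0 \<omega> = 0" and t: "overflow_time Q A n \<omega> = ereal t"
          and nf: "\<not> follows_path N Q A n Ts qs \<delta> \<omega>" and i: "real n * t \<le> real i" "real i < real n * t + 1"
          and sz: "real n * A - 2 * real CARD('k) * (d * real n) \<le> size (Q (real i) \<omega>)"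
        have sz': "real n * A - s * real n \<le> size (Q (real i) \<omega>)"
          using sz d(2) by (simp add: K_def flip: mult.assoc)
        show "\<omega> \<in> G1 i \<union> G2 i"
        proof (cases "real n * (J + g) \<le> lin \<theta> (Q (real i) \<omega>)")
          case True
          thus ?thesis using w by (simp add: G1_def)
        next
          case False
          hence le: "lin \<theta> (Q (real i) \<omega>) < real n * J + g * real n" by (simp add: algebra_simps)
          have "\<bar>real (Q (real i) \<omega> $ k) - real n * r $ k\<bar> \<le> \<epsilon> * real n" for k
          proof -
            have "\<bar>real (Q (real i) \<omega> $ k) - real n * r $ k\<bar> \<le> (g * real n + \<theta> $ j * (s * real n)) / gap + s * real n + g * real n / \<theta> $ j"
              by (rule near_target[OF _ _ sz' le]) (use g(1) s(1) in auto)
            also have "\<dots> = (g / gap + \<theta> $ j * s / gap + s + g / \<theta> $ j) * real n"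
              by (simp add: add_divide_distrib distrib_right)
            also have "\<dots> \<le> \<epsilon> * real n" by (rule mult_right_mono[rotated]) (simp, use s g in linarith)
            finally show ?thesis .
          qed
          moreover have "real n * (J - \<theta> $ j * s) \<le> lin \<theta> (Q (real i) \<omega>)"
          proof -
            have "real n * (J - \<theta> $ j * s) = \<theta> $ j * (real n * A - s * real n)" by (simp add: J_def algebra_simps)
            also have "\<dots> \<le> \<theta> $ j * size (Q (real i) \<omega>)" using sz' tj by (intro mult_left_mono) auto
            finally show ?thesis using lin_ge_size[of "Q (real i) \<omega>"] by linarith
          qed
          ultimately have QU: "Q (real i) \<omega> \<in> U" by (simp add: U_def)
          have "\<omega> \<in> dev_event \<delta>1 (Ts + 1) n i (Q (real i) \<omega>)"
          proof (rule ccontr)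
            assume no: "\<omega> \<notin> dev_event \<delta>1 (Ts + 1) n i (Q (real i) \<omega>)"
            have "follows_path N Q A n Ts qs \<delta> \<omega>"
              unfolding Ts_def
              by (rule follows_if_no_deviation[OF N C qs[unfolded Ts_def] n w Q0 t i no[unfolded Ts_def] cont[unfolded Ts_def] away[unfolded Ts_def] small \<delta>1(2)])
            thus False using nf by simp
          qed
          thus ?thesis using QU by (auto simp: G2_def)
        qed
      qed
      also have "\<dots> \<le> (real n * T + 2) * ((C1 + (S + S)) * exp (- real n * (J + 2 * \<gamma>)))"
      proof (rule mult_left_mono)
        have "S * exp (- (1 - \<kappa>) * (real n * (J - \<theta> $ j * s))) * exp (- \<gamma>1 * real n) \<le> S * exp (- real n * (J + 2 * \<gamma>))"
          unfolding mult.assoc using e2 S(1) by (intro mult_left_mono) auto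
        thus "2 * real CARD('k) * exp (Lam * (exp (2 * \<beta>) - 1)) * exp (- \<beta> * (d * real n))
           + (S * exp (- (1 - \<kappa>) * (real n * (J + g))) + S * exp (- (1 - \<kappa>) * (real n * (J - \<theta> $ j * s))) * exp (- \<gamma>1 * real n))
           \<le> (C1 + (S + S)) * exp (- real n * (J + 2 * \<gamma>))"
          using e1 e3 S(1) C1 unfolding distrib_right C1_def K_def by (intro add_mono mult_left_mono) auto
      qed (use T in simp)
      also have "\<dots> \<le> ((T + 2) * (real n + 1)) * ((C1 + (S + S)) * exp (- real n * (J + 2 * \<gamma>)))"
      proof (rule mult_right_mono)
        show "real n * T + 2 \<le> (T + 2) * (real n + 1)" using T by (simp add: algebra_simps)
      qed (use C1 S(1) in simp)
      also have "\<dots> = ((T + 2) * (C1 + (S + S))) * (real n + 1) * exp (- real n * ((J + \<gamma>) + \<gamma>))" by (simp add: mult_ac)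
      also note elim(1)
      finally show ?case .
    qed
  qed
qed

end

section \<open>Exponential lower bound\<close>

context jackson_process begin

text \<open>A fixed step length for which \<open>stay\<close> and \<open>one_jump\<close> both give
  explicit positive bounds, because \<open>(Lam + 1) * h0 = 1 / 2\<close>.\<close>

definition h0 :: real where "h0 = 1 / (2 * (Lam + 1))"

lemma Lam_nonneg: "0 \<le> Lam" using jump_semigroup.Lambda_nonneg[OF fwd] .

lemma h0: "0 < h0" "(Lam + 1) * h0 = 1 / 2" using Lam_nonneg by (auto simp: h0_def field_simps)

text \<open>Arrivals are possible in every state at rates bounded below, so c does not depend on x.
  Staying is included to let a path to a small state use up surplus steps.\<close>

lemma uniform_step:
  obtains c where "0 < c" "c \<le> 1 / 2" "\<And>x. c \<le> pmf (p h0 x) x" "\<And>x k. c \<le> pmf (p h0 x) (x + axis k 1)"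
proof -
  interpret F: jump_semigroup p "jackson_rate lam mu P" Lam by (rule fwd)
  define l where "l = Min (range (\<lambda>k. lam $ k))"
  have l: "0 < l" "l \<le> lam $ k" for k unfolding l_def using lam_pos by (auto simp: Min_gr_iff)
  define c where "c = min (1 / 2) (exp (- (1 / 2)) * (l * h0 / 2))"
  show ?thesis
  proof (rule that)
    show "0 < c" "c \<le> 1 / 2" using l(1) h0(1) by (auto simp: c_def)
    fix x k
    have "Lam * h0 \<le> 1 / 2" using h0 by (simp add: distrib_right)
    hence "1 / 2 \<le> pmf (p h0 x) x" using F.stay[of h0 x] h0(1) by simp
    thus "c \<le> pmf (p h0 x) x" by (simp add: c_def)
    have ne: "x + axis k 1 \<noteq> x" by (auto simp: vec_eq_iff axis_def)
    define q where "q = jackson_rate lam mu P x (x + axis k 1)"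
    have lq: "l \<le> q"
    proof -
      have "l \<le> lam $ k * of_bool (x + axis k 1 = x + axis k 1)" using l(2) by simp
      also have "\<dots> \<le> (\<Sum>m\<in>UNIV. lam $ m * of_bool (x + axis k 1 = x + axis m 1))"
        by (rule member_le_sum) (use lam_pos in \<open>auto simp: less_imp_le\<close>)
      also have "\<dots> \<le> q" unfolding q_def jackson_rate_def
        using routing(1) mu_pos by (intro add_increasing2 sum_nonneg add_nonneg_nonneg mult_nonneg_nonneg)
          (auto simp: substochastic_def less_imp_le)
      finally show ?thesis .
    qed
    have "q * h0 - (Lam + 1) * q * h0\<^sup>2 = q * h0 * (1 - (Lam + 1) * h0)" by (simp add: power2_eq_square algebra_simps)
    also have "\<dots> = q * h0 / 2" unfolding h0(2) by simp
    finally have eq: "q * h0 - (Lam + 1) * q * h0\<^sup>2 = q * h0 / 2" .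
    have "exp (- ((Lam + 1) * h0)) * (q * h0 - (Lam + 1) * q * h0\<^sup>2) \<le> pmf (p h0 x) (x + axis k 1)"
      unfolding q_def by (rule F.one_jump[OF ne less_imp_le[OF h0(1)]])
    hence "exp (- (1 / 2)) * (q * h0 / 2) \<le> pmf (p h0 x) (x + axis k 1)"
      unfolding eq h0(2) .
    moreover have "exp (- (1 / 2)) * (l * h0 / 2) \<le> exp (- (1 / 2)) * (q * h0 / 2)"
      using lq h0(1) by (intro mult_left_mono divide_right_mono mult_right_mono) auto
    moreover have "c \<le> exp (- (1 / 2)) * (l * h0 / 2)" unfolding c_def by (rule min.cobounded2)
    ultimately show "c \<le> pmf (p h0 x) (x + axis k 1)" by linarith
  qed
qed

text \<open>A crude bound by arrivals only; by reversal it lets the dual chain end exactly in \<open>0\<close>.\<close>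

lemma reach:
  assumes c: "0 < c" "c \<le> 1 / 2" "\<And>x. c \<le> pmf (p h0 x) x" "\<And>x k. c \<le> pmf (p h0 x) (x + axis k 1)"
  shows "(\<Sum>k\<in>UNIV. x $ k) \<le> m \<Longrightarrow> c ^ m \<le> pmf (p (real m * h0) 0) x"
proof (induction m arbitrary: x)
  case 0
  hence "x = 0" by (simp add: vec_eq_iff)
  thus ?case using jump_semigroup.p_0[OF fwd] by simp
next
  case (Suc m)
  interpret F: jump_semigroup p "jackson_rate lam mu P" Lam by (rule fwd)
  have t: "real (Suc m) * h0 = real m * h0 + h0" by (simp add: algebra_simps)
  have step: "c ^ Suc m \<le> pmf (p (real (Suc m) * h0) 0) x" if "c ^ m \<le> pmf (p (real m * h0) 0) y" "c \<le> pmf (p h0 y) x" for y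
  proof -
    have "c ^ Suc m = c ^ m * c" by simp
    also have "\<dots> \<le> pmf (p (real m * h0) 0) y * pmf (p h0 y) x" using that c(1) by (intro mult_mono) auto
    also have "\<dots> \<le> pmf (p (real (Suc m) * h0) 0) x"
      unfolding t using F.chapman_kolmogorov_ge[of "real m * h0" h0 "{y}" 0 x] h0(1) by simp
    finally show ?thesis .
  qed
  show ?case
  proof (cases "(\<Sum>k\<in>UNIV. x $ k) \<le> m")
    case True
    show ?thesis by (rule step[OF Suc.IH[OF True] c(3)])
  next
    case False
    have "\<exists>k. x $ k \<noteq> 0"
    proof (rule ccontr)
      assume "\<not> (\<exists>k. x $ k \<noteq> 0)"
      hence "(\<Sum>k\<in>UNIV. x $ k) = 0" by simp
      thus False using \<open>\<not> (\<Sum>k\<in>UNIV. x $ k) \<le> m\<close> by linarith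
    qed
    then obtain k where k: "0 < x $ k" by auto
    define y where "y = x - axis k 1"
    have xy: "x = y + axis k 1" unfolding y_def by (rule sub_add_axis[OF k, symmetric])
    have "(\<Sum>l\<in>UNIV. x $ l) = (\<Sum>l\<in>UNIV. y $ l) + 1"
      unfolding xy by (simp add: sum.distrib axis_def)
    hence "(\<Sum>l\<in>UNIV. y $ l) \<le> m" using Suc.prems by simp
    from Suc.IH[OF this] have "c ^ m \<le> pmf (p (real m * h0) 0) y" .
    thus ?thesis by (rule step) (use c(4)[of y k] xy in simp)
  qed
qed

lemma backward_ge_forward: "0 \<le> t \<Longrightarrow> pmf (p t 0) x \<le> pmf (p' t x) 0"
proof -
  assume t: "0 \<le> t"
  have "pmf (p t 0) x = wt x * pmf (p' t x) 0" using rev[OF t, of x 0] by (simp add: wt_0)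
  also have "\<dots> \<le> 1 * pmf (p' t x) 0" using wt_le_1 by (intro mult_right_mono) auto
  finally show ?thesis by simp
qed

end

context jackson_overflow begin

text \<open>It suffices to hit one state y next to \<open>n * r\<close> at one time. By reversal
  this probability is \<open>wt y\<close> times the probability that the dual chain started in y is
  in 0 at that time. After time \<open>n * Ts\<close> the dual chain is with probability at least
  1/2 within \<open>\<delta>1 * n\<close> of 0, and the remaining at most
  \<open>K * \<delta>1 * n\<close> customers are removed at a cost exponential in their number,
  which is small compared with \<open>exp (\<gamma> * n)\<close>. The extra unit in the bound on T
  leaves time for this last stretch.\<close>

lemma overflow_lower:
  assumes T: "first_zero_time z + 1 \<le> T" and \<gamma>: "0 < \<gamma>"
  shows "\<forall>\<^sub>F n :: nat in sequentially. exp (- real n * (J + \<gamma>)) \<le> \<P>(\<omega> in M. overflow_time Q A n \<omega> \<le> ereal T)"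
proof -
  define Ts where "Ts = first_zero_time z"
  have Ts: "0 \<le> Ts" "z Ts = 0" unfolding Ts_def by (rule first_zero)+
  interpret D: jump_semigroup p' "jackson_rate lamd mu Pd" Lam by (rule bwd)
  define K where "K = real CARD('k)"
  have K: "1 \<le> K" by (simp add: K_def Suc_leI)
  have tj: "0 < \<theta> $ j" by (rule theta_pos)
  obtain c where c: "0 < c" "c \<le> 1 / 2" "\<And>x. c \<le> pmf (p h0 x) x" "\<And>x k. c \<le> pmf (p h0 x) (x + axis k 1)"
    using uniform_step by blast
  define L where "L = - ln c"
  have "ln c < ln 1" using c(1,2) by (subst ln_less_cancel_iff) auto
  hence L: "0 < L" by (simp add: L_def)
  have cL: "c ^ m = exp (- L * real m)" for m :: nat
  proof -
    have "c ^ m = exp (ln c) ^ m" using c(1) by simp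
    thus ?thesis by (simp add: L_def mult.commute flip: exp_of_nat_mult)
  qed
  \<comment> \<open>The first entry limits the cost \<open>c ^ m\<close> of the last stretch, the
    second its duration \<open>m * h0\<close>.\<close>
  define \<delta>1 where "\<delta>1 = min (\<gamma> / (4 * K * L)) (1 / (4 * K * h0))"
  have \<delta>1: "0 < \<delta>1" "K * \<delta>1 * L \<le> \<gamma> / 4" "K * \<delta>1 * h0 \<le> 1 / 4"
  proof -
    show "0 < \<delta>1" using \<gamma> K L h0(1) by (simp add: \<delta>1_def)
    have "K * \<delta>1 * L = \<delta>1 * (K * L)" by simp
    also have "\<dots> \<le> \<gamma> / (4 * K * L) * (K * L)" using K L by (intro mult_right_mono) (auto simp: \<delta>1_def)
    finally show "K * \<delta>1 * L \<le> \<gamma> / 4" using K L by simp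
    have "K * \<delta>1 * h0 = \<delta>1 * (K * h0)" by simp
    also have "\<dots> \<le> 1 / (4 * K * h0) * (K * h0)" using K h0(1) by (intro mult_right_mono) (auto simp: \<delta>1_def)
    finally show "K * \<delta>1 * h0 \<le> 1 / 4" using K h0(1) by simp
  qed
  have H: "0 < Ts + 1" using Ts by simp
  obtain \<gamma>1 \<epsilon> :: real where \<gamma>1: "0 < \<gamma>1" and \<epsilon>: "0 < \<epsilon>" and ev:
    "\<forall>\<^sub>F n :: nat in sequentially. \<exists>Z :: real \<Rightarrow> nat ^ 'k \<Rightarrow> real. (\<forall>t x. 0 \<le> Z t x) \<and>
      (\<forall>t h x. 0 \<le> t \<longrightarrow> 0 \<le> h \<longrightarrow> t + h \<le> real n * (Ts + 1) \<longrightarrow>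
         (\<integral>\<^sup>+y. ennreal (Z (t + h) y) \<partial>measure_pmf (p' h x)) \<le> ennreal (Z t x)) \<and>
      (\<forall>t x. 0 \<le> t \<longrightarrow> t \<le> real n * (Ts + 1) \<longrightarrow> \<delta>1 < norm ((\<chi> k. real (x $ k) / real n) - z (t / real n)) \<longrightarrow> 1 \<le> Z t x) \<and>
      (\<forall>x. (\<forall>k. \<bar>real (x $ k) - real n * r $ k\<bar> \<le> \<epsilon> * real n) \<longrightarrow> Z 0 x \<le> exp (- \<gamma>1 * real n))"
    by (rule deviation_supermartingale[OF bwd \<delta>1(1) H])
  define C where "C = \<theta> $ j + 2 * L + ln 2"
  have big: "\<forall>\<^sub>F n :: nat in sequentially. max (max 1 (1 / \<epsilon>)) (max (ln 2 / \<gamma>1) (max (4 * h0) (2 * C / \<gamma>))) \<le> real n"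
    using filterlim_real_sequentially unfolding filterlim_at_top by blast
  show ?thesis using big ev
  proof eventually_elim
    case (elim n)
    have n1: "1 \<le> real n" using elim(1) by simp
    hence n: "0 < n" by simp
    have nb: "1 \<le> \<epsilon> * real n" "ln 2 \<le> \<gamma>1 * real n" "4 * h0 \<le> real n" "2 * C \<le> \<gamma> * real n"
      using elim(1) \<epsilon> \<gamma>1 \<gamma> by (auto simp: divide_le_eq mult.commute)
    obtain Z :: "real \<Rightarrow> nat ^ 'k \<Rightarrow> real" where Z: "\<And>t x. 0 \<le> Z t x"
        "\<And>t h x. 0 \<le> t \<Longrightarrow> 0 \<le> h \<Longrightarrow> t + h \<le> real n * (Ts + 1) \<Longrightarrow>
         (\<integral>\<^sup>+y. ennreal (Z (t + h) y) \<partial>measure_pmf (p' h x)) \<le> ennreal (Z t x)"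
        "\<And>t x. 0 \<le> t \<Longrightarrow> t \<le> real n * (Ts + 1) \<Longrightarrow> \<delta>1 < norm ((\<chi> k. real (x $ k) / real n) - z (t / real n)) \<Longrightarrow> 1 \<le> Z t x"
        "\<And>x. (\<forall>k. \<bar>real (x $ k) - real n * r $ k\<bar> \<le> \<epsilon> * real n) \<Longrightarrow> Z 0 x \<le> exp (- \<gamma>1 * real n)"
      using elim(2) by blast
    \<comment> \<open>Rounding up ensures that y itself has overflowed; the additional customer
      changes the weight only by a bounded factor.\<close>
    define a where "a = nat \<lceil>real n * A\<rceil>"
    have nA: "0 < real n * A" using n A by simp
    have a: "real n * A \<le> real a" "real a < real n * A + 1" using nA by (auto simp: a_def) linarith+
    define y where "y = (axis j a :: nat ^ 'k)"
    have ynear: "\<bar>real (y $ k) - real n * r $ k\<bar> \<le> \<epsilon> * real n" for k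
    proof (cases "k = j")
      case True
      have nr: "real n * r $ k = real n * A" using True by (simp add: r axis_def)
      have "y $ k = a" using True by (simp add: y_def axis_def)
      thus ?thesis unfolding nr using a nb(1) by (simp add: abs_le_iff)
    next
      case False
      have nr: "real n * r $ k = 0" using False by (simp add: r axis_def)
      show ?thesis unfolding nr using False \<epsilon> by (simp add: y_def axis_def)
    qed
    define W where "W = {x :: nat ^ 'k. norm ((\<chi> k. real (x $ k) / real n)) \<le> \<delta>1}"
    define t1 where "t1 = real n * Ts"
    have t1: "0 \<le> t1" "t1 \<le> real n * (Ts + 1)" using Ts by (auto simp: t1_def distrib_left)
    \<comment> \<open>At a single time Markov's inequality suffices; the fluid path is at 0 there,
      so leaving W is a deviation.\<close>
    have Wprob: "1 / 2 \<le> measure_pmf.prob (p' t1 y) W"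
    proof -
      have "emeasure (measure_pmf (p' t1 y)) (- W) = (\<integral>\<^sup>+x. indicator (- W) x \<partial>measure_pmf (p' t1 y))" by simp
      also have "\<dots> \<le> (\<integral>\<^sup>+x. ennreal (Z (0 + t1) x) \<partial>measure_pmf (p' t1 y))"
      proof (rule nn_integral_mono)
        fix x
        show "indicator (- W) x \<le> ennreal (Z (0 + t1) x)"
        proof (cases "x \<in> W")
          case False
          have "t1 / real n = Ts" using n by (simp add: t1_def)
          hence "1 \<le> Z t1 x" using False Ts(2) t1 by (intro Z(3)) (auto simp: W_def)
          hence "ennreal 1 \<le> ennreal (Z t1 x)" by (rule ennreal_leI)
          thus ?thesis using False by simp
        qed simp
      qed
      also have "\<dots> \<le> ennreal (Z 0 y)" using t1 by (intro Z(2)) auto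
      also have "\<dots> \<le> ennreal (exp (- \<gamma>1 * real n))" using ynear by (intro ennreal_leI Z(4)) auto
      also have "\<dots> \<le> ennreal (1 / 2)"
      proof (rule ennreal_leI)
        have "exp (- \<gamma>1 * real n) \<le> exp (- ln 2)" using nb(2) by simp
        thus "exp (- \<gamma>1 * real n) \<le> 1 / 2" by (simp add: exp_minus)
      qed
      finally have "measure_pmf.prob (p' t1 y) (- W) \<le> 1 / 2"
        unfolding measure_pmf.emeasure_eq_measure by (subst (asm) ennreal_le_iff) auto
      thus ?thesis using measure_pmf.prob_compl[of W "p' t1 y"] by (simp add: Compl_eq_Diff_UNIV)
    qed
    define m where "m = nat \<lceil>K * \<delta>1 * real n\<rceil>"
    have m: "K * \<delta>1 * real n \<le> real m" "real m \<le> K * \<delta>1 * real n + 1"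
      using K \<delta>1(1) unfolding m_def by (auto simp: of_nat_nat mult_nonneg_nonneg) 
    define t2 where "t2 = real m * h0"
    have t2: "0 \<le> t2" using h0(1) by (simp add: t2_def)
    have t2n: "t2 \<le> real n"
    proof -
      have "t2 \<le> (K * \<delta>1 * real n + 1) * h0" unfolding t2_def using m h0(1) by (intro mult_right_mono) auto
      also have "\<dots> = (K * \<delta>1 * h0) * real n + h0" by (simp add: algebra_simps)
      also have "\<dots> \<le> 1 / 4 * real n + real n / 4" using \<delta>1(3) nb(3) by (intro add_mono mult_right_mono) auto
      finally show ?thesis using n1 by simp
    qed
    have step2: "c ^ m \<le> pmf (p' t2 x) 0" if "x \<in> W" for x
    proof -
      have "real (x $ k) \<le> \<delta>1 * real n" for k
      proof -
        have "\<bar>(\<chi> k. real (x $ k) / real n) $ k\<bar> \<le> \<delta>1"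
          using that component_le_norm_cart order_trans unfolding W_def by blast
        thus ?thesis using n by (simp add: divide_le_eq)
      qed
      hence "(\<Sum>k\<in>UNIV. real (x $ k)) \<le> (\<Sum>k\<in>(UNIV :: 'k set). \<delta>1 * real n)" by (intro sum_mono)
      also have "\<dots> = K * \<delta>1 * real n" by (simp add: K_def)
      also note m(1)
      finally have "real (\<Sum>k\<in>UNIV. x $ k) \<le> real m" by simp
      hence "(\<Sum>k\<in>UNIV. x $ k) \<le> m" by (simp only: of_nat_le_iff)
      from reach[OF c this] have "c ^ m \<le> pmf (p t2 0) x" by (simp add: t2_def)
      also have "\<dots> \<le> pmf (p' t2 x) 0" by (rule backward_ge_forward[OF t2])
      finally show ?thesis .
    qed
    have p0: "c ^ m * (1 / 2) \<le> pmf (p' (t1 + t2) y) 0"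
    proof -
      have "c ^ m * (1 / 2) \<le> c ^ m * measure_pmf.prob (p' t1 y) W" using Wprob c(1) by (intro mult_left_mono) auto
      also have "\<dots> = (\<integral>x. c ^ m * indicator W x \<partial>measure_pmf (p' t1 y))" by simp
      also have "\<dots> \<le> (\<integral>x. pmf (p' t2 x) 0 \<partial>measure_pmf (p' t1 y))"
      proof (rule integral_mono)
        show "integrable (measure_pmf (p' t1 y)) (\<lambda>x. c ^ m * indicator W x)"
          by (rule pmf_bounded_integrable[where B = "c ^ m"]) (use c(1) in \<open>auto simp: indicator_def\<close>)
        show "integrable (measure_pmf (p' t1 y)) (\<lambda>x. pmf (p' t2 x) 0)"
          by (rule pmf_bounded_integrable[where B = 1]) (auto simp: pmf_le_1)
        show "c ^ m * indicator W x \<le> pmf (p' t2 x) 0" for x using step2[of x] by (auto simp: indicator_def)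
      qed
      also have "\<dots> = pmf (p' (t1 + t2) y) 0" using t1 t2 by (simp add: D.p_add pmf_bind)
      finally show ?thesis .
    qed
    have wy: "exp (- \<theta> $ j * (real n * A + 1)) \<le> wt y"
    proof -
      have "lin \<theta> y = \<theta> $ j * real a" by (simp add: lin_def y_def axis_def if_distrib[of real] if_distrib[of "\<lambda>u. _ * u"] cong: if_cong)
      thus ?thesis unfolding wt_exp using a tj by simp
    qed
    have "exp (- real n * (J + \<gamma>)) \<le> exp (- \<theta> $ j * (real n * A + 1)) * (c ^ m * (1 / 2))"
    proof -
      have "L * real m \<le> L * (K * \<delta>1 * real n + 1)" using m L by (intro mult_left_mono) auto
      also have "\<dots> = (K * \<delta>1 * L) * real n + L" by (simp add: algebra_simps)
      also have "\<dots> \<le> \<gamma> / 4 * real n + L" using \<delta>1(2) by (intro add_right_mono mult_right_mono) auto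
      finally have "\<theta> $ j * (real n * A + 1) + L * real m + ln 2 \<le> real n * J + \<gamma> / 4 * real n + C"
        using L by (simp add: J_def C_def algebra_simps)
      also have "\<dots> \<le> real n * (J + \<gamma>)"
      proof -
        have "C \<le> \<gamma> * real n / 2" "0 \<le> \<gamma> * real n" using nb(4) \<gamma> by auto
        thus ?thesis by (simp add: algebra_simps)
      qed
      finally have "exp (- real n * (J + \<gamma>)) \<le> exp (- (\<theta> $ j * (real n * A + 1) + L * real m + ln 2))" by simp
      also have "\<dots> = exp (- \<theta> $ j * (real n * A + 1)) * (c ^ m * exp (- ln 2))"
        unfolding cL by (simp add: algebra_simps flip: exp_add)
      also have "exp (- ln 2 :: real) = 1 / 2" by (simp add: exp_minus)
      finally show ?thesis .
    qed
    also have "\<dots> \<le> wt y * pmf (p' (t1 + t2) y) 0" using wy p0 c(1) wt_pos[of y] by (intro mult_mono) (auto simp: less_imp_le)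
    also have "\<dots> = pmf (p (t1 + t2) 0) y" using rev[of "t1 + t2" y 0] t1 t2 by (simp add: wt_0)
    also have "\<dots> = \<P>(\<omega> in M. Q (t1 + t2) \<omega> = y)" using t1 t2 by (simp add: marginal)
    also have "\<dots> \<le> \<P>(\<omega> in M. overflow_time Q A n \<omega> \<le> ereal T)"
    proof -
      interpret qp: queue_process M Q p A n using n by (rule queue)
      define u where "u = (t1 + t2) / real n"
      have u: "0 \<le> u" "u \<le> T" "real n * u = t1 + t2"
      proof -
        show "0 \<le> u" "real n * u = t1 + t2" using t1 t2 n by (auto simp: u_def)
        have "t1 + t2 \<le> real n * (Ts + 1)" using t2n by (simp add: t1_def distrib_left)
        hence "u \<le> Ts + 1" using n by (simp add: u_def divide_le_eq mult.commute)
        thus "u \<le> T" using T by (simp add: Ts_def)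
      qed
      have "qp.\<tau> \<omega> \<le> ereal T" if "Q (t1 + t2) \<omega> = y" for \<omega>
      proof -
        have "qp.tot u \<omega> = real a"
          using that u(3) by (simp add: qp.tot_def y_def axis_def if_distrib[of real] cong: if_cong)
        hence "qp.\<tau> \<omega> \<le> ereal u" using a u by (intro qp.\<tau>_le) auto
        also have "\<dots> \<le> ereal T" using u by simp
        finally show ?thesis .
      qed
      moreover have "{\<omega> \<in> space M. qp.\<tau> \<omega> \<le> ereal T} \<in> sets M" using qp.\<tau>_measurable by measurable
      ultimately show ?thesis by (intro finite_measure_mono) auto
    qed
    finally show ?case .
  qed
qed

section \<open>The two limits\<close>

lemma log_limit:
  assumes T: "first_zero_time z + 1 \<le> T"
  shows "(\<lambda>n. 1 / real n * ln \<P>(\<omega> in M. overflow_time Q A n \<omega> \<le> ereal T)) \<longlonglongrightarrow> - J"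
proof (rule tendstoI)
  fix e :: real assume e: "0 < e"
  have T0: "0 \<le> T" using T first_zero(1) by simp
  have half: "0 < e / 2" using e by simp
  show "\<forall>\<^sub>F n in sequentially. dist (1 / real n * ln \<P>(\<omega> in M. overflow_time Q A n \<omega> \<le> ereal T)) (- J) < e"
    using overflow_lower[OF T half] overflow_upper[OF T0 half] eventually_gt_at_top[of 0]
  proof eventually_elim
    case (elim n)
    define pr where "pr = \<P>(\<omega> in M. overflow_time Q A n \<omega> \<le> ereal T)"
    have b: "exp (- real n * (J + e / 2)) \<le> pr" "pr \<le> exp (- real n * (J - e / 2))" using elim e by (auto simp: pr_def)
    have pos: "0 < pr" using b(1) exp_gt_zero less_le_trans by blast
    have "- real n * (J + e / 2) \<le> ln pr" using b(1) pos by (simp add: ln_ge_iff)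
    moreover have "ln pr \<le> - real n * (J - e / 2)" using b(2) pos by (metis ln_exp ln_le_cancel_iff exp_gt_zero)
    ultimately have "- (J + e / 2) \<le> 1 / real n * ln pr" "1 / real n * ln pr \<le> - (J - e / 2)"
      using elim by (auto simp: field_simps)
    thus ?case using e unfolding pr_def[symmetric] by (simp add: dist_real_def abs_less_iff)
  qed
qed

text \<open>Overflow off the path has probability at most \<open>exp (- n * (J + \<gamma>))\<close>,
  overflow itself at least \<open>exp (- n * (J + \<gamma> / 2))\<close> for large n, and the
  quotient tends to 0.\<close>

lemma conditional_limit:
  fixes N :: "real ^ 'k \<Rightarrow> real"
  defines "Ts \<equiv> first_zero_time z"
  assumes T: "Ts + 1 \<le> T" and N: "is_norm N" and \<delta>: "0 < \<delta>"
    and qs: "\<And>t. 0 \<le> t \<Longrightarrow> t \<le> Ts \<Longrightarrow> qs t = z (Ts - t)"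
  shows "(\<lambda>n. \<P>(\<omega> in M. follows_path N Q A n Ts qs \<delta> \<omega> \<bar> overflow_time Q A n \<omega> \<le> ereal T)) \<longlonglongrightarrow> 1"
proof -
  have Ts: "0 \<le> Ts" unfolding Ts_def by (rule first_zero)
  have T0: "0 \<le> T" using T Ts by simp
  obtain \<gamma> where \<gamma>: "0 < \<gamma>" "\<forall>\<^sub>F n :: nat in sequentially. \<P>(\<omega> in M. \<not> follows_path N Q A n Ts qs \<delta> \<omega> \<and> overflow_time Q A n \<omega> \<le> ereal T) \<le> exp (- real n * (J + \<gamma>))"
    using deviation_upper[OF T0 N \<delta> qs[unfolded Ts_def]] unfolding Ts_def by blast
  have half: "0 < \<gamma> / 2" using \<gamma>(1) by simp
  have "(\<lambda>n. exp (- (\<gamma> / 2)) ^ n) \<longlonglongrightarrow> 0" by (rule LIMSEQ_power_zero) (use \<gamma>(1) in simp)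
  hence lim: "(\<lambda>n. 1 - exp (- (\<gamma> / 2)) ^ n) \<longlonglongrightarrow> 1 - 0" by (intro tendsto_diff tendsto_const)
  show ?thesis
  proof (rule tendsto_sandwich[OF _ _ lim[simplified] tendsto_const])
    show "\<forall>\<^sub>F n in sequentially. 1 - exp (- (\<gamma> / 2)) ^ n \<le> \<P>(\<omega> in M. follows_path N Q A n Ts qs \<delta> \<omega> \<bar> overflow_time Q A n \<omega> \<le> ereal T)"
      using \<gamma>(2) overflow_lower[OF T[unfolded Ts_def] half] eventually_gt_at_top[of 0]
    proof eventually_elim
      case (elim n)
      interpret qp: queue_process M Q p A n using elim by (intro queue) simp
      define F where "F = {\<omega> \<in> space M. follows_path N Q A n Ts qs \<delta> \<omega> \<and> overflow_time Q A n \<omega> \<le> ereal T}"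
      define E where "E = {\<omega> \<in> space M. overflow_time Q A n \<omega> \<le> ereal T}"
      define B where "B = {\<omega> \<in> space M. \<not> follows_path N Q A n Ts qs \<delta> \<omega> \<and> overflow_time Q A n \<omega> \<le> ereal T}"
      \<comment> \<open>Only with F measurable does a small probability of B turn into a large one
        of F.\<close>
      have Fs: "F \<in> sets M" unfolding F_def by (rule qp.follows_measurable[OF N Ts z_cont qs])
      have Es: "E \<in> sets M" unfolding E_def using qp.\<tau>_measurable by measurable
      have "E - F = B" by (auto simp: E_def F_def B_def)
      hence mB: "measure M B = measure M E - measure M F"
        using finite_measure_Diff[OF Es Fs] by (auto simp: E_def F_def)
      have lo: "exp (- real n * (J + \<gamma> / 2)) \<le> measure M E" using elim \<gamma> unfolding E_def by simp
      hence Epos: "0 < measure M E" using exp_gt_zero less_le_trans by blast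
      have up: "measure M B \<le> exp (- real n * (J + \<gamma>))" using elim unfolding B_def by simp
      have "measure M B \<le> exp (- (\<gamma> / 2)) ^ n * exp (- real n * (J + \<gamma> / 2))"
        using up by (simp add: algebra_simps flip: exp_of_nat_mult exp_add)
      also have "\<dots> \<le> exp (- (\<gamma> / 2)) ^ n * measure M E" using lo by (intro mult_left_mono) auto
      finally have "(1 - exp (- (\<gamma> / 2)) ^ n) * measure M E \<le> measure M F" using mB by (simp add: algebra_simps)
      hence "1 - exp (- (\<gamma> / 2)) ^ n \<le> measure M F / measure M E" using Epos by (simp add: pos_le_divide_eq)
      thus ?case by (simp add: cond_prob_def F_def E_def)
    qed
    show "\<forall>\<^sub>F n in sequentially. \<P>(\<omega> in M. follows_path N Q A n Ts qs \<delta> \<omega> \<bar> overflow_time Q A n \<omega> \<le> ereal T) \<le> 1"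
      using eventually_gt_at_top[of 0]
    proof eventually_elim
      case (elim n)
      interpret qp: queue_process M Q p A n using elim by (intro queue) simp
      have Es: "{\<omega> \<in> space M. overflow_time Q A n \<omega> \<le> ereal T} \<in> sets M" using qp.\<tau>_measurable by measurable
      show ?case unfolding cond_prob_def
        by (rule divide_le_eq_1[THEN iffD2]) (use Es in \<open>auto simp: zero_less_measure_iff intro!: finite_measure_mono\<close>)
    qed
  qed
qed

end

theorem mainTheorem5:
  fixes M :: "'w measure"
    and Q :: "real \<Rightarrow> 'w \<Rightarrow> nat ^ 'k"
    and P :: "real ^ 'k ^ 'k"
    and lam mu r :: "real ^ 'k"
    and N :: "real ^ 'k \<Rightarrow> real"
    and A Tstar :: real
    and qbar qstar :: "real \<Rightarrow> real ^ 'k"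
  assumes routing: "substochastic P" "spectral_radius P < 1"
    and rates: "\<And>k. lam $ k > 0" "\<And>k. mu $ k > 0"
    and ergodic: "\<And>k. load lam mu P $ k < 1"
    and queue: "jackson_queue M Q lam mu P" "AE \<omega> in M. Q 0 \<omega> = 0"
    and norm: "is_norm N"
    and level: "A > 0"
    and minimizer: "\<And>x. is_arg_min (\<lambda>x. theta_star lam mu P \<bullet> x)
          (\<lambda>x. (\<forall>k. 0 \<le> x $ k) \<and> (\<Sum>k\<in>UNIV. x $ k) = A) x \<longleftrightarrow> x = r"
    and fluid: "fluid_trajectory (dual_arrival lam P) mu (dual_routing lam P) r qbar"
    and Tstar: "Tstar = first_zero_time qbar"
    and qstar: "\<And>t. 0 \<le> t \<Longrightarrow> t \<le> Tstar \<Longrightarrow> qstar t = qbar (Tstar - t)"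
  shows "\<forall>\<^sub>F T in at_top.
      (\<lambda>n. 1 / real n * ln \<P>(\<omega> in M. overflow_time Q A n \<omega> \<le> ereal T))
        \<longlonglongrightarrow> - (theta_star lam mu P \<bullet> r) \<and>
      (\<forall>\<delta>>0. (\<lambda>n. \<P>(\<omega> in M. follows_path N Q A n Tstar qstar \<delta> \<omega>
                          \<bar> overflow_time Q A n \<omega> \<le> ereal T)) \<longlonglongrightarrow> 1)"
proof -
  interpret jackson_network lam mu P
    using routing rates ergodic by unfold_locales
  obtain \<phi> where
    \<phi>: "\<And>t. 0 \<le> t \<Longrightarrow> qbar t = r + t *\<^sub>R (lamd - DD *v mu) + DD *v \<phi> t"
      "\<And>t k. 0 \<le> t \<Longrightarrow> 0 \<le> qbar t $ k" "\<phi> 0 = 0"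
      "\<And>b. 0 \<le> b \<Longrightarrow> abs_continuous_on 0 b \<phi>" "\<And>k. mono_on {0..} (\<lambda>t. \<phi> t $ k)"
      "AE t in lborel. 0 < t \<longrightarrow> (\<exists>D. (\<phi> has_vector_derivative D) (at t) \<and> (\<forall>k. qbar t $ k * D $ k = 0))"
    using fluid unfolding fluid_trajectory_def lamd_def[symmetric] Pd_def[symmetric] DD_def[symmetric] by blast
  interpret jackson_fluid lam mu P r qbar \<phi>
    by unfold_locales (rule \<phi>; assumption?)+
  note chain = queue(1)[unfolded jackson_queue_def ctmc_def]
  have M: "prob_space M" using chain by (rule conjunct1)
  have meas: "Q t \<in> measurable M (count_space UNIV)" if "0 \<le> t" for t
    by (rule chain[THEN conjunct2, THEN conjunct1, THEN spec, THEN mp, OF that])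
  have rc: "\<forall>\<^sub>F s in at_right t. Q s \<omega> = Q t \<omega>" if "\<omega> \<in> space M" "0 \<le> t" for \<omega> t
    using chain[THEN conjunct2, THEN conjunct2, THEN conjunct1, THEN bspec, OF that(1), THEN conjunct1, THEN spec, THEN mp, OF that(2)] .
  obtain p where law: "transition_semigroup p \<and> has_jump_rates p (jackson_rate lam mu P) \<and>
        (\<forall>n (t :: nat \<Rightarrow> real) (x :: nat \<Rightarrow> nat ^ 'k). 0 \<le> t 0 \<and> (\<forall>i\<le>n. t i \<le> t (Suc i)) \<longrightarrow>
           \<P>(\<omega> in M. \<forall>i\<le>Suc n. Q (t i) \<omega> = x i) =
           \<P>(\<omega> in M. \<forall>i\<le>n. Q (t i) \<omega> = x i) * pmf (p (t (Suc n) - t n) (x n)) (x (Suc n)))"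
    by (rule exE[OF chain[THEN conjunct2, THEN conjunct2, THEN conjunct2]])
  have p: "transition_semigroup p" "has_jump_rates p (jackson_rate lam mu P)"
    by (rule law[THEN conjunct1], rule law[THEN conjunct2, THEN conjunct1])
  have fdd: "\<P>(\<omega> in M. \<forall>i\<le>Suc n. Q (t i) \<omega> = x i) =
           \<P>(\<omega> in M. \<forall>i\<le>n. Q (t i) \<omega> = x i) * pmf (p (t (Suc n) - t n) (x n)) (x (Suc n))"
    if "0 \<le> t 0" "\<forall>i\<le>n. t i \<le> t (Suc i)" for n and t :: "nat \<Rightarrow> real" and x :: "nat \<Rightarrow> nat ^ 'k"
    by (rule law[THEN conjunct2, THEN conjunct2, THEN spec, THEN spec, THEN spec, THEN mp, OF conjI[OF that]])
  obtain p' where p': "jump_semigroup p' (jackson_rate lamd mu Pd) Lam"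
    "\<And>t x y. 0 \<le> t \<Longrightarrow> wt y * pmf (p' t y) x = wt x * pmf (p t x) y"
    using reversal[OF p] by blast
  interpret prob_space M by (rule M)
  interpret markov_process M Q p 0
    by unfold_locales (rule meas rc fdd queue(2); assumption)+
  interpret jackson_process lam mu r P qbar \<phi> M Q p p'
    by intro_locales (rule jackson_process_axioms.intro, rule forward[OF p], rule p'(1), rule p'(2), assumption)
  define f where "f x = theta_star lam mu P \<bullet> x" for x
  define feas where "feas x \<longleftrightarrow> (\<forall>k. 0 \<le> x $ k) \<and> (\<Sum>k\<in>UNIV. x $ k) = A" for x :: "real ^ 'k"
  have arg: "is_arg_min f feas x \<longleftrightarrow> x = r" for x using minimizer[of x] by (simp add: f_def[abs_def] feas_def[abs_def])
  have f_sum: "f x = (\<Sum>k\<in>UNIV. \<theta> $ k * x $ k)" for x by (simp add: f_def \<theta>_def inner_vec_def)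
  have feas_axis: "feas (A *\<^sub>R axis k 1)" for k
    using level by (auto simp: feas_def axis_def if_distrib[of "\<lambda>u. A * u"] cong: if_cong)
  have f_axis: "f (A *\<^sub>R axis k 1) = \<theta> $ k * A" for k
    by (simp add: f_def \<theta>_def inner_axis)
  \<comment> \<open>A linear function on a simplex is minimal at the vertices of least coefficient.
    Uniqueness of the minimizer therefore means that exactly one node is cheapest and that r puts
    the whole population there, which is the form used in \<open>jackson_overflow\<close>.\<close>
  have opt: "A *\<^sub>R axis k 1 = r" if k: "\<And>l. \<theta> $ k \<le> \<theta> $ l" for k
  proof -
    have "f (A *\<^sub>R axis k 1) \<le> f y" if "feas y" for y
    proof -
      have "\<theta> $ k * A = (\<Sum>l\<in>UNIV. \<theta> $ k * y $ l)" using that by (simp add: feas_def flip: sum_distrib_left)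
      also have "\<dots> \<le> f y" unfolding f_sum using k that by (intro sum_mono mult_right_mono) (auto simp: feas_def)
      finally show ?thesis by (simp add: f_axis)
    qed
    hence "is_arg_min f feas (A *\<^sub>R axis k 1)" unfolding is_arg_min_linorder using feas_axis[of k] by blast
    thus ?thesis using arg by blast
  qed
  obtain j where j: "\<And>l. \<theta> $ j \<le> \<theta> $ l"
    using ex_is_arg_min_if_finite[of "UNIV :: 'k set" "\<lambda>l. \<theta> $ l"] by (auto simp: is_arg_min_linorder)
  have rj: "r = A *\<^sub>R axis j 1" using opt[OF j] by simp
  have strict: "\<theta> $ j < \<theta> $ k" if "k \<noteq> j" for k
  proof (rule ccontr)
    assume "\<not> \<theta> $ j < \<theta> $ k"
    hence "A *\<^sub>R axis k 1 = r" using j by (intro opt) (meson linorder_not_less order_trans)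
    hence "(A *\<^sub>R axis k 1 :: real ^ 'k) $ k = (A *\<^sub>R axis j 1 :: real ^ 'k) $ k" unfolding rj by (rule arg_cong)
    thus False using that level by (simp add: axis_def)
  qed
  interpret jackson_overflow lam mu r P qbar \<phi> M Q p p' A j
    by intro_locales (rule jackson_overflow_axioms.intro, rule level, rule rj, rule strict, assumption)
  have J: "theta_star lam mu P \<bullet> r = J" unfolding rj using f_axis[of j] by (simp add: f_def J_def)
  show ?thesis
    using eventually_ge_at_top[of "Tstar + 1"]
  proof eventually_elim
    case (elim T)
    show ?case
    proof (intro conjI allI impI)
      show "(\<lambda>n. 1 / real n * ln \<P>(\<omega> in M. overflow_time Q A n \<omega> \<le> ereal T)) \<longlonglongrightarrow> - (theta_star lam mu P \<bullet> r)"
        unfolding J using elim Tstar by (intro log_limit) simp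
      fix \<delta> :: real assume "0 < \<delta>"
      thus "(\<lambda>n. \<P>(\<omega> in M. follows_path N Q A n Tstar qstar \<delta> \<omega> \<bar> overflow_time Q A n \<omega> \<le> ereal T)) \<longlonglongrightarrow> 1"
        unfolding Tstar by (intro conditional_limit) (use elim Tstar norm qstar in auto)
    qed
  qed
qed

end
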